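(* Let $1<\alpha\le 2$, let $L$ be the spectrally positive $\alpha$-stable Lévy process normalized by $\ln \mathbb{E}[e^{i\lambda L_1}]=(i\lambda)^\alpha e^{-i\pi\alpha\,\mathrm{sgn}(\lambda)}$ ($\lambda\in\mathbb{R}$), let $L^{(\mathrm{me})}$ be its meander on $[0,1]$, and set $\mathcal{A}_{\mathrm{me}}=\int_0^1 L^{(\mathrm{me})}_t\,dt$. Let $$\Phi_\alpha(x)= \frac{1}{\pi}\sum_{n=0}^{+\infty} \frac{(-1)^{n}}{n!}\Gamma\left(\frac{1+n}{1+\alpha}\right)\sin\left(\pi\frac{1+n}{1+\alpha}\right) (1+\alpha)^{\frac{n-\alpha}{1+\alpha}} x^n,$$ $$\Psi_\alpha(x)= \frac{1}{\pi}\sum_{n=0}^{+\infty} \frac{(-1)^{n}}{n!}\Gamma\left(\frac{1+n}{1+\alpha}\right)\cos\left(\pi\frac{1+n}{1+\alpha}\right) (1+\alpha)^{\frac{n-\alpha}{1+\alpha}} x^n.$$ Then for every $\lambda>0$, $$\int_0^{+\infty}e^{-\lambda t}\, \mathbb{E}\left[e^{-t^{1+\frac{1}{\alpha}} \mathcal{A}_{\mathrm{me}}}\right] t^{-\frac{1}{\alpha}}\,dt =\pi\, \Gamma\left(1-\frac{1}{\alpha}\right)\frac{\Psi_\alpha'(\lambda) \Phi_\alpha(\lambda)- \Phi_\alpha'(\lambda)\Psi_\alpha(\lambda)}{\Phi_\alpha(\lambda)}.$$ In particular, $$\mathbb{E}[\mathcal{A}_{\mathrm{me}}]= \Gamma\left(1-\frac{1}{\alpha}\right)\frac{\alpha+1}{2\alpha},$$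 and, for $1<\alpha<2$, as $x\to+\infty$, $$\mathbb{P}(\mathcal{A}_{\mathrm{me}}>x)\sim \frac{(\alpha-1)\,\Gamma(1+\alpha)\,\Gamma\left(1-\frac{1}{\alpha}\right)}{\Gamma(2-\alpha)\,\Gamma\left(2+\alpha-\frac{1}{\alpha}\right)}\, x^{-\alpha},$$ where $\sim$ means that the ratio of both sides tends to $1$.
   Context: $L$ is an $\alpha$-stable Lévy process without negative jumps, $1<\alpha\le 2$, realized on the Skorokhod space of càdlàg paths. Powers of complex numbers are principal branches; the normalization is equivalent to $\mathbb{E}[e^{-\lambda L_1}]=e^{\lambda^\alpha}$ for $\lambda\ge0$ (so for $\alpha=2$, $L=\sqrt2\,B$ with $B$ a standard Brownian motion). $\mathbb{P}_x$ is the law of $L$ started at $L_0=x$, $\mathbb{P}=\mathbb{P}_0$, and $T_0=\inf\{t\ge0: L_t=0\}$. Meander: $L^{(\mathrm{me})}=(L^{(\mathrm{me})}_t)_{0\le t\le1}$ is the process whose law is the (weak, in the Skorokhod sense) limit as $x\downarrow0$ of the law of $(L_t)_{0\le t\le1}$ under $\mathbb{P}_x(\,\cdot\mid T_0>1)$. *)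

theory Defs
  imports "HOL-Probability.Probability"
begin

section \<open>Cadlag paths and the Skorokhod space on the unit interval\<close>

text \<open>A one-sided limit at a point that is not a limit point of \<open>I\<close> from that side (for example
  from the left at the left end point) is along the trivial filter, so it imposes nothing.\<close>

definition cadlag_on :: "real set \<Rightarrow> (real \<Rightarrow> real) \<Rightarrow> bool" where
  "cadlag_on I f \<longleftrightarrow>
     (\<forall>t\<in>I. (f \<longlongrightarrow> f t) (at t within (I \<inter> {t<..})) \<and>
            (\<exists>l. (f \<longlongrightarrow> l) (at t within (I \<inter> {..<t}))))"

definition skorokhod_space :: "(real \<Rightarrow> real) set" where
  "skorokhod_space = {f \<in> extensional {0..1}. cadlag_on {0..1} f}"

definition time_changes :: "(real \<Rightarrow> real) set" where
  "time_changes =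
     {\<phi>. strict_mono_on {0..1} \<phi> \<and> continuous_on {0..1} \<phi> \<and> \<phi> ` {0..1} = {0..1}}"

definition skorokhod_close :: "real \<Rightarrow> (real \<Rightarrow> real) \<Rightarrow> (real \<Rightarrow> real) \<Rightarrow> bool" where
  "skorokhod_close e f g \<longleftrightarrow>
     (\<exists>\<phi>\<in>time_changes. \<forall>t\<in>{0..1}. \<bar>\<phi> t - t\<bar> \<le> e \<and> \<bar>f t - g (\<phi> t)\<bar> \<le> e)"

text \<open>Skorokhod's \<open>J\<^sub>1\<close> metric; the value 0 off the space is a dummy.\<close>

definition skorokhod_dist :: "(real \<Rightarrow> real) \<Rightarrow> (real \<Rightarrow> real) \<Rightarrow> real" where
  "skorokhod_dist f g =
     (if f \<in> skorokhod_space \<and> g \<in> skorokhod_space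
      then Inf {e. 0 < e \<and> skorokhod_close e f g} else 0)"

lemma time_changes_id: "(\<lambda>t. t) \<in> time_changes"
  by (auto simp: time_changes_def strict_mono_on_def)

lemma time_changes_comp:
  assumes "\<phi> \<in> time_changes" "\<psi> \<in> time_changes"
  shows "(\<lambda>t. \<psi> (\<phi> t)) \<in> time_changes"
proof -
  have im: "\<phi> ` {0..1} = {0..1}" "\<psi> ` {0..1} = {0..1}"
    using assms by (auto simp: time_changes_def)
  have "(\<lambda>t. \<psi> (\<phi> t)) ` {0..1} = {0..1}"
    using im image_image[of \<psi> \<phi> "{0..1}"] by simp
  moreover have "continuous_on {0..1} (\<lambda>t. \<psi> (\<phi> t))"
    using assms im by (intro continuous_on_compose2[of "{0..1}" \<psi> "{0..1}" \<phi>])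
      (auto simp: time_changes_def)
  moreover have "strict_mono_on {0..1} (\<lambda>t. \<psi> (\<phi> t))"
  proof (rule strict_mono_onI)
    fix r s :: real assume rs: "r \<in> {0..1}" "s \<in> {0..1}" "r < s"
    have "\<phi> r < \<phi> s" "\<phi> r \<in> {0..1}" "\<phi> s \<in> {0..1}"
      using rs im strict_mono_onD[of "{0..1}" \<phi> r s] assms(1)
      unfolding time_changes_def by blast+
    then show "\<psi> (\<phi> r) < \<psi> (\<phi> s)"
      using strict_mono_onD[of "{0..1}" \<psi> "\<phi> r" "\<phi> s"] assms(2)
      unfolding time_changes_def by blast
  qed
  ultimately show ?thesis by (auto simp: time_changes_def)
qed

lemma time_changes_inverse:
  assumes "\<phi> \<in> time_changes"
  obtains \<psi> where "\<psi> \<in> time_changes"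
    "\<And>t. t \<in> {0..1} \<Longrightarrow> \<phi> (\<psi> t) = t" "\<And>t. t \<in> {0..1} \<Longrightarrow> \<psi> (\<phi> t) = t"
proof -
  define \<psi> where "\<psi> = the_inv_into {0..1} \<phi>"
  have sm: "strict_mono_on {0..1} \<phi>" and co: "continuous_on {0..1} \<phi>"
    and im: "\<phi> ` {0..1} = {0..1}"
    using assms by (auto simp: time_changes_def)
  have inj: "inj_on \<phi> {0..1}" using sm by (rule strict_mono_on_imp_inj_on)
  have 1: "\<phi> (\<psi> t) = t" if "t \<in> {0..1}" for t
    unfolding \<psi>_def using that im by (intro f_the_inv_into_f[OF inj]) auto
  have 2: "\<psi> (\<phi> t) = t" if "t \<in> {0..1}" for t
    unfolding \<psi>_def using that by (intro the_inv_into_f_f[OF inj]) auto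
  have im': "\<psi> ` {0..1} = {0..1}"
  proof -
    have "\<psi> ` {0..1} = \<psi> ` (\<phi> ` {0..1})" by (simp add: im)
    also have "\<dots> = (\<lambda>t. t) ` {0..1}"
      unfolding image_image by (rule image_cong) (simp_all add: 2)
    finally show ?thesis by simp
  qed
  have "continuous_on {0..1} \<psi>"
    using continuous_on_inv_into[OF co _ inj] im by (simp add: \<psi>_def)
  moreover have "strict_mono_on {0..1} \<psi>"
  proof (rule strict_mono_onI)
    fix r s :: real assume rs: "r \<in> {0..1}" "s \<in> {0..1}" "r < s"
    have "\<psi> r \<in> {0..1}" "\<psi> s \<in> {0..1}" using im' rs by auto
    then show "\<psi> r < \<psi> s"
      using 1[OF rs(1)] 1[OF rs(2)] rs(3) strict_mono_onD[OF sm, of "\<psi> s" "\<psi> r"]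
      by (cases "\<psi> r" "\<psi> s" rule: linorder_cases) auto
  qed
  ultimately have "\<psi> \<in> time_changes" using im' by (auto simp: time_changes_def)
  then show ?thesis using 1 2 that by blast
qed

lemma time_changes_1: "\<phi> \<in> time_changes \<Longrightarrow> \<phi> 1 = 1"
proof -
  assume p: "\<phi> \<in> time_changes"
  have "(1::real) \<in> {0..1}" by simp
  then have "1 \<in> \<phi> ` {0..1}" using p by (simp add: time_changes_def)
  then obtain s where s: "s \<in> {0..1}" "\<phi> s = 1" by auto
  have "\<phi> 1 \<in> {0..1}" using p by (auto simp: time_changes_def)
  then show "\<phi> 1 = 1"
  proof (cases "s = 1")
    case False
    then have "\<phi> s < \<phi> 1"
      using s p by (intro strict_mono_onD[of "{0..1}" \<phi>]) (auto simp: time_changes_def)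
    with s \<open>\<phi> 1 \<in> {0..1}\<close> show ?thesis by simp
  qed (use s in simp)
qed

lemma skorokhod_closeE:
  assumes "skorokhod_close e f g"
  obtains \<phi> where "\<phi> \<in> time_changes"
    "\<And>t. t \<in> {0..1} \<Longrightarrow> \<bar>\<phi> t - t\<bar> \<le> e \<and> \<bar>f t - g (\<phi> t)\<bar> \<le> e"
proof -
  from assms obtain \<phi> where "\<phi> \<in> time_changes"
    "\<forall>t\<in>{0..1}. \<bar>\<phi> t - t\<bar> \<le> e \<and> \<bar>f t - g (\<phi> t)\<bar> \<le> e"
    unfolding skorokhod_close_def by (elim bexE)
  then show thesis by (intro that) (assumption, erule (1) bspec)
qed

lemma skorokhod_closeI:
  assumes "\<phi> \<in> time_changes"
    "\<And>t. t \<in> {0..1} \<Longrightarrow> \<bar>\<phi> t - t\<bar> \<le> e \<and> \<bar>f t - g (\<phi> t)\<bar> \<le> e"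
  shows "skorokhod_close e f g"
  unfolding skorokhod_close_def by (intro bexI[where x = \<phi>] ballI assms)

lemma skorokhod_close_commute:
  assumes "skorokhod_close e f g" shows "skorokhod_close e g f"
proof -
  obtain \<phi> where \<phi>: "\<phi> \<in> time_changes"
    "\<And>t. t \<in> {0..1} \<Longrightarrow> \<bar>\<phi> t - t\<bar> \<le> e \<and> \<bar>f t - g (\<phi> t)\<bar> \<le> e"
    by (rule skorokhod_closeE[OF assms]) (rule that)
  obtain \<psi> where \<psi>: "\<psi> \<in> time_changes" "\<And>t. t \<in> {0..1} \<Longrightarrow> \<phi> (\<psi> t) = t"
    by (rule time_changes_inverse[OF \<phi>(1)]) (rule that)
  have "\<bar>\<psi> t - t\<bar> \<le> e \<and> \<bar>g t - f (\<psi> t)\<bar> \<le> e" if t: "t \<in> {0..1}" for t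
  proof -
    have "\<psi> t \<in> {0..1}" using \<psi>(1) t by (auto simp: time_changes_def)
    from \<phi>(2)[OF this] show ?thesis by (auto simp: \<psi>(2)[OF t] abs_minus_commute)
  qed
  then show ?thesis by (rule skorokhod_closeI[OF \<psi>(1)])
qed

lemma skorokhod_close_trans:
  assumes "skorokhod_close a f g" "skorokhod_close b g h"
  shows "skorokhod_close (a + b) f h"
proof -
  obtain \<phi> where \<phi>: "\<phi> \<in> time_changes"
    "\<And>t. t \<in> {0..1} \<Longrightarrow> \<bar>\<phi> t - t\<bar> \<le> a \<and> \<bar>f t - g (\<phi> t)\<bar> \<le> a"
    by (rule skorokhod_closeE[OF assms(1)]) (rule that)
  obtain \<psi> where \<psi>: "\<psi> \<in> time_changes"
    "\<And>t. t \<in> {0..1} \<Longrightarrow> \<bar>\<psi> t - t\<bar> \<le> b \<and> \<bar>g t - h (\<psi> t)\<bar> \<le> b"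
    by (rule skorokhod_closeE[OF assms(2)]) (rule that)
  have "\<bar>\<psi> (\<phi> t) - t\<bar> \<le> a + b \<and> \<bar>f t - h (\<psi> (\<phi> t))\<bar> \<le> a + b" if t: "t \<in> {0..1}" for t
  proof -
    have "\<phi> t \<in> {0..1}" using \<phi>(1) t by (auto simp: time_changes_def)
    from \<psi>(2)[OF this] \<phi>(2)[OF t] show ?thesis
      unfolding abs_le_iff by (intro conjI) linarith+
  qed
  then show ?thesis by (rule skorokhod_closeI[OF time_changes_comp[OF \<phi>(1) \<psi>(1)]])
qed

lemma skorokhod_close_mono:
  assumes "skorokhod_close a f g" "a \<le> b"
  shows "skorokhod_close b f g"
proof -
  obtain \<phi> where \<phi>: "\<phi> \<in> time_changes"
    "\<And>t. t \<in> {0..1} \<Longrightarrow> \<bar>\<phi> t - t\<bar> \<le> a \<and> \<bar>f t - g (\<phi> t)\<bar> \<le> a"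
    by (rule skorokhod_closeE[OF assms(1)]) (rule that)
  have "\<bar>\<phi> t - t\<bar> \<le> b \<and> \<bar>f t - g (\<phi> t)\<bar> \<le> b" if "t \<in> {0..1}" for t
    using \<phi>(2)[OF that] assms(2) by (meson order_trans)
  then show ?thesis by (rule skorokhod_closeI[OF \<phi>(1)])
qed

lemma cadlag_on_bounded:
  assumes "cadlag_on {0..1} f"
  shows "bounded (f ` {0..1})"
proof -
  define P where "P a b \<longleftrightarrow> bounded (f ` ({a..b} \<inter> {0..1}))" for a b
  have "P 0 1"
    using zero_le_one
  proof (induct rule: Bolzano)
    case (trans a b c)
    have "{a..c} \<inter> {0..1} = ({a..b} \<inter> {0..1}) \<union> ({b..c} \<inter> {0..1})"
      using trans by auto
    then show ?case using trans by (simp add: P_def image_Un)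
  next
    case (local x)
    then obtain l where r: "(f \<longlongrightarrow> f x) (at x within ({0..1} \<inter> {x<..}))"
      and l: "(f \<longlongrightarrow> l) (at x within ({0..1} \<inter> {..<x}))"
      using assms unfolding cadlag_on_def by (metis atLeastAtMost_iff)
    obtain d1 where d1: "d1 > 0"
      "\<And>s. s \<in> {0..1} \<Longrightarrow> s > x \<Longrightarrow> \<bar>s - x\<bar> < d1 \<Longrightarrow> \<bar>f s - f x\<bar> < 1"
      using tendstoD[OF r, of 1] unfolding eventually_at by (auto simp: dist_real_def)
    obtain d2 where d2: "d2 > 0"
      "\<And>s. s \<in> {0..1} \<Longrightarrow> s < x \<Longrightarrow> \<bar>s - x\<bar> < d2 \<Longrightarrow> \<bar>f s - l\<bar> < 1"
      using tendstoD[OF l, of 1] unfolding eventually_at by (auto simp: dist_real_def)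
    have "P a b" if ab: "a \<le> x" "x \<le> b" "b - a < min d1 d2" for a b
    proof -
      have "\<bar>f s\<bar> \<le> \<bar>f x\<bar> + \<bar>l\<bar> + 1" if s: "s \<in> {a..b} \<inter> {0..1}" for s
    proof (cases s x rule: linorder_cases)
      case less
      have "\<bar>f s - l\<bar> < 1" using s ab less by (intro d2(2)) auto
      then show ?thesis by linarith
    next
      case greater
      have "\<bar>f s - f x\<bar> < 1" using s ab greater by (intro d1(2)) auto
      then show ?thesis by linarith
    qed simp
      then show ?thesis unfolding P_def bounded_iff real_norm_def by blast
    qed
    moreover have "0 < min d1 d2" using d1(1) d2(1) by simp
    ultimately show ?case by blast
  qed
  then show ?thesis by (simp add: P_def)
qed

lemma skorokhod_close_exists:
  assumes "f \<in> skorokhod_space" "g \<in> skorokhod_space"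
  shows "\<exists>e>0. skorokhod_close e f g"
proof -
  obtain A where A: "\<And>t. t \<in> {0..1} \<Longrightarrow> \<bar>f t\<bar> \<le> A"
    using cadlag_on_bounded[of f] assms(1)
    unfolding skorokhod_space_def bounded_iff real_norm_def by blast
  obtain B where B: "\<And>t. t \<in> {0..1} \<Longrightarrow> \<bar>g t\<bar> \<le> B"
    using cadlag_on_bounded[of g] assms(2)
    unfolding skorokhod_space_def bounded_iff real_norm_def by blast
  have "skorokhod_close (\<bar>A\<bar> + \<bar>B\<bar> + 1) f g"
    unfolding skorokhod_close_def
  proof (intro bexI[OF _ time_changes_id] ballI)
    fix t :: real assume "t \<in> {0..1}"
    from A[OF this] B[OF this] have "\<bar>f t\<bar> \<le> \<bar>A\<bar>" "\<bar>g t\<bar> \<le> \<bar>B\<bar>" by simp_all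
    then have "\<bar>f t - g t\<bar> \<le> \<bar>A\<bar> + \<bar>B\<bar>"
      using abs_triangle_ineq4[of "f t" "g t"] by (meson add_mono order_trans)
    then show "\<bar>t - t\<bar> \<le> \<bar>A\<bar> + \<bar>B\<bar> + 1 \<and> \<bar>f t - g t\<bar> \<le> \<bar>A\<bar> + \<bar>B\<bar> + 1" by simp
  qed
  then show ?thesis by (intro exI[of _ "\<bar>A\<bar> + \<bar>B\<bar> + 1"]) auto
qed

lemma skorokhod_dist_less_iff:
  assumes "f \<in> skorokhod_space" "g \<in> skorokhod_space"
  shows "skorokhod_dist f g < r \<longleftrightarrow> (\<exists>e. 0 < e \<and> e < r \<and> skorokhod_close e f g)"
proof -
  have "{e. 0 < e \<and> skorokhod_close e f g} \<noteq> {}"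
    using skorokhod_close_exists[OF assms] by auto
  moreover have "bdd_below {e. 0 < e \<and> skorokhod_close e f g}"
    by (rule bdd_belowI[of _ 0]) auto
  ultimately have "Inf {e. 0 < e \<and> skorokhod_close e f g} < r \<longleftrightarrow>
      (\<exists>e\<in>{e. 0 < e \<and> skorokhod_close e f g}. e < r)"
    by (rule cInf_less_iff)
  then show ?thesis using assms unfolding skorokhod_dist_def by auto
qed

lemma skorokhod_dist_nonneg: "0 \<le> skorokhod_dist f g"
proof (cases "f \<in> skorokhod_space \<and> g \<in> skorokhod_space")
  case True
  then have "\<not> skorokhod_dist f g < 0"
    by (simp add: skorokhod_dist_less_iff)
  then show ?thesis by simp
qed (auto simp: skorokhod_dist_def)

lemma skorokhod_dist_eq_0_imp_eq:
  assumes f: "f \<in> skorokhod_space" and g: "g \<in> skorokhod_space"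
    and d: "skorokhod_dist f g = 0"
  shows "f = g"
proof -
  have close: "skorokhod_close e f g" if "e > 0" for e
  proof -
    have "skorokhod_dist f g < e" using d that by simp
    then obtain e' where "e' < e" "skorokhod_close e' f g"
      unfolding skorokhod_dist_less_iff[OF f g] by blast
    then show ?thesis by (meson skorokhod_close_mono less_imp_le)
  qed
  have at1: "f 1 = g 1"
  proof (rule ccontr)
    assume n: "f 1 \<noteq> g 1"
    define e where "e = \<bar>f 1 - g 1\<bar> / 2"
    have "e > 0" using n by (simp add: e_def)
    then obtain \<phi> where "\<phi> \<in> time_changes" "\<bar>f 1 - g (\<phi> 1)\<bar> \<le> e"
      using skorokhod_closeE[OF close[of e]] by (metis atLeastAtMost_iff order_refl zero_le_one)
    then have "\<bar>f 1 - g 1\<bar> \<le> e" by (simp add: time_changes_1)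
    then show False using n by (simp add: e_def)
  qed
  have lt1: "f t = g t" if t: "0 \<le> t" "t < 1" for t
  proof (rule ccontr)
    assume n: "f t \<noteq> g t"
    define e where "e = \<bar>f t - g t\<bar> / 4"
    have e: "e > 0" using n by (simp add: e_def)
    have rf: "(f \<longlongrightarrow> f t) (at t within ({0..1} \<inter> {t<..}))"
      using f t by (auto simp: skorokhod_space_def cadlag_on_def)
    have rg: "(g \<longlongrightarrow> g t) (at t within ({0..1} \<inter> {t<..}))"
      using g t by (auto simp: skorokhod_space_def cadlag_on_def)
    obtain d1 where d1: "d1 > 0"
      "\<And>s. s \<in> {0..1} \<Longrightarrow> s > t \<Longrightarrow> \<bar>s - t\<bar> < d1 \<Longrightarrow> \<bar>f s - f t\<bar> < e"
      using tendstoD[OF rf e] unfolding eventually_at by (auto simp: dist_real_def)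
    obtain d2 where d2: "d2 > 0"
      "\<And>s. s \<in> {0..1} \<Longrightarrow> s > t \<Longrightarrow> \<bar>s - t\<bar> < d2 \<Longrightarrow> \<bar>g s - g t\<bar> < e"
      using tendstoD[OF rg e] unfolding eventually_at by (auto simp: dist_real_def)
    define d where "d = min (min d1 d2) (1 - t)"
    have dp: "d > 0" using d1 d2 t by (auto simp: d_def)
    define s where "s = t + d / 2"
    have "d \<le> 1 - t" "d \<le> d1" by (auto simp: d_def)
    then have s: "s \<in> {0..1}" "s > t" "\<bar>s - t\<bar> < d1"
      using dp t by (auto simp: s_def)
    define h where "h = min e (d / 4)"
    have "h > 0" using e dp by (auto simp: h_def)
    then obtain \<phi> where \<phi>: "\<phi> \<in> time_changes" "\<bar>\<phi> s - s\<bar> \<le> h" "\<bar>f s - g (\<phi> s)\<bar> \<le> h"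
      using skorokhod_closeE[OF close[of h]] s(1) by metis
    have "\<phi> s \<in> {0..1}" using \<phi>(1) s(1) by (auto simp: time_changes_def)
    moreover have "\<phi> s > t" "\<bar>\<phi> s - t\<bar> < d2"
    proof -
      have "h \<le> d / 4" "d \<le> d2" unfolding h_def d_def by linarith+
      then show "\<phi> s > t" "\<bar>\<phi> s - t\<bar> < d2"
        using \<phi>(2) dp unfolding s_def abs_le_iff abs_less_iff by linarith+
    qed
    ultimately have "\<bar>g (\<phi> s) - g t\<bar> < e" by (rule d2(2))
    moreover have "\<bar>f s - f t\<bar> < e" using s by (intro d1(2))
    moreover have "\<bar>f s - g (\<phi> s)\<bar> \<le> e" using \<phi>(3) by (auto simp: h_def)
    ultimately have "\<bar>f t - g t\<bar> \<le> 3 * e" unfolding abs_le_iff abs_less_iff by linarith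
    moreover have "\<bar>f t - g t\<bar> = 4 * e" by (simp add: e_def)
    ultimately show False using e by simp
  qed
  show ?thesis
  proof (rule extensionalityI)
    show "f \<in> extensional {0..1}" "g \<in> extensional {0..1}"
      using f g by (auto simp: skorokhod_space_def)
    fix t :: real assume "t \<in> {0..1}"
    then show "f t = g t" using at1 lt1 by (cases "t = 1") auto
  qed
qed

lemma skorokhod_dist_refl: "skorokhod_dist f f = 0"
proof (cases "f \<in> skorokhod_space")
  case True
  have "skorokhod_dist f f < r" if "r > 0" for r
  proof -
    have "skorokhod_close (r / 2) f f"
      unfolding skorokhod_close_def using that by (intro bexI[OF _ time_changes_id]) simp
    then show ?thesis
      unfolding skorokhod_dist_less_iff[OF True True] using that by (intro exI[of _ "r / 2"]) simp
  qed
  then have "\<not> 0 < skorokhod_dist f f" by blast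
  then show ?thesis using skorokhod_dist_nonneg[of f f] by linarith
qed (auto simp: skorokhod_dist_def)

interpretation Skorokhod: Metric_space skorokhod_space skorokhod_dist
proof
  show "0 \<le> skorokhod_dist f g" for f g by (rule skorokhod_dist_nonneg)
  show "skorokhod_dist f g = skorokhod_dist g f" for f g
  proof -
    have "{e. 0 < e \<and> skorokhod_close e f g} = {e. 0 < e \<and> skorokhod_close e g f}"
      using skorokhod_close_commute by blast
    then show ?thesis by (simp add: skorokhod_dist_def)
  qed
  show "skorokhod_dist f g = 0 \<longleftrightarrow> f = g" if "f \<in> skorokhod_space" "g \<in> skorokhod_space" for f g
    using skorokhod_dist_eq_0_imp_eq[OF that] skorokhod_dist_refl by auto
  show "skorokhod_dist f h \<le> skorokhod_dist f g + skorokhod_dist g h"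
    if fgh: "f \<in> skorokhod_space" "g \<in> skorokhod_space" "h \<in> skorokhod_space" for f g h
  proof (rule field_le_epsilon)
    fix e :: real assume e: "e > 0"
    obtain a where a: "0 < a" "a < skorokhod_dist f g + e / 2" "skorokhod_close a f g"
      using skorokhod_dist_less_iff[OF fgh(1,2), of "skorokhod_dist f g + e / 2"] e by auto
    obtain b where b: "0 < b" "b < skorokhod_dist g h + e / 2" "skorokhod_close b g h"
      using skorokhod_dist_less_iff[OF fgh(2,3), of "skorokhod_dist g h + e / 2"] e by auto
    have "skorokhod_dist f h < skorokhod_dist f g + skorokhod_dist g h + e"
      unfolding skorokhod_dist_less_iff[OF fgh(1,3)]
      using skorokhod_close_trans[OF a(3) b(3)] a b by (intro exI[of _ "a + b"]) auto
    then show "skorokhod_dist f h \<le> skorokhod_dist f g + skorokhod_dist g h + e" by simp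
  qed
qed

abbreviation skorokhod_topology :: "(real \<Rightarrow> real) topology" where
  "skorokhod_topology \<equiv> Skorokhod.mtopology"

section \<open>Stable Levy processes without negative jumps\<close>

text \<open>Processes are indexed by \<open>real\<close>; only the indices in the stated time interval matter.\<close>

locale levy_process = prob_space M for M :: "'a measure" +
  fixes L :: "real \<Rightarrow> 'a \<Rightarrow> real"
  assumes random_variable_L: "\<And>t. 0 \<le> t \<Longrightarrow> L t \<in> borel_measurable M"
    and cadlag: "\<And>\<omega>. \<omega> \<in> space M \<Longrightarrow> cadlag_on {0..} (\<lambda>t. L t \<omega>)"
    and start_0: "AE \<omega> in M. L 0 \<omega> = 0"
    and indep_increments:
      "\<And>(n::nat) s. 0 \<le> s 0 \<Longrightarrow> mono_on {..n} s \<Longrightarrow>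
         indep_vars (\<lambda>_. borel) (\<lambda>i \<omega>. L (s (Suc i)) \<omega> - L (s i) \<omega>) {..<n}"
    and stationary_increments:
      "\<And>s t. 0 \<le> s \<Longrightarrow> s \<le> t \<Longrightarrow>
         distr M borel (\<lambda>\<omega>. L t \<omega> - L s \<omega>) = distr M borel (L (t - s))"

text \<open>Strict stability is scaling invariance of the law of the whole process, as a measure on the
  product sigma-algebra. Absence of negative jumps compares the value with the left limit, which
  exists and is unique by the cadlag property.\<close>

locale stable_levy_process_no_neg_jumps = levy_process M L
  for M :: "'a measure" and L :: "real \<Rightarrow> 'a \<Rightarrow> real" +
  fixes \<alpha> :: real
  assumes scaling:
      "\<And>c. 0 < c \<Longrightarrow>
         distr M (\<Pi>\<^sub>M t\<in>{0..}. borel) (\<lambda>\<omega>. \<lambda>t\<in>{0..}. L (c * t) \<omega>) =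
         distr M (\<Pi>\<^sub>M t\<in>{0..}. borel) (\<lambda>\<omega>. \<lambda>t\<in>{0..}. c powr (1 / \<alpha>) * L t \<omega>)"
    and no_neg_jumps:
      "AE \<omega> in M. \<forall>t>0. \<forall>l. ((\<lambda>s. L s \<omega>) \<longlongrightarrow> l) (at_left t) \<longrightarrow> l \<le> L t \<omega>"

section \<open>The meander\<close>

text \<open>\<open>T\<^sub>0\<close>, with the infimum of the empty set equal to \<open>\<infinity>\<close>.\<close>

definition hitting_time_0 :: "(real \<Rightarrow> real) \<Rightarrow> ereal" where
  "hitting_time_0 f = Inf (ereal ` {t. 0 \<le> t \<and> f t = 0})"

text \<open>The process started at \<open>x\<close> is \<open>x + L\<close>. The measure is completed because the hitting event of
  a cadlag process belongs in general only to the completed sigma-algebra, and \<open>uniform_measure\<close> is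
  the conditional measure only for a measurable event.\<close>

definition cond_not_hit :: "'a measure \<Rightarrow> (real \<Rightarrow> 'a \<Rightarrow> real) \<Rightarrow> real \<Rightarrow> 'a measure" where
  "cond_not_hit M L x =
     uniform_measure (completion M) {\<omega> \<in> space M. hitting_time_0 (\<lambda>t. x + L t \<omega>) > 1}"

text \<open>\<open>Y\<close> is a version of the meander of \<open>L\<close>: its law on the Skorokhod space is the weak limit, as
  \<open>x \<down> 0\<close>, of the conditional laws of \<open>(x + L\<^sub>t)\<close>, \<open>0 \<le> t \<le> 1\<close>.\<close>

definition is_meander ::
    "'a measure \<Rightarrow> (real \<Rightarrow> 'a \<Rightarrow> real) \<Rightarrow> 'b measure \<Rightarrow> (real \<Rightarrow> 'b \<Rightarrow> real) \<Rightarrow> bool" where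
  "is_meander M L N Y \<longleftrightarrow>
     prob_space N \<and>
     (\<forall>t\<in>{0..1}. Y t \<in> borel_measurable N) \<and>
     (\<forall>\<omega>\<in>space N. cadlag_on {0..1} (\<lambda>t. Y t \<omega>)) \<and>
     (\<forall>F. continuous_map skorokhod_topology euclideanreal F \<and> bounded (F ` skorokhod_space) \<longrightarrow>
        ((\<lambda>x. \<integral>\<omega>. F (\<lambda>t\<in>{0..1}. x + L t \<omega>) \<partial>cond_not_hit M L x)
           \<longlongrightarrow> (\<integral>\<omega>. F (\<lambda>t\<in>{0..1}. Y t \<omega>) \<partial>N)) (at_right 0))"

definition path_area :: "(real \<Rightarrow> 'b \<Rightarrow> real) \<Rightarrow> 'b \<Rightarrow> real" where
  "path_area Y \<omega> = (LINT t:{0..1}|lborel. Y t \<omega>)"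

section \<open>The special functions\<close>

definition Phi :: "real \<Rightarrow> real \<Rightarrow> real" where
  "Phi \<alpha> x = 1 / pi *
     (\<Sum>n. (-1) ^ n / fact n * Gamma ((1 + real n) / (1 + \<alpha>)) * sin (pi * ((1 + real n) / (1 + \<alpha>)))
            * (1 + \<alpha>) powr ((real n - \<alpha>) / (1 + \<alpha>)) * x ^ n)"

definition Psi :: "real \<Rightarrow> real \<Rightarrow> real" where
  "Psi \<alpha> x = 1 / pi *
     (\<Sum>n. (-1) ^ n / fact n * Gamma ((1 + real n) / (1 + \<alpha>)) * cos (pi * ((1 + real n) / (1 + \<alpha>)))
            * (1 + \<alpha>) powr ((real n - \<alpha>) / (1 + \<alpha>)) * x ^ n)"

end

theory Submission
  imports Defs "HOL-Complex_Analysis.Complex_Analysis" "HOL-Real_Asymp.Real_Asymp"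
begin

text \<open>
  On the ray of angle \<open>pi / (1 + \<alpha>)\<close> the function \<open>exp (s powr (1 + \<alpha>) / (1 + \<alpha>) - Y * s)\<close> decays;
  its integral \<open>H Y\<close> along that ray has real part \<open>pi * \<Psi> Y\<close> and imaginary part \<open>pi * \<Phi> Y\<close>. Averaging
  the exponential martingales of the process, sampled on a dyadic grid, over this ray shows that the
  resolvent of the process started at \<open>y\<close>, killed at 0 and weighted by the exponential of minus its area, is
  \<open>H (\<lambda> + y) - e * H \<lambda>\<close> for some real \<open>e\<close>; as the resolvent is real, the
  imaginary part gives \<open>e = \<Phi> (\<lambda> + y) / \<Phi> \<lambda>\<close>. The slope at \<open>y = 0\<close> is the Wronskian quotient, and dividing
  by the survival probability turns it into the law of the meander. Expanding \<open>\<Phi>\<close> and \<open>H\<close> for large \<open>\<lambda>\<close>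
  (a saddle point for \<open>\<Phi>\<close>) gives the behaviour at 0 of the Laplace transform of the
  area, hence its mean and, by monotonicity of the tail, the asymptotics of the tail.
\<close>

text \<open>The ray comes from the generator. As E[exp (- z L_t)] = exp (t z^al), the generator
  minus the killing rate l + x multiplies exp (- z x) by z^al - l - x. Weighted by exp
  (z^(1+al)/(1+al) - l z) this is the z-derivative of exp (z^(1+al)/(1+al) - (l+x) z), and its
  integral from 0 along a ray of decay is -1. Hence x -> H (l+x) solves the killed equation with
  source 1, and e is the expected discount at the exit, where H takes the value H l. That the exit
  value is H l rests on continuous downward passage: without negative jumps the undershoot of the
  grid walk tends to 0, and its exponential moments, uniform in the grid, let the limit be taken
  under the ray integral. The meander is conditioned on T_0 > 1, the walk on nonnegativity, and the
  two differ on paths that touch 0. At continuity points of the survival probability the difference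
  is null, so only such starting points are used; by scaling this excludes countably many times t.
  Large l probes small t^(1+1/al), so two orders of the expansion beyond the leading one are needed:
  the first gives the mean, the second the tail.\<close>

notation (input) LIMSEQ ("((_)/ ----> (_))" [60, 60] 60)
notation (input) tendsto (infixr "--->" 55)
abbreviation (input) "sint \<equiv> set_integrable lborel"
lemmas slint_def = set_lebesgue_integral_def

section \<open>Cadlag functions on the whole real line\<close>

text \<open>Paths are extended by constants to functions on all of the reals, so that the plain
  filters \<open>at_right\<close> and \<open>at_left\<close> replace the filters relative to an
  interval in \<open>cadlag_on\<close>.\<close>

definition rcll :: "(real => real) => bool" where
 "rcll f \<longleftrightarrow> (\<forall>t. (f ---> f t) (at_right t) & (\<exists>l. (f ---> l) (at_left t)))"

lemma rcll_right: "rcll f ==> (f ---> f t) (at_right t)"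
 by (simp add: rcll_def)

lemma rcll_left: "rcll f ==> \<exists>l. (f ---> l) (at_left t)"
 by (simp add: rcll_def)

lemma rcll_clamp_half_line:
 assumes "cadlag_on {0..} f"
 shows "rcll (%t. f (max 0 t))"
 unfolding rcll_def
proof (intro allI conjI)
 fix t :: real
 show "((%t. f (max 0 t)) ---> f (max 0 t)) (at_right t)"
 proof (cases "t < 0")
  case True
  have "eventually (%s. f (max 0 t) = f (max 0 s)) (at_right t)"
   using eventually_at_right_real[OF True] by eventually_elim (use True in auto)
  hence "eventually (%s. f (max 0 s) = f (max 0 t)) (at_right t)"
   by eventually_elim simp
  thus ?thesis by (rule tendsto_eventually)
 next
  case False
  hence "(f ---> f t) (at t within ({0..} \<inter> {t<..}))"
   using assms by (auto simp: cadlag_on_def)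
  moreover have "{0..} \<inter> {t<..} = {t<..}" using False by auto
  ultimately have "(f ---> f t) (at_right t)" by simp
  moreover have "eventually (%s. f s = f (max 0 s)) (at_right t)"
   using eventually_at_right_less[of t] by eventually_elim (use False in auto)
  ultimately have "((%t. f (max 0 t)) ---> f t) (at_right t)"
   by (rule Lim_transform_eventually)
  with False show ?thesis by (simp add: max_absorb2)
 qed
next
 fix t :: real
 show "\<exists>l. ((%t. f (max 0 t)) ---> l) (at_left t)"
 proof (cases "t <= 0")
  case True
  have "t-1 < t" by simp
  from eventually_at_left_real[OF this] have "eventually (%s. f (max 0 s) = f 0) (at_left t)"
   by eventually_elim (use True in \<open>simp add: max_absorb1\<close>)
  from tendsto_eventually[OF this] show ?thesis by (rule exI)
 next
  case False
  then obtain l where "(f ---> l) (at t within ({0..} \<inter> {..<t}))"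
   using assms unfolding cadlag_on_def by (metis atLeast_iff linorder_not_le less_imp_le)
  moreover have "at t within ({0..} \<inter> {..<t}) = at_left t"
   by (rule at_within_nhd[of t "{0<..}"]) (use False in auto)
  ultimately have "(f ---> l) (at_left t)" by simp
  moreover have "eventually (%s. f s = f (max 0 s)) (at_left t)"
   using eventually_at_left_real[of 0 t] False by (auto elim!: eventually_mono)
  ultimately have "((%t. f (max 0 t)) ---> l) (at_left t)"
   by (rule Lim_transform_eventually)
  thus ?thesis by (rule exI)
 qed
qed

lemma rcll_clamp_unit_interval:
 assumes "cadlag_on {0..1} f"
 shows "rcll (%t. f (max 0 (min 1 t)))"
proof -
 have "cadlag_on {0..} (%t. f (min 1 t))"
  unfolding cadlag_on_def
 proof (intro ballI conjI)
  fix t :: real assume t: "t \<in> {0..}"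
  show "((%t. f (min 1 t)) ---> f (min 1 t)) (at t within ({0..} \<inter> {t<..}))"
  proof (cases "t < 1")
   case True
   hence "(f ---> f t) (at t within ({0..1} \<inter> {t<..}))"
    using assms t by (auto simp: cadlag_on_def)
   also have "at t within ({0..1} \<inter> {t<..}) = at t within ({0..} \<inter> {t<..})"
    by (rule at_within_nhd[of t "{..<1}"]) (use True in auto)
   finally have "(f ---> f t) (at t within ({0..} \<inter> {t<..}))" .
   moreover have "eventually (%s. f s = f (min 1 s)) (at t within ({0..} \<inter> {t<..}))"
    unfolding eventually_at_topological by (intro exI[of _ "{..<1}"]) (use True in auto)
   ultimately have "((%s. f (min 1 s)) ---> f t) (at t within ({0..} \<inter> {t<..}))"
    by (rule Lim_transform_eventually)
   with True show ?thesis by (simp add: min_absorb2)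
  next
   case False
   have "eventually (%s. f (min 1 s) = f (min 1 t)) (at t within ({0..} \<inter> {t<..}))"
    unfolding eventually_at_topological by (intro exI[of _ UNIV]) (use False in auto)
   thus ?thesis by (rule tendsto_eventually)
  qed
  show "\<exists>l. ((%t. f (min 1 t)) ---> l) (at t within ({0..} \<inter> {..<t}))"
  proof (cases "t <= 1")
   case True
   then obtain l where l: "(f ---> l) (at t within ({0..1} \<inter> {..<t}))"
    using assms t unfolding cadlag_on_def by (metis atLeastAtMost_iff atLeast_iff)
   have e: "{0..1} \<inter> {..<t} = {0..} \<inter> {..<t}" using True by auto
   have "eventually (%s. f s = f (min 1 s)) (at t within ({0..} \<inter> {..<t}))"
    unfolding eventually_at_topological by (intro exI[of _ UNIV]) (use True in auto)
   from Lim_transform_eventually[OF l[unfolded e] this] show ?thesis by (rule exI)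
  next
   case False
   have "eventually (%s. f (min 1 s) = f 1) (at t within ({0..} \<inter> {..<t}))"
    unfolding eventually_at_topological by (intro exI[of _ "{1<..}"]) (use False in auto)
   from tendsto_eventually[OF this] show ?thesis by (rule exI)
  qed
 qed
 from rcll_clamp_half_line[OF this] have "rcll (%t. f (min 1 (max 0 t)))" .
 moreover have "(%t. f (min 1 (max 0 t))) = (%t. f (max 0 (min 1 t)))"
  by (rule ext) (simp add: min_def max_def)
 ultimately show ?thesis by simp
qed

text \<open>A jump time t gets a pair of rationals (p, a): p lies between the left limit and
  \<open>f t\<close>, and f stays below p on (a, t). Two times t < t' with the same pair are
  impossible, for then t lies in (a, t') and \<open>f t < p\<close>.\<close>

lemma countable_left_jumps:
 fixes f :: "real => real"
 shows "countable {t. \<exists>l. (f ---> l) (at_left t) & l < f t}" (is "countable ?A")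
proof -
 have "\<exists>p\<in>\<rat>. \<exists>a\<in>\<rat>. a < t & p < f t & (\<forall>s. a < s --> s < t --> f s < p)" if "t \<in> ?A" for t
 proof -
  obtain l where l: "(f ---> l) (at_left t)" "l < f t" using \<open>t \<in> ?A\<close> by auto
  obtain p where p: "p \<in> \<rat>" "l < p" "p < f t" using Rats_dense_in_real[OF l(2)] by auto
  have "eventually (%s. f s < p) (at_left t)" using order_tendstoD(2)[OF l(1) p(2)] .
  then obtain b where b: "b < t" "!!s. b < s ==> s < t ==> f s < p"
   unfolding eventually_at_left_field by auto
  obtain a where "a \<in> \<rat>" "b < a" "a < t" using Rats_dense_in_real[OF b(1)] by auto
  with p b show ?thesis by (intro bexI[of _ p] bexI[of _ a]) auto
 qed
 hence "\<forall>t\<in>?A. \<exists>q. fst q \<in> \<rat> & snd q \<in> \<rat> & snd q < t & fst q < f t &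
   (\<forall>s. snd q < s --> s < t --> f s < fst q)" by fastforce
 from bchoice[OF this] obtain q where q: "\<forall>t\<in>?A. fst (q t) \<in> \<rat> & snd (q t) \<in> \<rat> & snd (q t) < t &
   fst (q t) < f t & (\<forall>s. snd (q t) < s --> s < t --> f s < fst (q t))" by (rule exE)
 define p a where "p = (%t. fst (q t))" and "a = (%t. snd (q t))"
 have pa: "p t \<in> \<rat> & a t \<in> \<rat> & a t < t & p t < f t & (\<forall>s. a t < s --> s < t --> f s < p t)"
  if "t \<in> ?A" for t using bspec[OF q that] by (simp add: p_def a_def)
 have no: False if tt: "t < t'" "t \<in> ?A" "t' \<in> ?A" and e: "p t = p t'" "a t = a t'" for t t'
 proof -
  have "a t' < t" using pa[OF tt(2)] e by metis
  hence "f t < p t'" using pa[OF tt(3)] tt(1) by blast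
  moreover have "p t < f t" using pa[OF tt(2)] by blast
  ultimately show False using e by simp
 qed
 have "inj_on (%t. (p t, a t)) ?A"
 proof (rule inj_onI, rule ccontr)
  fix t t' assume *: "t \<in> ?A" "t' \<in> ?A" "(p t, a t) = (p t', a t')" "t ~= t'"
  then consider "t < t'" | "t' < t" by linarith
  thus False
  proof cases
   case 1 show False using no[OF 1] * by simp
  next
   case 2 show False using no[OF 2] * by simp
  qed
 qed
 moreover have "countable ((%t. (p t, a t)) ` ?A)"
 proof (rule countable_subset)
  show "(%t. (p t, a t)) ` ?A \<subseteq> \<rat> \<times> \<rat>" using pa by blast
  show "countable (\<rat> \<times> \<rat> :: (real \<times> real) set)" by (intro countable_SIGMA countable_rat)
 qed
 ultimately show ?thesis by (rule countable_image_inj_on[rotated])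
qed

text \<open>Downward jumps of f are upward jumps of - f, and by right continuity every discontinuity
  is a jump of one of the two kinds.\<close>

lemma rcll_countable_discont:
 assumes "rcll f"
 shows "countable {t. \<not> isCont f t}"
proof -
 have "countable {t. \<exists>l. (f ---> l) (at_left t) & f t < l}"
 proof (rule countable_subset[OF _ countable_left_jumps[of "%t. - f t"]], rule subsetI)
  fix t assume "t \<in> {t. \<exists>l. (f ---> l) (at_left t) & f t < l}"
  then obtain l where "(f ---> l) (at_left t)" "f t < l" by blast
  hence "((%t. - f t) --->-l) (at_left t) &-l < - f t" by (simp add: tendsto_minus)
  thus "t \<in> {t. \<exists>l. ((%t. - f t) ---> l) (at_left t) & l < - f t}" by blast
 qed
 with countable_left_jumps[of f]
 have "countable ({t. \<exists>l. (f ---> l) (at_left t) & l < f t} \<union>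
   {t. \<exists>l. (f ---> l) (at_left t) & f t < l})" by simp
 thus ?thesis
 proof (rule countable_subset[rotated], safe)
  fix t assume n: "\<not> isCont f t" "\<not> (\<exists>l. (f ---> l) (at_left t) & f t < l)"
  obtain l where l: "(f ---> l) (at_left t)" using rcll_left[OF assms] by auto
  have "l ~= f t"
   using n(1) l rcll_right[OF assms, of t] by (auto simp: continuous_within filterlim_at_split)
  thus "\<exists>l. (f ---> l) (at_left t) & l < f t" using l n(2) by (metis linorder_neqE)
 qed
qed

lemma rcll_borel_measurable [measurable_dest]:
 assumes "rcll f" shows "f \<in> borel_measurable borel"
 by (rule borel_measurable_continuous_countable_exceptions[OF rcll_countable_discont[OF assms]])
  (auto intro!: continuous_at_imp_continuous_on)

lemma rcll_scale:
 assumes "rcll f" "0 < c" shows "rcll (%t. f (c* t))"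
 unfolding rcll_def
proof (intro allI conjI)
 fix t :: real
 have "filterlim (%t. c* t) (at_right (c* t)) (at_right t)"
  unfolding filterlim_at using assms(2)
  by (auto intro!: tendsto_eq_intros eventually_at_right_less eventually_mono[OF eventually_at_right_less[of t]])
 from filterlim_compose[OF rcll_right[OF assms(1)] this]
 show "((%t. f (c* t)) ---> f (c* t)) (at_right t)" .
 obtain l where l: "(f ---> l) (at_left (c* t))" using rcll_left[OF assms(1)] by auto
 have "eventually (%s. s < t) (at_left t)"
  using eventually_at_left_real[of "t-1" t] by (auto elim!: eventually_mono)
 hence "filterlim (%t. c* t) (at_left (c* t)) (at_left t)"
  unfolding filterlim_at using assms(2)
  by (auto intro!: tendsto_eq_intros elim!: eventually_mono)
 from filterlim_compose[OF l this]
 show "\<exists>l. ((%t. f (c* t)) ---> l) (at_left t)" by auto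
qed

lemma rcll_bounded:
 assumes "rcll f" "0 < T"
 obtains B where "0 <= B" "!!t. 0 <= t ==> t <= T ==> \<bar>f t\<bar> <= B"
proof -
 have r: "rcll (%t. f (T* t))" using rcll_scale[OF assms] .
 have "cadlag_on {0..1} (%t. f (T* t))"
  unfolding cadlag_on_def
 proof (intro ballI conjI)
  fix t :: real
  show "((%t. f (T* t)) ---> f (T* t)) (at t within ({0..1} \<inter> {t<..}))"
   by (rule tendsto_mono[OF at_le rcll_right[OF r]]) auto
  obtain l where "((%t. f (T* t)) ---> l) (at_left t)" using rcll_left[OF r] by auto
  thus "\<exists>l. ((%t. f (T* t)) ---> l) (at t within ({0..1} \<inter> {..<t}))"
   by (intro exI[of _ l]) (rule tendsto_mono[OF at_le], auto)
 qed
 from cadlag_on_bounded[OF this] obtain B where "\<forall>t\<in>{0..1}. \<bar>f (T* t)\<bar> <= B"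
  unfolding bounded_iff by auto
 hence B: "\<bar>f (T* t)\<bar> <= B" if "t \<in> {0..1}" for t using that by blast
 have "\<bar>f t\<bar> <= B" if "0 <= t" "t <= T" for t
  using B[of "t/T"] that assms(2) by auto
 moreover from this[of 0] assms(2) have "0 <= B" by (auto intro: order_trans[OF abs_ge_zero])
 ultimately show ?thesis using that by blast
qed

section \<open>Dyadic grids and Riemann sums\<close>

text \<open>Turns sums over a grid into Lebesgue integrals of step functions, so that refining the
  grid becomes an application of dominated convergence.\<close>

lemma step_function_integral:
 fixes g :: "nat => 'a::euclidean_space"
 assumes "0 < dt"
 shows "has_bochner_integral lborel (%u. indicator {0..<real k* dt} u *\<^sub>R g (nat \<lfloor>u/dt\<rfloor>))
      (dt *\<^sub>R (\<Sum>j<k. g j))"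
proof (induction k)
 case (Suc k)
 have ind: "indicator {0..<real (Suc k)* dt} u *\<^sub>R g (nat \<lfloor>u/dt\<rfloor>) =
   indicator {0..<real k* dt} u *\<^sub>R g (nat \<lfloor>u/dt\<rfloor>) +
   indicator {real k* dt..<real (Suc k)* dt} u *\<^sub>R g k" for u
 proof (cases "u \<in> {real k* dt..<real (Suc k)* dt}")
  case True
  hence "real k <= u/dt" "u/dt < real k+1"
   using assms by (auto simp: field_simps)
  hence "\<lfloor>u/dt\<rfloor> = int k" by (intro floor_unique) auto
  moreover have "0 <= u" using True assms by (auto intro: order_trans[of 0 "real k* dt"])
  ultimately show ?thesis using True by (auto simp: indicator_def)
 next
  case False
  hence "u \<in> {0..<real (Suc k)* dt} \<longleftrightarrow> u \<in> {0..<real k* dt}"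
   using assms by (auto simp: algebra_simps)
  thus ?thesis using False by (simp add: indicator_def)
 qed
 have "has_bochner_integral lborel (%u. indicator {real k* dt..<real (Suc k)* dt} u *\<^sub>R g k)
   (measure lborel {real k* dt..<real (Suc k)* dt} *\<^sub>R g k)"
  by (rule has_bochner_integral_indicator)
   (use assms in \<open>auto simp: mult_right_mono\<close>)
 moreover have "measure lborel {real k* dt..<real (Suc k)* dt} = dt"
  using assms by (subst measure_lborel_Ico) (auto simp: algebra_simps)
 ultimately show ?case unfolding ind
  using has_bochner_integral_add[OF Suc] by (simp add: scaleR_add_right)
qed auto

definition grid_floor :: "nat => real => nat" where
 "grid_floor m t = nat \<lfloor>t*2^m\<rfloor>"

lemma grid_floor_bounds:
 assumes "0 <= t"
 shows "real (grid_floor m t)/2^m <= t" (is ?g1) "t < (real (grid_floor m t)+1)/2^m"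
proof -
 have "0 <= \<lfloor>t*2^m\<rfloor>" using assms by simp
 hence e: "real (grid_floor m t) = of_int \<lfloor>t*2^m\<rfloor>" by (simp add: grid_floor_def)
 show ?g1 "t < (real (grid_floor m t)+1)/2^m"
  unfolding e by (simp_all add: divide_simps)
qed

lemma grid_floor_tendsto:
 assumes "0 <= t"
 shows "(%m. real (grid_floor m t)/2^m) ----> t" (is ?g1)
  "(%m. (real (grid_floor m t)+1)/2^m) ----> t" (is ?g2)
proof -
 have 0: "(%m. 1/2^m) ----> (0::real)"
  using LIMSEQ_power_zero[of "1/2::real"] by (simp add: power_one_over)
 show 1: ?g1
 proof (rule tendsto_sandwich[of "%m. t-1/2^m" _ _ "%_. t"])
  show "\<forall>\<^sub>F m in sequentially. t-1/2^m <= real (grid_floor m t)/2^m"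
   using grid_floor_bounds[OF assms] by (auto simp: add_divide_distrib less_eq_real_def algebra_simps)
  show "\<forall>\<^sub>F m in sequentially. real (grid_floor m t)/2^m <= t"
   using grid_floor_bounds[OF assms] by auto
  show "(%m. t-1/2^m) ----> t" using tendsto_diff[OF tendsto_const 0, of t] by simp
 qed auto
 show ?g2
  using tendsto_add[OF 1 0] by (simp add: add_divide_distrib)
qed

text \<open>The next grid point lies strictly to the right of t, so right continuity carries
  information from the dyadic points to every t.\<close>

lemma grid_right_approx:
 assumes "0 <= t"
 shows "filterlim (%m. (real (grid_floor m t)+1)/2^m) (at_right t) sequentially"
 unfolding filterlim_at
proof (intro conjI always_eventually allI)
 show "(real (grid_floor m t)+1)/2^m \<in> {t<..}" for m
  using grid_floor_bounds(2)[OF assms] by simp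
 show "(real (grid_floor m t)+1)/2^m ~= t" for m
  using grid_floor_bounds(2)[OF assms, of m] by linarith
qed (rule grid_floor_tendsto(2)[OF assms])

lemma rcll_AE_isCont:
 assumes "rcll f" shows "AE u in lborel. isCont f u"
proof -
 have "AE u in lborel. u \<notin> {t. \<not> isCont f t}"
  by (intro AE_not_in countable_imp_null_set_lborel rcll_countable_discont assms)
 thus ?thesis by simp
qed

text \<open>Discontinuities are countable, hence null, and at a continuity point the value at the
  last grid point before u converges; a uniform bound on [0,t] dominates.\<close>

lemma rcll_riemann_sums:
 assumes f: "rcll f" and t: "0 < t"
 shows "(%m. (\<Sum>j<grid_floor m t. f (real j/2^m))/2^m) ----> (LBINT u:{0..t}. f u)"
proof -
 obtain B where B: "0 <= B" "!!s. 0 <= s ==> s <= t ==> \<bar>f s\<bar> <= B"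
  using rcll_bounded[OF f t] by metis
 define k where "k = (%m. grid_floor m t)"
 define s where "s = (%m u. indicator {0..<real (k m)*(1/2^m)} u *\<^sub>R
   f (real (nat \<lfloor>u/(1/2^m)\<rfloor>)/2^m))"
 have km: "real (k m)*(1/2^m) <= t" for m
  using grid_floor_bounds(1)[of t m] t by (simp add: k_def)
 have hb: "has_bochner_integral lborel (s m) ((\<Sum>j<k m. f (real j/2^m))/2^m)" for m
  unfolding s_def using step_function_integral[of "1/2^m" "k m" "%j. f (real j/2^m)"] by simp
 have sb: "\<bar>s m u\<bar> <= indicator {0..t} u* B" for m u
 proof (cases "u \<in> {0..<real (k m)*(1/2^m)}")
  case True
  hence u: "0 <= u" "u <= t" using km[of m] by auto
  have "real (nat \<lfloor>u/(1/2^m)\<rfloor>)/2^m <= u"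
   using grid_floor_bounds(1)[of u m] u by (simp add: grid_floor_def)
  thus ?thesis using True u B(2)[of "real (nat \<lfloor>u/(1/2^m)\<rfloor>)/2^m"]
   by (simp add: s_def)
 qed (auto simp: s_def B indicator_def)
 have "(%m. integral\<^sup>L lborel (s m)) ----> (LINT u|lborel. indicator {0..t} u *\<^sub>R f u)"
 proof (rule integral_dominated_convergence[where w = "%u. indicator {0..t} u* B"])
  show "(%u. indicator {0..t} u *\<^sub>R f u) \<in> borel_measurable lborel"
   using rcll_borel_measurable[OF f] by simp
  show "s m \<in> borel_measurable lborel" for m
   using hb[of m] by (rule borel_measurable_has_bochner_integral)
  show "integrable lborel (%u. indicator {0..t} u* B)"
   by (auto intro!: integrable_real_indicator simp: emeasure_lborel_Icc_eq)
  show "AE u in lborel. norm (s m u) <= indicator {0..t} u* B" for m using sb by auto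
  \<comment> \<open>The end point is excluded: all step functions vanish at u = t, while the limit
    there is \<open>f t\<close>.\<close>
  have "(%m. s m u) ----> indicator {0..t} u *\<^sub>R f u" if c: "isCont f u" "u ~= t" for u
  proof (cases "0 <= u & u < t")
   case True
   have "(%m. real (nat \<lfloor>u/(1/2^m)\<rfloor>)/2^m) ----> u"
    using grid_floor_tendsto(1)[of u] True by (simp add: grid_floor_def)
   hence 1: "(%m. f (real (nat \<lfloor>u/(1/2^m)\<rfloor>)/2^m)) ----> f u"
    by (rule isCont_tendsto_compose[OF c(1)])
   have "eventually (%m. u < real (k m)/2^m) sequentially"
    using order_tendstoD(1)[OF grid_floor_tendsto(1)[of t], of u] t True by (simp add: k_def)
   hence "eventually (%m. f (real (nat \<lfloor>u/(1/2^m)\<rfloor>)/2^m) = s m u) sequentially"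
    by eventually_elim (use True in \<open>simp add: s_def\<close>)
   from Lim_transform_eventually[OF 1 this] show ?thesis using True by simp
  next
   case False
   have "s m u = 0" for m using False km[of m] by (auto simp: s_def indicator_def)
   thus ?thesis using False c by (auto simp: indicator_def)
  qed
  note * = this
  show "AE u in lborel. (%m. s m u) ----> indicator {0..t} u *\<^sub>R f u"
   using rcll_AE_isCont[OF f] AE_lborel_singleton[of t] by eventually_elim (rule *)
 qed
 thus ?thesis
  using hb by (simp add: has_bochner_integral_iff slint_def k_def)
qed

section \<open>First passage below 0 without negative jumps\<close>

definition no_down_jumps :: "(real => real) => bool" where
 "no_down_jumps f \<longleftrightarrow> (\<forall>t>0. \<forall>l. (f ---> l) (at_left t) --> l <= f t)"

lemma no_down_jumps_nonneg_left:
 assumes "rcll f" "no_down_jumps f" "0 < t" "!!s. 0 <= s ==> s < t ==> 0 <= f s"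
 shows "0 <= f t"
proof -
 obtain l where l: "(f ---> l) (at_left t)" using rcll_left[OF assms(1)] by auto
 have "eventually (%s. 0 <= f s) (at_left t)"
  using eventually_at_left_real[OF assms(3)] by eventually_elim (use assms(4) in auto)
 hence "0 <= l" by (rule tendsto_lowerbound[OF l]) simp
 thus ?thesis using assms(2,3) l unfolding no_down_jumps_def by force
qed

text \<open>Right continuity reaches all times before t, but t itself need not be dyadic and its
  right neighbours are not controlled; there the absence of negative jumps transfers the sign from
  the left.\<close>

lemma nonneg_on_grid_imp_nonneg:
 assumes "rcll f" "no_down_jumps f" "0 <= t"
  "!!m j. real j/2^m <= t ==> 0 <= f (real j/2^m)" "0 <= s" "s <= t"
 shows "0 <= f s"
proof -
 have lt: "0 <= f s" if "0 <= s" "s < t" for s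
 proof (rule tendsto_lowerbound[OF filterlim_compose[OF rcll_right[OF assms(1)] grid_right_approx[OF that(1)]]])
  have "eventually (%m. (real (grid_floor m s)+1)/2^m < t) sequentially"
   using order_tendstoD(2)[OF grid_floor_tendsto(2)[OF that(1)] that(2)] .
  thus "eventually (%m. 0 <= f ((real (grid_floor m s)+1)/2^m)) sequentially"
  proof eventually_elim
   case (elim m)
   thus ?case using assms(4)[of "Suc (grid_floor m s)" m] by (simp add: add.commute)
  qed
 qed simp
 show ?thesis
 proof (cases "s < t")
  case True thus ?thesis using lt assms by auto
 next
  case False
  hence s: "s = t" using assms by auto
  show ?thesis
  proof (cases "t = 0")
   case True thus ?thesis using assms(4)[of 0 0] s by auto
  next
   case False
   with assms(3) have "0 < t" by simp
   from no_down_jumps_nonneg_left[OF assms(1,2) this lt] show ?thesis by (simp add: s)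
  qed
 qed
qed

lemma rcll_right_nbhd:
 assumes "rcll f" "open U" "f t \<in> U"
 obtains b where "t < b" "!!s. t <= s ==> s < b ==> f s \<in> U"
proof -
 have "eventually (%s. f s \<in> U) (at_right t)"
  using topological_tendstoD[OF rcll_right[OF assms(1)] assms(2,3)] .
 then obtain b where "t < b" "!!s. t < s ==> s < b ==> f s \<in> U"
  unfolding eventually_at_right_field by auto
 with assms(3) show ?thesis by (intro that[of b]) (auto simp: less_eq_real_def)
qed

text \<open>At the infimum a of the negative times the value is nonnegative, since no jump goes
  down, and not positive, by right continuity: the path creeps through 0.\<close>

lemma first_passage:
 assumes f: "rcll f" and j: "no_down_jumps f" and f0: "0 < f 0" and s: "0 <= s" "f s < 0"
 obtains a where "0 < a" "a <= s" "f a = 0" "!!u. 0 <= u ==> f u < 0 ==> a <= u"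
  "!!e. 0 < e ==> \<exists>u. a <= u & u < a+e & f u < 0"
proof -
 define S where "S = {u. 0 <= u & f u < 0}"
 define a where "a = Inf S"
 have sS: "s \<in> S" using s by (simp add: S_def)
 have bdd: "bdd_below S" by (rule bdd_belowI[of _ 0]) (simp add: S_def)
 have le: "a <= u" if "u \<in> S" for u unfolding a_def by (rule cInf_lower[OF that bdd])
 have ap: "\<exists>u. a <= u & u < a+e & f u < 0" if "0 < e" for e
 proof -
  have "S ~= {}" "Inf S < a+e" using sS that by (auto simp: a_def)
  then obtain u where "u \<in> S" "u < a+e" using cInf_lessD by blast
  thus ?thesis using le[of u] by (auto simp: S_def)
 qed
 obtain b where b: "0 < b" "!!u. 0 <= u ==> u < b ==> f u \<in> {0<..}"
  using rcll_right_nbhd[OF f, of "{0<..}" 0] f0 by auto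
 have "b <= a" unfolding a_def
 proof (rule cInf_greatest)
  show "S ~= {}" using sS by blast
  fix x assume "x \<in> S"
  thus "b <= x" using b(2)[of x] by (auto simp: S_def not_less[symmetric])
 qed
 hence a0: "0 < a" using b by auto
 have "0 <= f u" if "0 <= u" "u < a" for u using le[of u] that by (force simp: S_def)
 hence "0 <= f a" by (rule no_down_jumps_nonneg_left[OF f j a0])
 moreover have "\<not> 0 < f a"
 proof
  assume "0 < f a"
  then obtain c where c: "a < c" "!!u. a <= u ==> u < c ==> f u \<in> {0<..}"
   using rcll_right_nbhd[OF f, of "{0<..}" a] by auto
  obtain u where "a <= u" "u < a+(c-a)" "f u < 0" using ap[of "c-a"] c by auto
  thus False using c(2)[of u] by auto
 qed
 ultimately have "f a = 0" by simp
 thus ?thesis using that[of a] a0 le[OF sS] le ap by (auto simp: S_def)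
qed

definition undershoot :: "(nat => real) => nat => real" where
 "undershoot X n = (if \<exists>k\<le>n. X k < 0 then-X (LEAST k. X k < 0) else 0)"

text \<open>The first negative grid times are at least the continuous passage time a and converge to
  it; f is right continuous at a with value 0.\<close>

lemma undershoot_tendsto_0:
 assumes f: "rcll f" and j: "no_down_jumps f" and f0: "0 < f 0"
 shows "(%m. undershoot (%k. f (real k/2^m)) (T*2^m)) ----> 0"
proof (cases "\<exists>m. \<exists>k\<le>T*2^m. f (real k/2^m) < 0")
 case False
 hence "undershoot (%k. f (real k/2^m)) (T*2^m) = 0" for m
  by (auto simp: undershoot_def)
 thus ?thesis by simp
next
 case True
 then obtain m0 k0 where k0: "k0 <= T*2^m0" "f (real k0/2^m0) < 0" by auto
 \<comment> \<open>Grids are nested: index k on level m0 is index \<open>k * 2^(m-m0)\<close> on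
   level m, so a negative value seen once is seen on all finer levels.\<close>
 have ex: "\<exists>k\<le>T*2^m. f (real k/2^m) < 0" if "m0 <= m" for m
 proof (intro exI[of _ "k0*2^(m-m0)"] conjI)
  have e: "(2::nat)^m = 2^m0*2^(m-m0)" "(2::real)^m = 2^m0*2^(m-m0)"
   using that by (simp_all flip: power_add)
  show "k0*2^(m-m0) <= T*2^m" using k0(1) by (simp add: e)
  show "f (real (k0*2^(m-m0))/2^m) < 0" using k0(2) by (simp add: e)
 qed
 obtain a where a: "0 < a" "f a = 0" "!!u. 0 <= u ==> f u < 0 ==> a <= u"
  "!!e. 0 < e ==> \<exists>u. a <= u & u < a+e & f u < 0"
  using first_passage[OF f j f0 _ k0(2)] by (metis divide_nonneg_nonneg of_nat_0_le_iff zero_le_numeral zero_le_power)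
 define T' where "T' = (%m. real (LEAST k. f (real k/2^m) < 0)/2^m)"
 have T': "f (T' m) < 0" if m: "m0 <= m" for m
  unfolding T'_def using ex[OF m] LeastI_ex[of "%k. f (real k/2^m) < 0"] by blast
 have T'a: "a <= T' m" if m: "m0 <= m" for m
  using a(3)[of "T' m"] T'[OF m] by (simp add: T'_def)
 have lim: "T' ----> a"
 proof (rule order_tendstoI)
  fix y assume y: "y < a"
  show "eventually (%m. y < T' m) sequentially"
   using eventually_ge_at_top[of m0] by eventually_elim (use T'a y in force)
 next
  fix y assume y: "a < y"
  then obtain u where u: "a <= u" "u < y" "f u < 0" using a(4)[of "y-a"] by auto
  hence u0: "0 <= u" using a(1) by simp
  have "eventually (%m. f ((real (grid_floor m u)+1)/2^m) < 0) sequentially"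
   using order_tendstoD(2)[OF filterlim_compose[OF rcll_right[OF f] grid_right_approx[OF u0]] u(3)] .
  thus "eventually (%m. T' m < y) sequentially"
   using order_tendstoD(2)[OF grid_floor_tendsto(2)[OF u0] u(2)]
  proof eventually_elim
   case (elim m)
   hence "(LEAST k. f (real k/2^m) < 0) <= Suc (grid_floor m u)"
    by (intro Least_le) (simp add: add.commute)
   hence "T' m <= (real (grid_floor m u)+1)/2^m"
    unfolding T'_def by (intro divide_right_mono) auto
   with elim show ?case by simp
  qed
 qed
 \<comment> \<open>Continuity relative to {a..} tolerates grid times equal to a, which
   \<open>at_right\<close> would not.\<close>
 have cont: "continuous (at a within {a..}) f"
 proof -
  have "{a..}-{a} = {a<..}" by auto
  hence "at a within {a..} = at_right a" by (simp add: at_within_def)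
  thus ?thesis using rcll_right[OF f, of a] by (simp add: continuous_within)
 qed
 have "eventually (%m. T' m \<in> {a..}) sequentially"
  using eventually_ge_at_top[of m0] by eventually_elim (use T'a in auto)
 from continuous_within_tendsto_compose[OF cont this lim]
 have "(%m. - f (T' m)) ---->-f a" by (rule tendsto_minus)
 hence "(%m. - f (T' m)) ----> 0" by (simp add: a(2))
 moreover have "eventually (%m. - f (T' m) = undershoot (%k. f (real k/2^m)) (T*2^m)) sequentially"
  using eventually_ge_at_top[of m0] by eventually_elim (use ex in \<open>auto simp: undershoot_def T'_def\<close>)
 ultimately show ?thesis by (rule Lim_transform_eventually)
qed

text \<open>A negative value in [0,1] would force an earlier zero, by
  \<open>first_passage\<close>.\<close>

lemma hitting_time_gt_1_imp_nonneg:
 assumes f: "rcll f" and j: "no_down_jumps f" and f0: "0 < f 0"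
  and h: "hitting_time_0 f > 1" and s: "0 <= s" "s <= 1"
 shows "0 <= f s"
proof (rule ccontr)
 assume "\<not> 0 <= f s"
 then obtain a where a: "0 < a" "a <= s" "f a = 0"
  using first_passage[OF f j f0 s(1)] by (metis not_le)
 hence "hitting_time_0 f <= ereal a"
  unfolding hitting_time_0_def by (intro Inf_lower imageI) auto
 also have "... <= 1" using a s by (simp flip: ereal_less_eq(3) add: one_ereal_def)
 finally show False using h by simp
qed

text \<open>The margin e excludes zeros on [0,1]; right continuity at 1 pushes the hitting time
  strictly beyond 1. Mere nonnegativity would not do, since the path could touch 0.\<close>

lemma hitting_time_gt_1I:
 assumes f: "rcll f" and e: "0 < e" "!!s. 0 <= s ==> s <= 1 ==> e <= f s"
 shows "hitting_time_0 f > 1"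
proof -
 have "f 1 \<in> {0<..}" using e(1) e(2)[of 1] by simp
 then obtain b where b: "1 < b" "!!s. 1 <= s ==> s < b ==> f s \<in> {0<..}"
  using rcll_right_nbhd[OF f, of "{0<..}" 1] by auto
 have "b <= t" if "0 <= t" "f t = 0" for t
 proof (rule ccontr)
  assume "\<not> b <= t"
  thus False using e(1) e(2)[of t] b(2)[of t] that by (cases "t <= 1") auto
 qed
 hence "ereal b <= hitting_time_0 f"
  unfolding hitting_time_0_def by (intro Inf_greatest) auto
 moreover have "(1::ereal) < ereal b" using b(1) by (simp add: one_ereal_def)
 ultimately show ?thesis by (rule less_le_trans[rotated])
qed

section \<open>The area functional on the Skorokhod space\<close>

lemma skorokhod_spaceD: "f \<in> skorokhod_space ==> rcll (%t. f (max 0 (min 1 t)))"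
 by (auto simp: skorokhod_space_def intro: rcll_clamp_unit_interval)

lemma skorokhod_area_measurable:
 assumes "f \<in> skorokhod_space"
 shows "(%t. indicator {0..1} t *\<^sub>R f t) \<in> borel_measurable lborel"
proof -
 have "(%t. indicator {0..1} t *\<^sub>R f t) = (%t. indicator {0..1} t *\<^sub>R f (max 0 (min 1 t)))"
  by (auto simp: indicator_def fun_eq_iff min_def max_def)
 thus ?thesis using rcll_borel_measurable[OF skorokhod_spaceD[OF assms]] by simp
qed

text \<open>Skorokhod convergence to g gives pointwise convergence at the continuity points of g,
  hence almost everywhere, together with a uniform bound. Dominated convergence along a sequence
  that violates continuity is then a contradiction.\<close>

lemma continuous_map_area:
 "continuous_map skorokhod_topology euclideanreal (%f. LBINT t:{0..1}. f t)"
 unfolding Skorokhod.metric_continuous_map[OF Met_TC.Metric_space_axioms, unfolded mtopology_is_euclidean]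
proof (intro conjI ballI allI impI)
 fix g :: "real => real" and ep :: real
 assume g: "g \<in> skorokhod_space" and ep: "0 < ep"
 show "\<exists>dt>0. \<forall>f. f \<in> skorokhod_space & skorokhod_dist g f < dt -->
   dist (LBINT t:{0..1}. g t) (LBINT t:{0..1}. f t) < ep"
 proof (rule ccontr)
  assume "\<not> ?thesis"
  hence "\<forall>n::nat. \<exists>f. f \<in> skorokhod_space & skorokhod_dist g f < 1/(real n+1) &
   \<not> dist (LBINT t:{0..1}. g t) (LBINT t:{0..1}. f t) < ep"
   by (meson divide_pos_pos of_nat_0_le_iff add_nonneg_pos zero_less_one)
  from choice[OF this] obtain F :: "nat => real => real" where
   F: "!!n. F n \<in> skorokhod_space" "!!n. skorokhod_dist g (F n) < 1/(real n+1)"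
   "!!n. \<not> dist (LBINT t:{0..1}. g t) (LBINT t:{0..1}. F n t) < ep" by blast
  have "\<exists>ph. ph \<in> time_changes & (\<forall>t\<in>{0..1}. \<bar>ph t-t\<bar> <= 1/(real n+1) &
    \<bar>F n t-g (ph t)\<bar> <= 1/(real n+1))" for n
  proof -
   obtain e where e: "e < 1/(real n+1)" "skorokhod_close e g (F n)"
    using F(2)[of n] unfolding skorokhod_dist_less_iff[OF g F(1)] by blast
   \<comment> \<open>The roles are exchanged so that the time change sits inside the fixed path g,
     whose continuity points are known.\<close>
   have "skorokhod_close (1/(real n+1)) (F n) g"
    by (rule skorokhod_close_commute, rule skorokhod_close_mono[OF e(2)]) (use e in simp)
   thus ?thesis unfolding skorokhod_close_def by blast
  qed
  hence "\<forall>n. \<exists>ph. ph \<in> time_changes & (\<forall>t\<in>{0..1}. \<bar>ph t-t\<bar> <= 1/(real n+1) &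
    \<bar>F n t-g (ph t)\<bar> <= 1/(real n+1))" by blast
  from choice[OF this] obtain ph where ph: "!!n. ph n \<in> time_changes"
   "!!n t. t \<in> {0..1} ==> \<bar>ph n t-t\<bar> <= 1/(real n+1)"
   "!!n t. t \<in> {0..1} ==> \<bar>F n t-g (ph n t)\<bar> <= 1/(real n+1)" by blast
  have ph01: "ph n t \<in> {0..1}" if "t \<in> {0..1}" for n t
   using ph(1)[of n] that by (auto simp: time_changes_def)
  define gc where "gc = (%t. g (max 0 (min 1 t)))"
  have gc: "rcll gc" "!!t. t \<in> {0..1} ==> gc t = g t"
   unfolding gc_def using skorokhod_spaceD[OF g] by (auto simp: min_def max_def)
  obtain B where B: "!!t. 0 <= t ==> t <= 1 ==> \<bar>gc t\<bar> <= B"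
   using rcll_bounded[OF gc(1) zero_less_one] by metis
  have 0: "(%n. 1/(real n+1)) ----> 0"
   using LIMSEQ_inverse_real_of_nat by (simp add: inverse_eq_divide add.commute)
  have "(%n. \<integral>t. indicator {0..1} t *\<^sub>R F n t \<partial>lborel) ----> (LINT t|lborel. indicator {0..1} t *\<^sub>R g t)"
  proof (rule integral_dominated_convergence[where w = "%t. indicator {0..1} t*(B+1)"])
   show "(%t. indicator {0..1} t *\<^sub>R g t) \<in> borel_measurable lborel"
    by (rule skorokhod_area_measurable[OF g])
   show "(%t. indicator {0..1} t *\<^sub>R F n t) \<in> borel_measurable lborel" for n
    by (rule skorokhod_area_measurable[OF F(1)])
   show "integrable lborel (%t. indicator {0..1::real} t*(B+1))"
    by (auto intro!: integrable_real_indicator simp: emeasure_lborel_Icc_eq)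
   have "\<bar>F n t\<bar> <= B+1" if t: "t \<in> {0..1}" for n t
   proof -
    have "\<bar>g (ph n t)\<bar> <= B" using B[of "ph n t"] gc(2)[of "ph n t"] ph01[OF t, of n] by simp
    moreover have "1/(real n+1) <= 1" by simp
    ultimately show ?thesis using ph(3)[OF t, of n] by linarith
   qed
   thus "AE t in lborel. norm (indicator {0..1} t *\<^sub>R F n t) <= indicator {0..1} t*(B+1)" for n
    by (auto simp: indicator_def)
   have conv: "(%n. indicator {0..1} t *\<^sub>R F n t) ----> indicator {0..1} t *\<^sub>R g t" if c: "isCont gc t" for t
   proof (cases "t \<in> {0..1}")
    case True
    have "(%n. ph n t-t) ----> 0"
     by (rule Lim_null_comparison[OF _ 0]) (use ph(2)[OF True] in auto)
    hence "(%n. ph n t) ----> t" by (simp add: LIM_zero_iff)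
    hence "(%n. gc (ph n t)) ----> gc t" by (rule isCont_tendsto_compose[OF c])
    hence 1: "(%n. g (ph n t)) ----> g t" using gc(2) ph01 True by simp
    have "(%n. F n t-g (ph n t)) ----> 0"
     by (rule Lim_null_comparison[OF _ 0]) (use ph(3)[OF True] in auto)
    from tendsto_add[OF this 1] show ?thesis using True by simp
   qed simp
   show "AE t in lborel. (%n. indicator {0..1} t *\<^sub>R F n t) ----> indicator {0..1} t *\<^sub>R g t"
    using rcll_AE_isCont[OF gc(1)] by eventually_elim (rule conv)
  qed
  hence "(%n. LBINT t:{0..1}. F n t) ----> (LBINT t:{0..1}. g t)"
   by (simp add: slint_def)
  from tendstoD[OF this ep] have "eventually (%n. False) sequentially"
   by eventually_elim (use F(3) in \<open>simp add: dist_commute\<close>)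
  thus False by simp
 qed
qed simp

section \<open>A Laplace continuity theorem for monotone functions\<close>

lemma set_integrable_weighted_continuous:
 fixes p k :: "real => real"
 assumes "sint {0<..} (%t. exp (- t)* k t)" "continuous_on UNIV p"
 shows "sint {0<..} (%t. exp (- t)* p (exp (- t))* k t)"
proof -
 have "bounded (p ` {0..1})"
  using compact_continuous_image[OF continuous_on_subset[OF assms(2)]] by (simp add: compact_imp_bounded)
 then obtain C where C: "\<forall>x\<in>{0..1}. \<bar>p x\<bar> <= C" by (auto simp: bounded_iff)
 have m[measurable]: "p \<in> borel_measurable borel" by (rule borel_measurable_continuous_onI[OF assms(2)])
 have "integrable lborel (%t. C*(indicator {0<..} t *\<^sub>R (exp (- t)* k t)))"
  using assms(1) unfolding set_integrable_def by (rule integrable_mult_right)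
 thus ?thesis unfolding set_integrable_def
 proof (rule Bochner_Integration.integrable_bound)
  have "(%t. p (exp (- t))*(indicator {0<..} t *\<^sub>R (exp (- t)* k t))) \<in> borel_measurable lborel"
   using assms(1) unfolding set_integrable_def by (intro borel_measurable_times) auto
  thus "(%t. indicator {0<..} t *\<^sub>R (exp (- t)* p (exp (- t))* k t)) \<in> borel_measurable lborel"
   by (simp add: mult_ac)
  show "AE t in lborel. norm (indicator {0<..} t *\<^sub>R (exp (- t)* p (exp (- t))* k t))
    <= norm (C*(indicator {0<..} t *\<^sub>R (exp (- t)* k t)))"
  proof (rule AE_I2)
   fix t :: real
   show "norm (indicator {0<..} t *\<^sub>R (exp (- t)* p (exp (- t))* k t))
    <= norm (C*(indicator {0<..} t *\<^sub>R (exp (- t)* k t)))"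
   proof (cases "t > 0")
    case True
    hence "\<bar>p (exp (- t))\<bar> <= C" using C by auto
    hence "\<bar>p (exp (- t))\<bar> <= \<bar>C\<bar>" by linarith
    thus ?thesis using True by (simp add: abs_mult mult.assoc mult_mono mult_left_mono mult.left_commute[of "exp (- t)"] mult_right_mono)
   qed simp
  qed
 qed
qed

text \<open>Weierstrass approximation in the variable exp (- t): for a polynomial p the integral is
  a finite combination of Laplace transforms at positive integers, and the total masses of the
  measures with density exp (- t) k n t stay bounded, which controls the error for a general
  continuous p.\<close>

lemma laplace_tendsto_continuous:
 fixes k :: "nat => real => real" and k0 p :: "real => real"
 assumes int: "!!n l. 0 < l ==> sint {0<..} (%t. exp (- l* t)* k n t)"
  and int0: "!!l. 0 < l ==> sint {0<..} (%t. exp (- l* t)* k0 t)"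
  and nn: "!!n t. 0 < t ==> 0 <= k n t" "!!t. 0 < t ==> 0 <= k0 t"
  and lim: "!!l. 0 < l ==> (%n. LBINT t:{0<..}. exp (- l* t)* k n t)
        ----> (LBINT t:{0<..}. exp (- l* t)* k0 t)"
  and p: "continuous_on UNIV p"
 shows "(%n. LBINT t:{0<..}. exp (- t)* p (exp (- t))* k n t)
      ----> (LBINT t:{0<..}. exp (- t)* p (exp (- t))* k0 t)"
proof -
 define J where "J = (%(k::real => real) (p::real => real). LBINT t:{0<..}. exp (- t)* p (exp (- t))* k t)"
 define one where "one = (%x::real. 1::real)"
 have i1: "sint {0<..} (%t. exp (- t)* k n t)" for n using int[of 1 n] by simp
 have i10: "sint {0<..} (%t. exp (- t)* k0 t)" using int0[of 1] by simp
 have poly_lim: "(%n. J (k n) q) ----> J k0 q" if q: "real_polynomial_function q" for q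
 proof -
  obtain a N where q: "q = (%x. \<Sum>i\<le>N. a i* x^i)"
   using q unfolding real_polynomial_function_iff_sum by blast
  have e: "exp (- t)* q (exp (- t))* k t = (\<Sum>i\<le>N. a i*(exp (- (real i+1)* t)* k t))"
   for t and k :: "real => real"
  proof -
   have "exp (- (real i+1)* t) = exp (- t)* exp (- t)^i" for i
    by (simp add: exp_of_nat_mult[symmetric] exp_add[symmetric] algebra_simps)
   thus ?thesis unfolding q by (simp add: sum_distrib_left sum_distrib_right mult_ac)
  qed
  have J: "J k' q = (\<Sum>i\<le>N. a i*(LBINT t:{0<..}. exp (- (real i+1)* t)* k' t))"
   if "!!l. 0 < l ==> sint {0<..} (%t. exp (- l* t)* k' t)" for k'
  proof -
   have "J k' q = (LINT t|lborel. (\<Sum>i\<le>N. a i*(indicator {0<..} t *\<^sub>R (exp (- (real i+1)* t)* k' t))))"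
    unfolding J_def slint_def e by (simp add: sum_distrib_left mult_ac)
   also have "... = (\<Sum>i\<le>N. \<integral>t. a i*(indicator {0<..} t *\<^sub>R (exp (- (real i+1)* t)* k' t)) \<partial>lborel)"
   proof (rule Bochner_Integration.integral_sum)
    fix i
    show "integrable lborel (%t. a i*(indicator {0<..} t *\<^sub>R (exp (- (real i+1)* t)* k' t)))"
     using that[of "real i+1", unfolded set_integrable_def] by (rule integrable_mult_right) simp
   qed
   finally show ?thesis by (simp add: slint_def)
  qed
  have Jn: "J (k n) q = (\<Sum>i\<le>N. a i*(LBINT t:{0<..}. exp (- (real i+1)* t)* k n t))" for n
   by (rule J, rule int)
  have J0: "J k0 q = (\<Sum>i\<le>N. a i*(LBINT t:{0<..}. exp (- (real i+1)* t)* k0 t))"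
   by (rule J, rule int0)
  show ?thesis unfolding Jn J0
   by (intro tendsto_sum tendsto_mult tendsto_const lim) auto
 qed
 have "real_polynomial_function one" unfolding one_def by (rule real_polynomial_function.intros(2))
 from poly_lim[OF this] have J1: "(%n. J (k n) one) ----> J k0 one" .
 then obtain C where C: "!!n. \<bar>J (k n) one\<bar> <= C"
  using convergent_imp_Bseq[of "%n. J (k n) one"] by (auto simp: convergent_def Bseq_def)
 have C0: "0 <= C" using C[of 0] by linarith
 have C': "\<bar>J k0 one\<bar> <= C"
  by (rule LIMSEQ_le_const2[OF tendsto_rabs[OF J1]]) (use C in auto)
 have diff: "\<bar>J k' p-J k' q\<bar> <= e* J k' one"
  if i: "sint {0<..} (%t. exp (- t)* k' t)" and nn: "!!t. 0 < t ==> 0 <= k' t"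
   and c: "continuous_on UNIV q" and e: "!!x. x \<in> {0..1} ==> \<bar>p x-q x\<bar> <= e" for k' q e
 proof -
  note ip = set_integrable_weighted_continuous[OF i p] and iq = set_integrable_weighted_continuous[OF i c]
  have io: "sint {0<..} (%t. exp (- t)* one (exp (- t))* k' t)"
   by (rule set_integrable_weighted_continuous[OF i]) (simp add: one_def)
  have d: "sint {0<..} (%t. exp (- t)* p (exp (- t))* k' t-exp (- t)* q (exp (- t))* k' t)"
   by (rule set_integral_diff(1)[OF ip iq])
  have eq: "J k' p-J k' q = (LBINT t:{0<..}. exp (- t)* p (exp (- t))* k' t-exp (- t)* q (exp (- t))* k' t)"
   unfolding J_def by (rule set_integral_diff(2)[OF ip iq, symmetric])
  have "\<bar>J k' p-J k' q\<bar> <= (LBINT t:{0<..}. \<bar>exp (- t)* p (exp (- t))* k' t-exp (- t)* q (exp (- t))* k' t\<bar>)"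
   unfolding eq using set_integral_norm_bound[OF d] by simp
  also have "... <= (LBINT t:{0<..}. e*(exp (- t)* one (exp (- t))* k' t))"
  proof (rule set_integral_mono[OF set_integrable_abs[OF d] set_integrable_mult_right[OF io]])
   fix t :: real assume t: "t \<in> {0<..}"
   have 1: "exp (- t)* p (exp (- t))* k' t-exp (- t)* q (exp (- t))* k' t
     = (p (exp (- t))-q (exp (- t)))*(exp (- t)* k' t)"
    by (simp add: algebra_simps)
   have 2: "0 <= exp (- t)* k' t" using nn[of t] t by simp
   have 3: "\<bar>p (exp (- t))-q (exp (- t))\<bar> <= e" using e[of "exp (- t)"] t by simp
   show "\<bar>exp (- t)* p (exp (- t))* k' t-exp (- t)* q (exp (- t))* k' t\<bar>
     <= e*(exp (- t)* one (exp (- t))* k' t)"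
    unfolding 1 abs_mult[of "p (exp (- t))-q (exp (- t))"] one_def mult_1_right using mult_right_mono[OF 3 2] 2 by (simp only: abs_of_nonneg)
  qed
  also have "... = e* J k' one" unfolding J_def by (rule set_integral_mult_right)
  finally show ?thesis .
 qed
 have "(%n. J (k n) p) ----> J k0 p"
 proof (rule metric_LIMSEQ_I)
  fix r :: real assume r: "0 < r"
  \<comment> \<open>Makes both approximation errors, each at most e C, smaller than r/4; the
    polynomial part contributes a third r/4.\<close>
  define e where "e = r/(4*(C+1))"
  have e: "0 < e" using r C0 by (simp add: e_def)
  obtain q where q: "real_polynomial_function q" "!!x. x \<in> {0..1} ==> \<bar>p x-q x\<bar> < e"
   using Stone_Weierstrass_real_polynomial_function[OF _ continuous_on_subset[OF p subset_UNIV] e, of "{0..1}"] by auto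
  have qc: "continuous_on UNIV q"
   using q(1) continuous_polymonial_function[of q] real_polynomial_function_eq
   by (auto intro!: continuous_at_imp_continuous_on)
  have eC: "e* C < r/4" using r C0 by (simp add: e_def field_simps)
  have d: "\<bar>J (k n) p-J (k n) q\<bar> <= e* C" for n
   using diff[OF i1 nn(1) qc less_imp_le[OF q(2)], of n] C[of n] e
   by (smt (verit) mult_left_mono)
  have d0: "\<bar>J k0 p-J k0 q\<bar> <= e* C"
   using diff[OF i10 nn(2) qc less_imp_le[OF q(2)]] C' e by (smt (verit) mult_left_mono)
  obtain N where N: "!!n. N <= n ==> dist (J (k n) q) (J k0 q) < r/4"
   using metric_LIMSEQ_D[OF poly_lim[OF q(1)], of "r/4"] r by auto
  show "\<exists>N. \<forall>n\<ge>N. dist (J (k n) p) (J k0 p) < r"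
  proof (intro exI allI impI)
   fix n assume "N <= n"
   from N[OF this] d[of n] d0 eC show "dist (J (k n) p) (J k0 p) < r"
    unfolding dist_real_def by linarith
  qed
 qed
 thus ?thesis by (simp add: J_def)
qed

text \<open>Monotonicity compares the value at t0 with averages over a short interval on one side of
  t0, and such averages converge because the tent functions \<open>bet\<close> are continuous in exp
  (- t). The weight w allows an integrable singularity at 0.\<close>

lemma laplace_monotone_lim:
 fixes g :: "nat => real => real" and g0 w :: "real => real"
 assumes w: "!!t. 0 < t ==> 0 < w t" "sint {0<..} (%t. exp (- t)* w t)"
  and int: "!!n l. 0 < l ==> sint {0<..} (%t. exp (- l* t)*(g n t* w t))"
  and int0: "!!l. 0 < l ==> sint {0<..} (%t. exp (- l* t)*(g0 t* w t))"
  and nn: "!!n t. 0 < t ==> 0 <= g n t" "!!t. 0 < t ==> 0 <= g0 t"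
  and lim: "!!l. 0 < l ==> (%n. LBINT t:{0<..}. exp (- l* t)*(g n t* w t))
        ----> (LBINT t:{0<..}. exp (- l* t)*(g0 t* w t))"
  and mono: "(\<forall>n s t. 0 < s --> s <= t --> g n s <= g n t) \<or>
        (\<forall>n s t. 0 < s --> s <= t --> g n t <= g n s)"
  and cont: "isCont g0 t0" and t0: "0 < t0"
 shows "(%n. g n t0) ----> g0 t0"
proof -
 define J where "J = (%(k::real => real) (p::real => real). LBINT t:{0<..}. exp (- t)* p (exp (- t))* k t)"
 \<comment> \<open>A tent in the variable u = exp (- t), positive exactly for c < t < d.\<close>
 define bet where "bet = (%c d u::real. max 0 (min (u-exp (- d)) (exp (- c)-u)))"
 have betc: "continuous_on UNIV (bet c d)" for c d
  unfolding bet_def by (intro continuous_intros)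
 have bet0: "0 <= bet c d u" for c d u by (simp add: bet_def)
 have betz: "bet c d (exp (- t)) = 0" if "t <= c \<or> d <= t" for c d t
 proof -
  have "exp (- c) <= exp (- t) \<or> exp (- t) <= exp (- d)" using that by auto
  hence "min (exp (- t)-exp (- d)) (exp (- c)-exp (- t)) <= 0"
   unfolding min_le_iff_disj by linarith
  from max_absorb1[OF this] show ?thesis unfolding bet_def .
 qed
 have betp: "0 < bet c d (exp (- t))" if "c < t" "t < d" for c d t
  using that by (auto simp: bet_def)
 have nnw: "0 <= g n t* w t" "0 <= g0 t* w t" if "0 < t" for n t
  using nn(1)[OF that, of n] nn(2)[OF that] w(1)[OF that] by simp_all
 have Jlim: "(%n. J (%t. g n t* w t) (bet c d)) ----> J (%t. g0 t* w t) (bet c d)" for c d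
  unfolding J_def
  by (rule laplace_tendsto_continuous[OF int int0 nnw(1) nnw(2) lim betc])
 note iw = set_integrable_weighted_continuous[OF w(2) betc]
 have ig: "sint {0<..} (%t. exp (- t)* bet c d (exp (- t))*(g n t* w t))" for c d n
  by (rule set_integrable_weighted_continuous[OF _ betc]) (use int[of 1 n] in simp)
 have ig0: "sint {0<..} (%t. exp (- t)* bet c d (exp (- t))*(g0 t* w t))" for c d
  by (rule set_integrable_weighted_continuous[OF _ betc]) (use int0[of 1] in simp)
 have Jpos: "0 < J w (bet c d)" if cd: "0 < c" "c < d" for c d
 proof -
  let ?f = "%t. indicator {0<..} t *\<^sub>R (exp (- t)* bet c d (exp (- t))* w t)"
  have i: "integrable lborel ?f" using iw[of c d] by (simp add: set_integrable_def)
  have n: "AE t in lborel. 0 <= ?f t" using w(1) bet0 by (auto simp: indicator_def less_imp_le)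
  have "integral\<^sup>L lborel ?f ~= 0"
  proof
   assume "integral\<^sup>L lborel ?f = 0"
   hence "AE t in lborel. ?f t = 0" using integral_nonneg_eq_0_iff_AE[OF i n] by simp
   hence "AE t in lborel. t \<notin> {c<..<d}"
   proof eventually_elim
    case (elim t)
    thus ?case using betp[of c t d] w(1)[of t] cd by auto
   qed
   hence "{c<..<d} \<in> null_sets lborel" by (subst AE_iff_null_sets) auto
   thus False using cd by (auto simp: null_sets_def)
  qed
  moreover have "0 <= integral\<^sup>L lborel ?f" by (rule integral_nonneg_AE[OF n])
  ultimately show ?thesis by (simp add: J_def slint_def)
 qed
 have upper: "eventually (%n. g n t0 < U+e) sequentially"
  if cd: "0 < c" "c < d" and x: "!!n t. c <= t ==> t <= d ==> g n t0 <= g n t"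
   and U: "!!t. c <= t ==> t <= d ==> g0 t <= U" and e: "0 < e" for c d U e :: real
 proof -
  have "J (%t. g0 t* w t) (bet c d) <= J (%t. U* w t) (bet c d)"
   unfolding J_def
  proof (rule set_integral_mono[OF ig0])
   show "sint {0<..} (%t. exp (- t)* bet c d (exp (- t))*(U* w t))"
    using set_integrable_mult_right[OF iw[of c d], of U] by (simp add: mult_ac)
   fix t :: real assume "t \<in> {0<..}"
   thus "exp (- t)* bet c d (exp (- t))*(g0 t* w t) <= exp (- t)* bet c d (exp (- t))*(U* w t)"
    using betz[of t c d] bet0[of c d "exp (- t)"] U[of t] w(1)[of t]
    by (cases "t <= c \<or> d <= t") (auto intro!: mult_left_mono mult_right_mono)
  qed
  also have "J (%t. U* w t) (bet c d) = U* J w (bet c d)"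
   unfolding J_def by (subst set_integral_mult_right[symmetric]) (simp add: mult_ac)
  also have "... < (U+e)* J w (bet c d)" using Jpos[OF cd] e by (simp add: algebra_simps)
  finally have "eventually (%n. J (%t. g n t* w t) (bet c d) < (U+e)* J w (bet c d)) sequentially"
   by (rule order_tendstoD(2)[OF Jlim])
  thus ?thesis
  proof eventually_elim
   case (elim n)
   have "g n t0* J w (bet c d) <= J (%t. g n t* w t) (bet c d)"
    unfolding J_def set_integral_mult_right[symmetric]
   proof (rule set_integral_mono[OF _ ig])
    show "sint {0<..} (%t. g n t0*(exp (- t)* bet c d (exp (- t))* w t))"
     using set_integrable_mult_right[OF iw[of c d], of "g n t0"] by simp
    fix t :: real assume "t \<in> {0<..}"
    thus "g n t0*(exp (- t)* bet c d (exp (- t))* w t) <= exp (- t)* bet c d (exp (- t))*(g n t* w t)"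
     using betz[of t c d] bet0[of c d "exp (- t)"] x[of t n] w(1)[of t]
     by (cases "t <= c \<or> d <= t") (auto simp: mult.left_commute[of "g n t0"] mult.assoc intro!: mult_left_mono mult_right_mono)
   qed
   with elim have "g n t0* J w (bet c d) < (U+e)* J w (bet c d)" by linarith
   thus ?case using Jpos[OF cd] by (simp add: mult_less_cancel_right)
  qed
 qed
 have lower: "eventually (%n. U-e < g n t0) sequentially"
  if cd: "0 < c" "c < d" and x: "!!n t. c <= t ==> t <= d ==> g n t <= g n t0"
   and U: "!!t. c <= t ==> t <= d ==> U <= g0 t" and e: "0 < e" for c d U e :: real
 proof -
  have "(U-e)* J w (bet c d) < U* J w (bet c d)" using Jpos[OF cd] e by (simp add: algebra_simps)
  also have "U* J w (bet c d) = J (%t. U* w t) (bet c d)"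
   unfolding J_def by (subst set_integral_mult_right[symmetric]) (simp add: mult_ac)
  also have "... <= J (%t. g0 t* w t) (bet c d)"
   unfolding J_def
  proof (rule set_integral_mono[OF _ ig0])
   show "sint {0<..} (%t. exp (- t)* bet c d (exp (- t))*(U* w t))"
    using set_integrable_mult_right[OF iw[of c d], of U] by (simp add: mult_ac)
   fix t :: real assume "t \<in> {0<..}"
   thus "exp (- t)* bet c d (exp (- t))*(U* w t) <= exp (- t)* bet c d (exp (- t))*(g0 t* w t)"
    using betz[of t c d] bet0[of c d "exp (- t)"] U[of t] w(1)[of t]
    by (cases "t <= c \<or> d <= t") (auto intro!: mult_left_mono mult_right_mono)
  qed
  finally have "eventually (%n. (U-e)* J w (bet c d) < J (%t. g n t* w t) (bet c d)) sequentially"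
   by (rule order_tendstoD(1)[OF Jlim])
  thus ?thesis
  proof eventually_elim
   case (elim n)
   have "J (%t. g n t* w t) (bet c d) <= g n t0* J w (bet c d)"
    unfolding J_def set_integral_mult_right[symmetric]
   proof (rule set_integral_mono[OF ig])
    show "sint {0<..} (%t. g n t0*(exp (- t)* bet c d (exp (- t))* w t))"
     using set_integrable_mult_right[OF iw[of c d], of "g n t0"] by simp
    fix t :: real assume "t \<in> {0<..}"
    thus "exp (- t)* bet c d (exp (- t))*(g n t* w t) <= g n t0*(exp (- t)* bet c d (exp (- t))* w t)"
     using betz[of t c d] bet0[of c d "exp (- t)"] x[of t n] w(1)[of t]
     by (cases "t <= c \<or> d <= t") (auto simp: mult.left_commute[of "g n t0"] mult.assoc intro!: mult_left_mono mult_right_mono)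
   qed
   with elim have "(U-e)* J w (bet c d) < g n t0* J w (bet c d)" by linarith
   thus ?case using Jpos[OF cd] by (simp add: mult_less_cancel_right)
  qed
 qed
 have near: "\<exists>et>0. et < t0 & (\<forall>t. \<bar>t-t0\<bar> <= et --> \<bar>g0 t-g0 t0\<bar> <= e)" if e: "0 < e" for e :: real
 proof -
  obtain s where s: "0 < s" "!!t. \<bar>t-t0\<bar> < s ==> \<bar>g0 t-g0 t0\<bar> < e"
   using cont e unfolding continuous_at_eps_delta dist_real_def by blast
  show ?thesis
  proof (intro exI[of _ "min s t0/2"] conjI allI impI)
   fix t assume "\<bar>t-t0\<bar> <= min s t0/2"
   hence "\<bar>t-t0\<bar> < s" using s(1) t0 by linarith
   from s(2)[OF this] show "\<bar>g0 t-g0 t0\<bar> <= e" by simp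
  qed (use s(1) t0 in auto)
 qed
 show ?thesis
 proof (rule order_tendstoI)
  fix y assume y: "g0 t0 < y"
  define e where "e = (y-g0 t0)/2"
  have e: "0 < e" using y by (simp add: e_def)
  obtain et where et: "0 < et" "et < t0" "\<forall>t. \<bar>t-t0\<bar> <= et --> \<bar>g0 t-g0 t0\<bar> <= e"
   using near[OF e] by blast
  have b: "g0 t <= g0 t0+e" if "\<bar>t-t0\<bar> <= et" for t using et(3) that by (smt (verit))
  \<comment> \<open>For an upper bound the interval lies on the side of t0 where g n is larger: to
    the right if g n increases, to the left if it decreases. The lower bound uses the opposite
    side.\<close>
  from mono have "eventually (%n. g n t0 < g0 t0+e+e) sequentially"
  proof
   assume m: "\<forall>n s t. 0 < s --> s <= t --> g n s <= g n t"
   show ?thesis by (rule upper[of t0 "t0+et"]) (use t0 et e m b in auto)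
  next
   assume m: "\<forall>n s t. 0 < s --> s <= t --> g n t <= g n s"
   show ?thesis by (rule upper[of "t0-et" t0]) (use t0 et e m b in auto)
  qed
  thus "eventually (%n. g n t0 < y) sequentially" by (simp add: e_def)
 next
  fix y assume y: "y < g0 t0"
  define e where "e = (g0 t0-y)/2"
  have e: "0 < e" using y by (simp add: e_def)
  obtain et where et: "0 < et" "et < t0" "\<forall>t. \<bar>t-t0\<bar> <= et --> \<bar>g0 t-g0 t0\<bar> <= e"
   using near[OF e] by blast
  have b: "g0 t0-e <= g0 t" if "\<bar>t-t0\<bar> <= et" for t using et(3) that by (smt (verit))
  from mono have "eventually (%n. g0 t0-e-e < g n t0) sequentially"
  proof
   assume m: "\<forall>n s t. 0 < s --> s <= t --> g n s <= g n t"
   show ?thesis by (rule lower[of "t0-et" t0]) (use t0 et e m b in auto)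
  next
   assume m: "\<forall>n s t. 0 < s --> s <= t --> g n t <= g n s"
   show ?thesis by (rule lower[of t0 "t0+et"]) (use t0 et e m b in auto)
  qed
  thus "eventually (%n. y < g n t0) sequentially" by (simp add: e_def)
 qed
qed

section \<open>Contour deformation in the closed right half plane\<close>

text \<open>The boundary is included because rays start at 0 and the imaginary axis is a contour
  too; on it only continuity of f is assumed.\<close>

lemma halfplane_primitive:
 fixes f :: "complex => complex"
 assumes "continuous_on {z. 0 <= Re z} f" "!!z. 0 < Re z ==> f field_differentiable at z"
 obtains F where "!!z. 0 <= Re z ==> (F has_field_derivative f z) (at z within {z. 0 <= Re z})"
proof -
 have "interior {z. 0 <= Re z} \<subseteq> {z. 0 < Re z}"
 proof
  fix z assume "z \<in> interior {z. 0 <= Re z}"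
  hence "\<exists>e>0. cball z e \<subseteq> {z. 0 <= Re z}" by (simp only: mem_interior_cball)
  then obtain e where e: "0 < e" "cball z e \<subseteq> {z. 0 <= Re z}" by (elim exE conjE)
  have "z - of_real e \<in> cball z e" using e(1) by (simp add: dist_norm)
  hence "0 <= Re (z - of_real e)" using e(2) by blast
  thus "z \<in> {z. 0 < Re z}" using e(1) by simp
 qed
 hence "f field_differentiable at z" if "z \<in> interior {z. 0 <= Re z}-{}" for z
  using that assms(2) by blast
 from holomorphic_convex_primitive[OF convex_halfspace_Re_ge finite.emptyI assms(1) this]
 obtain F where "!!z. z \<in> {z. 0 <= Re z} ==> (F has_field_derivative f z) (at z within {z. 0 <= Re z})"
  by blast
 thus ?thesis by (intro that[of F]) simp
qed

lemma ray_integral: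
 fixes f :: "complex => complex"
 assumes F: "!!z. 0 <= Re z ==> (F has_field_derivative f z) (at z within {z. 0 <= Re z})"
  and f: "continuous_on {z. 0 <= Re z} f" and ad: "0 <= Re a" "0 <= Re d" and R: "0 <= R"
 shows "(LINT r|lborel. indicator {0..R} r *\<^sub>R (d* f (a + of_real r* d))) = F (a + of_real R* d)-F a"
proof -
 have in_hp: "a + of_real r* d \<in> {z. 0 <= Re z}" if "r \<in> {0..R}" for r
  using that ad by simp
 have "(LINT r|lborel. indicator {0..R} r *\<^sub>R (d* f (a + of_real r* d)))
   = (F \<circ> (%r. a + of_real r* d)) R-(F \<circ> (%r. a + of_real r* d)) 0"
 proof (rule integral_FTC_atLeastAtMost[OF R])
  fix r assume r: "0 <= r" "r <= R"
  have "((%r. a + of_real r* d) has_vector_derivative d) (at r within {0..R})"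
   by (auto intro!: derivative_eq_intros simp: has_vector_derivative_def scaleR_conv_of_real)
  moreover have "(F has_field_derivative f (a + of_real r* d)) (at (a + of_real r* d) within (%r. a + of_real r* d) ` {0..R})"
   by (rule has_field_derivative_subset[OF F]) (use in_hp r in auto)
  ultimately show "((F \<circ> (%r. a + of_real r* d)) has_vector_derivative d* f (a + of_real r* d)) (at r within {0..R})"
   by (rule field_vector_diff_chain_within)
 next
  show "continuous_on {0..R} (%r. d* f (a + of_real r* d))"
   by (intro continuous_intros continuous_on_compose2[OF f]) (use in_hp in auto)
 qed
 thus ?thesis by simp
qed

text \<open>Both rays are deformed into one another inside the half plane; only the primitive at the
 starting points survives.\<close>

lemma ray_deformation:
 fixes f :: "complex => complex" and b :: "real => real"
 assumes F: "!!z. 0 <= Re z ==> (F has_field_derivative f z) (at z within {z. 0 <= Re z})"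
  and f: "continuous_on {z. 0 <= Re z} f"
  and ad: "0 <= Re a1" "0 <= Re d1" "0 <= Re a2" "0 <= Re d2"
  and i1: "sint {0..} (%r. d1* f (a1 + of_real r* d1))"
  and i2: "sint {0..} (%r. d2* f (a2 + of_real r* d2))"
  and b: "eventually (%R. \<forall>z\<in>closed_segment (a1 + of_real R* d1) (a2 + of_real R* d2). norm (f z) <= b R) at_top"
  and lim: "((%R. b R*(norm (a2-a1)+R* norm (d2-d1))) ---> 0) at_top"
 shows "(LBINT r:{0..}. d1* f (a1 + of_real r* d1))+F a1
    = (LBINT r:{0..}. d2* f (a2 + of_real r* d2))+F a2"
proof -
 have ray: "((%R. F (a + of_real R* d)) ---> (LBINT r:{0..}. d* f (a + of_real r* d))+F a) at_top"
  if ad: "0 <= Re a" "0 <= Re d" and i: "sint {0..} (%r. d* f (a + of_real r* d))" for a d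
 proof -
  have "((%R. (LINT r|lborel. indicator {..R} r *\<^sub>R (indicator {0..} r *\<^sub>R (d* f (a + of_real r* d)))))
    ---> (LBINT r:{0..}. d* f (a + of_real r* d))) at_top"
   unfolding slint_def
   by (rule tendsto_integral_at_top) (use i in \<open>simp_all add: set_integrable_def\<close>)
  moreover have "eventually (%R. (LINT r|lborel. indicator {..R} r *\<^sub>R (indicator {0..} r *\<^sub>R (d* f (a + of_real r* d))))
    = F (a + of_real R* d)-F a) at_top"
   using eventually_ge_at_top[of 0]
  proof eventually_elim
   case (elim R)
   have "indicator {..R} r *\<^sub>R (indicator {0..} r *\<^sub>R x) = indicator {0..R} r *\<^sub>R x" for r and x :: complex
    by (auto simp: indicator_def)
   thus ?case using ray_integral[OF F f ad elim] by (simp only:)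
  qed
  ultimately have "((%R. F (a + of_real R* d)-F a) ---> (LBINT r:{0..}. d* f (a + of_real r* d))) at_top"
   by (rule Lim_transform_eventually)
  from tendsto_add[OF this tendsto_const[of "F a"]] show ?thesis by simp
 qed
 have "((%R. F (a1 + of_real R* d1)-F (a2 + of_real R* d2)) ---> 0) at_top"
 proof (rule Lim_null_comparison[OF _ lim])
  show "eventually (%R. norm (F (a1 + of_real R* d1)-F (a2 + of_real R* d2))
    <= b R*(norm (a2-a1)+R* norm (d2-d1))) at_top"
   using b eventually_ge_at_top[of 0]
  proof eventually_elim
   case (elim R)
   let ?S = "closed_segment (a1 + of_real R* d1) (a2 + of_real R* d2)"
   have hp: "?S \<subseteq> {z. 0 <= Re z}"
    by (rule closed_segment_subset[OF _ _ convex_halfspace_Re_ge]) (use ad elim in auto)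
   have "norm (F (a1 + of_real R* d1)-F (a2 + of_real R* d2))
     <= b R* norm ((a1 + of_real R* d1)-(a2 + of_real R* d2))"
    by (rule field_differentiable_bound[where S = ?S and f' = f])
     (use elim hp in \<open>auto intro!: has_field_derivative_subset[OF F]\<close>)
   also have "... <= b R*(norm (a2-a1)+R* norm (d2-d1))"
   proof (rule mult_left_mono)
    have "(a1 + of_real R* d1)-(a2 + of_real R* d2) = - ((a2-a1) + of_real R*(d2-d1))"
     by (simp add: algebra_simps)
    hence "norm ((a1 + of_real R* d1)-(a2 + of_real R* d2)) = norm ((a2-a1) + of_real R*(d2-d1))"
     by (simp only: norm_minus_cancel)
    thus "norm ((a1 + of_real R* d1)-(a2 + of_real R* d2)) <= norm (a2-a1)+R* norm (d2-d1)"
     using norm_triangle_ineq[of "a2-a1" "of_real R*(d2-d1)"] elim(2) by (simp only: norm_mult norm_of_real abs_of_nonneg)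
    show "0 <= b R" using elim(1) by (meson ends_in_segment(1) norm_ge_zero order_trans)
   qed
   finally show ?case .
  qed
 qed
 moreover have "((%R. F (a1 + of_real R* d1)-F (a2 + of_real R* d2)) --->
   ((LBINT r:{0..}. d1* f (a1 + of_real r* d1))+F a1) -
   ((LBINT r:{0..}. d2* f (a2 + of_real r* d2))+F a2)) at_top"
  by (intro tendsto_diff ray ad i1 i2)
 ultimately show ?thesis using tendsto_unique[OF trivial_limit_at_top_linorder] by fastforce
qed

lemma powr_rcis:
 assumes "0 <= r" "- pi < t" "t <= pi"
 shows "(of_real r* cis t) powr of_real s = of_real (r powr s)* cis (s* t)"
proof (cases "r = 0")
 case False
 hence r: "0 < r" using assms by simp
 have "Ln (of_real r* cis t) = of_real (ln r) + of_real t*\<i>"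
  using Ln_times_of_real[OF r, of "cis t"] Ln_cis[of t] assms Ln_of_real[OF r] by simp
 thus ?thesis using r assms
  by (simp add: powr_def cis_conv_exp exp_of_real[symmetric] exp_add[symmetric] algebra_simps)
qed simp

lemma continuous_on_powr_halfplane:
 assumes "0 < s"
 shows "continuous_on {z. 0 <= Re z} (%z. z powr of_real s)"
 by (rule continuous_on_powr_complex) (use assms in auto)

lemma has_field_derivative_powr_halfplane:
 assumes "0 < Re z"
 shows "((%z. z powr of_real s) has_field_derivative of_real s* z powr of_real (s-1)) (at z)"
 using has_field_derivative_powr[of z "of_real s"] assms
 by (auto simp: complex_nonpos_Reals_iff)

lemma norm_powr_of_real [simp]: "norm (z powr of_real s) = norm z powr s" for z :: complex
 by (simp add: norm_powr_real_powr')

lemma differentiable_powr_halfplane: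
 assumes "0 < Re z" shows "(%z. z powr of_real s) field_differentiable at z"
 using has_field_derivative_powr_halfplane[OF assms] field_differentiable_def by blast

text \<open>The value of exp (z^(1+al) / (1+al)) at distance r from 0 on the ray of angle pi /
  (1+al), where z^(1+al) = - r^(1+al).\<close>

definition ray_weight :: "real => real => real" where
 "ray_weight al r = exp (- (r powr (1+al)/(1+al)))"

text \<open>A common majorant of the integrands on the ray of angle \<open>pi / (1 + al)\<close>.\<close>

definition ray_bound :: "real => real => real => real" where
 "ray_bound al c r = exp (c*(1+r) powr al)* ray_weight al r"

text \<open>The exponent c (1+r)^al + r - r^(1+al)/(1+al) tends to minus infinity, hence is bounded
  above on r >= 0.\<close>

lemma ray_bound_exp_decay:
 assumes "1 < al"
 shows "\<exists>C. \<forall>r\<ge>0. ray_bound al c r <= C* exp (- r)"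
proof -
 define h where "h = (%r::real. c*(1+r) powr al+r-r powr (1+al)/(1+al))"
 have "filterlim h at_bot at_top"
  unfolding h_def using assms by real_asymp
 hence "eventually (%r. h r <= 0) at_top" by (simp add: filterlim_at_bot)
 then obtain R where R: "!!r. R <= r ==> h r <= 0" by (auto simp: eventually_at_top_linorder)
 have "continuous_on {0..max 0 R} h"
  unfolding h_def using assms by (intro continuous_intros continuous_on_powr') auto
 hence "bounded (h ` {0..max 0 R})" by (intro compact_imp_bounded compact_continuous_image) auto
 then obtain B where B: "\<forall>r\<in>{0..max 0 R}. \<bar>h r\<bar> <= B" by (auto simp: bounded_iff)
 have "h r <= max 0 B" if "0 <= r" for r
 proof (cases "r <= R")
  case True
  with B that have "\<bar>h r\<bar> <= B" by auto
  thus ?thesis by linarith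
 qed (use R[of r] in auto)
 moreover have "ray_bound al c r = exp (h r)* exp (- r)" for r
  by (simp add: ray_bound_def ray_weight_def h_def exp_add[symmetric])
 ultimately have "\<forall>r\<ge>0. ray_bound al c r <= exp (max 0 B)* exp (- r)"
  by (auto simp: mult_right_mono)
 thus ?thesis by blast
qed

lemma set_integrable_exp_neg: "sint {0..} (%r::real. exp (- r))"
proof -
 have "sint {0<..} (%r::real. exp (- r))"
  using integrable_I0i_exp_mscale[of 1] by simp
 moreover have sing: "sint {0} (%r::real. exp (- r))"
 proof -
  have "(%x. indicator {0} x *\<^sub>R exp (- x)) = (%x::real. indicator {0} x *\<^sub>R 1)"
   by (auto simp: indicator_def)
  thus ?thesis by (simp add: set_integrable_def)
 qed
 ultimately have "sint ({0<..} \<union> {0}) (%r::real. exp (- r))"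
  by (intro set_integrable_Un) (use sing in auto)
 moreover have "{0<..} \<union> {0} = {0::real..}" by auto
 ultimately show ?thesis by simp
qed

lemma measurable_ray_bound [measurable]: "ray_bound al c \<in> borel_measurable borel"
 "ray_weight al \<in> borel_measurable borel"
 unfolding ray_bound_def[abs_def] ray_weight_def[abs_def] by measurable

lemma ray_bound_integrable:
 assumes "1 < al" shows "sint {0..} (ray_bound al c)"
proof -
 obtain C where C: "\<forall>r\<ge>0. ray_bound al c r <= C* exp (- r)" using ray_bound_exp_decay[OF assms] by blast
 show ?thesis
 proof (rule set_integrable_bound[OF set_integrable_mult_right[OF set_integrable_exp_neg, of C]])
  show "set_borel_measurable lborel {0..} (ray_bound al c)"
   unfolding set_borel_measurable_def by measurable
  have "norm (ray_bound al c r) <= norm (C* exp (- r))" if "0 <= r" for r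
   using C that by (auto simp: ray_bound_def ray_weight_def intro: order_trans[OF _ abs_ge_self])
  thus "AE x in lborel. x \<in> {0..} --> norm (ray_bound al c x) <= norm (C* exp (- x))" by auto
 qed
qed

lemma ray_dominated_integrable:
 fixes f :: "real => complex"
 assumes "1 < al" "set_borel_measurable lborel {0..} f"
  "!!r. 0 <= r ==> norm (f r) <= C* ray_bound al c r"
 shows "sint {0..} f"
proof (rule set_integrable_bound[OF set_integrable_mult_right[OF ray_bound_integrable[OF assms(1), of c], of C] assms(2)])
 show "AE x in lborel. x \<in> {0..} --> norm (f x) <= norm (C* ray_bound al c x)"
  using assms(3) by (auto intro: order_trans[OF _ abs_ge_self])
qed

lemma integral_split_half_lines:
 fixes g :: "real => complex"
 assumes "integrable lborel g"
 shows "integral\<^sup>L lborel g = (LBINT r:{0..}. g r)+(LBINT r:{0..}. g (- r))"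
proof -
 have i1: "integrable lborel (%r. indicator {0..} r *\<^sub>R g r)" "integrable lborel (%r. indicator {..<0} r *\<^sub>R g r)"
  using assms by (auto intro!: integrable_mult_indicator)
 have "integral\<^sup>L lborel g = (LINT r|lborel. indicator {0..} r *\<^sub>R g r+indicator {..<0} r *\<^sub>R g r)"
  by (intro Bochner_Integration.integral_cong) (auto simp: indicator_def)
 also have "... = (LINT r|lborel. indicator {0..} r *\<^sub>R g r)+(LINT r|lborel. indicator {..<0} r *\<^sub>R g r)"
  by (rule Bochner_Integration.integral_add[OF i1])
 also have "(LINT r|lborel. indicator {..<0} r *\<^sub>R g r) = (LINT r|lborel. indicator {..<0} (- r) *\<^sub>R g (- r))"
  using lborel_integral_real_affine[of "-1" "%r. indicator {..<0} r *\<^sub>R g r" 0] by simp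
 also have "... = (LINT r|lborel. indicator {0..} r *\<^sub>R g (- r))"
 proof (rule integral_cong_AE)
  have [measurable]: "g \<in> borel_measurable borel" using assms by auto
  show "(%r. indicator {..<0} (- r) *\<^sub>R g (- r)) \<in> borel_measurable lborel"
   "(%r. indicator {0..} r *\<^sub>R g (- r)) \<in> borel_measurable lborel" by measurable
  show "AE r in lborel. indicator {..<0} (- r) *\<^sub>R g (- r) = indicator {0..} r *\<^sub>R g (- r)"
   using AE_lborel_singleton[of 0] by eventually_elim (auto simp: indicator_def)
 qed
 finally show ?thesis by (simp add: slint_def)
qed

section \<open>Exponential moments from the characteristic function\<close>

lemma integrable_gaussian:
 assumes "0 < c" shows "integrable lborel (%x::real. exp (- (c* x^2)))"
proof -
 have "integrable lborel (%x. sqrt (pi/c)* normal_density 0 (1/sqrt (2* c)) x)"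
  using assms by (intro integrable_mult_right integrable_normal_density) simp
 moreover have "sqrt (pi/c)* normal_density 0 (1/sqrt (2* c)) x = exp (- (c* x^2))" for x
 proof -
  have "2* pi*(1/sqrt (2* c))\<^sup>2 = pi/c" using assms by (simp add: power_divide)
  moreover have "(x-0)\<^sup>2/(2*(1/sqrt (2* c))\<^sup>2) = c* x^2" using assms by (simp add: power_divide)
  moreover have "sqrt (pi/c) ~= 0" using assms by simp
  ultimately show ?thesis unfolding normal_density_def by (simp add: field_simps)
 qed
 ultimately show ?thesis by simp
qed

text \<open>The line of integration moves from the imaginary axis to the vertical line through z.
  Since \<open>ep <= 1/8\<close>, the Gaussian decays in the imaginary direction at rate at least 4,
  which outweighs the growth permitted to P.\<close>

lemma gaussian_contour_shift:
 fixes P :: "complex => complex"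
 assumes P: "continuous_on {z. 0 <= Re z} P" "!!z. 0 < Re z ==> P field_differentiable at z"
  and bound: "!!w. 0 <= Re w ==> norm (P w) <= C* exp ((norm w)\<^sup>2)"
  and eps: "0 < ep" "ep <= 1/8" and z: "0 <= Re z"
 shows "(LINT u|lborel. P (- \<i>* of_real u)* exp ((- \<i>* of_real u-z)\<^sup>2 / of_real (2* ep)))
    = (LINT v|lborel. P (z-\<i>* of_real v)* of_real (exp (- (v^2/(2* ep)))))"
proof -
 define f where "f = (%w. P w* exp ((w-z)\<^sup>2 / of_real (2* ep)))"
 define x y where "x = Re z" and "y = Im z"
 have C0: "0 <= C" using bound[of 0] by (auto intro: order_trans[OF norm_ge_zero])
 \<comment> \<open>What remains after 4 (v - y)^2 >= 2 v^2 - 4 y^2 with v the imaginary part of w: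
   one v^2 cancels the growth of P, the other one survives as decay.\<close>
 define C' where "C' = C* exp (x^2+x^2/(2* ep)+4* y^2)"
 have fc: "continuous_on {z. 0 <= Re z} f"
  unfolding f_def using eps by (intro continuous_intros P(1)) auto
 have fd: "f field_differentiable at w" if "0 < Re w" for w
  unfolding f_def using that eps
  by (intro field_differentiable_mult P(2)) (auto intro!: derivative_eq_intros simp: field_differentiable_def)
 obtain F where F: "!!z. 0 <= Re z ==> (F has_field_derivative f z) (at z within {z. 0 <= Re z})"
  using halfplane_primitive[OF fc fd] by blast
 have nb: "norm (f w) <= C'* exp (- ((Im w)\<^sup>2))" if w: "0 <= Re w" "Re w <= x" for w
 proof -
  have "norm (f w) <= C* exp ((norm w)\<^sup>2)* exp (((Re w-x)\<^sup>2-(Im w-y)\<^sup>2)/(2* ep))"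
  proof -
   have "Re ((w-z)\<^sup>2 / of_real (2* ep)) = ((Re w-x)\<^sup>2-(Im w-y)\<^sup>2)/(2* ep)"
    unfolding Re_divide_of_real by (simp add: x_def y_def power2_eq_square)
   hence "norm (f w) = norm (P w)* exp (((Re w-x)\<^sup>2-(Im w-y)\<^sup>2)/(2* ep))"
    unfolding f_def norm_mult norm_exp_eq_Re by (simp only:)
   thus ?thesis using bound[OF w(1)] by (simp add: mult_right_mono)
  qed
  also have "... = C* exp ((norm w)\<^sup>2+((Re w-x)\<^sup>2-(Im w-y)\<^sup>2)/(2* ep))"
   by (simp add: exp_add)
  also have "... <= C* exp ((x^2+x^2/(2* ep)+4* y^2) + - ((Im w)\<^sup>2))"
  proof (rule mult_left_mono[OF _ C0], subst exp_le_cancel_iff)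
   have 1: "(Re w)\<^sup>2 <= x^2" using w by (intro power_mono) auto
   have 2: "(Re w-x)\<^sup>2 <= x^2" using w by (subst abs_le_square_iff[symmetric]) auto
   have 3: "4*(Im w-y)\<^sup>2 <= (Im w-y)\<^sup>2/(2* ep)"
   proof -
    have "(Im w-y)\<^sup>2*(8* ep) <= (Im w-y)\<^sup>2*1" using eps by (intro mult_left_mono) auto
    thus ?thesis using eps by (simp add: field_simps)
   qed
   have 4: "2*(Im w)\<^sup>2-4* y^2 <= 4*(Im w-y)\<^sup>2"
   proof -
    have "0 <= 2*(Im w-2* y)\<^sup>2" by simp
    thus ?thesis by (simp add: power2_eq_square algebra_simps)
   qed
   have 5: "(Re w-x)\<^sup>2/(2* ep) <= x^2/(2* ep)" using 2 eps by (intro divide_right_mono) auto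
   have 6: "(norm w)\<^sup>2 = (Re w)\<^sup>2+(Im w)\<^sup>2" by (rule cmod_power2)
   show "(norm w)\<^sup>2+((Re w-x)\<^sup>2-(Im w-y)\<^sup>2)/(2* ep) <= (x^2+x^2/(2* ep)+4* y^2) + - ((Im w)\<^sup>2)"
    using 1 3 4 5 6 by (simp only: diff_divide_distrib)
  qed
  also have "... = C'* exp (- ((Im w)\<^sup>2))" by (simp only: C'_def exp_add mult.assoc)
  finally show ?thesis .
 qed
 have C'0: "0 <= C'" using C0 by (simp add: C'_def)
 have fm: "(%r. f (of_real a + of_real r*\<i>)) \<in> borel_measurable lborel" if "0 <= a" for a
 proof -
  have "continuous_on UNIV (%r. f (of_real a + of_real r*\<i>))"
   by (intro continuous_on_compose2[OF fc] continuous_intros) (use that in auto)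
  thus ?thesis by (simp add: borel_measurable_continuous_onI)
 qed
 have fi: "integrable lborel (%r. f (of_real a + of_real r*\<i>))" if a: "0 <= a" "a <= x" for a
 proof (rule Bochner_Integration.integrable_bound[OF _ fm[OF a(1)]])
  show "integrable lborel (%r. C'* exp (- (1* r^2)))"
   by (intro integrable_mult_right integrable_gaussian) simp
  show "AE r in lborel. norm (f (of_real a + of_real r*\<i>)) <= norm (C'* exp (- (1* r^2)))"
   using nb[of "of_real a + of_real _*\<i>"] a by (auto intro: order_trans[OF _ abs_ge_self])
 qed
 \<comment> \<open>Each vertical line is split at the real axis into half lines of directions i and
   - i. Every half line is shifted separately, and the primitives at 0 and x cancel when the halves
   are recombined.\<close>
 have shift: "(LBINT r:{0..}. d* f (of_real 0 + of_real r* d))+F 0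
    = (LBINT r:{0..}. d* f (of_real x + of_real r* d))+F (of_real x)"
  if d: "d = \<i> \<or> d = - \<i>" for d
 proof -
  have i: "sint {0..} (%r. d* f (of_real a + of_real r* d))" if "0 <= a" "a <= x" for a
  proof -
   have "integrable lborel (%r. f (of_real a + of_real r* d))"
    using d fi[OF that] lborel_integrable_real_affine[of "%r. f (of_real a + of_real r*\<i>)" "-1" 0] by auto
   thus ?thesis
    unfolding set_integrable_def by (intro integrable_mult_indicator integrable_mult_right) auto
  qed
  have "(LBINT r:{0..}. d* f (of_real 0 + of_real r* d))+F (of_real 0)
    = (LBINT r:{0..}. d* f (of_real x + of_real r* d))+F (of_real x)"
  proof (rule ray_deformation[OF F fc, where b = "%R. C'* exp (- (R^2))"])
   show "eventually (%R. \<forall>w\<in>closed_segment (of_real 0 + of_real R* d) (of_real x + of_real R* d).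
     norm (f w) <= C'* exp (- (R^2))) at_top"
   proof (intro always_eventually allI ballI)
    fix R w assume "w \<in> closed_segment (of_real 0 + of_real R* d) (of_real x + of_real R* d)"
    then obtain u where u: "0 <= u" "u <= 1" "w = of_real (u* x) + of_real R* d"
     by (auto simp: closed_segment_def scaleR_conv_of_real algebra_simps)
    have "0 <= Re w" "Re w <= x" "(Im w)\<^sup>2 = R^2"
     using u d z by (auto simp: x_def mult_left_le_one_le)
    thus "norm (f w) <= C'* exp (- (R^2))" using nb[of w] by simp
   qed
   have "((%R::real. exp (- (R^2))) ---> 0) at_top" by real_asymp
   hence "((%R::real. C'* exp (- (R^2))* x) ---> C'*0* x) at_top" by (intro tendsto_intros)
   thus "((%R. C'* exp (- (R^2))*(norm (of_real x - of_real 0 :: complex)+R* norm (d-d))) ---> 0) at_top"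
    using z by (simp add: x_def)
  qed (use i[of 0] i[of x] z d in \<open>auto simp: x_def\<close>)
  thus ?thesis by simp
 qed
 have line: "(LINT r|lborel. f (of_real a + of_real r*\<i>)) =
   - \<i>*(LBINT r:{0..}. \<i>* f (of_real a + of_real r*\<i>))
   + \<i>*(LBINT r:{0..}. (- \<i>)* f (of_real a + of_real r*(- \<i>)))" if a: "0 <= a" "a <= x" for a
  unfolding integral_split_half_lines[OF fi[OF a]] set_integral_mult_right by simp
 have "0 <= x" using z by (simp add: x_def)
 have key: "- \<i>* A+\<i>* B = - \<i>* C+\<i>* D" if "A+G = C+H" "B+G = D+H" for A B C D G H :: complex
 proof -
  have "A-B = (A+G)-(B+G)" by simp
  also have "... = C-D" unfolding that by simp
  finally have e: "A-B = C-D" .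
  have "- \<i>* A+\<i>* B = - \<i>*(A-B)" by (simp add: algebra_simps)
  also have "... = - \<i>* C+\<i>* D" unfolding e by (simp add: algebra_simps)
  finally show ?thesis .
 qed
 have e1: "(LINT r|lborel. f (of_real 0 + of_real r*\<i>)) = (LINT r|lborel. f (of_real x + of_real r*\<i>))"
  unfolding line[OF order_refl \<open>0 <= x\<close>] line[OF \<open>0 <= x\<close> order_refl]
  by (rule key[OF shift shift]) simp_all
 have e2: "(LINT r|lborel. f (of_real 0 + of_real r*\<i>)) = (LINT u|lborel. f (- \<i>* of_real u))"
  using lborel_integral_real_affine[of "-1" "%r. f (of_real 0 + of_real r*\<i>)" 0] by (simp add: mult.commute)
 have e3: "(LINT r|lborel. f (of_real x + of_real r*\<i>)) = (LINT v|lborel. f (z-\<i>* of_real v))"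
 proof -
  have "z-\<i>* of_real v = of_real x + of_real (y + - 1* v)*\<i>" for v
   by (rule complex_eqI) (simp_all add: x_def y_def)
  thus ?thesis
   using lborel_integral_real_affine[of "-1" "%r. f (of_real x + of_real r*\<i>)" y] by simp
 qed
 have e4: "f (z-\<i>* of_real v) = P (z-\<i>* of_real v)* of_real (exp (- (v^2/(2* ep))))" for v
 proof -
  have "((z-\<i>* of_real v)-z)\<^sup>2 / of_real (2* ep) = of_real (- (v^2/(2* ep)))"
   by (simp add: power_mult_distrib)
  thus ?thesis by (simp only: f_def exp_of_real)
 qed
 have "(LINT u|lborel. f (- \<i>* of_real u)) = (LINT v|lborel. f (z-\<i>* of_real v))"
  using e1 e2 e3 by simp
 thus ?thesis unfolding e4 by (simp only: f_def)
qed

lemma char_gaussian_scaled: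
 "(LINT y|lborel. exp (\<i>* of_real (s* y))* of_real (exp (- (y^2/2)))) = of_real (sqrt (2* pi)* exp (- (s^2/2)))"
proof -
 have "of_real (exp (- (s^2/2))) = char std_normal_distribution s"
  by (simp add: char_std_normal_distribution)
 also have "... = (LINT y|lborel. std_normal_density y *\<^sub>R exp (\<i>* of_real (s* y)))"
  unfolding char_def by (subst integral_density) (auto simp: mult.commute)
 also have "... = (LINT y|lborel. of_real (1/sqrt (2* pi))*(exp (\<i>* of_real (s* y))* of_real (exp (- (y^2/2)))))"
  by (intro Bochner_Integration.integral_cong) (auto simp: normal_density_def scaleR_conv_of_real)
 also have "... = of_real (1/sqrt (2* pi))*(LINT y|lborel. exp (\<i>* of_real (s* y))* of_real (exp (- (y^2/2))))"
  by (rule integral_mult_right_zero)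
 finally have "of_real (sqrt (2* pi))* of_real (exp (- (s^2/2))) = of_real (sqrt (2* pi))*(of_real (1/sqrt (2* pi)) *
   (LINT y|lborel. exp (\<i>* of_real (s* y))* of_real (exp (- (y^2/2)))))" by (simp only:)
 also have "... = (of_real (sqrt (2* pi)*(1/sqrt (2* pi))) :: complex) *
   (LINT y|lborel. exp (\<i>* of_real (s* y))* of_real (exp (- (y^2/2))))" by (simp only: of_real_mult mult.assoc)
 also have "sqrt (2* pi)*(1/sqrt (2* pi)) = 1" by simp
 finally show ?thesis by simp
qed

text \<open>The contour shift with P w = exp (- w X) reduces the complex centre to a real Gaussian;
  |w| |X| <= X^2/4 + |w|^2 provides the growth bound.\<close>

lemma gaussian_fourier_complex:
 assumes eps: "0 < ep" "ep <= 1/8" and z: "0 <= Re z"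
 shows "(LINT u|lborel. exp (\<i>* of_real (u* X))* exp ((- \<i>* of_real u-z)\<^sup>2 / of_real (2* ep)))
    = of_real (sqrt (2* pi* ep))*(exp (- z* of_real X)* of_real (exp (- (ep* X^2/2))))"
proof -
 have "(LINT u|lborel. exp (- (- \<i>* of_real u)* of_real X)* exp ((- \<i>* of_real u-z)\<^sup>2 / of_real (2* ep)))
   = (LINT v|lborel. exp (- (z-\<i>* of_real v)* of_real X)* of_real (exp (- (v^2/(2* ep)))))"
 proof (rule gaussian_contour_shift[where C = "exp (X^2/4)", OF _ _ _ eps z])
  show "continuous_on {z. 0 <= Re z} (%w. exp (- w* of_real X))" by (intro continuous_intros)
  show "(%w. exp (- w* of_real X)) field_differentiable at w" for w
   by (auto intro!: derivative_eq_intros simp: field_differentiable_def)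
  show "norm (exp (- w* of_real X)) <= exp (X^2/4)* exp ((norm w)\<^sup>2)" for w :: complex
  proof -
   have "Re (- w* of_real X) <= norm (- w* of_real X)" by (rule complex_Re_le_cmod)
   also have "... = norm w*\<bar>X\<bar>" by (simp add: norm_mult)
   also have "... <= X^2/4+(norm w)\<^sup>2"
   proof -
    have "0 <= (norm w-\<bar>X\<bar>/2)\<^sup>2" by simp
    thus ?thesis by (simp add: power2_diff power_divide)
   qed
   finally show ?thesis unfolding norm_exp_eq_Re exp_add[symmetric] by simp
  qed
 qed
 also have "... = sqrt ep *\<^sub>R (LINT y|lborel. exp (- (z-\<i>* of_real (sqrt ep* y))* of_real X)* of_real (exp (- ((sqrt ep* y)\<^sup>2/(2* ep)))))"
  using lborel_integral_real_affine[of "sqrt ep" "%v. exp (- (z-\<i>* of_real v)* of_real X)* of_real (exp (- (v^2/(2* ep))))" 0] eps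
  by simp
 also have "(%y. exp (- (z-\<i>* of_real (sqrt ep* y))* of_real X)* of_real (exp (- ((sqrt ep* y)\<^sup>2/(2* ep)))))
   = (%y. exp (- z* of_real X)*(exp (\<i>* of_real ((sqrt ep* X)* y))* of_real (exp (- (y^2/2)))))"
 proof
  fix y
  have 1: "(sqrt ep* y)\<^sup>2/(2* ep) = y^2/2" using eps by (simp add: power_mult_distrib)
  have 2: "- (z-\<i>* of_real (sqrt ep* y))* of_real X = - z* of_real X+\<i>* of_real ((sqrt ep* X)* y)"
   by (simp add: algebra_simps)
  show "exp (- (z-\<i>* of_real (sqrt ep* y))* of_real X)* of_real (exp (- ((sqrt ep* y)\<^sup>2/(2* ep))))
   = exp (- z* of_real X)*(exp (\<i>* of_real ((sqrt ep* X)* y))* of_real (exp (- (y^2/2))))"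
   unfolding 1 2 exp_add by (simp only: mult.assoc)
 qed
 also have "sqrt ep *\<^sub>R (LINT y|lborel. exp (- z* of_real X)*(exp (\<i>* of_real ((sqrt ep* X)* y))* of_real (exp (- (y^2/2)))))
   = sqrt ep *\<^sub>R (exp (- z* of_real X)* of_real (sqrt (2* pi)* exp (- ((sqrt ep* X)\<^sup>2/2))))"
  by (simp only: integral_mult_right_zero char_gaussian_scaled)
 also have "... = of_real (sqrt (2* pi* ep))*(exp (- z* of_real X)* of_real (exp (- (ep* X^2/2))))"
  using eps by (simp add: power_mult_distrib real_sqrt_mult scaleR_conv_of_real)
 finally show ?thesis by (simp add: mult_ac)
qed

text \<open>For al <= 2 this bounds exp (w^al) by a constant times exp (|w|^2), the growth that
  \<open>gaussian_contour_shift\<close> admits.\<close>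

lemma powr_le_1_plus_square:
 assumes "0 <= (r::real)" "0 < al" "al <= 2" shows "r powr al <= 1+r^2"
proof (cases "r <= 1")
 case True
 hence "r powr al <= 1" using assms by (intro powr_le1) auto
 thus ?thesis by (smt (verit) zero_le_power2)
next
 case False
 hence "r powr al <= r powr 2" using assms by (intro powr_mono) auto
 thus ?thesis using False by (simp add: powr_numeral)
qed

lemma integrable_norm_gaussian_shift:
 assumes eps: "0 < ep"
 shows "integrable lborel (%u. exp ((- \<i>* of_real u-z)\<^sup>2 / of_real (2* ep)))"
proof (rule Bochner_Integration.integrable_bound)
 have "integrable lborel (%u. exp (- ((1/(2* ep))*(u+Im z)\<^sup>2)))"
  using lborel_integrable_real_affine[OF integrable_gaussian[of "1/(2* ep)"], of 1 "Im z"] eps by (simp add: add.commute)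
 thus "integrable lborel (%u. exp ((Re z)\<^sup>2/(2* ep))* exp (- ((1/(2* ep))*(u+Im z)\<^sup>2)))"
  by (rule integrable_mult_right)
 show "(%u. exp ((- \<i>* of_real u-z)\<^sup>2 / of_real (2* ep))) \<in> borel_measurable lborel" by measurable
 have "norm (exp ((- \<i>* of_real u-z)\<^sup>2 / of_real (2* ep))) = exp ((Re z)\<^sup>2/(2* ep))* exp (- ((1/(2* ep))*(u+Im z)\<^sup>2))" for u
 proof -
  have "Re ((- \<i>* of_real u-z)\<^sup>2 / of_real (2* ep)) = ((Re z)\<^sup>2-(u+Im z)\<^sup>2)/(2* ep)"
   unfolding Re_divide_of_real by (simp add: power2_eq_square algebra_simps)
  thus ?thesis unfolding norm_exp_eq_Re exp_add[symmetric] by (simp add: diff_divide_distrib)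
 qed
 thus "AE u in lborel. norm (exp ((- \<i>* of_real u-z)\<^sup>2 / of_real (2* ep)))
   <= norm (exp ((Re z)\<^sup>2/(2* ep))* exp (- ((1/(2* ep))*(u+Im z)\<^sup>2)))" by simp
qed

text \<open>The Gaussian factor makes the characteristic function determine the left hand side although no
 exponential moment is known to be finite yet.\<close>

lemma regularized_laplace:
 assumes D: "real_distribution D" and al: "1 < al" "al <= 2"
  and ch: "!!u. char D u = exp ((- \<i>* of_real u) powr of_real al)"
  and eps: "0 < ep" "ep <= 1/8" and z: "0 <= Re z"
 shows "(LINT x|D. exp (- z* of_real x)* of_real (exp (- (ep* x^2/2))))
    = (LINT y|lborel. std_normal_density y *\<^sub>R exp ((z-\<i>* of_real (sqrt ep* y)) powr of_real al))"
proof -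
 interpret D: real_distribution D by (rule D)
 interpret P: pair_sigma_finite D lborel by standard
 define ga where "ga = (%u. exp ((- \<i>* of_real u-z)\<^sup>2 / of_real (2* ep)))"
 have gai: "integrable lborel ga" unfolding ga_def by (rule integrable_norm_gaussian_shift[OF eps(1)])
 have [measurable]: "ga \<in> borel_measurable borel" using gai by auto
 have pi: "integrable (D \<Otimes>\<^sub>M lborel) (%(x, u). exp (\<i>* of_real (u* x))* ga u)"
 proof (rule Bochner_Integration.integrable_bound)
  show "integrable (D \<Otimes>\<^sub>M lborel) (%(x, u). norm (ga u))"
   by (rule P.Fubini_integrable) (use gai in auto)
  show "AE p in D \<Otimes>\<^sub>M lborel. norm (case p of (x, u) => exp (\<i>* of_real (u* x))* ga u) <= norm (case p of (x, u) => norm (ga u))"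
   by (auto simp: norm_mult)
 qed measurable
 have "of_real (sqrt (2* pi* ep))*(LINT x|D. exp (- z* of_real x)* of_real (exp (- (ep* x^2/2))))
   = (LINT x|D. (LINT u|lborel. exp (\<i>* of_real (u* x))* ga u))"
  unfolding ga_def gaussian_fourier_complex[OF eps z] by (simp only: integral_mult_right_zero)
 also have "... = (LINT u|lborel. (LINT x|D. exp (\<i>* of_real (u* x))* ga u))"
  using P.Fubini_integral[OF pi] by simp
 also have "... = (LINT u|lborel. exp ((- \<i>* of_real u) powr of_real al)* ga u)"
  by (simp only: integral_mult_left_zero ch[symmetric] char_def)
 also have "... = (LINT v|lborel. exp ((z-\<i>* of_real v) powr of_real al)* of_real (exp (- (v^2/(2* ep)))))"
  unfolding ga_def
 proof (rule gaussian_contour_shift[where C = "exp 1", OF _ _ _ eps z])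
  show "continuous_on {z. 0 <= Re z} (%w. exp (w powr of_real al))"
   using al by (intro continuous_on_exp continuous_on_powr_halfplane) simp
  show "(%w. exp (w powr of_real al)) field_differentiable at w" if "0 < Re w" for w
   using DERIV_chain2[OF DERIV_exp has_field_derivative_powr_halfplane[OF that]]
   by (auto simp: field_differentiable_def)
  show "norm (exp (w powr of_real al)) <= exp 1* exp ((norm w)\<^sup>2)" for w :: complex
  proof -
   have "Re (w powr of_real al) <= norm (w powr of_real al)" by (rule complex_Re_le_cmod)
   also have "... <= 1+(norm w)\<^sup>2" using powr_le_1_plus_square[of "norm w" al] al by simp
   finally show ?thesis unfolding norm_exp_eq_Re exp_add[symmetric] by simp
  qed
 qed
 also have "... = sqrt ep *\<^sub>R (LINT y|lborel. exp ((z-\<i>* of_real (sqrt ep* y)) powr of_real al)* of_real (exp (- ((sqrt ep* y)\<^sup>2/(2* ep)))))"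
  using lborel_integral_real_affine[of "sqrt ep" "%v. exp ((z-\<i>* of_real v) powr of_real al)* of_real (exp (- (v^2/(2* ep))))" 0] eps
  by simp
 also have "(%y. exp ((z-\<i>* of_real (sqrt ep* y)) powr of_real al)* of_real (exp (- ((sqrt ep* y)\<^sup>2/(2* ep)))))
   = (%y. of_real (sqrt (2* pi))*(std_normal_density y *\<^sub>R exp ((z-\<i>* of_real (sqrt ep* y)) powr of_real al)))"
 proof
  fix y
  have "(sqrt ep* y)\<^sup>2/(2* ep) = y^2/2" using eps by (simp add: power_mult_distrib)
  thus "exp ((z-\<i>* of_real (sqrt ep* y)) powr of_real al)* of_real (exp (- ((sqrt ep* y)\<^sup>2/(2* ep))))
   = of_real (sqrt (2* pi))*(std_normal_density y *\<^sub>R exp ((z-\<i>* of_real (sqrt ep* y)) powr of_real al))"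
   by (simp add: normal_density_def scaleR_conv_of_real)
 qed
 also have "sqrt ep *\<^sub>R (LINT y|lborel. of_real (sqrt (2* pi))*(std_normal_density y *\<^sub>R exp ((z-\<i>* of_real (sqrt ep* y)) powr of_real al)))
   = of_real (sqrt (2* pi* ep))*(LINT y|lborel. std_normal_density y *\<^sub>R exp ((z-\<i>* of_real (sqrt ep* y)) powr of_real al))"
  unfolding integral_mult_right_zero using eps by (simp add: real_sqrt_mult scaleR_conv_of_real mult_ac)
 finally show ?thesis using eps by simp
qed

text \<open>The regularisation is removed as \<open>e k\<close> tends to 0. The right-hand side
  converges by domination. For real arguments the left-hand side increases with k, so monotone
  convergence yields a finite exponential moment, and that moment dominates the left-hand side for
  complex z.\<close>

lemma laplace_of_char:
 assumes D: "real_distribution D" and al: "1 < al" "al <= 2"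
  and ch: "!!u. char D u = exp ((- \<i>* of_real u) powr of_real al)"
  and z: "0 < Re z"
 shows "integrable D (%x. exp (- z* of_real x))" (is ?g1)
  "(LINT x|D. exp (- z* of_real x)) = exp (z powr of_real al)" (is ?g2)
proof -
 interpret D: real_distribution D by (rule D)
 \<comment> \<open>Starts at 1/8, as \<open>regularized_laplace\<close> requires, and decreases, for
   monotone convergence.\<close>
 define e where "e = (%k::nat. 1/(real k+8))"
 have e: "0 < e k" "e k <= 1/8" for k by (auto simp: e_def)
 have e0: "e ----> 0" unfolding e_def by real_asymp
 have edec: "e k' <= e k" if "k <= k'" for k k' using that by (auto simp: e_def intro!: divide_left_mono)
 have lim: "(%k. LINT x|D. exp (- z* of_real x)* of_real (exp (- (e k* x^2/2)))) ----> exp (z powr of_real al)"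
  if z: "0 < Re z" for z
 proof -
  have "(%k. LINT y|lborel. std_normal_density y *\<^sub>R exp ((z-\<i>* of_real (sqrt (e k)* y)) powr of_real al))
    ----> (LINT y|lborel. std_normal_density y *\<^sub>R exp (z powr of_real al))"
  proof (rule integral_dominated_convergence[where w = "%y. (1/sqrt (2* pi)* exp (1+2*(norm z)\<^sup>2))* exp (- ((1/4)* y^2))"])
   have hp: "continuous_on {z. 0 <= Re z} (%w. exp (w powr of_real al))"
    using al by (intro continuous_on_exp continuous_on_powr_halfplane) simp
   have "continuous_on UNIV (%y. exp ((z-\<i>* of_real (sqrt (e k)* y)) powr of_real al))" for k
    by (rule continuous_on_compose2[OF hp]) (use z in \<open>auto intro!: continuous_intros\<close>)
   hence [measurable]: "(%y. exp ((z-\<i>* of_real (sqrt (e k)* y)) powr of_real al)) \<in> borel_measurable borel" for k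
    by (rule borel_measurable_continuous_onI)
   show "(%y. std_normal_density y *\<^sub>R exp ((z-\<i>* of_real (sqrt (e k)* y)) powr of_real al)) \<in> borel_measurable lborel" for k
    by measurable
   show "integrable lborel (%y. (1/sqrt (2* pi)* exp (1+2*(norm z)\<^sup>2))* exp (- ((1/4)* y^2)))"
    by (intro integrable_mult_right integrable_gaussian) simp
   show "AE y in lborel. (%k. std_normal_density y *\<^sub>R exp ((z-\<i>* of_real (sqrt (e k)* y)) powr of_real al))
     ----> std_normal_density y *\<^sub>R exp (z powr of_real al)"
   proof (intro AE_I2 tendsto_scaleR tendsto_const tendsto_exp)
    fix y
    have "(%k. z-\<i>* of_real (sqrt (e k)* y)) ----> z-\<i>* of_real (sqrt 0* y)"
     by (intro tendsto_intros e0)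
    hence "(%k. z-\<i>* of_real (sqrt (e k)* y)) ----> z" by simp
    moreover have "isCont (%w. w powr of_real al) z"
     using has_field_derivative_powr_halfplane[OF z] by (rule DERIV_isCont)
    ultimately show "(%k. (z-\<i>* of_real (sqrt (e k)* y)) powr of_real al) ----> z powr of_real al"
     by (rule isCont_tendsto_compose[rotated])
   qed
   show "AE y in lborel. norm (std_normal_density y *\<^sub>R exp ((z-\<i>* of_real (sqrt (e k)* y)) powr of_real al))
     <= (1/sqrt (2* pi)* exp (1+2*(norm z)\<^sup>2))* exp (- ((1/4)* y^2))" for k
   proof (rule AE_I2)
    fix y :: real
    let ?w = "z-\<i>* of_real (sqrt (e k)* y)"
    have "Re (?w powr of_real al) <= norm (?w powr of_real al)" by (rule complex_Re_le_cmod)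
    also have "... <= 1+(norm ?w)\<^sup>2" using powr_le_1_plus_square[of "norm ?w" al] al by simp
    also have "norm ?w <= norm z+sqrt (e k)*\<bar>y\<bar>"
     using norm_triangle_ineq4[of z "\<i>* of_real (sqrt (e k)* y)"] e[of k] by (simp add: norm_mult abs_mult)
    hence "(norm ?w)\<^sup>2 <= (norm z+sqrt (e k)*\<bar>y\<bar>)\<^sup>2" by (rule power_mono) simp
    also have "... <= 2*(norm z)\<^sup>2+2*(e k* y^2)"
    proof -
     have "0 <= (norm z-sqrt (e k)*\<bar>y\<bar>)\<^sup>2" by simp
     thus ?thesis using e[of k] by (simp add: power2_sum power2_diff power_mult_distrib)
    qed
    also have "e k* y^2 <= (1/8)* y^2" using e[of k] by (intro mult_right_mono) auto
    finally have "Re (?w powr of_real al) <= (1+2*(norm z)\<^sup>2)+(1/4)* y^2" by simp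
    hence "exp (Re (?w powr of_real al)) <= exp ((1+2*(norm z)\<^sup>2)+(1/4)* y^2)" by simp
    hence "std_normal_density y* exp (Re (?w powr of_real al)) <= std_normal_density y* exp ((1+2*(norm z)\<^sup>2)+(1/4)* y^2)"
     by (rule mult_left_mono) simp
    also have "... = (1/sqrt (2* pi)* exp (1+2*(norm z)\<^sup>2))* exp (- ((1/4)* y^2))"
    proof -
     have "exp (- y\<^sup>2/2)* exp ((1+2*(norm z)\<^sup>2)+(1/4)* y^2) = exp (1+2*(norm z)\<^sup>2)* exp (- ((1/4)* y^2))"
      unfolding exp_add[symmetric] by (simp add: algebra_simps)
     thus ?thesis by (simp add: normal_density_def)
    qed
    finally show "norm (std_normal_density y *\<^sub>R exp (?w powr of_real al))
     <= (1/sqrt (2* pi)* exp (1+2*(norm z)\<^sup>2))* exp (- ((1/4)* y^2))" by (simp add: norm_mult)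
   qed
  qed measurable
  moreover have "(LINT y|lborel. std_normal_density y *\<^sub>R exp (z powr of_real al)) = exp (z powr of_real al)"
   using integral_normal_density[of 1 0] by (subst integral_scaleR_left) auto
  ultimately show ?thesis
   using regularized_laplace[OF D al ch e less_imp_le[OF z]] by (simp only:)
 qed
 have real: "integrable D (%x. exp (- (c* x)))" if c: "0 < c" for c
 proof (rule integrable_monotone_convergence)
  define g where "g = (%(k::nat) x. exp (- (c* x))* exp (- (e k* x^2/2)))"
  show gi: "integrable D (g k)" for k
  proof (rule D.integrable_const_bound[where B = "exp (c^2/(2* e k))"])
   have "- (c* x) + - (e k* x^2/2) <= c^2/(2* e k)" for x
   proof -
    have "0 <= (e k* x+c)\<^sup>2/(2* e k)" using e[of k] by simp
    also have "... = e k* x^2/2+c* x+c^2/(2* e k)"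
     using e[of k] by (simp add: power2_eq_square field_simps)
    finally show ?thesis by simp
   qed
   thus "AE x in D. norm (g k x) <= exp (c^2/(2* e k))"
    by (auto simp: g_def exp_add[symmetric])
   show "g k \<in> borel_measurable D" unfolding g_def by measurable
  qed
  show "AE x in D. mono (%k. g k x)"
   by (auto simp: mono_def g_def intro!: mult_left_mono mult_right_mono edec)
  show "AE x in D. (%k. g k x) ----> exp (- (c* x))"
  proof (rule AE_I2)
   fix x
   have "(%k. g k x) ----> exp (- (c* x))* exp (- (0* x^2/2))"
    unfolding g_def by (intro tendsto_intros e0) simp
   thus "(%k. g k x) ----> exp (- (c* x))" by simp
  qed
  have "(LINT x|D. exp (- of_real c* of_real x)* of_real (exp (- (e k* x^2/2)))) = complex_of_real (integral\<^sup>L D (g k))" for k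
   unfolding integral_complex_of_real[symmetric] by (simp add: g_def exp_of_real[symmetric])
  with lim[of "of_real c"] c have "(%k. complex_of_real (integral\<^sup>L D (g k))) ----> exp (of_real c powr of_real al)" by simp
  from tendsto_Re[OF this] show "(%k. integral\<^sup>L D (g k)) ----> Re (exp (of_real c powr of_real al))" by simp
 qed measurable
 show int: ?g1
  by (rule Bochner_Integration.integrable_bound[OF real[OF z]]) auto
 have "(%k. LINT x|D. exp (- z* of_real x)* of_real (exp (- (e k* x^2/2)))) ----> (LINT x|D. exp (- z* of_real x))"
 proof (rule integral_dominated_convergence[OF _ _ real[OF z]])
  show "AE x in D. (%k. exp (- z* of_real x)* of_real (exp (- (e k* x^2/2)))) ----> exp (- z* of_real x)"
  proof (rule AE_I2)
   fix x
   have "(%k. exp (- z* of_real x)* of_real (exp (- (e k* x^2/2)))) ----> exp (- z* of_real x)* of_real (exp (- (0* x^2/2)))"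
    by (intro tendsto_intros e0) simp
   thus "(%k. exp (- z* of_real x)* of_real (exp (- (e k* x^2/2)))) ----> exp (- z* of_real x)" by simp
  qed
  show "AE x in D. norm (exp (- z* of_real x)* of_real (exp (- (e k* x^2/2)))) <= exp (- (Re z* x))" for k
   using e[of k] by (auto simp: norm_mult mult_left_le)
 qed measurable
 from LIMSEQ_unique[OF this lim[OF z]] show ?g2 .
qed

section \<open>The ray integrals and their power series\<close>

definition ray_dir :: "real => complex" where
 "ray_dir al = cis (pi/(1+al))"

text \<open>For al > 1 the angle is below pi/2, so the ray runs inside the half plane where the
  exponential moments exist.\<close>

lemma ray_dir_facts:
 assumes "1 < al"
 shows "norm (ray_dir al) = 1" "0 < Re (ray_dir al)" "Re (ray_dir al) <= 1" "0 < Im (ray_dir al)" "ray_dir al ~= 0"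
proof -
 have "pi/(1+al) < pi/2"
  by (rule divide_strict_left_mono) (use assms pi_gt_zero in auto)
 hence 1: "0 < pi/(1+al)" "pi/(1+al) < pi/2" "pi/(1+al) < pi"
  using assms pi_gt_zero less_trans[of "pi/(1+al)" "pi/2" pi] by simp_all
 show "0 < Re (ray_dir al)" unfolding ray_dir_def using cos_gt_zero[OF 1(1,2)] by simp
 show "0 < Im (ray_dir al)" unfolding ray_dir_def using sin_gt_zero[OF 1(1,3)] by simp
qed (auto simp: ray_dir_def)

lemma ray_dir_powr:
 assumes "1 < al" "0 <= r"
 shows "(of_real r* ray_dir al) powr of_real (1+al) = - of_real (r powr (1+al))"
proof -
 have 1: "0 < pi/(1+al)" "pi/(1+al) <= pi" using assms by (auto simp: field_simps)
 have "(of_real r* cis (pi/(1+al))) powr of_real (1+al) =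
   of_real (r powr (1+al))* cis ((1+al)*(pi/(1+al)))"
  by (rule powr_rcis) (use assms 1 pi_gt_zero in linarith)+
 also have "(1+al)*(pi/(1+al)) = pi" using assms by simp
 finally show ?thesis by (simp add: ray_dir_def)
qed

definition kernel :: "real => real => complex => complex" where
 "kernel al Y z = exp (z powr of_real (1+al) / of_real (1+al)-z* of_real Y)"

text \<open>This is H for k = 0 and - H' for k = 1 (\<open>Hray_derivative\<close>). The argument is
  complex so that power series can be differentiated in it.\<close>

definition Hray :: "real => nat => complex => complex" where
 "Hray al k Y = (LBINT r:{0..}. ray_dir al*((of_real r* ray_dir al)^k* exp (- (of_real r* ray_dir al* Y))
   * of_real (ray_weight al r)))"

lemma one_plus_le_powr: "1 < al ==> 0 <= r ==> 1+r <= (1+r) powr al" for r :: real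
 using powr_mono[of 1 al "1+r"] by (simp add: powr_one)

lemma power_exp_le_ray_bound:
 assumes "1 < al" "0 <= r" "0 <= c"
 shows "(1+r)^k* exp (c*(1+r))* ray_weight al r <= ray_bound al (real k+c) r"
proof -
 have "(1+r)^k <= exp r^k" using assms by (intro power_mono) auto
 also have "... = exp (real k* r)" by (simp add: exp_of_nat_mult)
 also have "... <= exp (real k*(1+r) powr al)"
  using one_plus_le_powr[OF assms(1,2)] by (simp add: mult_left_mono)
 finally have "(1+r)^k* exp (c*(1+r)) <= exp (real k*(1+r) powr al)* exp (c*(1+r) powr al)"
  using one_plus_le_powr[OF assms(1,2)] assms(3) by (intro mult_mono) (auto simp: mult_left_mono)
 hence "(1+r)^k* exp (c*(1+r))* ray_weight al r
   <= exp (real k*(1+r) powr al)* exp (c*(1+r) powr al)* ray_weight al r"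
  by (rule mult_right_mono) (simp add: ray_weight_def)
 thus ?thesis unfolding ray_bound_def distrib_right exp_add .
qed

lemma Hray_integrand_bound:
 assumes "1 < al" "0 <= r"
 shows "norm (ray_dir al*((of_real r* ray_dir al)^k* exp (- (of_real r* ray_dir al* Y))* of_real (ray_weight al r)))
   <= 1* ray_bound al (real k+norm Y) r"
proof -
 have "Re (- (of_real r* ray_dir al* Y)) <= norm (- (of_real r* ray_dir al* Y))" by (rule complex_Re_le_cmod)
 also have "... = r* norm Y" using assms ray_dir_facts[OF assms(1)] by (simp add: norm_mult)
 also have "... <= norm Y*(1+r)" by (simp add: algebra_simps)
 finally have "exp (Re (- (of_real r* ray_dir al* Y))) <= exp (norm Y*(1+r))" by simp
 moreover have "r^k <= (1+r)^k" using assms by (intro power_mono) auto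
 ultimately have "r^k* exp (Re (- (of_real r* ray_dir al* Y)))* ray_weight al r
   <= (1+r)^k* exp (norm Y*(1+r))* ray_weight al r"
  using assms by (intro mult_right_mono mult_mono) (auto simp: ray_weight_def)
 also have "... <= ray_bound al (real k+norm Y) r"
  by (rule power_exp_le_ray_bound) (use assms in auto)
 finally show ?thesis using assms ray_dir_facts[OF assms(1)]
  by (simp add: norm_mult norm_power ray_weight_def)
qed

lemma Hray_integrable:
 assumes "1 < al"
 shows "sint {0..} (%r. ray_dir al*((of_real r* ray_dir al)^k* exp (- (of_real r* ray_dir al* Y))
   * of_real (ray_weight al r)))"
proof (rule ray_dominated_integrable[OF assms, where C = 1 and c = "real k+norm Y"])
 show "set_borel_measurable lborel {0..} (%r. ray_dir al*((of_real r* ray_dir al)^k* exp (- (of_real r* ray_dir al* Y))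
   * of_real (ray_weight al r)))"
  unfolding set_borel_measurable_def by measurable
qed (rule Hray_integrand_bound[OF assms])

definition ray_moment :: "real => nat => real" where
 "ray_moment al n = (LBINT r:{0..}. r^n* ray_weight al r)"

lemma ray_moment_integrable:
 assumes "1 < al" shows "sint {0..} (%r. r^n* ray_weight al r)"
proof (rule set_integrable_bound[OF ray_bound_integrable[OF assms, of "real n+0"]])
 show "set_borel_measurable lborel {0..} (%r. r^n* ray_weight al r)"
  unfolding set_borel_measurable_def by measurable
 have "norm (r^n* ray_weight al r) <= norm (ray_bound al (real n+0) r)" if "0 <= r" for r
 proof -
  have "r^n* ray_weight al r <= (1+r)^n* exp (0*(1+r))* ray_weight al r"
   using that by (auto intro!: mult_right_mono power_mono simp: ray_weight_def)
  also have "... <= ray_bound al (real n+0) r"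
   by (rule power_exp_le_ray_bound) (use assms that in auto)
  finally show ?thesis using that by (simp add: ray_weight_def abs_mult)
 qed
 thus "AE r in lborel. r \<in> {0..} --> norm (r^n* ray_weight al r) <= norm (ray_bound al (real n+0) r)" by auto
qed

text \<open>The exponential is expanded under the integral. Its partial sums are dominated by the
  series of absolute values, exp (r |Y|), which the ray weight beats.\<close>

lemma Hray_series:
 assumes "1 < al"
 shows "(%n. (ray_dir al^Suc k*(- ray_dir al)^n/fact n* of_real (ray_moment al (n+k)))* Y^n) sums Hray al k Y"
proof -
 let ?d = "ray_dir al"
 define s where "s = (%n r. indicator {0..} r *\<^sub>R (?d*((of_real r*?d)^k*((- (of_real r*?d* Y))^n /\<^sub>R fact n)* of_real (ray_weight al r))))"
 have term_eq: "s n r = (?d^Suc k*(- ?d)^n/fact n* Y^n)* of_real (indicator {0..} r *\<^sub>R (r^(n+k)* ray_weight al r))" for n r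
 proof -
  have "(- (of_real r*?d* Y))^n = of_real r^n*(- ?d)^n* Y^n"
   by (simp add: power_mult_distrib[symmetric] mult_ac)
  thus ?thesis
   by (simp add: s_def power_mult_distrib power_add scaleR_conv_of_real field_simps indicator_def)
 qed
 have si: "integrable lborel (s n)" for n
 proof -
  have "integrable lborel (%r. complex_of_real (indicator {0..} r *\<^sub>R (r^(n+k)* ray_weight al r)))"
   using ray_moment_integrable[OF assms, of "n+k"] unfolding set_integrable_def by (rule integrable_of_real)
  thus ?thesis unfolding term_eq by (rule integrable_mult_right)
 qed
 have sI: "integral\<^sup>L lborel (s n) = (?d^Suc k*(- ?d)^n/fact n* of_real (ray_moment al (n+k)))* Y^n" for n
  unfolding term_eq integral_mult_right_zero integral_complex_of_real
  by (simp add: ray_moment_def slint_def)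
 have ssums: "(%n. s n r) sums (indicator {0..} r *\<^sub>R (?d*((of_real r*?d)^k* exp (- (of_real r*?d* Y))* of_real (ray_weight al r))))" for r
  unfolding s_def
  by (intro sums_scaleR_right sums_mult sums_mult2 exp_converges)
 have "(%N. \<integral>r. (\<Sum>n<N. s n r) \<partial>lborel) ---->
   (LINT r|lborel. indicator {0..} r *\<^sub>R (?d*((of_real r*?d)^k* exp (- (of_real r*?d* Y))* of_real (ray_weight al r))))"
 proof (rule integral_dominated_convergence[where w = "%r. indicator {0..} r *\<^sub>R ray_bound al (real k+norm Y) r"])
  show "integrable lborel (%r. indicator {0..} r *\<^sub>R ray_bound al (real k+norm Y) r)"
   using ray_bound_integrable[OF assms] by (simp add: set_integrable_def)
  show "AE r in lborel. (%N. \<Sum>n<N. s n r) ----> indicator {0..} r *\<^sub>R (?d*((of_real r*?d)^k* exp (- (of_real r*?d* Y))* of_real (ray_weight al r)))"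
   using ssums by (simp add: sums_def)
  show "AE r in lborel. norm (\<Sum>n<N. s n r) <= indicator {0..} r *\<^sub>R ray_bound al (real k+norm Y) r" for N
  proof (rule AE_I2)
   fix r :: real
   show "norm (\<Sum>n<N. s n r) <= indicator {0..} r *\<^sub>R ray_bound al (real k+norm Y) r"
   proof (cases "0 <= r")
    case True
    have "norm (\<Sum>n<N. s n r) <= (\<Sum>n<N. norm (s n r))" by (rule norm_sum)
    also have "... = r^k*(\<Sum>n<N. (r* norm Y)^n /\<^sub>R fact n)* ray_weight al r"
     using True ray_dir_facts[OF assms]
     by (simp add: s_def norm_mult norm_power norm_divide sum_distrib_left sum_distrib_right ray_weight_def divide_inverse mult_ac)
    also have "... <= (1+r)^k* exp (norm Y*(1+r))* ray_weight al r"
    proof (intro mult_right_mono mult_mono)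
     have "(\<Sum>n<N. (r* norm Y)^n /\<^sub>R fact n) <= exp (r* norm Y)"
      using sum_le_suminf[of "%n. (r* norm Y)^n /\<^sub>R fact n" "{..<N}"] summable_exp_generic[of "r* norm Y"] True
      by (simp add: exp_def)
     also have "... <= exp (norm Y*(1+r))" by (simp add: algebra_simps)
     finally show "(\<Sum>n<N. (r* norm Y)^n /\<^sub>R fact n) <= exp (norm Y*(1+r))" .
     show "r^k <= (1+r)^k" using True by (intro power_mono) auto
    qed (use True in \<open>auto simp: ray_weight_def intro!: sum_nonneg\<close>)
    also have "... <= ray_bound al (real k+norm Y) r"
     by (rule power_exp_le_ray_bound) (use assms True in auto)
    finally show ?thesis using True by simp
   qed (simp add: s_def)
  qed
  show "(%r. \<Sum>n<N. s n r) \<in> borel_measurable lborel" for N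
   using si by (intro borel_measurable_sum) auto
 qed measurable
 thus ?thesis unfolding sums_def Hray_def slint_def
  by (subst (asm) Bochner_Integration.integral_sum) (auto simp: si sI)
qed

text \<open>The substitution u = r^(1+al) / (1+al) turns the moment into a Gamma integral and
  produces the power of 1+al.\<close>

lemma ray_moment_eq:
 assumes "1 < al"
 shows "ray_moment al n = Gamma ((1+real n)/(1+al))*(1+al) powr ((real n-al)/(1+al))"
proof -
 define s where "s = (1+real n)/(1+al)"
 have s: "0 < s" using assms by (simp add: s_def)
 define g where "g = (%r. r powr (1+al)/(1+al))"
 have der: "(g has_field_derivative r powr al) (at r within {0<..})" if "r \<in> {0<..}" for r
  unfolding g_def using that assms
  by (auto intro!: derivative_eq_intros)
 have inj: "inj_on g {0<..}"
 proof (rule inj_onI)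
  fix x y assume "x \<in> {0<..}" "y \<in> {0<..}" "g x = g y"
  hence "(x powr (1+al)) powr (1/(1+al)) = (y powr (1+al)) powr (1/(1+al))"
   using assms by (simp add: g_def)
  with \<open>x \<in> {0<..}\<close> \<open>y \<in> {0<..}\<close> show "x = y" using assms by (simp add: powr_powr)
 qed
 have im: "g ` {0<..} = {0<..}"
 proof safe
  fix u :: real assume u: "0 < u"
  thus "u \<in> g ` {0<..}" using assms
   by (intro image_eqI[of _ _ "((1+al)* u) powr (1/(1+al))"]) (auto simp: g_def powr_powr)
 qed (use assms in \<open>auto simp: g_def\<close>)
 have G: "(%u. u powr (s-1)/exp u) absolutely_integrable_on {0<..}"
  "integral {0<..} (%u. u powr (s-1)/exp u) = Gamma s"
 proof -
  have "((%u. u powr (s-1)/exp u) has_integral Gamma s) {0<..} \<longleftrightarrow> ((%u. u powr (s-1)/exp u) has_integral Gamma s) {0..}"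
   by (rule has_integral_spike_set_eq) (auto intro: negligible_subset[of "{0}"])
  hence 1: "((%u. u powr (s-1)/exp u) has_integral Gamma s) {0<..}"
   using Gamma_integral_real[OF s] by blast
  thus "integral {0<..} (%u. u powr (s-1)/exp u) = Gamma s" by (rule integral_unique)
  show "(%u. u powr (s-1)/exp u) absolutely_integrable_on {0<..}"
   using 1 by (intro nonnegative_absolutely_integrable_1) (auto simp: has_integral_integrable)
 qed
 have "(%r. \<bar>r powr al\<bar>*(g r powr (s-1)/exp (g r))) absolutely_integrable_on {0<..} &
   integral {0<..} (%r. \<bar>r powr al\<bar>*(g r powr (s-1)/exp (g r))) = Gamma s"
  using has_absolute_integral_change_of_variables_1'[of "{0<..}" g "%r. r powr al" "%u. u powr (s-1)/exp u" "Gamma s"]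
   der inj G im by simp
 moreover have "\<bar>r powr al\<bar>*(g r powr (s-1)/exp (g r)) = (1+al) powr (1-s)*(r^n* ray_weight al r)" if "r \<in> {0<..}" for r
 proof -
  have "g r powr (s-1) = r powr ((1+al)*(s-1))*(1+al) powr (1-s)"
   using that assms by (simp add: g_def powr_divide powr_powr powr_minus_divide[of _ "s-1"] powr_minus field_simps powr_diff)
  moreover have "(1+al)*(s-1) = real n-al" using assms by (simp add: s_def field_simps)
  moreover have "r powr al* r powr (real n-al) = r^n"
   using that by (simp add: powr_add[symmetric] powr_realpow)
  ultimately show ?thesis by (simp add: ray_weight_def g_def exp_minus field_simps)
 qed
 ultimately have A: "integral {0<..} (%r. (1+al) powr (1-s)*(r^n* ray_weight al r)) = Gamma s"
  by (metis (no_types, lifting) Henstock_Kurzweil_Integration.integral_cong)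
 have B1: "(1+al) powr (1-s)* integral {0<..} (%r. r^n* ray_weight al r) = Gamma s"
  using A by simp
 have B2: "integral {0<..} (%r. r^n* ray_weight al r) = ray_moment al n"
 proof -
  have "(LBINT r:{0..}. r^n* ray_weight al r) = integral {0..} (%r. r^n* ray_weight al r)"
   by (rule set_borel_integral_eq_integral(2)[OF ray_moment_integrable[OF assms]])
  also have "... = integral {0<..} (%r. r^n* ray_weight al r)"
   by (rule integral_spike_set) (auto intro: negligible_subset[of "{0}"])
  finally show ?thesis by (simp add: ray_moment_def)
 qed
 have B3: "(1+al) powr (1-s)*(1+al) powr (s-1) = 1"
  using assms by (simp add: powr_add[symmetric])
 have B4: "s-1 = (real n-al)/(1+al)" using assms by (simp add: s_def field_simps)
 have "ray_moment al n = ((1+al) powr (1-s)*(1+al) powr (s-1))* ray_moment al n"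
  unfolding B3 by simp
 also have "... = ((1+al) powr (1-s)* ray_moment al n)*(1+al) powr (s-1)" by (simp only: mult_ac)
 also have "... = Gamma s*(1+al) powr (s-1)" using B1 unfolding B2 by (simp only:)
 finally show ?thesis unfolding B4 unfolding s_def .
qed

text \<open>The n-th coefficient carries \<open>ray_dir al ^ (n+1)\<close>, of angle pi
  (n+1)/(1+al); real and imaginary part are the cosine and the sine of the two series.\<close>

lemma Hray_0_eq:
 assumes "1 < al"
 shows "Re (Hray al 0 (of_real x)) = pi* Psi al x" (is ?g1) "Im (Hray al 0 (of_real x)) = pi* Phi al x"
proof -
 define c where "c = (%n. (ray_dir al^Suc 0*(- ray_dir al)^n/fact n* of_real (ray_moment al (n+0)))*(of_real x :: complex)^n)"
 have S: "c sums Hray al 0 (of_real x)" unfolding c_def by (rule Hray_series[OF assms])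
 have c: "c n = cis (pi*((1+real n)/(1+al)))* of_real ((-1)^n/fact n* ray_moment al n* x^n)" for n
 proof -
  have "ray_dir al^Suc 0*(- ray_dir al)^n = (-1)^n* ray_dir al^Suc n"
   by (simp add: power_minus[of "ray_dir al"])
  also have "ray_dir al^Suc n = cis (pi*((1+real n)/(1+al)))"
   unfolding ray_dir_def Complex.DeMoivre by (simp add: algebra_simps)
  finally have e: "ray_dir al^Suc 0*(- ray_dir al)^n = (-1)^n* cis (pi*((1+real n)/(1+al)))" .
  show ?thesis unfolding c_def e by simp
 qed
 have re_im: "Re (cis t* of_real a) = cos t* a" "Im (cis t* of_real a) = sin t* a" for t a
  by simp_all
 have re: "Re (c n) = (-1)^n/fact n* Gamma ((1+real n)/(1+al))* cos (pi*((1+real n)/(1+al)))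
      * (1+al) powr ((real n-al)/(1+al))* x^n"
  and im: "Im (c n) = (-1)^n/fact n* Gamma ((1+real n)/(1+al))* sin (pi*((1+real n)/(1+al)))
      * (1+al) powr ((real n-al)/(1+al))* x^n" for n
  unfolding c re_im ray_moment_eq[OF assms] by simp_all
 have "(%n. Re (c n)) sums Re (Hray al 0 (of_real x))" "(%n. Im (c n)) sums Im (Hray al 0 (of_real x))"
  using S by (auto intro: sums_Re sums_Im)
 thus ?g1 "Im (Hray al 0 (of_real x)) = pi* Phi al x"
  unfolding re im Psi_def Phi_def by (auto dest: sums_unique)
qed

lemma Hray_derivative:
 assumes "1 < al"
 shows "(Hray al 0 has_field_derivative-Hray al 1 Y) (at Y)"
proof -
 define c where "c = (%n. ray_dir al^Suc 0*(- ray_dir al)^n/fact n* complex_of_real (ray_moment al (n+0)))"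
 have S: "(%n. c n* Z^n) sums Hray al 0 Z" for Z unfolding c_def by (rule Hray_series[OF assms])
 have "((%Z. \<Sum>n. c n* Z^n) has_field_derivative (\<Sum>n. diffs c n* Y^n)) (at Y)"
  by (rule termdiffs_strong_converges_everywhere) (use S in \<open>auto simp: sums_iff\<close>)
 moreover have "(%Z. \<Sum>n. c n* Z^n) = Hray al 0" using S by (auto simp: sums_iff fun_eq_iff)
 moreover have "(\<Sum>n. diffs c n* Y^n) = - Hray al 1 Y"
 proof -
  have "diffs c n* Y^n = - ((ray_dir al^Suc 1*(- ray_dir al)^n/fact n* of_real (ray_moment al (n+1)))* Y^n)" for n
  proof -
   have "of_nat (Suc n)*(a/fact (Suc n)) = a/fact n" for a :: complex
    unfolding fact_Suc of_nat_mult by (simp add: divide_simps del: of_nat_Suc)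
   note e = this[of "ray_dir al^Suc 0*(- ray_dir al)^Suc n"]
   have "diffs c n* Y^n = (of_nat (Suc n)*(ray_dir al^Suc 0*(- ray_dir al)^Suc n/fact (Suc n)))
     * (of_real (ray_moment al (Suc n))* Y^n)"
    unfolding diffs_def c_def by (simp only: mult.assoc add_0_right)
   thus ?thesis unfolding e by simp
  qed
  hence "(%n. diffs c n* Y^n) sums-Hray al 1 Y"
   using sums_minus[OF Hray_series[OF assms, of 1 Y]] by (simp only:)
  thus ?thesis by (simp add: sums_iff)
 qed
 ultimately show ?thesis by simp
qed

lemma Psi_Phi_derivative:
 assumes "1 < al"
 shows "(Psi al has_field_derivative-Re (Hray al 1 (of_real x))/pi) (at x)" (is ?g1)
  "(Phi al has_field_derivative-Im (Hray al 1 (of_real x))/pi) (at x)" (is ?g2)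
proof -
 have v: "((%x. Hray al 0 (of_real x)) has_vector_derivative-Hray al 1 (of_real x)) (at x)"
  by (rule has_vector_derivative_real_field[OF Hray_derivative[OF assms]])
 have r: "((%x. Re (Hray al 0 (of_real x))) has_vector_derivative Re (- Hray al 1 (of_real x))) (at x)"
  by (rule bounded_linear.has_vector_derivative[OF bounded_linear_Re v])
 have i: "((%x. Im (Hray al 0 (of_real x))) has_vector_derivative Im (- Hray al 1 (of_real x))) (at x)"
  by (rule bounded_linear.has_vector_derivative[OF bounded_linear_Im v])
 have "((%x. (pi* Psi al x)/pi) has_field_derivative Re (- Hray al 1 (of_real x))/pi) (at x)"
  by (rule DERIV_cdivide) (use r in \<open>simp add: Hray_0_eq[OF assms] has_real_derivative_iff_has_vector_derivative\<close>)
 thus ?g1 by simp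
 have "((%x. (pi* Phi al x)/pi) has_field_derivative Im (- Hray al 1 (of_real x))/pi) (at x)"
  by (rule DERIV_cdivide) (use i in \<open>simp add: Hray_0_eq[OF assms] has_real_derivative_iff_has_vector_derivative\<close>)
 thus ?g2 by simp
qed

section \<open>Moving the starting point of the ray\<close>

text \<open>Mean value inequality on the segment. The start z = 0 of the ray lies on the boundary of
  the domain of differentiability and is treated directly.\<close>

lemma powr_increment_bound:
 fixes z :: complex
 assumes "0 < Re z \<or> z = 0" "0 <= s" "1 <= bet"
 shows "norm ((z + of_real s) powr of_real bet-z powr of_real bet) <= bet* s*(norm z+s) powr (bet-1)"
proof (cases "z = 0")
 case True
 have "s powr bet = 1* s* s powr (bet-1)"
  using assms by (cases "s = 0") (auto simp: powr_diff)
 also have "... <= bet* s* s powr (bet-1)" using assms by (intro mult_right_mono) auto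
 finally show ?thesis using True assms by simp
next
 case False
 hence z: "0 < Re z" using assms by auto
 let ?S = "closed_segment z (z + of_real s)"
 have S: "0 < Re w" "norm w <= norm z+s" if "w \<in> ?S" for w
 proof -
  have "\<exists>u. 0 <= u & u <= 1 & w = (1-u) *\<^sub>R z+u *\<^sub>R (z + of_real s)"
   using that by (simp only: in_segment)
  then obtain u where u0: "0 <= u" "u <= 1" "w = (1-u) *\<^sub>R z+u *\<^sub>R (z + of_real s)"
   by (elim exE conjE)
  hence u: "0 <= u" "u <= 1" "w = z + of_real (u* s)"
   by (simp_all add: scaleR_conv_of_real algebra_simps)
  have us: "0 <= u* s" "u* s <= s" using u assms by (auto intro: mult_left_le_one_le)
  thus "0 < Re w" using z u by simp
  have "norm w <= norm z+norm (complex_of_real (u* s))" unfolding u(3) by (rule norm_triangle_ineq)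
  thus "norm w <= norm z+s" using us by (simp only: norm_of_real abs_of_nonneg)
 qed
 have "norm ((z + of_real s) powr of_real bet-z powr of_real bet) <= (bet*(norm z+s) powr (bet-1))* norm ((z + of_real s)-z)"
 proof (rule field_differentiable_bound[where S = ?S and f' = "%w. of_real bet* w powr of_real (bet-1)"])
  fix w assume w: "w \<in> ?S"
  show "((%z. z powr of_real bet) has_field_derivative of_real bet* w powr of_real (bet-1)) (at w within ?S)"
   by (rule has_field_derivative_at_within[OF has_field_derivative_powr_halfplane[OF S(1)[OF w]]])
  have "norm w powr (bet-1) <= (norm z+s) powr (bet-1)"
   using S(2)[OF w] assms by (intro powr_mono2) auto
  thus "norm (of_real bet* w powr of_real (bet-1)) <= bet*(norm z+s) powr (bet-1)"
   unfolding norm_mult norm_powr_of_real using assms by (simp add: mult_left_mono)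
 qed auto
 thus ?thesis using assms by (simp add: mult_ac)
qed

lemma half_line_FTC:
 fixes F f :: "real => complex"
 assumes d: "!!r. 0 <= r ==> (F has_vector_derivative f r) (at r within {0..})"
  and c: "continuous_on {0..} f" and i: "sint {0..} f" and l: "(F ---> 0) at_top"
 shows "(LBINT r:{0..}. f r) = - F 0"
proof -
 have "((%R. \<integral>r. indicator {..R} r *\<^sub>R (indicator {0..} r *\<^sub>R f r) \<partial>lborel) ---> (LBINT r:{0..}. f r)) at_top"
  unfolding slint_def
  by (rule tendsto_integral_at_top) (use i in \<open>simp_all add: set_integrable_def\<close>)
 moreover have "eventually (%R. (LINT r|lborel. indicator {..R} r *\<^sub>R (indicator {0..} r *\<^sub>R f r)) = F R-F 0) at_top"
  using eventually_ge_at_top[of 0]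
 proof eventually_elim
  case (elim R)
  have e: "indicator {..R} r *\<^sub>R (indicator {0..} r *\<^sub>R x) = indicator {0..R} r *\<^sub>R x" for r and x :: complex
   by (auto simp: indicator_def)
  have "(LINT r|lborel. indicator {0..R} r *\<^sub>R f r) = F R-F 0"
   by (rule integral_FTC_atLeastAtMost[OF elim])
    (auto intro!: has_vector_derivative_within_subset[OF d] continuous_on_subset[OF c])
  thus ?case by (simp only: e)
 qed
 ultimately have "((%R. F R-F 0) ---> (LBINT r:{0..}. f r)) at_top"
  by (rule Lim_transform_eventually)
 moreover have "((%R. F R-F 0) ---> 0-F 0) at_top" by (intro tendsto_diff l tendsto_const)
 ultimately show ?thesis using tendsto_unique[OF trivial_limit_at_top_linorder] by fastforce
qed

lemma set_integral_half_line_scale: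
 fixes f :: "real => 'a::{banach, second_countable_topology}"
 assumes "0 < c"
 shows "(LBINT r:{0..}. f r) = c *\<^sub>R (LBINT r:{0..}. f (c* r))"
proof -
 have "indicator {0..} (c* r) = (indicator {0..} r :: real)" for r
  using assms by (auto simp: indicator_def zero_le_mult_iff)
 thus ?thesis
  using lborel_integral_real_affine[of c "%r. indicator {0..} r *\<^sub>R f r" 0] assms
  by (simp add: slint_def)
qed

lemma kernel_on_ray:
 assumes "1 < al" "0 <= r"
 shows "kernel al Y (of_real r* ray_dir al) = exp (- (of_real r* ray_dir al* of_real Y))* of_real (ray_weight al r)"
proof -
 have "- complex_of_real (r powr (1+al)) / of_real (1+al) - of_real r* ray_dir al* of_real Y
   = - (of_real r* ray_dir al* of_real Y) + of_real (- (r powr (1+al)/(1+al)))" by simp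
 thus ?thesis
  unfolding kernel_def ray_dir_powr[OF assms] ray_weight_def by (simp only: exp_add exp_of_real)
qed

text \<open>Moving the ray to the right by s changes z^(1+al)/(1+al) by at most s (r+s)^al, which is
  of lower order than the decay r^(1+al)/(1+al).\<close>

lemma kernel_shift_bound:
 assumes al: "1 < al" and r: "0 <= r" and s: "0 <= s" "s <= dt"
 shows "norm ((of_real s + of_real r* ray_dir al)^k* kernel al Y (of_real s + of_real r* ray_dir al))
   <= (1+dt)^k* ray_bound al (real k+\<bar>Y\<bar>*(1+dt)+dt*(1+dt) powr al) r"
proof -
 note df = ray_dir_facts[OF al]
 let ?z = "of_real r* ray_dir al"
 have nz: "norm ?z = r" using df r by (simp add: norm_mult)
 have ns: "norm (of_real s+?z) <= s+r"
  using norm_triangle_ineq[of "of_real s" ?z] nz s by simp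
 have "0 <= dt* r" using s r by simp
 moreover have "(1+dt)*(1+r) = 1+r+dt+dt* r" by (simp add: algebra_simps)
 ultimately have rs: "r+s <= (1+dt)*(1+r)" using s r by linarith
 have n1: "norm (of_real s+?z)^k <= (1+dt)^k*(1+r)^k"
  unfolding power_mult_distrib[symmetric] using ns rs by (intro power_mono) auto
 have z0: "0 < Re ?z \<or> ?z = 0" using r df by (cases "r = 0") auto
 have "Re ((of_real s+?z) powr of_real (1+al))-Re (?z powr of_real (1+al)) <= (1+al)* s*(r+s) powr al"
  using powr_increment_bound[OF z0 s(1), of "1+al"] al complex_Re_le_cmod[of "(?z + of_real s) powr of_real (1+al)-?z powr of_real (1+al)"]
  by (simp add: nz add.commute)
 hence "Re ((of_real s+?z) powr of_real (1+al)) <= - (r powr (1+al))+(1+al)* s*(r+s) powr al"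
  unfolding ray_dir_powr[OF al r] by simp
 hence "Re ((of_real s+?z) powr of_real (1+al))/(1+al) <= (- (r powr (1+al))+(1+al)* s*(r+s) powr al)/(1+al)"
  using al by (intro divide_right_mono) auto
 also have "... = - (r powr (1+al)/(1+al))+s*(r+s) powr al"
  using al by (simp add: field_simps)
 also have "s*(r+s) powr al <= dt*((1+dt) powr al*(1+r) powr al)"
 proof (rule mult_mono[OF s(2)])
  show "(r+s) powr al <= (1+dt) powr al*(1+r) powr al"
   using rs r s al by (subst powr_mult[symmetric]) (auto intro!: powr_mono2)
 qed (use s in auto)
 finally have 1: "Re ((of_real s+?z) powr of_real (1+al))/(1+al) <= - (r powr (1+al)/(1+al))+dt*((1+dt) powr al*(1+r) powr al)"
  by simp
 have "\<bar>Re (of_real s+?z)* Y\<bar> <= (r+s)*\<bar>Y\<bar>"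
  unfolding abs_mult using abs_Re_le_cmod[of "of_real s+?z"] ns by (intro mult_right_mono) auto
 also have "... <= ((1+dt)*(1+r))*\<bar>Y\<bar>" using rs by (intro mult_right_mono) auto
 finally have 2: "- (Re (of_real s+?z)* Y) <= (\<bar>Y\<bar>*(1+dt))*(1+r)" by (simp add: mult_ac abs_le_iff)
 have "Re ((of_real s+?z) powr of_real (1+al) / of_real (1+al)-(of_real s+?z)* of_real Y)
   = Re ((of_real s+?z) powr of_real (1+al))/(1+al)-Re (of_real s+?z)* Y"
  unfolding minus_complex.sel Re_divide_of_real by simp
 hence "norm (kernel al Y (of_real s+?z)) <= exp (- (r powr (1+al)/(1+al))+dt*((1+dt) powr al*(1+r) powr al)+(\<bar>Y\<bar>*(1+dt))*(1+r))"
  unfolding kernel_def norm_exp_eq_Re using 1 2 by simp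
 hence n2: "norm (kernel al Y (of_real s+?z)) <= exp ((\<bar>Y\<bar>*(1+dt))*(1+r))* ray_weight al r* exp (dt*(1+dt) powr al*(1+r) powr al)"
  by (simp only: ray_weight_def exp_add[symmetric] mult_ac add_ac)
 have "norm ((of_real s+?z)^k* kernel al Y (of_real s+?z)) <= ((1+dt)^k*(1+r)^k)*(exp ((\<bar>Y\<bar>*(1+dt))*(1+r))* ray_weight al r* exp (dt*(1+dt) powr al*(1+r) powr al))"
  unfolding norm_mult norm_power using n1 n2 r s by (intro mult_mono) auto
 also have "... = (1+dt)^k*(((1+r)^k* exp ((\<bar>Y\<bar>*(1+dt))*(1+r))* ray_weight al r)* exp (dt*(1+dt) powr al*(1+r) powr al))"
  by (simp only: mult_ac)
 also have "... <= (1+dt)^k*(ray_bound al (real k+\<bar>Y\<bar>*(1+dt)) r* exp (dt*(1+dt) powr al*(1+r) powr al))"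
  by (intro mult_left_mono mult_right_mono power_exp_le_ray_bound) (use al r s in auto)
 also have "... = (1+dt)^k* ray_bound al (real k+\<bar>Y\<bar>*(1+dt)+dt*(1+dt) powr al) r"
  by (simp add: ray_bound_def distrib_right exp_add)
 finally show ?thesis .
qed

lemma kernel_regular:
 assumes "1 < al"
 shows "continuous_on {z. 0 <= Re z} (%z. z^k* kernel al Y z)" (is ?g1)
  "0 < Re z ==> (%z. z^k* kernel al Y z) field_differentiable at z"
proof -
 have nz: "complex_of_real (1+al) ~= 0" using assms by (simp del: of_real_add)
 show ?g1
  unfolding kernel_def using assms nz by (intro continuous_intros continuous_on_powr_halfplane) (auto simp del: of_real_add)
 assume "0 < Re z"
 hence "((%z. kernel al Y z) has_field_derivative exp (z powr of_real (1+al) / of_real (1+al)-z* of_real Y)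
   * (of_real (1+al)* z powr of_real (1+al-1) / of_real (1+al)-1* of_real Y)) (at z)"
  unfolding kernel_def
  by (intro DERIV_chain2[OF DERIV_exp] DERIV_diff DERIV_cdivide has_field_derivative_powr_halfplane DERIV_cmult_right DERIV_ident)
 thus "(%z. z^k* kernel al Y z) field_differentiable at z"
  by (intro field_differentiable_mult) (auto simp: field_differentiable_def intro!: derivative_eq_intros)
qed

lemma ray_bound_tendsto_0:
 assumes "1 < al" shows "((%R. ray_bound al c R) ---> 0) at_top"
proof -
 obtain C where C: "\<forall>r\<ge>0. ray_bound al c r <= C* exp (- r)" using ray_bound_exp_decay[OF assms] by blast
 have "((%r::real. C* exp (- r)) ---> 0) at_top" by real_asymp
 thus ?thesis
  by (rule tendsto_sandwich[rotated 2, OF tendsto_const])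
   (use C in \<open>auto simp: ray_bound_def ray_weight_def intro!: eventually_mono[OF eventually_ge_at_top[of 0]]\<close>)
qed

lemma kernel_shift_integrable:
 assumes al: "1 < al" and dt: "0 <= dt"
 shows "sint {0..} (%r. ray_dir al*((of_real dt + of_real r* ray_dir al)^k* kernel al Y (of_real dt + of_real r* ray_dir al)))"
proof (rule ray_dominated_integrable[OF al])
 have "continuous_on {0..} (%r. ray_dir al*((of_real dt + of_real r* ray_dir al)^k* kernel al Y (of_real dt + of_real r* ray_dir al)))"
  by (intro continuous_on_mult_left continuous_on_compose2[OF kernel_regular(1)[OF al]] continuous_intros)
   (use ray_dir_facts[OF al] dt in auto)
 from borel_measurable_continuous_on_indicator[OF _ this]
 show "set_borel_measurable lborel {0..} (%r. ray_dir al*((of_real dt + of_real r* ray_dir al)^k* kernel al Y (of_real dt + of_real r* ray_dir al)))"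
  by (simp add: set_borel_measurable_def)
 show "norm (ray_dir al*((of_real dt + of_real r* ray_dir al)^k* kernel al Y (of_real dt + of_real r* ray_dir al)))
   <= (1+dt)^k* ray_bound al (real k+\<bar>Y\<bar>*(1+dt)+dt*(1+dt) powr al) r" if "0 <= r" for r
  unfolding norm_mult[of "ray_dir al"] ray_dir_facts(1)[OF al] mult_1_left
  by (rule kernel_shift_bound[OF al that dt order_refl])
qed

text \<open>Cauchy's theorem: starting the ray at dt instead of 0 costs the integral over the real
  segment between them. It is applied with dt the grid step and with dt the saddle point.\<close>

lemma kernel_shift:
 assumes al: "1 < al" and dt: "0 <= dt"
 shows "(LBINT r:{0..}. ray_dir al*((of_real dt + of_real r* ray_dir al)^k* kernel al Y (of_real dt + of_real r* ray_dir al)))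
   = Hray al k (of_real Y)-(LINT s|lborel. indicator {0..dt} s *\<^sub>R (of_real s^k* kernel al Y (of_real s)))"
proof -
 note df = ray_dir_facts[OF al]
 define f where "f = (%z. z^k* kernel al Y z)"
 obtain F where F: "!!z. 0 <= Re z ==> (F has_field_derivative f z) (at z within {z. 0 <= Re z})"
  using halfplane_primitive[OF kernel_regular[OF al]] unfolding f_def by blast
 have fc: "continuous_on {z. 0 <= Re z} f" unfolding f_def by (rule kernel_regular(1)[OF al])
 have A: "(LBINT r:{0..}. ray_dir al* f (of_real 0 + of_real r* ray_dir al))+F (of_real 0)
   = (LBINT r:{0..}. ray_dir al* f (of_real dt + of_real r* ray_dir al))+F (of_real dt)"
 proof (rule ray_deformation[OF F fc, where b = "%r. (1+dt)^k* ray_bound al (real k+\<bar>Y\<bar>*(1+dt)+dt*(1+dt) powr al) r"])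
  show "sint {0..} (%r. ray_dir al* f (of_real 0 + of_real r* ray_dir al))"
   "sint {0..} (%r. ray_dir al* f (of_real dt + of_real r* ray_dir al))"
   unfolding f_def by (rule kernel_shift_integrable[OF al]; use dt in simp)+
  show "eventually (%R. \<forall>z\<in>closed_segment (of_real 0 + of_real R* ray_dir al) (of_real dt + of_real R* ray_dir al).
    norm (f z) <= (1+dt)^k* ray_bound al (real k+\<bar>Y\<bar>*(1+dt)+dt*(1+dt) powr al) R) at_top"
   using eventually_ge_at_top[of 0]
  proof eventually_elim
   case (elim R)
   show ?case
   proof
    fix w assume "w \<in> closed_segment (of_real 0 + of_real R* ray_dir al) (of_real dt + of_real R* ray_dir al)"
    hence "\<exists>u. 0 <= u & u <= 1 & w = (1-u) *\<^sub>R (of_real 0 + of_real R* ray_dir al)+u *\<^sub>R (of_real dt + of_real R* ray_dir al)"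
     by (simp only: in_segment)
    then obtain u where u: "0 <= u" "u <= 1" "w = (1-u) *\<^sub>R (of_real 0 + of_real R* ray_dir al)+u *\<^sub>R (of_real dt + of_real R* ray_dir al)"
     by (elim exE conjE)
    hence w: "w = of_real (u* dt) + of_real R* ray_dir al"
     by (simp add: scaleR_conv_of_real algebra_simps)
    have "0 <= u* dt" "u* dt <= dt" using u dt by (auto intro: mult_left_le_one_le)
    thus "norm (f w) <= (1+dt)^k* ray_bound al (real k+\<bar>Y\<bar>*(1+dt)+dt*(1+dt) powr al) R"
     unfolding f_def w by (rule kernel_shift_bound[OF al elim])
   qed
  qed
  have "((%R. (1+dt)^k* ray_bound al (real k+\<bar>Y\<bar>*(1+dt)+dt*(1+dt) powr al) R* dt) ---> (1+dt)^k*0* dt) at_top"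
   by (intro tendsto_intros ray_bound_tendsto_0 al)
  thus "((%R. (1+dt)^k* ray_bound al (real k+\<bar>Y\<bar>*(1+dt)+dt*(1+dt) powr al) R
    * (norm (of_real dt - of_real 0 :: complex)+R* norm (ray_dir al-ray_dir al))) ---> 0) at_top"
   using dt by simp
 qed (use df dt in auto)
 have B: "(LBINT r:{0..}. ray_dir al* f (of_real 0 + of_real r* ray_dir al)) = Hray al k (of_real Y)"
  unfolding Hray_def
  by (intro set_lebesgue_integral_cong) (auto simp: f_def kernel_on_ray[OF al])
 have C: "(LINT s|lborel. indicator {0..dt} s *\<^sub>R (1* f (0 + of_real s*1))) = F (0 + of_real dt*1)-F 0"
  by (rule ray_integral[OF F fc]) (use dt in auto)
 from A have "(LBINT r:{0..}. ray_dir al* f (of_real dt + of_real r* ray_dir al)) = Hray al k (of_real Y)+F (of_real 0)-F (of_real dt)"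
  unfolding B eq_diff_eq by (rule sym)
 moreover have "(LINT s|lborel. indicator {0..dt} s *\<^sub>R f (of_real s)) = F (of_real dt)-F (of_real 0)"
  using C by simp
 ultimately have "(LBINT r:{0..}. ray_dir al* f (of_real dt + of_real r* ray_dir al))
   = Hray al k (of_real Y)-(LINT s|lborel. indicator {0..dt} s *\<^sub>R f (of_real s))"
  by (simp only: diff_diff_eq2)
 thus ?thesis unfolding f_def .
qed

section \<open>Saddle point expansion of Phi\<close>

text \<open>For x = z0^al the exponent z^(1+al)/(1+al) - x z is critical at z0. In z = z0 (1+w) it
  is its value at z0 plus La = z0^(1+al) times this phase, which has a double zero at w = 0.\<close>

definition saddle_phase :: "real => complex => complex" where
 "saddle_phase al w = ((1+w) powr of_real (1+al)-1) / of_real (1+al)-w"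

definition saddle_integral :: "real => nat => real => complex" where
 "saddle_integral al k La = (LBINT r:{0..}. ray_dir al*((of_real r* ray_dir al)^k* exp (of_real La* saddle_phase al (of_real r* ray_dir al))))"

lemma kernel_saddle:
 assumes al: "1 < al" and x: "0 < x" and z0: "z0 = x powr (1/al)" and La: "La = z0 powr (1+al)"
  and w: "0 <= Re w"
 shows "kernel al x (of_real z0*(1+w)) = of_real (exp (- (La* al/(1+al))))* exp (of_real La* saddle_phase al w)"
proof -
 have z0p: "0 < z0" using x z0 by simp
 have xz: "x* z0 = La" unfolding La powr_add using x al z0 by (simp add: powr_powr)
 have 1: "(of_real z0*(1+w)) powr of_real (1+al) = of_real La*(1+w) powr of_real (1+al)"
  unfolding La using z0p powr_times_real_left[of "of_real z0" "1+w" "of_real (1+al)"] powr_of_real[of z0 "1+al"]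
  by (simp del: of_real_add)
 have 2: "of_real z0*(1+w)* of_real x = of_real La*(1+w)"
  unfolding xz[symmetric] by (simp add: mult_ac)
 have nz: "complex_of_real (1+al) ~= 0" using al by (simp del: of_real_add)
 have "of_real La*(1+w) powr of_real (1+al) / of_real (1+al) - of_real La*(1+w)
   = of_real (- (La* al/(1+al))) + of_real La* saddle_phase al w"
 proof -
  have "complex_of_real (La* al/(1+al)) = of_real La*(1-1 / of_real (1+al))"
  proof -
   have "La* al/(1+al) = La*(1-1/(1+al))" using al by (simp add: field_simps)
   thus ?thesis by simp
  qed
  thus ?thesis by (simp add: saddle_phase_def diff_divide_distrib algebra_simps)
 qed
 thus ?thesis unfolding kernel_def 1 2 by (simp only: exp_add exp_of_real)
qed

text \<open>The ray is moved so as to start at z0. The segment from 0 to z0 contributes a real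
  number and disappears from the imaginary part, which leaves the exponentially small value of the
  kernel at the saddle as a factor.\<close>

lemma Phi_via_saddle:
 assumes al: "1 < al" and x: "0 < x" and z0: "z0 = x powr (1/al)" and La: "La = z0 powr (1+al)"
  and int: "!!k. sint {0..} (%r. ray_dir al*((of_real r* ray_dir al)^k* exp (of_real La* saddle_phase al (of_real r* ray_dir al))))"
 shows "Im (Hray al 0 (of_real x)) = z0* exp (- (La* al/(1+al)))* Im (saddle_integral al 0 La)"
  "Im (Hray al 1 (of_real x)) = z0^2* exp (- (La* al/(1+al)))*(Im (saddle_integral al 0 La)+Im (saddle_integral al 1 La))"
proof -
 have z0p: "0 < z0" using x z0 by simp
 let ?d = "ray_dir al" and ?E = "exp (- (La* al/(1+al)))"
 have re: "Im (LINT s|lborel. indicator {0..z0} s *\<^sub>R (of_real s^k* kernel al x (of_real s))) = 0" for k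
 proof -
  have "indicator {0..z0} s *\<^sub>R (of_real s^k* kernel al x (of_real s))
    = complex_of_real (indicator {0..z0} s*(s^k* exp (s powr (1+al)/(1+al)-s* x)))" for s
   using al by (auto simp: kernel_def indicator_def powr_of_real exp_of_real[symmetric] simp del: of_real_add)
  hence "(LINT s|lborel. indicator {0..z0} s *\<^sub>R (of_real s^k* kernel al x (of_real s))) =
    complex_of_real (LINT s|lborel. indicator {0..z0} s*(s^k* exp (s powr (1+al)/(1+al)-s* x)))"
   by (simp only: integral_complex_of_real)
  thus ?thesis by simp
 qed
 \<comment> \<open>In z0^(k+1) one factor comes from rescaling r and k factors from z^k = z0^k
   (1+w)^k.\<close>
 have sc: "(LBINT r:{0..}. ?d*((of_real z0 + of_real r*?d)^k* kernel al x (of_real z0 + of_real r*?d)))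
   = of_real (z0^Suc k*?E)*(LBINT r:{0..}. ?d*((1 + of_real r*?d)^k* exp (of_real La* saddle_phase al (of_real r*?d))))" for k
 proof -
  have "(LBINT r:{0..}. ?d*((of_real z0 + of_real r*?d)^k* kernel al x (of_real z0 + of_real r*?d)))
   = z0 *\<^sub>R (LBINT r:{0..}. ?d*((of_real z0 + of_real (z0* r)*?d)^k* kernel al x (of_real z0 + of_real (z0* r)*?d)))"
   by (rule set_integral_half_line_scale[OF z0p])
  also have "(LBINT r:{0..}. ?d*((of_real z0 + of_real (z0* r)*?d)^k* kernel al x (of_real z0 + of_real (z0* r)*?d)))
   = (LBINT r:{0..}. of_real (z0^k*?E)*(?d*((1 + of_real r*?d)^k* exp (of_real La* saddle_phase al (of_real r*?d)))))"
  proof (intro set_lebesgue_integral_cong allI impI)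
   fix r :: real assume r: "r \<in> {0..}"
   have e: "of_real z0 + of_real (z0* r)*?d = of_real z0*(1 + of_real r*?d)" by (simp add: algebra_simps)
   have "0 <= Re (of_real r*?d)" using r ray_dir_facts[OF al] by simp
   from kernel_saddle[OF al x z0 La this]
   show "?d*((of_real z0 + of_real (z0* r)*?d)^k* kernel al x (of_real z0 + of_real (z0* r)*?d)) =
    of_real (z0^k*?E)*(?d*((1 + of_real r*?d)^k* exp (of_real La* saddle_phase al (of_real r*?d))))"
    unfolding e power_mult_distrib by (simp add: mult_ac)
  qed simp
  also have "... = of_real (z0^k*?E)*(LBINT r:{0..}. ?d*((1 + of_real r*?d)^k* exp (of_real La* saddle_phase al (of_real r*?d))))"
   by (rule set_integral_mult_right)
  finally show ?thesis by (simp add: scaleR_conv_of_real mult_ac)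
 qed
 have I: "Im (Hray al k (of_real x)) = Im (of_real (z0^Suc k*?E)*(LBINT r:{0..}. ?d*((1 + of_real r*?d)^k* exp (of_real La* saddle_phase al (of_real r*?d)))))" for k
  using kernel_shift[OF al less_imp_le[OF z0p], of k x] re[of k] unfolding sc by simp
 show "Im (Hray al 0 (of_real x)) = z0*?E* Im (saddle_integral al 0 La)"
  using I[of 0] by (simp add: saddle_integral_def)
 have "(LBINT r:{0..}. ?d*((1 + of_real r*?d)^1* exp (of_real La* saddle_phase al (of_real r*?d))))
   = (LBINT r:{0..}. ?d*((of_real r*?d)^0* exp (of_real La* saddle_phase al (of_real r*?d)))
     + ?d*((of_real r*?d)^1* exp (of_real La* saddle_phase al (of_real r*?d))))"
  by (rule set_lebesgue_integral_cong) (auto simp: algebra_simps)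
 also have "... = saddle_integral al 0 La+saddle_integral al 1 La"
  unfolding saddle_integral_def by (rule set_integral_add(2)[OF int int])
 finally show "Im (Hray al 1 (of_real x)) = z0^2*?E*(Im (saddle_integral al 0 La)+Im (saddle_integral al 1 La))"
  unfolding I by (simp add: power2_eq_square)
qed

lemma has_field_derivative_one_plus_powr:
 assumes "0 <= Re w"
 shows "((%w. (1+w) powr of_real bet) has_field_derivative of_real bet*(1+w) powr of_real (bet-1)) (at w)"
proof -
 have "((%w. (1+w) powr of_real bet) has_field_derivative of_real bet*(1+w) powr of_real (bet-1)*1) (at w)"
  by (rule DERIV_chain2[OF has_field_derivative_powr_halfplane])
   (use assms in \<open>auto intro!: derivative_eq_intros\<close>)
 thus ?thesis by simp
qed

lemma saddle_phase_derivative: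
 assumes "1 < al" "0 <= Re w"
 shows "(saddle_phase al has_field_derivative (1+w) powr of_real al-1) (at w)"
proof -
 have nz: "complex_of_real (1+al) ~= 0" using assms by (simp del: of_real_add)
 have "((%w. ((1+w) powr of_real (1+al)-1) / of_real (1+al)-w) has_field_derivative
   (of_real (1+al)*(1+w) powr of_real (1+al-1)-0) / of_real (1+al)-1) (at w)"
  by (intro DERIV_diff DERIV_cdivide has_field_derivative_one_plus_powr assms DERIV_const DERIV_ident)
 moreover have "(of_real (1+al)*(1+w) powr of_real (1+al-1)-0) / of_real (1+al)-1 = (1+w) powr of_real al-1"
  using nz by simp
 ultimately show ?thesis unfolding saddle_phase_def[abs_def] by simp
qed

lemma ray_vector_derivative:
 assumes "(F has_field_derivative F') (at (of_real r* d))"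
 shows "((%r. F (of_real r* d)) has_vector_derivative d* F') (at r)"
proof -
 have "((%r. of_real r* d) has_vector_derivative d) (at r)"
  by (auto intro!: derivative_eq_intros simp: has_vector_derivative_def scaleR_conv_of_real)
 from field_vector_diff_chain_at[OF this assms] show ?thesis by (simp add: o_def)
qed

lemma Re_ray_derivative:
 assumes "(F has_field_derivative F') (at (of_real r* d))"
 shows "((%r. Re (F (of_real r* d))) has_field_derivative Re (d* F')) (at r)"
 unfolding has_real_derivative_iff_has_vector_derivative
 by (rule bounded_linear.has_vector_derivative[OF bounded_linear_Re ray_vector_derivative[OF assms]])

text \<open>With th = pi/(1+al) in [pi/3, pi/2), the argument of 1 + r d lies in [0, th]. So the
  argument of the product lies between 2 th >= 2 pi/3 and 2 th + (al-1) th = pi, where the cosine is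
  at most -1/2, and the modulus is at least 1.\<close>

lemma ray_second_derivative_sign:
 assumes al: "1 < al" "al <= 2" and r: "0 <= r"
 shows "Re ((ray_dir al)\<^sup>2*(1 + of_real r* ray_dir al) powr of_real (al-1)) <= - 1/2"
proof -
 note df = ray_dir_facts[OF al(1)]
 define tht where "tht = pi/(1+al)"
 define z where "z = 1 + of_real r* ray_dir al"
 have rz: "1 <= Re z" "0 <= Im z" using df r by (simp_all add: z_def)
 hence z0: "z ~= 0" by auto
 define ph where "ph = Im (Ln z)"
 have ph: "0 <= ph" "ph < pi/2"
  using rz Im_Ln_pos_le[OF z0] Re_Ln_pos_lt[OF z0] by (auto simp: ph_def)
 have th: "pi/3 <= tht" "tht < pi/2"
  unfolding tht_def using al pi_gt_zero by (auto intro!: divide_left_mono simp: field_simps)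
 have "z = exp (Ln z)" using z0 by simp
 hence zp: "z = of_real (norm z)* cis ph"
  using z0 by (metis ph_def Re_Ln exp_Ln exp_eq_polar exp_ln norm_eq_zero exp_of_real zero_less_norm_iff)
 \<comment> \<open>The sign of sin (tht - ph) is that of Im (d cnj z) = Im d > 0.\<close>
 have "ph <= tht"
 proof -
  have "Im (ray_dir al* cnj z) = Im (ray_dir al)"
   by (simp add: z_def algebra_simps)
  moreover have "ray_dir al* cnj z = of_real (norm z)* cis (tht-ph)"
  proof -
   have cz: "cnj z = of_real (norm z)* cis (- ph)"
    using arg_cong[OF zp, of cnj] by (simp add: cis_cnj)
   have "ray_dir al*(of_real (norm z)* cis (- ph)) = of_real (norm z)*(cis tht* cis (- ph))"
    by (simp add: ray_dir_def tht_def)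
   thus ?thesis unfolding cz by (simp add: cis_mult)
  qed
  ultimately have "norm z* sin (tht-ph) = Im (ray_dir al)" by simp
  hence "0 < norm z* sin (tht-ph)" using df by simp
  hence "0 < sin (tht-ph)" using z0 by (simp add: zero_less_mult_iff)
  moreover have "sin (tht-ph) < 0" if "tht < ph"
  proof -
   have "0 < pi/3" using pi_gt_zero by simp
   hence "0 < sin (ph-tht)" using that ph th by (intro sin_gt_zero) linarith+
   thus ?thesis using sin_minus[of "ph-tht"] by simp
  qed
  ultimately show ?thesis by force
 qed
 define a where "a = 2* tht+(al-1)* ph"
 have p0: "0 <= (al-1)* ph" using al ph by simp
 have p1: "(al-1)* ph <= (al-1)* tht" using \<open>ph <= tht\<close> al by (intro mult_left_mono) auto
 have p2: "2* tht+(al-1)* tht = pi"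
 proof -
  have "2* tht+(al-1)* tht = (1+al)* tht" by (simp add: algebra_simps)
  also have "... = pi" using al by (simp add: tht_def)
  finally show ?thesis .
 qed
 have a1: "2* pi/3 <= a" unfolding a_def using th(1) p0 by linarith
 have a2: "a <= pi" unfolding a_def using p1 p2 by linarith
 have "cos a <= cos (2* pi/3)" using a1 a2 pi_gt_zero by (intro cos_monotone_0_pi_le) auto
 hence ca: "cos a <= - 1/2" by (simp add: cos_120)
 have "(of_real (norm z)* cis ph) powr of_real (al-1) = of_real (norm z powr (al-1))* cis ((al-1)* ph)"
  by (rule powr_rcis) (use ph in auto)
 hence "z powr of_real (al-1) = of_real (norm z powr (al-1))* cis ((al-1)* ph)"
  unfolding zp[symmetric] .
 moreover have "(ray_dir al)\<^sup>2 = cis (2* tht)" by (simp add: ray_dir_def tht_def Complex.DeMoivre)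
 ultimately have "(ray_dir al)\<^sup>2* z powr of_real (al-1) = of_real (norm z powr (al-1))* cis a"
  by (simp add: a_def cis_mult[symmetric] mult_ac)
 hence e: "Re ((ray_dir al)\<^sup>2* z powr of_real (al-1)) = norm z powr (al-1)* cos a" by simp
 have "1 <= norm z" using rz abs_Re_le_cmod[of z] by linarith
 hence n: "1 <= norm z powr (al-1)" using al by (intro ge_one_powr_ge_zero) auto
 have "norm z powr (al-1)* cos a <= 1* cos a" by (rule mult_right_mono_neg[OF n]) (use ca in simp)
 with ca e show ?thesis unfolding z_def[symmetric] by linarith
qed

text \<open>The second derivative of the real part along the ray is at most - al/2; it is integrated
  twice from the double zero at 0.\<close>

lemma saddle_phase_bound:
 assumes al: "1 < al" "al <= 2" and r: "0 <= r"
 shows "Re (saddle_phase al (of_real r* ray_dir al)) <= - (al/4* r^2)"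
proof -
 let ?d = "ray_dir al"
 note df = ray_dir_facts[OF al(1)]
 have hp: "0 <= Re (of_real s*?d)" if "0 <= s" for s using that df by simp
 \<comment> \<open>v is the derivative of the function u below; both are nonincreasing and vanish at
   0.\<close>
 define v where "v = (%s. Re (?d*((1 + of_real s*?d) powr of_real al-1))+al/2* s)"
 have v: "v s <= 0" if s: "0 <= s" for s
 proof -
  have "v s <= v 0"
  proof (rule DERIV_nonpos_imp_nonincreasing[OF s])
   fix x assume x: "0 <= x" "x <= s"
   have "((%w. ?d*((1+w) powr of_real al-1)) has_field_derivative ?d*(of_real al*(1 + of_real x*?d) powr of_real (al-1)-0)) (at (of_real x*?d))"
    by (intro DERIV_cmult DERIV_diff has_field_derivative_one_plus_powr hp x DERIV_const)
   from DERIV_add[OF Re_ray_derivative[OF this] DERIV_cmult[OF DERIV_ident, of "al/2"]]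
   have "(v has_field_derivative Re (?d*(?d*(of_real al*(1 + of_real x*?d) powr of_real (al-1)-0)))+al/2*1) (at x)"
    unfolding v_def .
   moreover have "Re (?d*(?d*(of_real al*(1 + of_real x*?d) powr of_real (al-1)-0)))+al/2*1
     = al* Re (?d\<^sup>2*(1 + of_real x*?d) powr of_real (al-1))+al/2"
   proof -
    have "?d*(?d*(of_real al*(1 + of_real x*?d) powr of_real (al-1)-0)) = of_real al*(?d\<^sup>2*(1 + of_real x*?d) powr of_real (al-1))"
     by (simp add: power2_eq_square mult_ac)
    moreover have "Re (of_real al* B) = al* Re B" for B by simp
    ultimately show ?thesis by (simp only: mult_1_right)
   qed
   moreover have "al* Re (?d\<^sup>2*(1 + of_real x*?d) powr of_real (al-1)) <= al*(- 1/2)"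
    using ray_second_derivative_sign[OF al x(1)] al by (intro mult_left_mono) auto
   ultimately show "\<exists>y. (v has_real_derivative y) (at x) & y <= 0" by force
  qed
  also have "v 0 = 0" by (simp add: v_def)
  finally show ?thesis .
 qed
 define u where "u = (%s. Re (saddle_phase al (of_real s*?d))+al/4* s^2)"
 have "u r <= u 0"
 proof (rule DERIV_nonpos_imp_nonincreasing[OF r])
  fix x assume x: "0 <= x" "x <= r"
  have "((%s. al/4* s^2) has_field_derivative al/2* x) (at x)"
   by (auto intro!: derivative_eq_intros)
  from DERIV_add[OF Re_ray_derivative[OF saddle_phase_derivative[OF al(1) hp[OF x(1)]]] this]
  have "(u has_field_derivative v x) (at x)" unfolding u_def v_def .
  with v[OF x(1)] show "\<exists>y. (u has_real_derivative y) (at x) & y <= 0" by blast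
 qed
 also have "u 0 = 0" by (simp add: u_def saddle_phase_def)
 finally show ?thesis by (simp add: u_def)
qed

definition half_gauss_moment :: "nat => real => real" where
 "half_gauss_moment k c = (LBINT r:{0..}. r^k* exp (- (c* r^2)))"

lemma half_gauss_moment_integrable:
 assumes "0 < c" shows "sint {0..} (%r::real. r^k* exp (- (c* r^2)))"
proof -
 have "integrable lborel (%x. sqrt (pi/c)*(normal_density 0 (1/sqrt (2* c)) x*(x-0)^k))"
  using assms by (intro integrable_mult_right integrable_normal_moment) simp
 moreover have "sqrt (pi/c)*(normal_density 0 (1/sqrt (2* c)) x*(x-0)^k) = x^k* exp (- (c* x^2))" for x
 proof -
  have "2* pi*(1/sqrt (2* c))\<^sup>2 = pi/c" using assms by (simp add: power_divide)
  moreover have "(x-0)\<^sup>2/(2*(1/sqrt (2* c))\<^sup>2) = c* x^2" using assms by (simp add: power_divide)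
  moreover have "sqrt (pi/c) ~= 0" using assms by simp
  ultimately show ?thesis unfolding normal_density_def by (simp add: field_simps)
 qed
 ultimately have "integrable lborel (%r::real. r^k* exp (- (c* r^2)))" by (simp only:)
 thus ?thesis unfolding set_integrable_def by (intro integrable_mult_indicator) auto
qed

lemma half_gauss_moment_scale:
 assumes "0 < La" shows "half_gauss_moment k (La* c) = (1/sqrt La)^Suc k* half_gauss_moment k c"
proof -
 have "half_gauss_moment k (La* c) = (1/sqrt La) *\<^sub>R (LBINT r:{0..}. ((1/sqrt La)* r)^k* exp (- (La* c*((1/sqrt La)* r)\<^sup>2)))"
  unfolding half_gauss_moment_def by (rule set_integral_half_line_scale) (use assms in simp)
 also have "(%r. ((1/sqrt La)* r)^k* exp (- (La* c*((1/sqrt La)* r)\<^sup>2))) = (%r. (1/sqrt La)^k*(r^k* exp (- (c* r^2))))"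
  using assms by (auto simp: power_mult_distrib power_divide)
 finally show ?thesis by (simp add: half_gauss_moment_def)
qed

lemma half_gauss_moment_nonneg: "0 <= half_gauss_moment k c"
 unfolding half_gauss_moment_def slint_def by (intro integral_nonneg_AE) (auto simp: indicator_def)

text \<open>Everything below is measured in powers of \<open>1 / sqrt La\<close>, the width of the saddle.\<close>

context
 fixes al :: real
 assumes al: "1 < al" "al <= 2"
begin

abbreviation (input) "d \<equiv> ray_dir al"
abbreviation (input) "ex La r \<equiv> exp (complex_of_real La* saddle_phase al (of_real r* ray_dir al))"

lemma saddle_hp: "0 <= r ==> 0 <= Re (of_real r* d)"
 using ray_dir_facts[OF al(1)] by simp

lemma norm_ray: "0 <= r ==> norm (of_real r* d) = r"
 using ray_dir_facts[OF al(1)] by (simp add: norm_mult)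

lemma continuous_saddle: "continuous_on {0..} (%r. ex La r)"
proof -
 have "continuous_on {w. 0 <= Re w} (saddle_phase al)"
 proof (rule continuous_at_imp_continuous_on, rule ballI)
  fix w :: complex assume "w \<in> {w. 0 <= Re w}"
  thus "isCont (saddle_phase al) w"
   by (intro DERIV_isCont[OF saddle_phase_derivative[OF al(1)]]) simp
 qed
 hence "continuous_on {0..} (%r. saddle_phase al (of_real r* d))"
 proof (rule continuous_on_compose2)
  show "continuous_on {0..} (%r. of_real r* d)" by (intro continuous_intros)
  show "(%r. of_real r* d) ` {0..} \<subseteq> {w. 0 <= Re w}" using saddle_hp by blast
 qed
 thus ?thesis by (intro continuous_on_exp continuous_on_mult_left)
qed

lemma saddle_exp_bound:
 assumes "0 <= r" "0 <= La" shows "norm (ex La r) <= exp (- ((La*(al/4))* r^2))"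
proof -
 have "La* Re (saddle_phase al (of_real r* d)) <= La*(- (al/4* r^2))"
  by (rule mult_left_mono[OF saddle_phase_bound[OF al assms(1)] assms(2)])
 thus ?thesis unfolding norm_exp_eq_Re by (simp add: mult_ac)
qed

text \<open>The Gaussian majorant has width 1 / sqrt La, so a weight of size r^m yields (1 / sqrt
  La)^(m+1), the extra power being the length element.\<close>

lemma saddle_weighted:
 fixes ph :: "real => complex"
 assumes c: "continuous_on {0..} ph" and b: "!!r. 0 <= r ==> norm (ph r) <= C* r^m" and L: "0 < La"
 shows "sint {0..} (%r. d*(ph r* ex La r))" (is ?g1)
  "norm (LBINT r:{0..}. d*(ph r* ex La r)) <= C* half_gauss_moment m (al/4)*(1/sqrt La)^Suc m" (is ?g2)
proof -
 have L4: "0 < La*(al/4)" using L al by simp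
 note mi = set_integrable_mult_right[OF half_gauss_moment_integrable[OF L4, of m], of C]
 have cont: "continuous_on {0..} (%r. d*(ph r* ex La r))"
  by (intro continuous_on_mult_left continuous_on_mult c continuous_saddle)
 have bd: "norm (d*(ph r* ex La r)) <= C*(r^m* exp (- ((La*(al/4))* r^2)))" if r: "0 <= r" for r
 proof -
  have "norm (ph r)* norm (ex La r) <= (C* r^m)* exp (- ((La*(al/4))* r^2))"
   using b[OF r] saddle_exp_bound[OF r less_imp_le[OF L]] by (intro mult_mono) (auto intro: order_trans[OF norm_ge_zero])
  thus ?thesis unfolding norm_mult ray_dir_facts(1)[OF al(1)] by (simp add: mult_ac)
 qed
 show i: ?g1
 proof (rule set_integrable_bound[OF mi])
  show "set_borel_measurable lborel {0..} (%r. d*(ph r* ex La r))"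
   using borel_measurable_continuous_on_indicator[OF _ cont] by (simp add: set_borel_measurable_def)
  show "AE r in lborel. r \<in> {0..} --> norm (d*(ph r* ex La r)) <= norm (C*(r^m* exp (- ((La*(al/4))* r^2))))"
  proof (intro AE_I2 impI)
   fix r :: real assume "r \<in> {0..}"
   thus "norm (d*(ph r* ex La r)) <= norm (C*(r^m* exp (- ((La*(al/4))* r^2))))"
    using bd[of r] abs_ge_self[of "C*(r^m* exp (- ((La*(al/4))* r^2)))"] unfolding real_norm_def by (meson atLeast_iff order_trans)
  qed
 qed
 have "norm (LBINT r:{0..}. d*(ph r* ex La r)) <= (LBINT r:{0..}. norm (d*(ph r* ex La r)))"
  by (rule set_integral_norm_bound[OF i])
 also have "... <= (LBINT r:{0..}. C*(r^m* exp (- ((La*(al/4))* r^2))))"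
  by (rule set_integral_mono[OF set_integrable_norm[OF i] mi]) (use bd in auto)
 also have "... = C* half_gauss_moment m (La*(al/4))"
  unfolding half_gauss_moment_def by (rule set_integral_mult_right)
 finally show ?g2
  unfolding half_gauss_moment_scale[OF L] by (simp add: mult_ac)
qed

lemma saddle_power:
 assumes L: "0 < La"
 shows "sint {0..} (%r. d*((of_real r* d)^k* ex La r))" (is ?g1)
  "norm (saddle_integral al k La) <= half_gauss_moment k (al/4)*(1/sqrt La)^Suc k" (is ?g2)
proof -
 have c: "continuous_on {0..} (%r. (of_real r* d)^k)" by (intro continuous_intros)
 have b: "norm ((of_real r* d)^k) <= 1* r^k" if "0 <= r" for r
  using norm_ray[OF that] by (simp add: norm_power)
 show ?g1
  by (rule saddle_weighted(1)[OF c b L])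
 show ?g2
  using saddle_weighted(2)[OF c b L] by (simp add: saddle_integral_def)
qed

text \<open>The fourth derivative is a constant times (1+w)^(al-4), bounded on the half plane
  because |1+w| >= 1 there; hence the remainder is uniform.\<close>

lemma saddle_taylor_derivative:
 "\<exists>C. \<forall>w. 0 <= Re w --> norm (((1+w) powr of_real al-1)-(of_real al* w + of_real (al*(al-1)/2)* w^2
   + of_real (al*(al-1)*(al-2)/6)* w^3)) <= C* norm w^4"
proof -
 \<comment> \<open>Falling factorials: \<open>c i\<close> is the coefficient of the i-th derivative
   of z^al.\<close>
 define c where "c = (%i::nat. \<Prod>j<i. (al-real j))"
 define f where "f = (%(i::nat) z. complex_of_real (c i)* z powr of_real (al-real i))"
 have S: "convex {z. 1 <= Re z}" by (rule convex_halfspace_Re_ge)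
 have T: "norm (f 0 (1+w)-(\<Sum>i\<le>3. f i 1*((1+w)-1)^i/fact i)) <= \<bar>c 4\<bar>* norm ((1+w)-1)^Suc 3/fact 3"
  if w: "0 <= Re w" for w
 proof (rule complex_Taylor[OF S])
  show "(f i has_field_derivative f (Suc i) x) (at x within {z. 1 <= Re z})" if "x \<in> {z. 1 <= Re z}" for i x
  proof -
   have "0 < Re x" using that by auto
   from has_field_derivative_at_within[OF DERIV_cmult[OF has_field_derivative_powr_halfplane[OF this]]]
   have "(f i has_field_derivative of_real (c i)*(of_real (al-real i)* x powr of_real (al-real i-1))) (at x within {z. 1 <= Re z})"
    unfolding f_def .
   moreover have "of_real (c i)*(of_real (al-real i)* x powr of_real (al-real i-1)) = f (Suc i) x"
    by (simp add: f_def c_def diff_diff_eq add.commute)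
   ultimately show ?thesis by simp
  qed
  show "norm (f (Suc 3) x) <= \<bar>c 4\<bar>" if "x \<in> {z. 1 <= Re z}" for x
  proof -
   have "1 <= norm x" using that abs_Re_le_cmod[of x] by simp
   hence "norm x powr (al-4) <= norm x powr 0" using al by (intro powr_mono) auto
   hence "norm x powr (al-4) <= 1" using \<open>1 <= norm x\<close> by (cases "x = 0") auto
   hence "\<bar>c 4\<bar>* norm x powr (al-4) <= \<bar>c 4\<bar>" by (rule mult_left_le) simp
   thus ?thesis unfolding f_def norm_mult norm_powr_of_real by (simp add: numeral_eq_Suc)
  qed
 qed (use w in auto)
 have E: "(\<Sum>i\<le>3. f i 1*((1+w)-1)^i/fact i) = 1+(of_real al* w + of_real (al*(al-1)/2)* w^2
   + of_real (al*(al-1)*(al-2)/6)* w^3)" for w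
  by (simp add: f_def c_def numeral_eq_Suc fact_Suc lessThan_Suc mult_ac)
 have f0: "f 0 z = z powr of_real al" for z by (simp add: f_def c_def)
 have B: "\<bar>c 4\<bar>* norm ((1+w)-1)^Suc 3/fact 3 = (\<bar>c 4\<bar>/fact 3)* norm w^4" for w :: complex
  by (simp add: numeral_eq_Suc)
 show ?thesis
 proof (intro exI[of _ "\<bar>c 4\<bar>/fact 3"] allI impI)
  fix w :: complex assume "0 <= Re w"
  from T[OF this, unfolded E f0 B]
  show "norm (((1+w) powr of_real al-1)-(of_real al* w + of_real (al*(al-1)/2)* w^2
   + of_real (al*(al-1)*(al-2)/6)* w^3)) <= (\<bar>c 4\<bar>/fact 3)* norm w^4"
   by (simp only: diff_diff_eq)
 qed
qed

lemma saddle_taylor: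
 assumes "0 <= Re w"
 shows "norm (saddle_phase al w - of_real (al/2)* w^2) <= al*(al-1)* norm w^3"
proof -
 define f where "f = (%(i::nat) w. if i = 0 then saddle_phase al w else if i = 1 then (1+w) powr of_real al-1
   else if i = 2 then of_real al*(1+w) powr of_real (al-1) else of_real al*(of_real (al-1)*(1+w) powr of_real (al-1-1)))"
 have "norm (f 0 w-(\<Sum>i\<le>2. f i 0*(w-0)^i/fact i)) <= (al*(al-1))* norm (w-0)^Suc 2/fact 2"
 proof (rule complex_Taylor[of "{z. 0 <= Re z}"])
  show "convex {z. 0 <= Re z}" by (rule convex_halfspace_Re_ge)
  show "(f i has_field_derivative f (Suc i) x) (at x within {z. 0 <= Re z})" if x: "x \<in> {z. 0 <= Re z}" and i: "i <= 2" for i x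
  proof -
   have x0: "0 <= Re x" using x by simp
   consider "i = 0" | "i = 1" | "i = 2" using i by linarith
   hence "(f i has_field_derivative f (Suc i) x) (at x)"
   proof cases
    case 1 thus ?thesis using saddle_phase_derivative[OF al(1) x0] by (simp add: f_def)
   next
    case 2 thus ?thesis using DERIV_diff[OF has_field_derivative_one_plus_powr[OF x0, of al] DERIV_const[of 1]]
     by (simp add: f_def)
   next
    case 3 thus ?thesis using DERIV_cmult[OF has_field_derivative_one_plus_powr[OF x0, of "al-1"], of "of_real al"]
     by (simp add: f_def)
   qed
   thus ?thesis by (rule has_field_derivative_at_within)
  qed
  show "norm (f (Suc 2) x) <= al*(al-1)" if "x \<in> {z. 0 <= Re z}" for x
  proof -
   have "1 <= norm (1+x)" using that abs_Re_le_cmod[of "1+x"] by simp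
   hence "norm (1+x) powr (al-1-1) <= norm (1+x) powr 0" using al by (intro powr_mono) auto
   hence "norm (1+x) powr (al-1-1) <= 1" using \<open>1 <= norm (1 + x)\<close> by (cases "1+x = 0") auto
   hence "(al*(al-1))* norm (1+x) powr (al-1-1) <= al*(al-1)"
    using al by (intro mult_left_le) auto
   moreover have "norm (f (Suc 2) x) = (al*(al-1))* norm (1+x) powr (al-1-1)"
    unfolding f_def using al by (simp add: norm_mult del: of_real_diff)
   ultimately show ?thesis by simp
  qed
 qed (use assms in auto)
 moreover have "(\<Sum>i\<le>2. f i 0*(w-0)^i/fact i) = of_real (al/2)* w^2"
  by (simp add: f_def numeral_eq_Suc saddle_phase_def)
 ultimately have "norm (saddle_phase al w - of_real (al/2)* w^2) <= (al*(al-1))* norm w^3/2"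
  by (simp add: f_def numeral_eq_Suc)
 also have "... <= al*(al-1)* norm w^3" using al by simp
 finally show ?thesis .
qed

lemma saddle_powr_continuous: "continuous_on {0..} (%r. (1 + of_real r* d) powr of_real al-1)"
proof -
 have "continuous_on {w. 0 <= Re w} (%w. (1+w) powr complex_of_real al)"
 proof (rule continuous_at_imp_continuous_on, rule ballI)
  fix w :: complex assume "w \<in> {w. 0 <= Re w}"
  thus "isCont (%w. (1+w) powr complex_of_real al) w"
   by (intro DERIV_isCont[OF has_field_derivative_one_plus_powr]) simp
 qed
 hence "continuous_on {0..} (%r. (1 + of_real r* d) powr complex_of_real al)"
 proof (rule continuous_on_compose2)
  show "continuous_on {0..} (%r. of_real r* d)" by (intro continuous_intros)
  show "(%r. of_real r* d) ` {0..} \<subseteq> {w. 0 <= Re w}" using saddle_hp by blast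
 qed
 thus ?thesis by (rule continuous_on_diff[OF _ continuous_on_const])
qed

text \<open>The derivative of w^k exp (La phase) integrates along the ray to minus the value at 0,
  and that value is 1 for k = 0 and 0 otherwise. For k = 0 the truncated k - 1 stands behind the
  factor 0.\<close>

lemma saddle_ibp:
 assumes L: "0 < La"
 shows "of_real La*(LBINT r:{0..}. d*(((of_real r* d)^k*((1 + of_real r* d) powr of_real al-1))* ex La r))
   = - (of_nat k* saddle_integral al (k-1) La)-(if k = 0 then 1 else 0)"
proof -
 define F where "F = (%w. w^k* exp (of_real La* saddle_phase al w))"
 obtain C where C: "!!w. 0 <= Re w ==> norm (((1+w) powr of_real al-1)-(of_real al* w + of_real (al*(al-1)/2)* w^2
   + of_real (al*(al-1)*(al-2)/6)* w^3)) <= C* norm w^4" using saddle_taylor_derivative by blast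
 note pc = saddle_powr_continuous
 \<comment> \<open>The derivative of the phase is a cubic polynomial plus a remainder of order r^4,
   and each piece is integrable against the exponential.\<close>
 have i0: "sint {0..} (%r. d*(((of_real r* d)^j*((1 + of_real r* d) powr of_real al-1))* ex La r))" for j
 proof -
  let ?R = "%r. (of_real r* d)^j*(((1 + of_real r* d) powr of_real al-1)-(of_real al*(of_real r* d) + of_real (al*(al-1)/2)*(of_real r* d)^2
   + of_real (al*(al-1)*(al-2)/6)*(of_real r* d)^3))"
  have "sint {0..} (%r. d*(?R r* ex La r))"
  proof (rule saddle_weighted(1)[OF _ _ L])
   have "continuous_on {0..} (%r. of_real al*(of_real r* d) + of_real (al*(al-1)/2)*(of_real r* d)^2
    + of_real (al*(al-1)*(al-2)/6)*(of_real r* d)^3)" by (intro continuous_intros)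
   moreover have "continuous_on {0..} (%r. (of_real r* d)^j)" by (intro continuous_intros)
   ultimately show "continuous_on {0..} ?R" by (intro continuous_on_mult continuous_on_diff[OF pc])
   show "norm (?R r) <= C* r^(j+4)" if "0 <= r" for r
    using mult_left_mono[OF C[OF saddle_hp[OF that]], of "r^j"] that norm_ray[OF that]
    unfolding norm_mult[of "(of_real r* d)^j"] norm_power by (simp add: power_add mult_ac)
  qed
  moreover have "sint {0..} (%r. of_real al*(d*((of_real r* d)^(j+1)* ex La r))
    + of_real (al*(al-1)/2)*(d*((of_real r* d)^(j+2)* ex La r))
    + of_real (al*(al-1)*(al-2)/6)*(d*((of_real r* d)^(j+3)* ex La r)))"
   by (intro set_integral_add set_integrable_mult_right saddle_power L)
  ultimately have "sint {0..} (%r. d*(?R r* ex La r)+(of_real al*(d*((of_real r* d)^(j+1)* ex La r))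
    + of_real (al*(al-1)/2)*(d*((of_real r* d)^(j+2)* ex La r))
    + of_real (al*(al-1)*(al-2)/6)*(d*((of_real r* d)^(j+3)* ex La r))))"
   by (rule set_integral_add(1))
  moreover have "d*(?R r* ex La r)+(of_real al*(d*((of_real r* d)^(j+1)* ex La r))
    + of_real (al*(al-1)/2)*(d*((of_real r* d)^(j+2)* ex La r))
    + of_real (al*(al-1)*(al-2)/6)*(d*((of_real r* d)^(j+3)* ex La r)))
    = d*(((of_real r* d)^j*((1 + of_real r* d) powr of_real al-1))* ex La r)" for r
   by (simp add: algebra_simps power_add power2_eq_square power3_eq_cube)
  ultimately show ?thesis by simp
 qed
 have der: "((%r. F (of_real r* d)) has_vector_derivative
   of_nat k*(d*((of_real r* d)^(k-1)* ex La r)) + of_real La*(d*(((of_real r* d)^k*((1 + of_real r* d) powr of_real al-1))* ex La r))) (at r within {0..})"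
  if r: "0 <= r" for r
 proof -
  let ?w = "of_real r* d"
  have D1: "((%w. w^k) has_field_derivative of_nat k*?w^(k-1)) (at ?w)"
   by (auto intro!: derivative_eq_intros)
  have D2: "((%w. exp (of_real La* saddle_phase al w)) has_field_derivative
    exp (of_real La* saddle_phase al ?w)*(of_real La*((1+?w) powr of_real al-1))) (at ?w)"
   by (rule DERIV_chain2[OF DERIV_exp DERIV_cmult[OF saddle_phase_derivative[OF al(1) saddle_hp[OF r]]]])
  have "(F has_field_derivative (of_nat k*?w^(k-1))* exp (of_real La* saddle_phase al ?w)
    + exp (of_real La* saddle_phase al ?w)*(of_real La*((1+?w) powr of_real al-1))*?w^k) (at ?w)"
   unfolding F_def by (rule DERIV_mult[OF D1 D2])
  from has_vector_derivative_at_within[OF ray_vector_derivative[OF this]]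
  show ?thesis by (rule back_subst[of "%y. (_ has_vector_derivative y) _"]) (simp add: algebra_simps)
 qed
 have "(LBINT r:{0..}. of_nat k*(d*((of_real r* d)^(k-1)* ex La r)) + of_real La*(d*(((of_real r* d)^k*((1 + of_real r* d) powr of_real al-1))* ex La r)))
   = - F (of_real 0* d)"
 proof (rule half_line_FTC[OF der])
  show "continuous_on {0..} (%r. of_nat k*(d*((of_real r* d)^(k-1)* ex La r)) + of_real La*(d*(((of_real r* d)^k*((1 + of_real r* d) powr of_real al-1))* ex La r)))"
   by (intro continuous_on_add continuous_on_mult continuous_on_const continuous_on_power continuous_on_of_real
     continuous_on_id continuous_saddle pc)
  show "sint {0..} (%r. of_nat k*(d*((of_real r* d)^(k-1)* ex La r)) + of_real La*(d*(((of_real r* d)^k*((1 + of_real r* d) powr of_real al-1))* ex La r)))"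
   by (intro set_integral_add set_integrable_mult_right saddle_power L i0)
  have L4: "0 < La*(al/4)" using L al by simp
  define c where "c = La*(al/4)"
  have "((%r. exp (real k* r-c* r^2)) ---> 0) at_top"
   using L4 unfolding c_def[symmetric] by real_asymp
  thus "((%r. F (of_real r* d)) ---> 0) at_top"
  proof (rule Lim_null_comparison[rotated])
   show "eventually (%r. norm (F (of_real r* d)) <= exp (real k* r-c* r^2)) at_top"
    using eventually_ge_at_top[of 0]
   proof eventually_elim
    case (elim r)
    have "r <= exp r" using exp_ge_add_one_self[of r] by linarith
    hence "r^k <= exp r^k" using elim by (rule power_mono)
    also have "... = exp (real k* r)" by (simp add: exp_of_nat_mult)
    finally have "r^k* norm (ex La r) <= exp (real k* r)* exp (- (c* r^2))"
     unfolding c_def by (rule mult_mono[OF _ saddle_exp_bound]) (use L elim in auto)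
    thus ?case unfolding F_def norm_mult[of "_^k"] norm_power norm_ray[OF elim]
     by (simp add: exp_add[symmetric])
   qed
  qed
 qed
 also have "(LBINT r:{0..}. of_nat k*(d*((of_real r* d)^(k-1)* ex La r)) + of_real La*(d*(((of_real r* d)^k*((1 + of_real r* d) powr of_real al-1))* ex La r)))
   = of_nat k* saddle_integral al (k-1) La + of_real La*(LBINT r:{0..}. d*(((of_real r* d)^k*((1 + of_real r* d) powr of_real al-1))* ex La r))"
  unfolding saddle_integral_def set_integral_mult_right[symmetric]
  by (intro set_integral_add(2) set_integrable_mult_right saddle_power L i0)
 also have "F (of_real 0* d) = (if k = 0 then 1 else 0)" by (simp add: F_def saddle_phase_def)
 finally have *: "of_nat k* saddle_integral al (k-1) La + of_real La*(LBINT r:{0..}. d*(((of_real r* d)^k*((1 + of_real r* d) powr of_real al-1))* ex La r))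
   = - (if k = 0 then 1 else 0)" .
 have **: "B = - A-c" if "A+B = - c" for A B c :: complex
 proof -
  have "B = (A+B)-A" by simp
  thus ?thesis unfolding that by simp
 qed
 show ?thesis by (rule **[OF *])
qed

text \<open>Let E k be the imaginary parts and e = 1 / sqrt La; a priori E k = O(e^(k+1)). The
  imaginary parts of \<open>saddle_ibp\<close> for k = 0, 1, 2, where the real boundary term 1 drops
  out, link E 0 to E 5 up to remainders. Solving from the top improves this to E 1 = O(e^3), E 3 =
  O(e^5) and al E 2 = - e^2 E 0 + O(e^5); eliminating E 2 from the first relation determines E 1 up
  to O(e^5).\<close>

lemma saddle_integral_expansion:
 "\<exists>C. \<forall>La\<ge>1. \<bar>al\<^sup>2* Im (saddle_integral al 1 La)-al*(al-1)/2*(1/sqrt La)\<^sup>2* Im (saddle_integral al 0 La)\<bar>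
   <= C*(1/sqrt La)^5"
proof -
 define a2 a3 where "a2 = al*(al-1)/2" and "a3 = al*(al-1)*(al-2)/6"
 obtain C where C: "!!w. 0 <= Re w ==> norm (((1+w) powr of_real al-1)-(of_real al* w + of_real a2* w^2
   + of_real a3* w^3)) <= C* norm w^4" using saddle_taylor_derivative unfolding a2_def a3_def by blast
 define g where "g = (%k. half_gauss_moment k (al/4))"
 have g0: "0 <= g k" for k by (simp add: g_def half_gauss_moment_nonneg)
 define R where "R = (%w::complex. ((1+w) powr of_real al-1)-(of_real al* w + of_real a2* w^2 + of_real a3* w^3))"
 define B where "B = \<bar>C\<bar>*(g 4+g 5+g 6)+\<bar>a2\<bar>*(g 2+g 3+g 4)+\<bar>a3\<bar>*(g 3+g 4+g 5)"
 \<comment> \<open>The cubic Taylor polynomial of the phase derivative is inserted into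
   \<open>saddle_ibp\<close>; rh collects the quartic remainder.\<close>
 have eqk: "\<exists>rh. \<bar>rh\<bar> <= \<bar>C\<bar>* g (k+4)*(1/sqrt La)^(k+5) &
   al* Im (saddle_integral al (k+1) La)+a2* Im (saddle_integral al (k+2) La)+a3* Im (saddle_integral al (k+3) La)+rh
   = - (real k* Im (saddle_integral al (k-1) La))*(1/sqrt La)\<^sup>2" if L: "0 < La" for k La
 proof -
  let ?w = "%r. of_real r* d"
  let ?I = "LBINT r:{0..}. d*(((?w r)^k* R (?w r))* ex La r)"
  have Rc: "continuous_on {0..} (%r. (?w r)^k* R (?w r))"
  proof -
   have "continuous_on {0..} (%r. of_real al*?w r + of_real a2*?w r^2 + of_real a3*?w r^3)"
    by (intro continuous_intros)
   moreover have "continuous_on {0..} (%r. ?w r^k)" by (intro continuous_intros)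
   ultimately show ?thesis unfolding R_def by (intro continuous_on_mult continuous_on_diff[OF saddle_powr_continuous])
  qed
  have Rb: "norm ((?w r)^k* R (?w r)) <= \<bar>C\<bar>* r^(k+4)" if "0 <= r" for r
  proof -
   have "norm (R (?w r)) <= C* r^4" using C[OF saddle_hp[OF that]] norm_ray[OF that] by (simp only: R_def)
   also have "... <= \<bar>C\<bar>* r^4" using that by (intro mult_right_mono) auto
   finally have "r^k* norm (R (?w r)) <= r^k*(\<bar>C\<bar>* r^4)" by (rule mult_left_mono) (use that in simp)
   thus ?thesis using norm_ray[OF that] unfolding norm_mult[of "(?w r)^k"] norm_power by (simp add: power_add mult_ac)
  qed
  note RI = saddle_weighted[OF Rc Rb L]
  have I: "(LBINT r:{0..}. d*(((?w r)^k*((1+?w r) powr of_real al-1))* ex La r))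
    = of_real al* saddle_integral al (k+1) La + of_real a2* saddle_integral al (k+2) La + of_real a3* saddle_integral al (k+3) La+?I"
  proof -
   have "(LBINT r:{0..}. d*(((?w r)^k*((1+?w r) powr of_real al-1))* ex La r)) =
     (LBINT r:{0..}. of_real al*(d*((?w r)^(k+1)* ex La r)) + of_real a2*(d*((?w r)^(k+2)* ex La r))
      + of_real a3*(d*((?w r)^(k+3)* ex La r))+d*(((?w r)^k* R (?w r))* ex La r))"
    by (rule set_lebesgue_integral_cong) (auto simp: R_def algebra_simps power_add power2_eq_square power3_eq_cube)
   also have "... = (LBINT r:{0..}. of_real al*(d*((?w r)^(k+1)* ex La r)) + of_real a2*(d*((?w r)^(k+2)* ex La r))
      + of_real a3*(d*((?w r)^(k+3)* ex La r)))+?I"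
    by (intro set_integral_add(2) set_integral_add(1) set_integrable_mult_right saddle_power L RI)
   also have "(LBINT r:{0..}. of_real al*(d*((?w r)^(k+1)* ex La r)) + of_real a2*(d*((?w r)^(k+2)* ex La r))
      + of_real a3*(d*((?w r)^(k+3)* ex La r)))
     = (LBINT r:{0..}. of_real al*(d*((?w r)^(k+1)* ex La r)) + of_real a2*(d*((?w r)^(k+2)* ex La r)))
      + (LBINT r:{0..}. of_real a3*(d*((?w r)^(k+3)* ex La r)))"
    by (intro set_integral_add(2) set_integral_add(1) set_integrable_mult_right saddle_power L)
   also have "(LBINT r:{0..}. of_real al*(d*((?w r)^(k+1)* ex La r)) + of_real a2*(d*((?w r)^(k+2)* ex La r)))
     = (LBINT r:{0..}. of_real al*(d*((?w r)^(k+1)* ex La r)))+(LBINT r:{0..}. of_real a2*(d*((?w r)^(k+2)* ex La r)))"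
    by (intro set_integral_add(2) set_integrable_mult_right saddle_power L)
   finally show ?thesis by (simp only: set_integral_mult_right saddle_integral_def)
  qed
  have "Im (of_real La*(of_real al* saddle_integral al (k+1) La + of_real a2* saddle_integral al (k+2) La + of_real a3* saddle_integral al (k+3) La+?I))
    = Im (- (of_nat k* saddle_integral al (k-1) La)-(if k = 0 then 1 else 0))"
   using saddle_ibp[OF L, of k] unfolding I by (simp only:)
  hence e: "La*(al* Im (saddle_integral al (k+1) La)+a2* Im (saddle_integral al (k+2) La)+a3* Im (saddle_integral al (k+3) La)+Im ?I)
    = - (real k* Im (saddle_integral al (k-1) La))" by simp
  have s2: "(1/sqrt La)\<^sup>2 = 1/La" using L by (simp add: power_divide)
  show ?thesis
  proof (intro exI[of _ "Im ?I"] conjI)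
   have "\<bar>Im ?I\<bar> <= norm ?I" by (rule abs_Im_le_cmod)
   also have "... <= \<bar>C\<bar>* half_gauss_moment (k+4) (al/4)*(1/sqrt La)^Suc (k+4)" by (rule RI(2))
   also have "Suc (k+4) = k+5" by simp
   finally show "\<bar>Im ?I\<bar> <= \<bar>C\<bar>* g (k+4)*(1/sqrt La)^(k+5)" unfolding g_def .
   show "al* Im (saddle_integral al (k+1) La)+a2* Im (saddle_integral al (k+2) La)+a3* Im (saddle_integral al (k+3) La)+Im ?I
    = - (real k* Im (saddle_integral al (k-1) La))*(1/sqrt La)\<^sup>2"
   proof -
    have "x = y*(1/La)" if "La* x = y" for x y using that L by (auto simp: field_simps)
    from this[OF e] show ?thesis unfolding s2 .
   qed
  qed
 qed
 define K1 where "K1 = \<bar>a2\<bar>* g 2+\<bar>a3\<bar>* g 3+\<bar>C\<bar>* g 4"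
 define K3 where "K3 = \<bar>a2\<bar>* g 4+\<bar>a3\<bar>* g 5+\<bar>C\<bar>* g 6+2* K1"
 define K2 where "K2 = \<bar>a2\<bar>* K3+\<bar>a3\<bar>* g 4+\<bar>C\<bar>* g 5"
 show ?thesis
 proof (intro exI[of _ "al*(\<bar>a3\<bar>* K3+\<bar>C\<bar>* g 4)+\<bar>a2\<bar>* K2"] allI impI)
  fix La :: real assume L1: "1 <= La"
  hence L: "0 < La" by simp
  define e where "e = 1/sqrt La"
  have e: "0 < e" "e <= 1" using L1 by (auto simp: e_def)
  define E where "E = (%k. Im (saddle_integral al k La))"
  have Eb: "\<bar>E k\<bar> <= g k* e^Suc k" for k
   using saddle_power(2)[OF L, of k] abs_Im_le_cmod[of "saddle_integral al k La"] unfolding E_def g_def e_def by linarith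
  have pw: "e^m <= e^n" if "n <= m" for m n using e that by (intro power_decreasing) auto
  have up: "x* e^m <= x* e^n" if "n <= m" "0 <= x" for m n x using pw[OF that(1)] that(2) by (rule mult_left_mono)
  obtain r0 where r0: "\<bar>r0\<bar> <= \<bar>C\<bar>* g 4* e^5" "al* E 1+a2* E 2+a3* E 3+r0 = 0"
   using eqk[OF L, of 0] by (auto simp: E_def e_def numeral_eq_Suc)
  obtain r1 where r1: "\<bar>r1\<bar> <= \<bar>C\<bar>* g 5* e^6" "al* E 2+a2* E 3+a3* E 4+r1 = - (E 0* e^2)"
   using eqk[OF L, of 1] by (auto simp: E_def e_def numeral_eq_Suc)
  obtain r2 where r2: "\<bar>r2\<bar> <= \<bar>C\<bar>* g 6* e^7" "al* E 3+a2* E 4+a3* E 5+r2 = - (2* E 1* e^2)"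
   using eqk[OF L, of 2] by (auto simp: E_def e_def numeral_eq_Suc)
  have am: "\<bar>a* b\<bar> <= \<bar>a\<bar>* c" if "\<bar>b\<bar> <= c" for a b c :: real
   unfolding abs_mult using that by (intro mult_left_mono) auto
  have bd: "\<bar>a* E k\<bar> <= \<bar>a\<bar>* g k* e^n" if "n <= Suc k" for a k n
  proof -
   have "\<bar>E k\<bar> <= g k* e^n" using Eb[of k] up[OF that g0[of k]] by linarith
   from am[OF this, of a] show ?thesis by (simp add: mult.assoc)
  qed
  have alE: "\<bar>E k\<bar> <= \<bar>al* E k\<bar>" for k
   using al mult_right_mono[of 1 al "\<bar>E k\<bar>"] by (simp add: abs_mult)
  have tri: "\<bar>x\<bar> <= a+b+c+f" if "x+u+v+w = y" "\<bar>u\<bar> <= a" "\<bar>v\<bar> <= b" "\<bar>w\<bar> <= c" "\<bar>y\<bar> <= f"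
   for x u v w y a b c f :: real
   using that unfolding abs_le_iff by linarith
  have r0': "\<bar>r0\<bar> <= \<bar>C\<bar>* g 4* e^3" using r0(1) up[of 3 5 "\<bar>C\<bar>* g 4"] g0[of 4] by simp
  have "\<bar>al* E 1\<bar> <= \<bar>a2\<bar>* g 2* e^3+\<bar>a3\<bar>* g 3* e^3+\<bar>C\<bar>* g 4* e^3"
   using tri[OF r0(2) bd[of 3 2 a2] bd[of 3 3 a3] r0', of 0] by simp
  hence E1: "\<bar>E 1\<bar> <= K1* e^3" using alE[of 1] unfolding K1_def by (simp add: distrib_right)
  have r2y: "\<bar>- (2* E 1* e^2)\<bar> <= 2* K1* e^5"
  proof -
   have "\<bar>- (2* E 1* e^2)\<bar> = (2* e^2)*\<bar>E 1\<bar>" by (simp add: abs_mult)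
   also have "... <= (2* e^2)*(K1* e^3)" by (rule mult_left_mono[OF E1]) simp
   also have "... = 2* K1* e^5" by (simp add: numeral_eq_Suc mult_ac)
   finally show ?thesis .
  qed
  have r2': "\<bar>r2\<bar> <= \<bar>C\<bar>* g 6* e^5" using r2(1) up[of 5 7 "\<bar>C\<bar>* g 6"] g0[of 6] by simp
  have "\<bar>al* E 3\<bar> <= \<bar>a2\<bar>* g 4* e^5+\<bar>a3\<bar>* g 5* e^5+\<bar>C\<bar>* g 6* e^5+2* K1* e^5"
   using tri[OF r2(2) bd[of 5 4 a2] bd[of 5 5 a3] r2' r2y] by simp
  \<comment> \<open>One power better than the a priori e^4; this is what pushes the terms with E 3
    in the other two relations to order e^5.\<close>
  hence E3: "\<bar>E 3\<bar> <= K3* e^5" using alE[of 3] unfolding K3_def by (simp add: distrib_right)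
  have r1': "\<bar>r1\<bar> <= \<bar>C\<bar>* g 5* e^5" using r1(1) up[of 5 6 "\<bar>C\<bar>* g 5"] g0[of 5] by simp
  have "\<bar>al* E 2+E 0* e^2\<bar> <= \<bar>a2\<bar>*(K3* e^5)+\<bar>a3\<bar>* g 4* e^5+\<bar>C\<bar>* g 5* e^5"
  proof -
   have "(al* E 2+E 0* e^2)+a2* E 3+a3* E 4+r1 = 0" using r1(2) by linarith
   from tri[OF this am[OF E3, of a2] bd[of 5 4 a3] r1', of 0] show ?thesis by simp
  qed
  hence E2: "\<bar>al* E 2+E 0* e^2\<bar> <= K2* e^5" unfolding K2_def by (simp add: distrib_right mult.assoc)
  have E12: "\<bar>al* E 1+a2* E 2\<bar> <= (\<bar>a3\<bar>* K3+\<bar>C\<bar>* g 4)* e^5"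
  proof -
   have "(al* E 1+a2* E 2)+a3* E 3+r0+0 = 0" using r0(2) by linarith
   from tri[OF this am[OF E3, of a3] r0(1), of 0 0] show ?thesis by (simp add: distrib_right mult.assoc)
  qed
  have "\<bar>al*(al* E 1+a2* E 2)-a2*(al* E 2+E 0* e^2)\<bar> <= \<bar>al*(al* E 1+a2* E 2)\<bar>+\<bar>a2*(al* E 2+E 0* e^2)\<bar>"
   by (rule abs_triangle_ineq4)
  also have "... <= \<bar>al\<bar>*((\<bar>a3\<bar>* K3+\<bar>C\<bar>* g 4)* e^5)+\<bar>a2\<bar>*(K2* e^5)"
   by (intro add_mono am E12 E2)
  also have "\<bar>al\<bar> = al" using al by simp
  finally have "\<bar>al*(al* E 1+a2* E 2)-a2*(al* E 2+E 0* e^2)\<bar> <= (al*(\<bar>a3\<bar>* K3+\<bar>C\<bar>* g 4)+\<bar>a2\<bar>* K2)* e^5"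
   by (simp add: distrib_right mult.assoc)
  moreover have "al*(al* E 1+a2* E 2)-a2*(al* E 2+E 0* e^2) = al^2* E 1-a2* e^2* E 0"
   by (simp add: algebra_simps power2_eq_square)
  ultimately show "\<bar>al\<^sup>2* Im (saddle_integral al 1 La)-al*(al-1)/2*(1/sqrt La)\<^sup>2* Im (saddle_integral al 0 La)\<bar>
   <= (al*(\<bar>a3\<bar>* K3+\<bar>C\<bar>* g 4)+\<bar>a2\<bar>* K2)*(1/sqrt La)^5"
   unfolding E_def e_def a2_def by (simp only:)
 qed
qed

text \<open>The leading term at the saddle. Rotated to the imaginary axis the integral is i times a
  real half Gaussian, and this positivity becomes the positivity of Phi for large arguments.\<close>

lemma gaussian_ray:
 shows "sint {0..} (%r. d* exp (of_real (al/2)*(of_real r* d)\<^sup>2))" (is ?g1)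
  "0 < Im (LBINT r:{0..}. d* exp (of_real (al/2)*(of_real r* d)\<^sup>2))" (is ?g2)
proof -
 note df = ray_dir_facts[OF al(1)]
 define f where "f = (%z::complex. exp (of_real (al/2)* z^2))"
 have fc: "continuous_on S f" for S unfolding f_def by (intro continuous_intros)
 have fd: "f field_differentiable at z" for z
  unfolding f_def by (auto intro!: derivative_eq_intros simp: field_differentiable_def)
 obtain F where F: "!!z. 0 <= Re z ==> (F has_field_derivative f z) (at z within {z. 0 <= Re z})"
  using halfplane_primitive[OF fc fd] by blast
 have cs: "(Re d)\<^sup>2-(Im d)\<^sup>2 <= - 1/2"
  using ray_second_derivative_sign[OF al order_refl] by (simp add: power2_eq_square)
 have imd: "Im d <= 1" using abs_Im_le_cmod[of d] df by simp
 \<comment> \<open>Going from d to i shrinks the real part and enlarges the imaginary part, so the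
   real part of the square, at most -1/2 at d, stays at most -1/2.\<close>
 have fb: "norm (f (of_real R*((1-u) *\<^sub>R d+u *\<^sub>R \<i>))) <= exp (- (al/4* R^2))" if u: "0 <= u" "u <= 1" for u R
 proof -
  have re: "((1-u)* Re d)\<^sup>2 <= (Re d)\<^sup>2" using u df by (intro power_mono) (auto simp: mult_left_le_one_le)
  have "Im d <= (1-u)* Im d+u"
  proof -
   have "u* Im d <= u*1" using u imd by (intro mult_left_mono) auto
   thus ?thesis by (simp add: algebra_simps)
  qed
  hence "(Im d)\<^sup>2 <= ((1-u)* Im d+u)\<^sup>2" using df by (intro power_mono) auto
  with re cs have q: "((1-u)* Re d)\<^sup>2-((1-u)* Im d+u)\<^sup>2 <= - 1/2" by linarith
  have "Re (of_real (al/2)*(of_real R*((1-u) *\<^sub>R d+u *\<^sub>R \<i>))\<^sup>2) = (al/2* R^2)*(((1-u)* Re d)\<^sup>2-((1-u)* Im d+u)\<^sup>2)"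
  proof -
   have 1: "Re (of_real c* z^2) = c*((Re z)\<^sup>2-(Im z)\<^sup>2)" for c z
    by (simp add: power2_eq_square)
   have 2: "Re (of_real R*((1-u) *\<^sub>R d+u *\<^sub>R \<i>)) = R*((1-u)* Re d)"
    "Im (of_real R*((1-u) *\<^sub>R d+u *\<^sub>R \<i>)) = R*((1-u)* Im d+u)" by simp_all
   show ?thesis unfolding 1 2 power_mult_distrib[of R] by (simp only: right_diff_distrib mult.assoc)
  qed
  also have "... <= (al/2* R^2)*(- 1/2)" using q al by (intro mult_left_mono) auto
  finally show ?thesis unfolding f_def norm_exp_eq_Re by simp
 qed
 have a4: "0 < al/4" using al by simp
 note gi = half_gauss_moment_integrable[OF a4, of 0]
 have fi: "sint {0..} (%r. e* f (of_real 0 + of_real r* e))" if e: "norm e = 1" "!!r. norm (f (of_real r* e)) <= exp (- (al/4* r^2))" for e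
 proof (rule set_integrable_bound[OF gi])
  show "set_borel_measurable lborel {0..} (%r. e* f (of_real 0 + of_real r* e))"
   unfolding set_borel_measurable_def f_def by measurable
 qed (use e in \<open>auto simp: norm_mult\<close>)
 have id: "sint {0..} (%r. d* f (of_real 0 + of_real r* d))"
  by (rule fi) (use df fb[of 0] in auto)
 have ii: "sint {0..} (%r. \<i>* f (of_real 0 + of_real r*\<i>))"
  by (rule fi) (use fb[of 1] in auto)
 have "(LBINT r:{0..}. d* f (of_real 0 + of_real r* d))+F (of_real 0)
   = (LBINT r:{0..}. \<i>* f (of_real 0 + of_real r*\<i>))+F (of_real 0)"
 proof (rule ray_deformation[OF F fc _ _ _ _ id ii, where b = "%R. exp (- (al/4* R^2))"])
  show "eventually (%R. \<forall>z\<in>closed_segment (of_real 0 + of_real R* d) (of_real 0 + of_real R*\<i>). norm (f z) <= exp (- (al/4* R^2))) at_top"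
  proof (intro always_eventually allI ballI)
   fix R z assume "z \<in> closed_segment (of_real 0 + of_real R* d) (of_real 0 + of_real R*\<i>)"
   hence "\<exists>u. 0 <= u & u <= 1 & z = (1-u) *\<^sub>R (of_real 0 + of_real R* d)+u *\<^sub>R (of_real 0 + of_real R*\<i>)"
    by (simp only: in_segment)
   then obtain u where u: "0 <= u" "u <= 1" "z = (1-u) *\<^sub>R (of_real 0 + of_real R* d)+u *\<^sub>R (of_real 0 + of_real R*\<i>)"
    by (elim exE conjE)
   have "z = of_real R*((1-u) *\<^sub>R d+u *\<^sub>R \<i>)" unfolding u(3) by (simp add: scaleR_conv_of_real algebra_simps)
   thus "norm (f z) <= exp (- (al/4* R^2))" using fb[OF u(1,2)] by simp
  qed
  define q n where "q = al/4" and "n = norm (\<i>-d)"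
  have "0 < q" using a4 by (simp add: q_def)
  hence "((%R. exp (- (q* R^2))*(0+R* n)) ---> 0) at_top" by real_asymp
  thus "((%R. exp (- (al/4* R^2))*(norm (of_real 0 - of_real 0 :: complex)+R* norm (\<i>-d))) ---> 0) at_top"
   by (simp add: q_def n_def)
 qed (use df in auto)
 hence e: "(LBINT r:{0..}. d* f (of_real 0 + of_real r* d)) = (LBINT r:{0..}. \<i>* f (of_real 0 + of_real r*\<i>))"
  by (simp only: add_right_cancel)
 also have "... = (LBINT r:{0..}. \<i>* complex_of_real (r^0* exp (- (al/2* r^2))))"
  by (rule set_lebesgue_integral_cong) (auto simp: f_def power_mult_distrib exp_of_real[symmetric])
 also have "... = \<i>* complex_of_real (half_gauss_moment 0 (al/2))"
  unfolding set_integral_mult_right half_gauss_moment_def set_integral_complex_of_real ..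
 finally have "Im (LBINT r:{0..}. d* f (of_real 0 + of_real r* d)) = half_gauss_moment 0 (al/2)" by simp
 moreover have "0 < half_gauss_moment 0 (al/2)"
 proof -
  have i2: "integrable lborel (%r. indicator {0..} r *\<^sub>R ((r::real)^0* exp (- (al/2* r^2))))"
   using half_gauss_moment_integrable[of "al/2" 0] al by (simp add: set_integrable_def)
  have nn: "AE r in lborel. 0 <= indicator {0..} r *\<^sub>R ((r::real)^0* exp (- (al/2* r^2)))" by simp
  have "half_gauss_moment 0 (al/2) ~= 0"
  proof
   assume "half_gauss_moment 0 (al/2) = 0"
   hence "AE r in lborel. indicator {0..} r *\<^sub>R ((r::real)^0* exp (- (al/2* r^2))) = 0"
    using integral_nonneg_eq_0_iff_AE[OF i2 nn] by (simp add: half_gauss_moment_def slint_def)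
   hence "AE r in lborel. r \<notin> {0<..<1::real}" by eventually_elim (auto simp: indicator_def)
   hence "{0<..<1::real} \<in> null_sets lborel" by (subst AE_iff_null_sets) auto
   thus False by (auto simp: null_sets_def)
  qed
  thus ?thesis using half_gauss_moment_nonneg[of 0 "al/2"] by linarith
 qed
 ultimately show ?g2
  unfolding f_def by simp
 show ?g1
  using id unfolding f_def by simp
qed

text \<open>Rescaling r by 1 / sqrt La turns La times the phase into al/2 (r d)^2 plus an error of
  order 1 / sqrt La, and turns \<open>saddle_exp_bound\<close> into a Gaussian majorant independent
  of La.\<close>

lemma saddle_integral_leading:
 "\<exists>c>0. ((%La. sqrt La* Im (saddle_integral al 0 La)) ---> c) at_top"
proof (intro exI conjI)
 show "0 < Im (LBINT r:{0..}. d* exp (of_real (al/2)*(of_real r* d)\<^sup>2))" by (rule gaussian_ray(2))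
 \<comment> \<open>\<open>max 1 La\<close> keeps the integrand well behaved for every La; it equals
   La from 1 on.\<close>
 have "((%La. \<integral>r. indicator {0..} r *\<^sub>R (d* ex (max 1 La) (1/sqrt (max 1 La)* r)) \<partial>lborel)
   ---> (LINT r|lborel. indicator {0..} r *\<^sub>R (d* exp (of_real (al/2)*(of_real r* d)\<^sup>2)))) at_top"
 proof (rule integral_dominated_convergence_at_top[where w = "%r. indicator {0..} r *\<^sub>R (r^0* exp (- (al/4* r^2)))"])
  show "(%r. indicator {0..} r *\<^sub>R (d* ex (max 1 La) (1/sqrt (max 1 La)* r))) \<in> borel_measurable lborel" for La
  proof -
   have "continuous_on {0..} (%r. ex (max 1 La) (1/sqrt (max 1 La)* r))"
    by (rule continuous_on_compose2[OF continuous_saddle]) (auto intro!: continuous_intros)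
   hence "continuous_on {0..} (%r. d* ex (max 1 La) (1/sqrt (max 1 La)* r))" by (rule continuous_on_mult_left)
   from borel_measurable_continuous_on_indicator[OF _ this] show ?thesis by simp
  qed
  show "(%r. indicator {0..} r *\<^sub>R (d* exp (of_real (al/2)*(of_real r* d)\<^sup>2))) \<in> borel_measurable lborel"
   using gaussian_ray(1) unfolding set_integrable_def by (rule borel_measurable_integrable)
  show "integrable lborel (%r. indicator {0..} r *\<^sub>R (r^0* exp (- (al/4* r^2))))"
   using half_gauss_moment_integrable[of "al/4" 0] al by (simp add: set_integrable_def)
  show "\<forall>\<^sub>F La in at_top. AE r in lborel. norm (indicator {0..} r *\<^sub>R (d* ex (max 1 La) (1/sqrt (max 1 La)* r))) <= indicator {0..} r *\<^sub>R (r^0* exp (- (al/4* r^2)))"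
  proof (intro always_eventually allI AE_I2)
   fix La r :: real
   show "norm (indicator {0..} r *\<^sub>R (d* ex (max 1 La) (1/sqrt (max 1 La)* r))) <= indicator {0..} r *\<^sub>R (r^0* exp (- (al/4* r^2)))"
   proof (cases "0 <= r")
    case True
    define M where "M = max 1 La"
    have M: "1 <= M" by (simp add: M_def)
    have "norm (ex M (1/sqrt M* r)) <= exp (- ((M*(al/4))*(1/sqrt M* r)\<^sup>2))"
     by (rule saddle_exp_bound) (use True M in auto)
    also have "(M*(al/4))*(1/sqrt M* r)\<^sup>2 = al/4* r^2" using M by (simp add: power_mult_distrib power_divide)
    finally show ?thesis using True unfolding M_def[symmetric] norm_scaleR norm_mult ray_dir_facts(1)[OF al(1)] by simp
   qed simp
  qed
  show "AE r in lborel. ((%La. indicator {0..} r *\<^sub>R (d* ex (max 1 La) (1/sqrt (max 1 La)* r))) ---> indicator {0..} r *\<^sub>R (d* exp (of_real (al/2)*(of_real r* d)\<^sup>2))) at_top"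
  proof (rule AE_I2)
   fix r :: real
   show "((%La. indicator {0..} r *\<^sub>R (d* ex (max 1 La) (1/sqrt (max 1 La)* r))) ---> indicator {0..} r *\<^sub>R (d* exp (of_real (al/2)*(of_real r* d)\<^sup>2))) at_top"
   proof (cases "0 <= r")
    case r: True
    have "((%La. of_real (max 1 La)* saddle_phase al (of_real (1/sqrt (max 1 La)* r)* d) - of_real (al/2)*(of_real r* d)\<^sup>2) ---> 0) at_top"
    proof (rule Lim_null_comparison)
     show "eventually (%La. norm (of_real (max 1 La)* saddle_phase al (of_real (1/sqrt (max 1 La)* r)* d) - of_real (al/2)*(of_real r* d)\<^sup>2)
       <= (al*(al-1)* r^3)*(1/sqrt La)) at_top"
      using eventually_ge_at_top[of 1]
     proof eventually_elim
      case (elim M)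
      have mx: "max 1 M = M" using elim by simp
      have r': "0 <= 1/sqrt M* r" using r elim by simp
      let ?w = "of_real (1/sqrt M* r)* d"
      have "of_real (al/2)*(of_real r* d)\<^sup>2 = of_real M*(of_real (al/2)*?w\<^sup>2)"
      proof -
       have "M*(1/sqrt M* r)\<^sup>2 = r^2" using elim by (simp add: power_mult_distrib power_divide)
       hence "complex_of_real r^2 = of_real M* of_real (1/sqrt M* r)^2" unfolding of_real_power[symmetric] of_real_mult[symmetric] by simp
       thus ?thesis unfolding power_mult_distrib by (simp only: mult_ac)
      qed
      hence "norm (of_real M* saddle_phase al ?w - of_real (al/2)*(of_real r* d)\<^sup>2) = M* norm (saddle_phase al ?w - of_real (al/2)*?w\<^sup>2)"
       using elim by (simp only: right_diff_distrib[symmetric] norm_mult norm_of_real abs_of_nonneg)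
      also have "... <= M*(al*(al-1)*(1/sqrt M* r)^3)"
       using saddle_taylor[OF saddle_hp[OF r']] norm_ray[OF r'] elim by (intro mult_left_mono) auto
      also have "... = (al*(al-1)* r^3)*(M*(1/sqrt M)^3)" unfolding power_mult_distrib by (simp only: mult_ac)
      also have "M*(1/sqrt M)^3 = 1/sqrt M"
       using elim by (simp add: numeral_eq_Suc field_simps)
      finally show ?case unfolding mx .
     qed
     have "((%La::real. 1/sqrt La) ---> 0) at_top" by real_asymp
     from tendsto_mult[OF tendsto_const[of "al*(al-1)* r^3"] this]
     show "((%La. (al*(al-1)* r^3)*(1/sqrt La)) ---> 0) at_top" by simp
    qed
    hence "((%La. of_real (max 1 La)* saddle_phase al (of_real (1/sqrt (max 1 La)* r)* d)) ---> of_real (al/2)*(of_real r* d)\<^sup>2) at_top"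
     by (simp only: LIM_zero_iff)
    thus ?thesis by (rule tendsto_scaleR[OF tendsto_const tendsto_mult[OF tendsto_const tendsto_exp]])
   qed simp
  qed
 qed
 hence "((%La. Im (LBINT r:{0..}. d* ex (max 1 La) (1/sqrt (max 1 La)* r))) ---> Im (LBINT r:{0..}. d* exp (of_real (al/2)*(of_real r* d)\<^sup>2))) at_top"
  unfolding slint_def by (rule tendsto_Im)
 moreover have "eventually (%La. Im (LBINT r:{0..}. d* ex (max 1 La) (1/sqrt (max 1 La)* r)) = sqrt La* Im (saddle_integral al 0 La)) at_top"
  using eventually_ge_at_top[of 1]
 proof eventually_elim
  case (elim M)
  have mx: "max 1 M = M" using elim by simp
  have "(LBINT r:{0..}. d* ex M r) = (1/sqrt M) *\<^sub>R (LBINT r:{0..}. d* ex M (1/sqrt M* r))"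
   by (rule set_integral_half_line_scale) (use elim in simp)
  hence "sqrt M* Im (LBINT r:{0..}. d* ex M r) = sqrt M*(1/sqrt M)* Im (LBINT r:{0..}. d* ex M (1/sqrt M* r))"
   by simp
  also have "sqrt M*(1/sqrt M) = 1" using elim by simp
  finally show ?case unfolding mx saddle_integral_def by simp
 qed
 ultimately show "((%La. sqrt La* Im (saddle_integral al 0 La)) ---> Im (LBINT r:{0..}. d* exp (of_real (al/2)*(of_real r* d)\<^sup>2))) at_top"
  by (rule Lim_transform_eventually)
qed

end

section \<open>Expansion of the ray integrals for large arguments\<close>

lemma powr_collect: "a+b = c ==> x powr a* x powr b = x powr (c::real)" for x :: real
 by (simp add: powr_add[symmetric])

lemma one_plus_le_exp_scaled:
 assumes "0 < c" "0 <= (u::real)" shows "1+u <= (1+8/c)* exp (c* u/8)"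
proof -
 have "1+u <= (1+8/c)*(1+c* u/8)" using assms by (simp add: field_simps)
 also have "... <= (1+8/c)* exp (c* u/8)"
  using assms exp_ge_add_one_self[of "c* u/8"] by (intro mult_left_mono) auto
 finally show ?thesis .
qed

lemma poly_exp_integrable:
 assumes c: "0 < c" shows "sint {0..} (%u::real. (1+u)^4* exp (- (c* u)))"
proof -
 have i: "sint {0..} (%u::real. exp (- ((c/2)* u)))"
 proof -
  have "integrable lborel (%u. indicator {0..} (0+(c/2)* u) *\<^sub>R exp (- (0+(c/2)* u)))"
   using set_integrable_exp_neg c unfolding set_integrable_def
   by (subst lborel_integrable_real_affine_iff) auto
  moreover have "indicator {0..} (0+(c/2)* u) = (indicator {0..} u :: real)" for u
   using c by (auto simp: indicator_def zero_le_mult_iff zero_le_divide_iff)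
  ultimately show ?thesis by (simp add: set_integrable_def)
 qed
 show ?thesis
 proof (rule set_integrable_bound[OF set_integrable_mult_right[OF i, of "(1+8/c)^4"]])
  show "set_borel_measurable lborel {0..} (%u::real. (1+u)^4* exp (- (c* u)))"
   unfolding set_borel_measurable_def by measurable
  have "(1+u)^4* exp (- (c* u)) <= (1+8/c)^4* exp (- ((c/2)* u))" if u: "0 <= u" for u
  proof -
   have "(1+u)^4 <= ((1+8/c)* exp (c* u/8))^4"
    using one_plus_le_exp_scaled[OF c u] u by (intro power_mono) auto
   also have "... = (1+8/c)^4* exp (c* u/2)"
    by (simp add: power_mult_distrib exp_of_nat_mult[symmetric])
   finally have "(1+u)^4* exp (- (c* u)) <= (1+8/c)^4* exp (c* u/2)* exp (- (c* u))"
    by (rule mult_right_mono) simp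
   also have "... = (1+8/c)^4* exp (- ((c/2)* u))"
    by (simp add: mult.assoc exp_add[symmetric])
   finally show ?thesis .
  qed
  thus "AE u in lborel. u \<in> {0..} --> norm ((1+u)^4* exp (- (c* u))) <= norm ((1+8/c)^4* exp (- ((c/2)* u)))"
   by (auto intro: order_trans[OF _ abs_ge_self])
 qed
qed

text \<open>In the sector between the ray and the positive axis exp (- z) decays at a rate at least
  m, the cosine of the angle, and beats the polynomial growth of ph, so the two integrals
  agree.\<close>

lemma exp_ray_rotate:
 fixes ph :: "complex => complex"
 assumes al: "1 < al"
  and c: "continuous_on {z. 0 <= Re z} ph" and df: "!!z. 0 < Re z ==> ph field_differentiable at z"
  and b: "!!z. 0 <= Re z ==> norm (ph z) <= (1+norm z)^4"
 shows "sint {0..} (%u. ray_dir al*(ph (of_real u* ray_dir al)* exp (- (of_real u* ray_dir al))))" (is ?g1)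
  "(LBINT u:{0..}. ray_dir al*(ph (of_real u* ray_dir al)* exp (- (of_real u* ray_dir al))))
   = (LBINT u:{0..}. ph (of_real u)* exp (- of_real u))" (is ?g2)
proof -
 note rd = ray_dir_facts[OF al]
 define f where "f = (%z. ph z* exp (- z))"
 have fc: "continuous_on {z. 0 <= Re z} f" unfolding f_def by (intro continuous_intros c)
 have fd: "f field_differentiable at z" if "0 < Re z" for z
  unfolding f_def using df[OF that]
  by (intro field_differentiable_mult) (auto simp: field_differentiable_def intro!: derivative_eq_intros)
 obtain F where F: "!!z. 0 <= Re z ==> (F has_field_derivative f z) (at z within {z. 0 <= Re z})"
  using halfplane_primitive[OF fc fd] by blast
 define m where "m = Re (ray_dir al)"
 have m: "0 < m" "m <= 1" using rd by (auto simp: m_def)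
 have fb: "norm (f z) <= (1+R)^4* exp (- (m* R))" if "m* R <= Re z" "norm z <= R" "0 <= R" for z R
 proof -
  have "0 <= m* R" using m that by simp
  hence rz: "0 <= Re z" using that by linarith
  have "norm (ph z) <= (1+norm z)^4" by (rule b[OF rz])
  also have "... <= (1+R)^4" using that by (intro power_mono) auto
  finally show ?thesis unfolding f_def norm_mult norm_exp_eq_Re using that by (intro mult_mono) auto
 qed
 have fi: "sint {0..} (%u. e* f (of_real 0 + of_real u* e))" if e: "norm e = 1" "m <= Re e" for e
 proof (rule set_integrable_bound[OF poly_exp_integrable[OF m(1)]])
  have "continuous_on {0..} (%u. f (of_real 0 + of_real u* e))"
  proof (rule continuous_on_compose2[OF fc])
   show "continuous_on {0..} (%u. of_real 0 + of_real u* e)" by (intro continuous_intros)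
   show "(%u. of_real 0 + of_real u* e) ` {0..} \<subseteq> {z. 0 <= Re z}" using e m by auto
  qed
  hence "continuous_on {0..} (%u. e* f (of_real 0 + of_real u* e))" by (rule continuous_on_mult_left)
  from borel_measurable_continuous_on_indicator[OF _ this]
  show "set_borel_measurable lborel {0..} (%u. e* f (of_real 0 + of_real u* e))"
   unfolding set_borel_measurable_def by simp
  show "AE u in lborel. u \<in> {0..} --> norm (e* f (of_real 0 + of_real u* e)) <= norm ((1+u)^4* exp (- (m* u)))"
  proof (intro AE_I2 impI)
   fix u :: real assume u: "u \<in> {0..}"
   have "norm (f (of_real 0 + of_real u* e)) <= (1+u)^4* exp (- (m* u))"
    by (rule fb) (use u e in \<open>auto simp: norm_mult mult.commute[of m] mult_left_mono\<close>)
   thus "norm (e* f (of_real 0 + of_real u* e)) <= norm ((1+u)^4* exp (- (m* u)))"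
    unfolding norm_mult[of e] e(1) using u by simp
  qed
 qed
 have i1: "sint {0..} (%u. ray_dir al* f (of_real 0 + of_real u* ray_dir al))"
  by (rule fi) (use rd in \<open>auto simp: m_def\<close>)
 have i2: "sint {0..} (%u. 1* f (of_real 0 + of_real u*1))"
  by (rule fi) (use m in auto)
 have "(LBINT u:{0..}. ray_dir al* f (of_real 0 + of_real u* ray_dir al))+F (of_real 0)
   = (LBINT u:{0..}. 1* f (of_real 0 + of_real u*1))+F (of_real 0)"
 proof (rule ray_deformation[OF F fc _ _ _ _ i1 i2, where b = "%R. (1+R)^4* exp (- (m* R))"])
  show "eventually (%R. \<forall>z\<in>closed_segment (of_real 0 + of_real R* ray_dir al) (of_real 0 + of_real R*1).
    norm (f z) <= (1+R)^4* exp (- (m* R))) at_top"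
   using eventually_ge_at_top[of 0]
  proof eventually_elim
   case (elim R)
   show ?case
   proof
    fix z assume "z \<in> closed_segment (of_real 0 + of_real R* ray_dir al) (of_real 0 + of_real R*1)"
    hence "\<exists>u. 0 <= u & u <= 1 & z = (1-u) *\<^sub>R (of_real 0 + of_real R* ray_dir al)+u *\<^sub>R (of_real 0 + of_real R*1)"
     by (simp only: in_segment)
    then obtain u where u: "0 <= u" "u <= 1" "z = (1-u) *\<^sub>R (of_real 0 + of_real R* ray_dir al)+u *\<^sub>R (of_real 0 + of_real R*1)"
     by (elim exE conjE)
    show "norm (f z) <= (1+R)^4* exp (- (m* R))"
    proof (rule fb)
     have "norm z <= (1-u)* R+u* R"
      unfolding u(3) using norm_triangle_ineq[of "(1-u) *\<^sub>R (of_real 0 + of_real R* ray_dir al)" "u *\<^sub>R (of_real 0 + of_real R*1)"] u elim rd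
      by (simp add: norm_mult)
     thus "norm z <= R" by (simp add: algebra_simps)
     have "u* R* m <= u* R*1" using u elim m by (intro mult_left_mono) auto
     hence "m* R <= (1-u)* R* m+u* R" by (simp add: algebra_simps)
     thus "m* R <= Re z" unfolding u(3) by (simp add: m_def mult.assoc)
    qed (rule elim)
   qed
  qed
  define n where "n = norm (1-ray_dir al)"
  have "((%R. (1+R)^4* exp (- (m* R))*(0+R* n)) ---> 0) at_top" using m(1) by real_asymp
  thus "((%R. (1+R)^4* exp (- (m* R))*(norm (of_real 0 - of_real 0 :: complex)+R* norm (1-ray_dir al))) ---> 0) at_top"
   by (simp add: n_def)
 qed (use rd in auto)
 thus ?g2
  unfolding f_def by simp
 show ?g1
  using i1 unfolding f_def by simp
qed

lemma Gamma_set_integral: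
 fixes s :: real
 assumes "0 < s" shows "(LBINT u:{0..}. u powr (s-1)* exp (- u)) = Gamma s"
proof -
 have h: "((%u. u powr (s-1)/exp u) has_integral Gamma s) {0..}" by (rule Gamma_integral_real[OF assms])
 have "integral\<^sup>L lborel (%u. indicator {0..} u*(u powr (s-1)/exp u)) = Gamma s"
 proof (rule integral_eq_nn_integral[THEN trans])
  show "enn2real (\<integral>\<^sup>+u. ennreal (indicator {0..} u*(u powr (s-1)/exp u)) \<partial>lborel) = Gamma s"
   using nn_integral_has_integral_lebesgue[OF _ h] Gamma_conv_nn_integral_real[OF assms] Gamma_real_pos[OF assms]
   by (simp add: nn_integral_completion)
 qed auto
 thus ?thesis by (simp add: slint_def exp_minus divide_inverse)
qed

text \<open>Both values are factorials, 0! = 1! = 1.\<close>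

lemma exp_ray_power:
 assumes al: "1 < al" and k: "k <= (1::nat)"
 shows "sint {0..} (%u. ray_dir al*((of_real u* ray_dir al)^k* exp (- (of_real u* ray_dir al))))" (is ?g1)
  "(LBINT u:{0..}. ray_dir al*((of_real u* ray_dir al)^k* exp (- (of_real u* ray_dir al)))) = 1" (is ?g2)
proof -
 have a: "continuous_on {z. 0 <= Re z} (%z. z^k)" by (intro continuous_intros)
 have b: "(%z. z^k) field_differentiable at z" for z :: complex
  by (auto simp: field_differentiable_def intro!: derivative_eq_intros)
 have c: "norm (z^k) <= (1+norm z)^4" for z :: complex
 proof -
  have "norm z^k <= (1+norm z)^k" by (intro power_mono) auto
  also have "... <= (1+norm z)^4" using k by (intro power_increasing) auto
  finally show ?thesis by (simp add: norm_power)
 qed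
 show ?g1
  by (rule exp_ray_rotate(1)[OF al a b c])
 have "(LBINT u:{0..}. ray_dir al*((of_real u* ray_dir al)^k* exp (- (of_real u* ray_dir al))))
   = (LBINT u:{0..}. complex_of_real u^k* exp (- of_real u))"
  by (rule exp_ray_rotate(2)[OF al a b c])
 also have "... = (LBINT u:{0..}. complex_of_real (u^k* exp (- u)))"
  by (simp add: exp_of_real[symmetric])
 also have "... = complex_of_real (LBINT u:{0..}. u^k* exp (- u))"
  by (rule set_integral_complex_of_real)
 also have "(LBINT u:{0..}. u^k* exp (- u)) = (LBINT u:{0..}. u powr (real (Suc k)-1)* exp (- u))"
  unfolding slint_def
 proof (rule integral_cong_AE)
  show "AE u in lborel. indicator {0..} u *\<^sub>R (u^k* exp (- u)) = indicator {0..} u *\<^sub>R (u powr (real (Suc k)-1)* exp (- u))"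
   using AE_lborel_singleton[of "0::real"] by eventually_elim (auto simp: indicator_def powr_realpow)
 qed measurable
 also have "... = 1" using Gamma_set_integral[of "real (Suc k)"] k by (cases k) (auto simp: Gamma_numeral)
 finally show ?g2 by simp
qed

text \<open>Under r = u/x, x^(k+1) times the ray integral becomes an integral with the factor exp (-
  u d) and the weight taken at u/x. For weight 1 its value is 1, and the first correction of the
  weight is - (u/x)^(1+al)/(1+al).\<close>

lemma Hray_tail_expansion:
 assumes al: "1 < al" "al <= 2" and k: "k <= (1::nat)"
 shows "((%x. (of_real (x^Suc k)* Hray al k (of_real x)-1)* of_real (x powr (1+al))) --->
   (LBINT u:{0..}. ray_dir al*((of_real u* ray_dir al)^k* exp (- (of_real u* ray_dir al)))* of_real (- (u powr (1+al)/(1+al))))) at_top"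
proof -
 let ?d = "ray_dir al"
 note rd = ray_dir_facts[OF al(1)]
 define g where "g = (%u. ?d*((of_real u*?d)^k* exp (- (of_real u*?d))))"
 have gi: "sint {0..} g" unfolding g_def by (rule exp_ray_power(1)[OF al(1) k])
 have gm[measurable]: "g \<in> borel_measurable borel" unfolding g_def by measurable
 define h where "h = (%x u. (ray_weight al (u/x)-1)* x powr (1+al))"
 have hb: "\<bar>h x u\<bar> <= u powr (1+al)/(1+al)" if "0 < x" "0 <= u" for x u
 proof -
  have t: "0 <= (u/x) powr (1+al)/(1+al)" using al by simp
  have "\<bar>ray_weight al (u/x)-1\<bar> <= (u/x) powr (1+al)/(1+al)"
   using t exp_ge_add_one_self[of "- ((u/x) powr (1+al)/(1+al))"] by (simp add: ray_weight_def)
  hence "\<bar>h x u\<bar> <= (u/x) powr (1+al)/(1+al)* x powr (1+al)"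
   unfolding h_def abs_mult using that by (intro mult_mono) auto
  also have "... = u powr (1+al)/(1+al)" using that by (simp add: powr_divide)
  finally show ?thesis .
 qed
 have "((%x. \<integral>u. indicator {0..} u *\<^sub>R (g u* of_real (h (max 1 x) u)) \<partial>lborel) --->
   (LINT u|lborel. indicator {0..} u *\<^sub>R (g u* of_real (- (u powr (1+al)/(1+al)))))) at_top"
 proof (rule integral_dominated_convergence_at_top[where w = "%u. indicator {0..} u *\<^sub>R ((1+u)^4* exp (- (Re ?d* u)))"])
  show "(%u. indicator {0..} u *\<^sub>R (g u* of_real (h (max 1 x) u))) \<in> borel_measurable lborel" for x
   unfolding h_def by measurable
  show "integrable lborel (%u. indicator {0..} u *\<^sub>R ((1+u)^4* exp (- (Re ?d* u))))"
   using poly_exp_integrable[OF rd(2)] by (simp add: set_integrable_def)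
  show "\<forall>\<^sub>F x in at_top. AE u in lborel. norm (indicator {0..} u *\<^sub>R (g u* of_real (h (max 1 x) u))) <= indicator {0..} u *\<^sub>R ((1+u)^4* exp (- (Re ?d* u)))"
  proof (intro always_eventually allI AE_I2)
   fix x u :: real
   show "norm (indicator {0..} u *\<^sub>R (g u* of_real (h (max 1 x) u))) <= indicator {0..} u *\<^sub>R ((1+u)^4* exp (- (Re ?d* u)))"
   proof (cases "0 <= u")
    case u: True
    have "norm (g u) = u^k* exp (- (Re ?d* u))"
     unfolding g_def norm_mult norm_power norm_exp_eq_Re using rd u by (simp add: mult.commute)
    moreover have "u^k <= 1+u" using k u by (cases k) auto
    moreover have "\<bar>h (max 1 x) u\<bar> <= (1+u)^3"
    proof -
     have "\<bar>h (max 1 x) u\<bar> <= u powr (1+al)/(1+al)" by (rule hb) (use u in auto)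
     also have "... <= u powr (1+al)/1" using al by (intro divide_left_mono) auto
     also have "... = u powr (1+al)" by simp
     also have "... <= (1+u) powr (1+al)" using u al by (intro powr_mono2) auto
     also have "... <= (1+u) powr (real 3)" using u al by (intro powr_mono) auto
     also have "... = (1+u)^3" using u by (intro powr_realpow) auto
     finally show ?thesis .
    qed
    ultimately have "norm (g u)*\<bar>h (max 1 x) u\<bar> <= ((1+u)* exp (- (Re ?d* u)))*(1+u)^3"
     by (intro mult_mono) (use u in auto)
    also have "... = (1+u)^4* exp (- (Re ?d* u))" by (simp add: numeral_eq_Suc mult_ac)
    finally show ?thesis using u by (simp add: norm_mult)
   qed simp
  qed
  show "AE u in lborel. ((%x. indicator {0..} u *\<^sub>R (g u* of_real (h (max 1 x) u))) ---> indicator {0..} u *\<^sub>R (g u* of_real (- (u powr (1+al)/(1+al))))) at_top"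
  proof (rule AE_I2)
   fix u :: real
   show "((%x. indicator {0..} u *\<^sub>R (g u* of_real (h (max 1 x) u))) ---> indicator {0..} u *\<^sub>R (g u* of_real (- (u powr (1+al)/(1+al))))) at_top"
   proof (cases "0 <= u")
    case u: True
    define p where "p = u powr (1+al)/(1+al)"
    have p: "0 <= p" using al by (simp add: p_def)
    have "((%x. (exp (- (p* x powr (- (1+al))))-1)* x powr (1+al)) --->-p) at_top"
    proof (cases "p = 0")
     case False
     with p have "0 < p" by simp
     thus ?thesis using al by real_asymp
    qed simp
    moreover have "eventually (%x. (exp (- (p* x powr (- (1+al))))-1)* x powr (1+al) = h (max 1 x) u) at_top"
     using eventually_ge_at_top[of 1]
    proof eventually_elim
     case (elim x)
     hence "max 1 x = x" by simp
     moreover have "(u/x) powr (1+al)/(1+al) = p* x powr (- (1+al))"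
     proof -
      have "(u/x) powr (1+al) = u powr (1+al)/x powr (1+al)" by (rule powr_divide)
      thus ?thesis unfolding powr_minus p_def by (simp only: divide_inverse mult.assoc mult.commute mult.left_commute)
     qed
     ultimately show ?case by (simp add: h_def ray_weight_def)
    qed
    ultimately have "((%x. h (max 1 x) u) --->-p) at_top" by (rule Lim_transform_eventually)
    thus ?thesis unfolding p_def by (intro tendsto_intros)
   qed simp
  qed
 qed measurable
 moreover have "eventually (%x. (LINT u|lborel. indicator {0..} u *\<^sub>R (g u* of_real (h (max 1 x) u)))
   = (of_real (x^Suc k)* Hray al k (of_real x)-1)* of_real (x powr (1+al))) at_top"
  using eventually_ge_at_top[of 1]
 proof eventually_elim
  case (elim x)
  hence mx: "max 1 x = x" and x: "0 < x" by auto
  have "Hray al k (of_real x) = (1/x) *\<^sub>R (LBINT u:{0..}. ?d*((of_real (1/x* u)*?d)^k* exp (- (of_real (1/x* u)*?d* of_real x))* of_real (ray_weight al (1/x* u))))"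
   unfolding Hray_def by (rule set_integral_half_line_scale) (use x in simp)
  also have "(LBINT u:{0..}. ?d*((of_real (1/x* u)*?d)^k* exp (- (of_real (1/x* u)*?d* of_real x))* of_real (ray_weight al (1/x* u))))
    = (LBINT u:{0..}. of_real ((1/x)^k)*(g u* of_real (ray_weight al (u/x))))"
  proof (rule set_lebesgue_integral_cong)
   show "\<forall>u. u \<in> {0..} --> ?d*((of_real (1/x* u)*?d)^k* exp (- (of_real (1/x* u)*?d* of_real x))* of_real (ray_weight al (1/x* u)))
     = of_real ((1/x)^k)*(g u* of_real (ray_weight al (u/x)))"
   proof (intro allI impI)
    fix u
    have "of_real (1/x* u)*?d* of_real x = of_real u*?d" using x by simp
    moreover have "(of_real (1/x* u)*?d)^k = of_real ((1/x)^k)*(of_real u*?d)^k"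
     unfolding of_real_power power_mult_distrib[symmetric] by simp
    ultimately show "?d*((of_real (1/x* u)*?d)^k* exp (- (of_real (1/x* u)*?d* of_real x))* of_real (ray_weight al (1/x* u)))
     = of_real ((1/x)^k)*(g u* of_real (ray_weight al (u/x)))"
     by (simp add: g_def mult_ac)
   qed
  qed simp
  also have "... = of_real ((1/x)^k)*(LBINT u:{0..}. g u* of_real (ray_weight al (u/x)))"
   by (rule set_integral_mult_right)
  finally have H: "of_real (x^Suc k)* Hray al k (of_real x) = (LBINT u:{0..}. g u* of_real (ray_weight al (u/x)))"
   using x by (simp add: scaleR_conv_of_real field_simps)
  have wi: "sint {0..} (%u. g u* of_real (ray_weight al (u/x)))"
  proof (rule set_integrable_bound[OF gi])
   show "set_borel_measurable lborel {0..} (%u. g u* of_real (ray_weight al (u/x)))"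
    unfolding set_borel_measurable_def by measurable
   show "AE u in lborel. u \<in> {0..} --> norm (g u* of_real (ray_weight al (u/x))) <= norm (g u)"
    using al by (auto simp: norm_mult ray_weight_def intro!: mult_left_le)
  qed
  have "(LBINT u:{0..}. g u* of_real (ray_weight al (u/x)))-1 = (LBINT u:{0..}. g u* of_real (ray_weight al (u/x))-g u)"
   using set_integral_diff(2)[OF wi gi] exp_ray_power(2)[OF al(1) k] by (simp add: g_def)
  hence "((LBINT u:{0..}. g u* of_real (ray_weight al (u/x)))-1)* of_real (x powr (1+al))
    = (LBINT u:{0..}. (g u* of_real (ray_weight al (u/x))-g u)* of_real (x powr (1+al)))"
   by (simp only: set_integral_mult_left)
  also have "... = (LBINT u:{0..}. g u* of_real (h x u))"
   by (rule set_lebesgue_integral_cong) (auto simp: h_def algebra_simps)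
  finally show ?case unfolding H mx slint_def by simp
 qed
 ultimately show ?thesis unfolding slint_def g_def by (rule Lim_transform_eventually)
qed

text \<open>On the ray - u^(1+al) is (u d)^(1+al), so the integrand is analytic in u d and can be
  rotated to the positive axis, where it is a Gamma integral.\<close>

lemma Hray_0_tail_constant:
 assumes al: "1 < al" "al <= 2"
 shows "(LBINT u:{0..}. ray_dir al*((of_real u* ray_dir al)^0* exp (- (of_real u* ray_dir al)))* of_real (- (u powr (1+al)/(1+al))))
   = of_real (Gamma (2+al)/(1+al))"
proof -
 let ?d = "ray_dir al"
 have a: "continuous_on {z. 0 <= Re z} (%z. z powr of_real (1+al))"
  by (rule continuous_on_powr_halfplane) (use al in simp)
 have b: "(%z. z powr of_real (1+al)) field_differentiable at z" if "0 < Re z" for z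
  by (rule differentiable_powr_halfplane[OF that])
 have c: "norm (z powr of_real (1+al)) <= (1+norm z)^4" for z :: complex
 proof -
  have "norm z powr (1+al) <= (1+norm z) powr (1+al)" using al by (intro powr_mono2) auto
  also have "... <= (1+norm z) powr (real 4)" using al by (intro powr_mono) auto
  also have "... = (1+norm z)^4" by (intro powr_realpow) (auto intro: add_pos_nonneg)
  finally show ?thesis by (simp only: norm_powr_of_real)
 qed
 have "(LBINT u:{0..}. ?d*((of_real u*?d)^0* exp (- (of_real u*?d)))* of_real (- (u powr (1+al)/(1+al))))
   = (LBINT u:{0..}. of_real (1/(1+al))*(?d*((of_real u*?d) powr of_real (1+al)* exp (- (of_real u*?d)))))"
  by (rule set_lebesgue_integral_cong) (auto simp: ray_dir_powr[OF al(1)] simp del: of_real_add)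
 also have "... = of_real (1/(1+al))*(LBINT u:{0..}. ?d*((of_real u*?d) powr of_real (1+al)* exp (- (of_real u*?d))))"
  by (rule set_integral_mult_right)
 also have "(LBINT u:{0..}. ?d*((of_real u*?d) powr of_real (1+al)* exp (- (of_real u*?d))))
   = (LBINT u:{0..}. complex_of_real u powr of_real (1+al)* exp (- of_real u))"
  by (rule exp_ray_rotate(2)[OF al(1) a b c])
 also have "... = (LBINT u:{0..}. complex_of_real (u powr ((2+al)-1)* exp (- u)))"
  by (rule set_lebesgue_integral_cong) (auto simp: powr_of_real exp_of_real[symmetric] simp del: of_real_add)
 also have "... = complex_of_real (Gamma (2+al))"
  unfolding set_integral_complex_of_real using Gamma_set_integral[of "2+al"] al by simp
 finally show ?thesis by simp
qed

text \<open>The second part expands - Phi'/Phi. The quotient is z0 (1 + E 1 / E 0) with z0 =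
  x^(1/al), and E 1 / E 0 is (al-1)/(2 al) times 1 / La up to O(1 / La^2), where 1 / La =
  x^(-1-1/al).\<close>

lemma Phi_eventually_pos:
 assumes al: "1 < al" "al <= 2" shows "eventually (%x. 0 < Im (Hray al 0 (of_real x))) at_top" (is ?g1)
  and "\<exists>K. eventually (%x. \<bar>Im (Hray al 1 (of_real x))/Im (Hray al 0 (of_real x))/x powr (1/al)
    - 1-(al-1)/(2* al)* x powr (- 1-1/al)\<bar> <= K*(x powr (- 1-1/al))\<^sup>2) at_top" (is ?g2)
proof -
 define La where "La = (%x::real. (x powr (1/al)) powr (1+al))"
 have La: "La x = x powr (1+1/al)" for x using al by (simp add: La_def powr_powr field_simps)
 have Ltop: "filterlim La at_top at_top"
 proof -
  define b where "b = 1+1/al"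
  have "0 < b" using al by (simp add: b_def add_pos_pos)
  hence "filterlim (%x::real. x powr b) at_top at_top" by real_asymp
  moreover have "La = (%x. x powr b)" by (simp add: La fun_eq_iff b_def)
  ultimately show ?thesis by simp
 qed
 obtain c where c: "0 < c" "((%La. sqrt La* Im (saddle_integral al 0 La)) ---> c) at_top"
  using saddle_integral_leading[OF al] by blast
 obtain C where C: "!!La. 1 <= La ==> \<bar>al\<^sup>2* Im (saddle_integral al 1 La)-al*(al-1)/2*(1/sqrt La)\<^sup>2* Im (saddle_integral al 0 La)\<bar>
   <= C*(1/sqrt La)^5" using saddle_integral_expansion[OF al] by blast
 have "eventually (%La. c/2 < sqrt La* Im (saddle_integral al 0 La)) at_top"
  using order_tendstoD(1)[OF c(2), of "c/2"] c(1) by simp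
 hence ev: "eventually (%x. c/2 < sqrt (La x)* Im (saddle_integral al 0 (La x))) at_top"
  using Ltop by (rule eventually_compose_filterlim)
 have ev1: "eventually (%x. 1 <= La x) at_top" using Ltop by (simp add: filterlim_at_top)
 have both: "eventually (%x. 0 < x & 1 <= La x & c/2 < sqrt (La x)* Im (saddle_integral al 0 (La x))) at_top"
  using ev ev1 eventually_gt_at_top[of 0] by eventually_elim blast
 have P: "Im (Hray al 0 (of_real x)) = x powr (1/al)* exp (- (La x* al/(1+al)))* Im (saddle_integral al 0 (La x))"
  "Im (Hray al 1 (of_real x)) = (x powr (1/al))\<^sup>2* exp (- (La x* al/(1+al)))*(Im (saddle_integral al 0 (La x))+Im (saddle_integral al 1 (La x)))"
  if "0 < x" "1 <= La x" for x
 proof -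
  have L0: "0 < La x" using that by simp
  show "Im (Hray al 0 (of_real x)) = x powr (1/al)* exp (- (La x* al/(1+al)))* Im (saddle_integral al 0 (La x))"
   by (rule Phi_via_saddle(1)[OF al(1) that(1) refl _ saddle_power(1)[OF al L0]]) (simp add: La_def)
  show "Im (Hray al 1 (of_real x)) = (x powr (1/al))\<^sup>2* exp (- (La x* al/(1+al)))*(Im (saddle_integral al 0 (La x))+Im (saddle_integral al 1 (La x)))"
   by (rule Phi_via_saddle(2)[OF al(1) that(1) refl _ saddle_power(1)[OF al L0]]) (simp add: La_def)
 qed
 have E0: "0 < Im (saddle_integral al 0 (La x))" if "1 <= La x" "c/2 < sqrt (La x)* Im (saddle_integral al 0 (La x))" for x
 proof -
  have "0 < sqrt (La x)* Im (saddle_integral al 0 (La x))" using that c(1) by linarith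
  thus ?thesis using that(1) by (simp add: zero_less_mult_iff)
 qed
 show ?g1
  using both by eventually_elim (use P(1) E0 in auto)
 show ?g2
 proof (intro exI[of _ "2*\<bar>C\<bar>/c"])
  show "eventually (%x. \<bar>Im (Hray al 1 (of_real x))/Im (Hray al 0 (of_real x))/x powr (1/al)
    - 1-(al-1)/(2* al)* x powr (- 1-1/al)\<bar> <= (2*\<bar>C\<bar>/c)*(x powr (- 1-1/al))\<^sup>2) at_top"
   using both
  proof eventually_elim
   case (elim x)
   define E e where "E = (%k. Im (saddle_integral al k (La x)))" and "e = 1/sqrt (La x)"
   have e: "0 < e" using elim by (simp add: e_def)
   have E0': "0 < E 0" unfolding E_def by (rule E0) (use elim in auto)
   have Ec: "c/2* e < E 0" using elim unfolding E_def e_def by (simp add: field_simps)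
   have e2: "e\<^sup>2 = x powr (- 1-1/al)"
   proof -
    have "e\<^sup>2 = 1/La x" using elim by (simp add: e_def power_divide)
    also have "... = x powr (- (1+1/al))" unfolding La powr_minus by (simp add: divide_inverse)
    finally show ?thesis by simp
   qed
   have q: "Im (Hray al 1 (of_real x))/Im (Hray al 0 (of_real x))/x powr (1/al) = 1+E 1/E 0"
   proof -
    have "exp (- (La x* al/(1+al))) ~= 0" "x powr (1/al) ~= 0" using elim by simp_all
    moreover have "p\<^sup>2* w*(E 0+E 1)/(p* w* E 0)/p = 1+E 1/E 0" if "w ~= 0" "p ~= 0" for w p
     using that E0' by (simp add: field_simps power2_eq_square)
    ultimately show ?thesis using elim by (simp only: P) (simp only: E_def)
   qed
   have "\<bar>al\<^sup>2* E 1-al*(al-1)/2* e^2* E 0\<bar> <= C* e^5"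
    unfolding E_def e_def by (rule C) (use elim in auto)
   also have "... <= \<bar>C\<bar>* e^5" using e by (intro mult_right_mono) auto
   finally have b: "\<bar>al\<^sup>2* E 1-al*(al-1)/2* e^2* E 0\<bar> <= \<bar>C\<bar>* e^5" .
   have "\<bar>E 1/E 0-(al-1)/(2* al)* e^2\<bar> = \<bar>al\<^sup>2* E 1-al*(al-1)/2* e^2* E 0\<bar>/(al^2* E 0)"
   proof -
    have "E 1/E 0-(al-1)/(2* al)* e^2 = (al^2* E 1-al*(al-1)/2* e^2* E 0)/(al^2* E 0)"
     using E0' al by (simp add: field_simps power2_eq_square)
    thus ?thesis using E0' al by (simp add: abs_mult)
   qed
   also have "... <= (\<bar>C\<bar>* e^5)/(1*(c/2* e))"
   proof (rule frac_le[OF _ b])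
    have "1 <= al^2" using al by (simp add: power2_eq_square) (smt (verit) mult_less_cancel_right1)
    thus "1*(c/2* e) <= al^2* E 0" using Ec c(1) e by (intro mult_mono) auto
   qed (use c(1) e in auto)
   also have "... = (2*\<bar>C\<bar>/c)*(e^2)\<^sup>2"
    using e c(1) by (simp add: field_simps numeral_eq_Suc)
   finally show ?case unfolding q e2[symmetric] by simp
  qed
 qed
qed

section \<open>The Wronskian quotient at infinity\<close>

text \<open>It is pi times the Wronskian quotient (\<open>laplace_rhs_eq\<close>), written with the
  ray integrals, whose asymptotics are at hand.\<close>

definition laplace_rhs :: "real => real => real" where
 "laplace_rhs al x = - Re (Hray al 1 (of_real x))+Im (Hray al 1 (of_real x))/Im (Hray al 0 (of_real x))* Re (Hray al 0 (of_real x))"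

text \<open>The product of the leading terms is x^(1/al-1). At order x^(-2), the coefficient -1
  comes from \<open>Hray al 1\<close> and c = (al-1)/(2 al) from the saddle correction, in total -
  (al+1)/(2 al), the source of the mean. The term of order x^(1/al-2-al) comes from the first
  correction of the ray weight and is the source of the tail.\<close>

lemma laplace_rhs_expansion:
 assumes al: "1 < al" "al <= 2"
 shows "((%x. x\<^sup>2*(x powr (1/al-1)-laplace_rhs al x)) ---> (al+1)/(2* al)) at_top" (is ?g1)
  "al < 2 ==> ((%x. x powr (al+2-1/al)*(laplace_rhs al x-x powr (1/al-1)+(al+1)/(2* al)* x powr (- 2)))
    ---> Gamma (2+al)/(1+al)) at_top"
proof -
 define A where "A = (%x. (x* Re (Hray al 0 (of_real x))-1)* x powr (1+al))"
 define B where "B = (%x. (x^2* Re (Hray al 1 (of_real x))-1)* x powr (1+al))"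
 define q where "q = (%x. Im (Hray al 1 (of_real x))/Im (Hray al 0 (of_real x))/x powr (1/al))"
 define c where "c = (al-1)/(2* al)"
 define r where "r = (%x. q x-1-c* x powr (- 1-1/al))"
 have Alim: "(A ---> Gamma (2+al)/(1+al)) at_top"
  using tendsto_Re[OF Hray_tail_expansion[OF al, of 0]] unfolding Hray_0_tail_constant[OF al]
  by (simp add: A_def)
 obtain B0 where Blim: "(B ---> B0) at_top"
  using tendsto_Re[OF Hray_tail_expansion[OF al, of 1]] by (simp add: B_def numeral_2_eq_2)
 obtain K where K: "eventually (%x. \<bar>r x\<bar> <= K*(x powr (- 1-1/al))\<^sup>2) at_top"
  using Phi_eventually_pos(2)[OF al] unfolding r_def q_def c_def by blast
 have rsmall: "((%x. r x* x powr bet) ---> 0) at_top" if "bet < 2+2/al" for bet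
 proof (rule Lim_null_comparison)
  show "eventually (%x. norm (r x* x powr bet) <= K* x powr (bet-(2+2/al))) at_top"
   using K eventually_gt_at_top[of 0]
  proof eventually_elim
   case (elim x)
   have "\<bar>r x\<bar>* x powr bet <= K*(x powr (- 1-1/al))\<^sup>2* x powr bet" using elim by (intro mult_right_mono) auto
   also have "(x powr (- 1-1/al))\<^sup>2 = x powr (- (2+2/al))"
    by (simp add: power2_eq_square powr_add[symmetric])
   also have "K* x powr (- (2+2/al))* x powr bet = K* x powr (bet-(2+2/al))"
    by (simp add: mult.assoc powr_collect[of _ _ "bet-(2+2/al)"])
   finally show ?case by (simp add: abs_mult)
  qed
  have "((%x. x powr (bet-(2+2/al))) ---> 0) at_top"
   by (rule tendsto_neg_powr) (use that in \<open>auto intro: filterlim_ident\<close>)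
  from tendsto_mult[OF tendsto_const[of K] this] show "((%x. K* x powr (bet-(2+2/al))) ---> 0) at_top" by simp
 qed
 have neg: "((%x::real. x powr (- bet)) ---> 0) at_top" if "0 < bet" for bet
  by (rule tendsto_neg_powr) (use that in \<open>auto intro: filterlim_ident\<close>)
 have qlim: "(q ---> 1) at_top"
 proof -
  have "((%x. r x* x powr 0) ---> 0) at_top" by (rule rsmall) (use al in \<open>auto intro: add_pos_pos\<close>)
  hence "((%x. r x* x powr 0+1+c* x powr (- (1+1/al))) ---> 0+1+c*0) at_top"
   by (intro tendsto_add tendsto_mult tendsto_const neg) (use al in \<open>auto intro: add_pos_pos\<close>)
  moreover have "eventually (%x. r x* x powr 0+1+c* x powr (- (1+1/al)) = q x) at_top"
   using eventually_gt_at_top[of 0] by eventually_elim (simp add: r_def)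
  ultimately show ?thesis by (simp add: Lim_transform_eventually)
 qed
 \<comment> \<open>An exact identity: A, B, q and r only name the errors, so both limits are read
   off from it.\<close>
 have key: "laplace_rhs al x-x powr (1/al-1)+(1-c)* x powr (- 2)
   = - B x* x powr (- al-3)+x powr (1/al-1)*(A x* q x* x powr (- 1-al)+r x)" if x: "0 < x" for x
 proof -
  have 1: "Re (Hray al 0 (of_real x)) = x powr (- 1)*(1+A x* x powr (- 1-al))"
  proof -
   have "A x* x powr (- 1-al) = (x* Re (Hray al 0 (of_real x))-1)*(x powr (1+al)* x powr (- 1-al))"
    by (simp add: A_def)
   also have "x powr (1+al)* x powr (- 1-al) = 1" using x by (simp add: powr_add[symmetric])
   finally show ?thesis using x by (simp add: powr_minus divide_inverse)
  qed
  have 2: "Re (Hray al 1 (of_real x)) = x powr (- 2)*(1+B x* x powr (- 1-al))"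
  proof -
   have "B x* x powr (- 1-al) = (x^2* Re (Hray al 1 (of_real x))-1)*(x powr (1+al)* x powr (- 1-al))"
    by (simp add: B_def)
   also have "x powr (1+al)* x powr (- 1-al) = 1" using x by (simp add: powr_add[symmetric])
   finally show ?thesis using x by (simp add: powr_minus powr_numeral field_simps)
  qed
  have 3: "Im (Hray al 1 (of_real x))/Im (Hray al 0 (of_real x)) = x powr (1/al)* q x"
   using x by (simp add: q_def)
  have 4: "q x = 1+c* x powr (- 1-1/al)+r x" by (simp add: r_def)
  have p1: "x powr (- 2)* x powr (- 1-al) = x powr (- al-3)" by (rule powr_collect) simp
  have p2: "x powr (1/al)* x powr (- 1) = x powr (1/al-1)" by (rule powr_collect) simp
  have p3: "x powr (1/al-1)* x powr (- 1-1/al) = x powr (- 2)" by (rule powr_collect) simp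
  have "laplace_rhs al x = - (x powr (- 2)*(1+B x* x powr (- 1-al)))+(x powr (1/al)* q x)*(x powr (- 1)*(1+A x* x powr (- 1-al)))"
   unfolding laplace_rhs_def 1 2 3 ..
  also have "... = - (x powr (- 2))-B x*(x powr (- 2)* x powr (- 1-al))+(x powr (1/al)* x powr (- 1))*(q x+A x* q x* x powr (- 1-al))"
   by (simp add: algebra_simps)
  also have "... = - (x powr (- 2))-B x* x powr (- al-3)+x powr (1/al-1)*(1+c* x powr (- 1-1/al)+r x+A x* q x* x powr (- 1-al))"
   unfolding p1 p2 by (subst 4) simp
  also have "... = - (x powr (- 2))-B x* x powr (- al-3)+x powr (1/al-1)+c*(x powr (1/al-1)* x powr (- 1-1/al))+x powr (1/al-1)*(A x* q x* x powr (- 1-al)+r x)"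
   by (simp add: algebra_simps)
  finally show ?thesis unfolding p3 by (simp add: algebra_simps)
 qed
 have c1: "1-c = (al+1)/(2* al)" using al by (simp add: c_def field_simps)
 have al1: "1/al < 1" using al by simp
 have aa: "1 < al* al" using al by (intro less_1_mult) auto
 have "((%x. - (- B x* x powr (- (al+1))+(A x* q x* x powr (- (al-1/al))+r x* x powr (1/al+1)))+(1-c))
   --->-(- B0*0+(Gamma (2+al)/(1+al)*1*0+0))+(1-c)) at_top"
  by (intro tendsto_add tendsto_minus tendsto_mult Alim Blim qlim neg rsmall tendsto_const)
   (use al al1 aa in \<open>auto simp: field_simps intro: add_pos_pos\<close>)
 moreover have "eventually (%x. - (- B x* x powr (- (al+1))+(A x* q x* x powr (- (al-1/al))+r x* x powr (1/al+1)))+(1-c)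
    = x^2*(x powr (1/al-1)-laplace_rhs al x)) at_top"
  using eventually_gt_at_top[of 0]
 proof eventually_elim
  case (elim x)
  have x2: "x\<^sup>2 = x powr 2" using elim by (simp add: powr_numeral)
  have p0: "x powr 2* x powr (- 2) = 1" using elim powr_collect[of 2 "- 2" 0 x] by simp
  have p: "x powr 2* x powr (- al-3) = x powr (- (al+1))"
   "x powr 2* x powr (1/al-1) = x powr (1/al+1)" "x powr (1/al+1)* x powr (- 1-al) = x powr (- (al-1/al))"
   by ((rule powr_collect, simp)+)
  have eq: "x powr (1/al-1)-laplace_rhs al x = (1-c)* x powr (- 2)-(- B x* x powr (- al-3)+x powr (1/al-1)*(A x* q x* x powr (- 1-al)+r x))"
   using key[OF elim] by linarith
  have "x\<^sup>2*(x powr (1/al-1)-laplace_rhs al x) = (1-c)*(x powr 2* x powr (- 2))-(- B x*(x powr 2* x powr (- al-3))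
    + (A x* q x*((x powr 2* x powr (1/al-1))* x powr (- 1-al))+r x*(x powr 2* x powr (1/al-1))))"
   unfolding x2 eq by (simp add: algebra_simps)
  thus ?case unfolding p p0 by simp
 qed
 ultimately show ?g1
  unfolding c1 by (simp add: Lim_transform_eventually)
 assume a2: "al < 2"
 \<comment> \<open>Here \<open>al < 2\<close> enters: at al = 2 the saddle remainder, of relative
   order x^(-2-2/al), could be as large as the Gamma term, of relative order x^(-1-al).\<close>
 have exq: "al+1 < 2+2/al"
 proof -
  have "al* al-al-2 = (al-2)*(al+1)" by (simp add: algebra_simps)
  also have "... < 0" using a2 al by (intro mult_neg_pos) auto
  finally show ?thesis using al by (simp add: field_simps)
 qed
 have "((%x. - B x* x powr (- (1+1/al))+(A x* q x+r x* x powr (al+1)))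
   --->-B0*0+(Gamma (2+al)/(1+al)*1+0)) at_top"
  by (intro tendsto_add tendsto_minus tendsto_mult Alim Blim qlim neg rsmall exq) (use al in \<open>auto intro: add_pos_pos\<close>)
 moreover have "eventually (%x. - B x* x powr (- (1+1/al))+(A x* q x+r x* x powr (al+1))
    = x powr (al+2-1/al)*(laplace_rhs al x-x powr (1/al-1)+(al+1)/(2* al)* x powr (- 2))) at_top"
  using eventually_gt_at_top[of 0]
 proof eventually_elim
  case (elim x)
  have p: "x powr (al+2-1/al)* x powr (- al-3) = x powr (- (1+1/al))"
   "x powr (al+2-1/al)* x powr (1/al-1) = x powr (al+1)"
   by ((rule powr_collect, simp)+)
  have p0: "x powr (al+1)* x powr (- 1-al) = 1"
   using elim powr_collect[of "al+1" "- 1-al" 0 x] by simp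
  have "x powr (al+2-1/al)*(laplace_rhs al x-x powr (1/al-1)+(al+1)/(2* al)* x powr (- 2))
    = - B x*(x powr (al+2-1/al)* x powr (- al-3))+(A x* q x*((x powr (al+2-1/al)* x powr (1/al-1))* x powr (- 1-al))
     + r x*(x powr (al+2-1/al)* x powr (1/al-1)))"
   unfolding c1[symmetric] key[OF elim] by (simp add: algebra_simps)
  thus ?case unfolding p p0 by simp
 qed
 ultimately show "((%x. x powr (al+2-1/al)*(laplace_rhs al x-x powr (1/al-1)+(al+1)/(2* al)* x powr (- 2)))
    ---> Gamma (2+al)/(1+al)) at_top"
  by (simp add: Lim_transform_eventually)
qed

section \<open>Killed random walks and exponential martingales\<close>

definition walk :: "real => (nat => real) => nat => real" where
 "walk y v k = y+(\<Sum>i<k. v i)"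

text \<open>Discretised Feynman-Kac weight with killing at the first negative value: ka = 1 charges
  the area, ka = 0 only the time.\<close>

definition killed :: "real => real => real => (nat => real) => nat => real" where
 "killed dt l ka x k = (if \<forall>j\<le>k. 0 <= x j then exp (- dt*(\<Sum>j<k. l+ka* x j)) else 0)"

text \<open>At most one summand is nonzero, the discount accumulated up to the first negative
  index.\<close>

definition exited :: "real => real => real => (nat => real) => nat => real" where
 "exited dt l ka x n = (\<Sum>j<n. if x (Suc j) < 0 then killed dt l ka x j* exp (- dt*(l+ka* x j)) else 0)"

lemma walk_Suc: "walk y v (Suc k) = walk y v k+v k" by (simp add: walk_def)

lemma killed_nz: "killed dt l ka x k ~= 0 ==> j <= k ==> 0 <= x j"
 by (auto simp: killed_def split: if_splits)

lemma killed_nonneg: "0 <= killed dt l ka x k" by (simp add: killed_def)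

lemma killed_Suc:
 "killed dt l ka x (Suc k) = (if x (Suc k) < 0 then 0 else killed dt l ka x k* exp (- dt*(l+ka* x k)))"
proof -
 have e: "exp (- dt*(\<Sum>j<Suc k. l+ka* x j)) = exp (- dt*(\<Sum>j<k. l+ka* x j))* exp (- dt*(l+ka* x k))"
  by (simp add: exp_add[symmetric] algebra_simps)
 have h: "(\<forall>j\<le>Suc k. 0 <= x j) \<longleftrightarrow> \<not> x (Suc k) < 0 & (\<forall>j\<le>k. 0 <= x j)"
  unfolding le_Suc_eq not_less by blast
 have "(if \<not> Q & P then a* b else 0) = (if Q then 0 else (if P then a else 0)* b)" for P Q and a b :: real by simp
 thus ?thesis unfolding killed_def h e .
qed

lemma killed_cong:
 assumes "!!j. j <= k ==> x j = x' j" shows "killed dt l ka x k = killed dt l ka x' k"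
proof -
 have "(\<Sum>j<k. l+ka* x j) = (\<Sum>j<k. l+ka* x' j)" using assms by (intro sum.cong) auto
 thus ?thesis unfolding killed_def using assms by simp
qed

lemma killed_bound:
 assumes "0 <= dt" "0 <= ka" shows "killed dt l ka x k <= exp (- dt* l* real k)"
proof (cases "\<forall>j\<le>k. 0 <= x j")
 case True
 have "(\<Sum>j<k. l) <= (\<Sum>j<k. l+ka* x j)" using True assms by (intro sum_mono) simp
 hence "dt*(l* real k) <= dt*(\<Sum>j<k. l+ka* x j)"
  using assms by (intro mult_left_mono) (simp_all add: mult.commute)
 thus ?thesis using True by (simp add: killed_def mult.assoc)
next
 case False
 hence "killed dt l ka x k = 0" unfolding killed_def by (rule if_not_P)
 thus ?thesis by simp
qed

lemma exited_nonneg: "0 <= exited dt l ka x n"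
 unfolding exited_def by (intro sum_nonneg) (simp add: killed_nonneg)

lemma exited_Suc: "exited dt l ka x (Suc n) = exited dt l ka x n +
  (if x (Suc n) < 0 then killed dt l ka x n* exp (- dt*(l+ka* x n)) else 0)"
 by (simp add: exited_def)

text \<open>What leaves \<open>killed\<close> by an exit is what \<open>exited\<close> gains;
  discounting can only lose mass, since it acts at nonnegative positions.\<close>

lemma killed_exited_le_1:
 assumes "0 <= dt" "0 <= ka" "0 <= l" shows "killed dt l ka x n+exited dt l ka x n <= 1"
proof (induction n)
 case 0 thus ?case by (simp add: killed_def exited_def)
next
 case (Suc n)
 have "killed dt l ka x (Suc n)+exited dt l ka x (Suc n) = killed dt l ka x n* exp (- dt*(l+ka* x n))+exited dt l ka x n"
  by (simp add: killed_Suc exited_Suc)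
 moreover have "killed dt l ka x n* exp (- dt*(l+ka* x n)) <= killed dt l ka x n*1"
 proof (cases "killed dt l ka x n = 0")
  case False
  hence "0 <= x n" by (rule killed_nz) simp
  thus ?thesis using assms by (intro mult_left_mono) (auto simp: killed_nonneg)
 qed simp
 ultimately show ?case using Suc by simp
qed

lemma exit_undershoot:
 assumes "killed dt l ka x j ~= 0" "x (Suc j) < 0" "j < n" shows "x (Suc j) = - undershoot x n"
proof -
 have "(LEAST k. x k < 0) = Suc j"
  using assms(2) killed_nz[OF assms(1)] by (intro Least_equality) (auto simp: not_less_eq_eq[symmetric] not_less[symmetric])
 moreover have "\<exists>k\<le>n. x k < 0" using assms by (intro exI[of _ "Suc j"]) auto
 ultimately show ?thesis by (simp add: undershoot_def)
qed

lemma undershoot_nonneg: "0 <= undershoot x n" for n :: nat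
proof (cases "\<exists>k\<le>n. x k < 0")
 case True
 then obtain k where "x k < 0" by blast
 hence "x (LEAST k. x k < 0) < 0" by (rule LeastI)
 thus ?thesis using True by (simp add: undershoot_def)
qed (auto simp: undershoot_def)

text \<open>Removes \<open>LEAST\<close>, so that measurability becomes a matter of finite
  sums.\<close>

lemma undershoot_eq_sum:
 "undershoot x n = (\<Sum>j<n. if (\<forall>i\<le>j. 0 <= x i) & x (Suc j) < 0 then-x (Suc j) else 0)+max 0 (- x 0)"
proof (induction n)
 case 0 thus ?case by (auto simp: undershoot_def Least_eq_0 max_def)
next
 case (Suc n)
 have "undershoot x (Suc n) = undershoot x n+(if (\<forall>i\<le>n. 0 <= x i) & x (Suc n) < 0 then-x (Suc n) else 0)"
 proof (cases "\<exists>k\<le>n. x k < 0")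
  case True
  hence "\<not> (\<forall>i\<le>n. 0 <= x i)" "\<exists>k\<le>Suc n. x k < 0" by (auto simp: not_le intro: le_SucI)
  thus ?thesis using True unfolding undershoot_def by simp
 next
  case False
  hence n: "!!i. i <= n ==> 0 <= x i" by (meson not_le)
  show ?thesis
  proof (cases "x (Suc n) < 0")
   case t: True
   have "(LEAST k. x k < 0) = Suc n"
    using t n by (intro Least_equality) (auto simp: not_less_eq_eq[symmetric] not_less[symmetric])
   thus ?thesis using t n False by (auto simp: undershoot_def)
  next
   case f: False
   hence "\<not> (\<exists>k\<le>Suc n. x k < 0)" using n by (metis le_Suc_eq not_less)
   hence "undershoot x (Suc n) = 0" unfolding undershoot_def by (rule if_not_P)
   moreover have "undershoot x n = 0" unfolding undershoot_def using False by (rule if_not_P)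
   ultimately show ?thesis using f by simp
  qed
 qed
 thus ?case using Suc by simp
qed

lemma exited_times_exp:
 "(\<Sum>j<n. of_real (if x (Suc j) < 0 then killed dt l ka x j* exp (- dt*(l+ka* x j)) else 0)* exp (- (s* of_real (x (Suc j)))))
  = of_real (exited dt l ka x n)* exp (s* of_real (undershoot x n))" for s :: complex
proof -
 have "of_real (if x (Suc j) < 0 then killed dt l ka x j* exp (- dt*(l+ka* x j)) else 0)* exp (- (s* of_real (x (Suc j))))
   = of_real (if x (Suc j) < 0 then killed dt l ka x j* exp (- dt*(l+ka* x j)) else 0)* exp (s* of_real (undershoot x n))" if "j < n" for j
  using exit_undershoot[of dt l ka x j n] that by (cases "killed dt l ka x j = 0"; cases "x (Suc j) < 0") auto
 thus ?thesis unfolding exited_def of_real_sum sum_distrib_right by (intro sum.cong) auto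
qed

text \<open>The increments of the process on a grid of mesh dt, reduced to what the martingale
  argument uses: independence and the Laplace transform in the open half plane.\<close>

locale exp_walk = prob_space M for M :: "'a measure" +
 fixes xi :: "nat => 'a => real" and al dt :: real
 assumes indep: "!!n. indep_vars (%_. borel) xi {..<n}"
  and laplace: "!!i s. 0 < Re s ==> integrable M (%om. exp (- (s* of_real (xi i om))))"
   "!!i s. 0 < Re s ==> (LINT om|M. exp (- (s* of_real (xi i om)))) = exp (of_real dt* s powr of_real al)"
  and dt_pos: "0 < dt" and al_pos: "0 < al"
begin

lemma xi_measurable [measurable]: "xi i \<in> borel_measurable M"
 using indep[of "Suc i"] by (auto simp: indep_vars_def)

abbreviation path :: "real => 'a => nat => real" where "path y om \<equiv> walk y (%i. xi i om)"

lemma path_measurable [measurable]: "(%om. path y om k) \<in> borel_measurable M"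
 unfolding walk_def by measurable

lemma killed_measurable [measurable]: "(%om. killed dt l ka (path y om) k) \<in> borel_measurable M"
 unfolding killed_def by measurable

lemma exited_measurable [measurable]: "(%om. exited dt l ka (path y om) k) \<in> borel_measurable M"
 unfolding exited_def by measurable

lemma undershoot_measurable [measurable]: "(%om. undershoot (path y om) n) \<in> borel_measurable M"
 unfolding undershoot_eq_sum by measurable

lemma laplace': 
 assumes "0 < Re s \<or> s = 0"
 shows "integrable M (%om. exp (- (s* of_real (xi i om))))"
  "(LINT om|M. exp (- (s* of_real (xi i om)))) = exp (of_real dt* s powr of_real al)"
 using assms laplace al_pos by (auto simp: prob_space)

lemma killed_exp_bound:
 assumes "0 <= l" "0 <= ka" "0 <= Re s"
 shows "norm (of_real (killed dt l ka x k* exp (- dt*(l+ka* x k)))* exp (- (s* of_real (x k)))) <= 1" (is ?g1)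
  "norm (of_real (killed dt l ka x k)* exp (- (s* of_real (x k)))) <= exp (- dt* l* real k)"
proof -
 have b: "killed dt l ka x k <= exp (- dt* l* real k)" using killed_bound assms dt_pos by simp
 have "exp (- dt* l* real k) <= 1" using assms dt_pos by simp
 hence b1: "killed dt l ka x k <= 1" using b by linarith
 have "norm (of_real (killed dt l ka x k)* exp (- (s* of_real (x k)))) <= exp (- dt* l* real k) &
   norm (of_real (killed dt l ka x k* exp (- dt*(l+ka* x k)))* exp (- (s* of_real (x k)))) <= 1"
 proof (cases "killed dt l ka x k = 0")
  case False
  hence x: "0 <= x k" by (rule killed_nz) simp
  have e: "exp (- (Re s* x k)) <= 1" "exp (- dt*(l+ka* x k)) <= 1" using x assms dt_pos by auto
  have "killed dt l ka x k* exp (- (Re s* x k)) <= exp (- dt* l* real k)*1"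
   using b e killed_nonneg by (intro mult_mono) auto
  moreover have "(killed dt l ka x k* exp (- dt*(l+ka* x k)))* exp (- (Re s* x k)) <= (1*1)*1"
   using b1 e killed_nonneg by (intro mult_mono) auto
  ultimately show ?thesis unfolding norm_mult norm_exp_eq_Re norm_of_real by (simp add: killed_nonneg)
 qed simp
 thus ?g1
  "norm (of_real (killed dt l ka x k)* exp (- (s* of_real (x k)))) <= exp (- dt* l* real k)" by blast+
qed

text \<open>The next increment is independent of the path up to k and is integrated out; the area
  part exp (- dt ka x) of the discount merges into the exponent, which becomes s + dt ka.\<close>

lemma step:
 fixes y :: real and k :: nat and s :: complex
 assumes l: "0 <= l" "0 <= ka" and s: "0 < Re s \<or> s = 0"
 defines "g \<equiv> (%om. of_real (killed dt l ka (path y om) k* exp (- dt*(l+ka* path y om k)))* exp (- (s* of_real (path y om (Suc k)))))"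
 shows "integrable M g"
  "integral\<^sup>L M g = (LINT om|M. of_real (killed dt l ka (path y om) k)*(exp (- ((s + of_real (dt* ka))* of_real (path y om k)))
    * exp (of_real dt*(s powr of_real al - of_real l))))" (is ?g1)
proof -
 have rs: "0 <= Re s" using s by auto
 define F where "F = (%v. of_real (killed dt l ka (walk y v) k* exp (- dt*(l+ka* walk y v k)))* exp (- (s* of_real (walk y v k))))"
 \<comment> \<open>Truncation to the first k coordinates exhibits F as a measurable function on the
   product over {..<k}.\<close>
 define G where "G = (%v i. if i < k then v i else (0::real))"
 have Gr: "G (restrict v {..<k}) = G v" for v by (simp add: G_def fun_eq_iff)
 have "walk y (G v) j = walk y v j" if "j <= k" for v j
  using that by (auto simp: walk_def G_def intro!: sum.cong)
 hence FG: "F (G v) = F v" for v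
  unfolding F_def using killed_cong[of k "walk y (G v)" "walk y v"] by simp
 have Fr: "F (restrict v {..<k}) = F v" for v using FG[of "restrict v {..<k}"] FG[of v] Gr[of v] by simp
 have [measurable]: "(%v. G v i) \<in> borel_measurable (PiM {..<k} (%_. borel))" for i
  unfolding G_def by (cases "i < k") (auto intro: measurable_component_singleton)
 have m1: "(%v. F (G v)) \<in> borel_measurable (PiM {..<k} (%_. borel))"
  unfolding F_def killed_def walk_def by measurable
 have "indep_var (PiM {..<k} (%_. borel)) (%om. restrict (%i. xi i om) {..<k}) (PiM {k} (%_. borel)) (%om. restrict (%i. xi i om) {k})"
  by (rule indep_var_restrict[OF indep[of "Suc k"]]) auto
 from indep_var_compose[OF this m1, of "%v. exp (- (s* of_real (v k)))" borel]
 have iv: "indep_var borel (%om. F (%i. xi i om)) borel (%om. exp (- (s* of_real (xi k om))))"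
  by (auto simp: o_def Fr FG)
 have gF: "g om = F (%i. xi i om)* exp (- (s* of_real (xi k om)))" for om
 proof -
  have "exp (- (s* of_real (path y om (Suc k)))) = exp (- (s* of_real (path y om k)))* exp (- (s* of_real (xi k om)))"
   by (simp add: walk_Suc exp_add[symmetric] algebra_simps)
  thus ?thesis unfolding g_def F_def by (simp only: mult.assoc)
 qed
 have Fi: "integrable M (%om. F (%i. xi i om))"
 proof (rule integrable_const_bound[of _ 1])
  show "AE om in M. norm (F (%i. xi i om)) <= 1"
   unfolding F_def using killed_exp_bound(1)[OF l rs] by auto
  show "(%om. F (%i. xi i om)) \<in> borel_measurable M" unfolding F_def by measurable
 qed
 show "integrable M g" unfolding gF[abs_def] by (rule indep_var_integrable[OF iv Fi laplace'(1)[OF s]])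
 have "integral\<^sup>L M g = (LINT om|M. F (%i. xi i om)* exp (of_real dt* s powr of_real al))"
  unfolding gF[abs_def] using indep_var_lebesgue_integral[OF iv Fi laplace'(1)[OF s]] laplace'(2)[OF s] by simp
 also have "... = (LINT om|M. of_real (killed dt l ka (path y om) k)*(exp (- ((s + of_real (dt* ka))* of_real (path y om k)))
    * exp (of_real dt*(s powr of_real al - of_real l))))"
  unfolding F_def of_real_mult mult.assoc exp_of_real[symmetric] exp_add[symmetric]
  by (rule arg_cong[where f = "integral\<^sup>L M"]) (simp add: fun_eq_iff algebra_simps)
 finally show ?g1 .
qed

lemma killed_integrable:
 assumes "0 <= l" "0 <= ka" "0 <= Re s"
 shows "integrable M (%om. of_real (killed dt l ka (path y om) k)* exp (- (s* of_real (path y om k))))"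
proof (rule integrable_const_bound)
 show "AE om in M. norm (of_real (killed dt l ka (path y om) k)* exp (- (s* of_real (path y om k)))) <= exp (- dt* l* real k)"
  using killed_exp_bound(2)[OF assms] by auto
qed measurable

text \<open>Discrete Dynkin formula. In each step the discounted mass either survives or exits at
  the value - undershoot, and telescoping adds up the one-step defects;
  \<open>exited_times_exp\<close> collects the exit terms into one.\<close>

lemma dynkin:
 assumes l: "0 <= l" "0 <= ka" and s: "0 < Re s \<or> s = 0" and y: "0 <= y"
 shows "integrable M (%om. of_real (exited dt l ka (path y om) n)* exp (s* of_real (undershoot (path y om) n)))" (is ?g1)
  "(LINT om|M. of_real (killed dt l ka (path y om) n)* exp (- (s* of_real (path y om n))))
   + (LINT om|M. of_real (exited dt l ka (path y om) n)* exp (s* of_real (undershoot (path y om) n)))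
   = exp (- (s* of_real y))+(\<Sum>k<n. \<integral>om. of_real (killed dt l ka (path y om) k) *
    (exp (- ((s + of_real (dt* ka))* of_real (path y om k)))* exp (of_real dt*(s powr of_real al - of_real l))
      - exp (- (s* of_real (path y om k)))) \<partial>M)" (is ?g2)
proof -
 have rs: "0 <= Re s" using s by auto
 define A where "A = (%k om. of_real (killed dt l ka (path y om) k)* exp (- (s* of_real (path y om k))))"
 define G where "G = (%k om. of_real (killed dt l ka (path y om) k* exp (- dt*(l+ka* path y om k)))* exp (- (s* of_real (path y om (Suc k)))))"
 define C where "C = (%k om. of_real (killed dt l ka (path y om) k)*(exp (- ((s + of_real (dt* ka))* of_real (path y om k)))
    * exp (of_real dt*(s powr of_real al - of_real l))))"
 define B where "B = (%k om. of_real (if path y om (Suc k) < 0 then killed dt l ka (path y om) k* exp (- dt*(l+ka* path y om k)) else 0)* exp (- (s* of_real (path y om (Suc k)))))"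
 have Ai: "integrable M (A k)" for k unfolding A_def by (rule killed_integrable[OF l rs])
 have Gi: "integrable M (G k)" "integral\<^sup>L M (G k) = integral\<^sup>L M (C k)" for k unfolding G_def C_def by (rule step[OF l s])+
 have rel: "B k om = G k om-A (Suc k) om" for k om by (simp add: B_def G_def A_def killed_Suc)
 have Bi: "integrable M (B k)" for k unfolding rel[abs_def] using Ai Gi by simp
 have Ci: "integrable M (C k)" for k
 proof -
  have "0 <= Re (s + of_real (dt* ka))" using rs l dt_pos by simp
  from integrable_mult_left[OF killed_integrable[OF l this, of y k], of "exp (of_real dt*(s powr of_real al - of_real l))"]
  show ?thesis unfolding C_def by (simp only: mult.assoc)
 qed
 have Bsum: "of_real (exited dt l ka (path y om) n)* exp (s* of_real (undershoot (path y om) n)) = (\<Sum>k<n. B k om)" for n om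
  unfolding B_def by (rule exited_times_exp[symmetric])
 show ?g1
  unfolding Bsum using Bi by (intro Bochner_Integration.integrable_sum)
 have A0: "integral\<^sup>L M (A 0) = exp (- (s* of_real y))"
  using y by (simp add: A_def killed_def walk_def prob_space)
 have "integral\<^sup>L M (A n)+(\<Sum>k<n. integral\<^sup>L M (B k)) = integral\<^sup>L M (A 0)+(\<Sum>k<n. integral\<^sup>L M (C k)-integral\<^sup>L M (A k))" for n
 proof (induction n)
  case (Suc n)
  have "integral\<^sup>L M (B n) = integral\<^sup>L M (C n)-integral\<^sup>L M (A (Suc n))"
   unfolding rel[abs_def] Gi(2)[symmetric] by (rule Bochner_Integration.integral_diff[OF Gi(1) Ai])
  moreover have "a'+(sb+(c-a')) = a0+(sd+(c-a))" if "a+sb = a0+sd" for a a' a0 sb sd c :: complex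
   using that by algebra
  ultimately show ?case using Suc by simp
 qed simp
 moreover have "integral\<^sup>L M (C k)-integral\<^sup>L M (A k) = (LINT om|M. of_real (killed dt l ka (path y om) k) *
    (exp (- ((s + of_real (dt* ka))* of_real (path y om k)))* exp (of_real dt*(s powr of_real al - of_real l))
      - exp (- (s* of_real (path y om k)))))" for k
  unfolding Bochner_Integration.integral_diff[OF Ci Ai, symmetric] by (simp add: C_def A_def right_diff_distrib)
 moreover have "(LINT om|M. of_real (exited dt l ka (path y om) n)* exp (s* of_real (undershoot (path y om) n))) = (\<Sum>k<n. integral\<^sup>L M (B k))"
  unfolding Bsum using Bi by (intro Bochner_Integration.integral_sum)
 ultimately show ?g2
  unfolding A0 by (simp add: A_def)
qed

text \<open>For s = p, ka = 0 and l = p^al all one-step defects vanish, so the exit term has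
  expectation at most exp (- p y) <= 1. After an exit by index n the discount is at least exp (-
  p^al dt n) and can be divided out; without an exit the undershoot is 0.\<close>

lemma undershoot_exp_moment:
 assumes p: "0 < p" and y: "0 <= y"
 shows "integrable M (%om. exp (p* undershoot (path y om) n))"
  "(LINT om|M. exp (p* undershoot (path y om) n)) <= 1+exp (p powr al*(dt* real n))"
proof -
 let ?l = "p powr al" and ?s = "complex_of_real p"
 let ?U = "%om. undershoot (path y om) n" and ?E = "%om. exited dt (p powr al) 0 (path y om) n"
 have s: "0 < Re ?s \<or> ?s = 0" using p by simp
 have sp: "?s powr of_real al - of_real ?l = 0" using p by (simp add: powr_of_real)
 have ce: "of_real (?E om)* exp (?s* of_real (?U om)) = complex_of_real (?E om* exp (p*?U om))" for om
  by (simp add: exp_of_real[symmetric])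
 have ck: "of_real (killed dt ?l 0 (path y om) n)* exp (- (?s* of_real (path y om n))) = complex_of_real (killed dt ?l 0 (path y om) n* exp (- (p* path y om n)))" for om
  by (simp add: exp_of_real[symmetric])
 note d = dynkin[of ?l 0 ?s y n, OF _ _ s y, unfolded ce ck]
 have i: "integrable M (%om. ?E om* exp (p*?U om))"
  using d(1) by (simp only: complex_of_real_integrable_eq powr_ge_zero order_refl)
 have "(LINT om|M. killed dt ?l 0 (path y om) n* exp (- (p* path y om n)))+(LINT om|M. ?E om* exp (p*?U om)) = exp (- (p* y))"
 proof -
  have "complex_of_real ((LINT om|M. killed dt ?l 0 (path y om) n* exp (- (p* path y om n)))+(LINT om|M. ?E om* exp (p*?U om))) = complex_of_real (exp (- (p* y)))"
   using d(2) unfolding sp integral_complex_of_real by (simp add: exp_of_real[symmetric])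
  thus ?thesis by (simp only: of_real_eq_iff)
 qed
 moreover have "0 <= (LINT om|M. killed dt ?l 0 (path y om) n* exp (- (p* path y om n)))"
  by (intro integral_nonneg_AE) (simp add: killed_nonneg)
 moreover have "exp (- (p* y)) <= 1" using p y by simp
 ultimately have le1: "(LINT om|M. ?E om* exp (p*?U om)) <= 1" by linarith
 have pw: "exp (p*?U om) <= 1+exp (?l*(dt* real n))*(?E om* exp (p*?U om))" for om
 proof (cases "\<exists>k\<le>n. path y om k < 0")
  case False
  hence "?U om = 0" unfolding undershoot_def by (rule if_not_P)
  thus ?thesis by (simp add: exited_nonneg)
 next
  case True
  define j where "j = (LEAST k. path y om k < 0)"
  obtain k where k: "k <= n" "path y om k < 0" using True by blast
  have j: "path y om j < 0" "j <= k" unfolding j_def using k(2) by (auto intro: LeastI Least_le)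
  have jn: "!!i. i < j ==> 0 <= path y om i" unfolding j_def using not_less_Least by (metis not_le)
  have "j ~= 0" using j(1) y by (cases j) (auto simp: walk_def)
  then obtain i where i: "j = Suc i" by (cases j) auto
  have "exp (- ?l*(dt* real n)) <= exp (- dt*(?l* real (Suc i)))"
  proof -
   have "dt*(?l* real (Suc i)) <= dt*(?l* real n)" using i j k dt_pos by (intro mult_left_mono) auto
   thus ?thesis by (simp add: algebra_simps)
  qed
  also have "... = killed dt ?l 0 (path y om) i* exp (- dt*(?l+0* path y om i))"
   using jn i by (simp add: killed_def exp_add[symmetric] algebra_simps)
  also have "... <= ?E om"
   unfolding exited_def using i j k
   by (intro order_trans[OF _ member_le_sum[of i]]) (auto simp: killed_nonneg)
  finally have "exp (?l*(dt* real n))* exp (- ?l*(dt* real n)) <= exp (?l*(dt* real n))*?E om"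
   by (rule mult_left_mono) simp
  hence "1 <= exp (?l*(dt* real n))*?E om" by (simp add: exp_add[symmetric])
  hence "1* exp (p*?U om) <= exp (?l*(dt* real n))*?E om* exp (p*?U om)" by (rule mult_right_mono) simp
  thus ?thesis unfolding mult_1_left mult.assoc by linarith
 qed
 have ib: "integrable M (%om. 1+exp (?l*(dt* real n))*(?E om* exp (p*?U om)))" using i by simp
 show "integrable M (%om. exp (p*?U om))"
  by (rule Bochner_Integration.integrable_bound[OF ib]) (use pw in \<open>auto intro: order_trans[OF _ abs_ge_self]\<close>)
 hence "(LINT om|M. exp (p*?U om)) <= (LINT om|M. 1+exp (?l*(dt* real n))*(?E om* exp (p*?U om)))"
  by (intro integral_mono ib pw)
 also have "... = 1+exp (?l*(dt* real n))*(LINT om|M. ?E om* exp (p*?U om))"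
  using i by (simp add: prob_space)
 also have "... <= 1+exp (?l*(dt* real n))*1" using le1 by (intro add_left_mono mult_left_mono) auto
 finally show "(LINT om|M. exp (p*?U om)) <= 1+exp (p powr al*(dt* real n))" by simp
qed

end

section \<open>One grid step averaged over the ray\<close>

lemma norm_exp_minus_1_le: "norm (exp z-1) <= norm z* exp (norm z)" for z :: complex
proof -
 have "norm (exp z-exp 0) <= exp (norm z)* norm (z-0)"
 proof (rule field_differentiable_bound[where S = "cball 0 (norm z)" and f' = exp])
  fix w :: complex assume "w \<in> cball 0 (norm z)"
  hence "Re w <= norm z" using complex_Re_le_cmod[of w] by simp
  thus "norm (exp w) <= exp (norm z)" by simp
 qed (auto intro!: derivative_eq_intros)
 thus ?thesis by (simp add: mult.commute)
qed

text \<open>Mean value inequality for w^(1+al)/(1+al) - w z^al, whose derivative w^al - z^al is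
  itself of order dt on the segment.\<close>

lemma powr_second_increment_bound:
 fixes z :: complex
 assumes z: "0 < Re z \<or> z = 0" and d: "0 <= dt" "dt <= 1" and al: "1 < al"
 shows "norm ((z + of_real dt) powr of_real (1+al) / of_real (1+al)-(z powr of_real (1+al) / of_real (1+al) + of_real dt* z powr of_real al))
  <= al* dt^2*(norm z+1) powr (al-1)"
proof -
 have nz: "complex_of_real (1+al) ~= 0" using al by (simp del: of_real_add)
 show ?thesis
 proof (cases "z = 0")
  case True
  have "dt powr (1+al) <= dt powr 2"
   using powr_mono'[of 2 "1+al" dt] d al by simp
  also have "... = dt^2" using d by (cases "dt = 0") auto
  finally have "dt powr (1+al)/(1+al) <= dt^2/(1+al)" using al by (intro divide_right_mono) auto
  also have "... <= dt^2/1" using al by (intro divide_left_mono) auto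
  also have "... <= al* dt^2" using al mult_right_mono[of 1 al "dt\<^sup>2"] by simp
  finally show ?thesis using True al d by (simp add: norm_divide del: of_real_add)
 next
  case False
  hence z: "0 < Re z" using z by auto
  let ?S = "closed_segment z (z + of_real dt)"
  let ?F = "%w. w powr of_real (1+al) / of_real (1+al)-w* z powr of_real al"
  have "norm (?F (z + of_real dt)-?F z) <= (al* dt*(norm z+1) powr (al-1))* norm ((z + of_real dt)-z)"
  proof (rule field_differentiable_bound[where S = ?S and f' = "%w. w powr of_real al-z powr of_real al"])
   fix w assume "w \<in> ?S"
   hence "\<exists>u. 0 <= u & u <= 1 & w = (1-u) *\<^sub>R z+u *\<^sub>R (z + of_real dt)"
    by (simp only: in_segment)
   then obtain u where u0: "0 <= u" "u <= 1" "w = (1-u) *\<^sub>R z+u *\<^sub>R (z + of_real dt)"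
    by (elim exE conjE)
   hence u: "0 <= u" "u <= 1" "w = z + of_real (u* dt)"
    by (simp_all add: scaleR_conv_of_real algebra_simps)
   have us: "0 <= u* dt" "u* dt <= dt" using u d by (auto intro: mult_left_le_one_le)
   have rw: "0 < Re w" using u z us by simp
   have e1: "1+al-1 = al" by simp
   have "((%w. w powr of_real (1+al)) has_field_derivative of_real (1+al)* w powr of_real al) (at w)"
    using has_field_derivative_powr_halfplane[OF rw, of "1+al"] unfolding e1 .
   from DERIV_diff[OF DERIV_cdivide[OF this, of "of_real (1+al)"] DERIV_cmult_Id[of "z powr of_real al"]]
   have "(?F has_field_derivative w powr of_real al-z powr of_real al) (at w)"
    using nz by (simp add: mult.commute del: of_real_add)
   thus "(?F has_field_derivative w powr of_real al-z powr of_real al) (at w within ?S)"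
    by (rule has_field_derivative_at_within)
   have "norm (w powr of_real al-z powr of_real al) <= al*(u* dt)*(norm z+u* dt) powr (al-1)"
    unfolding u(3) by (rule powr_increment_bound) (use z us al in auto)
   also have "... <= al* dt*(norm z+1) powr (al-1)"
    using us d al by (intro mult_mono powr_mono2) auto
   finally show "norm (w powr of_real al-z powr of_real al) <= al* dt*(norm z+1) powr (al-1)" .
  qed auto
  thus ?thesis using d by (simp add: algebra_simps power2_eq_square del: of_real_add)
 qed
qed

text \<open>Complex density on the ray such that integrating exp (- s x) against it gives H (l +
  x).\<close>

definition ray_measure_density :: "real => real => real => complex" where
 "ray_measure_density al l r = ray_dir al*(exp (- (of_real r* ray_dir al* of_real l))* of_real (ray_weight al r))"

text \<open>The source term 1 of the killed equation after discretisation: the mean of the kernel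
  over the real segment that \<open>kernel_shift\<close> splits off.\<close>

definition kernel_mean :: "real => real => real => real" where
 "kernel_mean al dt Y = (LBINT s:{0..dt}. exp (s powr (1+al)/(1+al)-s* Y))/dt"

lemma ray_measure_density_bound:
 assumes "1 < al" "0 <= l" "0 <= r" shows "norm (ray_measure_density al l r) <= ray_weight al r"
proof -
 have "exp (- (r* Re (ray_dir al)* l)) <= 1" using ray_dir_facts[OF assms(1)] assms by simp
 thus ?thesis unfolding ray_measure_density_def norm_mult norm_exp_eq_Re using ray_dir_facts[OF assms(1)]
  by (simp add: ray_weight_def mult_left_le_one_le)
qed

lemma measurable_ray_measure_density [measurable]: "ray_measure_density al l \<in> borel_measurable borel"
 unfolding ray_measure_density_def ray_weight_def by measurable

text \<open>The one-step defect in \<open>dynkin\<close> for ka = 1.\<close>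

definition exp_step :: "real => real => real => complex => real => complex" where
 "exp_step al dt l s x = exp (- ((s + of_real dt)* of_real x))* exp (of_real dt*(s powr of_real al - of_real l))-exp (- (s* of_real x))"

lemma exp_step_bound:
 assumes al: "1 < al" and d: "0 <= dt" "dt <= 1" and l: "0 <= l" and x: "0 <= x" and r: "0 <= r"
 shows "norm (ray_measure_density al l r* exp_step al dt l (of_real r* ray_dir al) x) <= 2* ray_bound al 1 r"
proof -
 let ?s = "of_real r* ray_dir al"
 note rd = ray_dir_facts[OF al]
 have ns: "norm ?s = r" using rd r by (simp add: norm_mult)
 have rs: "0 <= Re ?s" using rd r by simp
 have "Re (?s powr of_real al) <= r powr al" using complex_Re_le_cmod[of "?s powr of_real al"] ns by simp
 also have "... <= (1+r) powr al" using r al by (intro powr_mono2) auto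
 finally have p: "Re (?s powr of_real al) <= (1+r) powr al" .
 have "dt*(Re (?s powr of_real al)-l) <= dt*(1+r) powr al" using p l d by (intro mult_left_mono) auto
 also have "... <= 1*(1+r) powr al" using d by (intro mult_right_mono) auto
 finally have e1: "norm (exp (of_real dt*(?s powr of_real al - of_real l))) <= exp ((1+r) powr al)"
  unfolding norm_exp_eq_Re by simp
 have e2: "norm (exp (- ((?s + of_real dt)* of_real x))) <= 1" "norm (exp (- (?s* of_real x))) <= 1"
  unfolding norm_exp_eq_Re using rs x d by auto
 have "norm (exp_step al dt l ?s x) <= 1* exp ((1+r) powr al)+1"
  unfolding exp_step_def by (rule order_trans[OF norm_triangle_ineq4 add_mono])
   (use e1 e2 in \<open>auto simp only: norm_mult intro!: mult_mono\<close>, auto)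
 also have "... <= 2* exp ((1+r) powr al)" by simp
 finally have "norm (ray_measure_density al l r* exp_step al dt l ?s x) <= ray_weight al r*(2* exp ((1+r) powr al))"
  unfolding norm_mult using ray_measure_density_bound[OF al l r] by (intro mult_mono) (auto simp: ray_weight_def)
 thus ?thesis by (simp add: ray_bound_def mult_ac)
qed

text \<open>Up to O(dt^2), z^(1+al)/(1+al) + dt z^al is (z+dt)^(1+al)/(1+al). So the average of
  \<open>exp_step\<close> is nearly the kernel integral along the ray shifted by dt minus the
  unshifted one, and \<open>kernel_shift\<close> evaluates this difference as minus the integral
  over a real segment.\<close>

lemma ray_one_step:
 assumes al: "1 < al" "al <= 2" and d: "0 < dt" "dt <= 1" and l: "0 <= l" and x: "0 <= x"
 shows "norm ((LBINT r:{0..}. ray_measure_density al l r* exp_step al dt l (of_real r* ray_dir al) x)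
   + of_real (dt* kernel_mean al dt (l+x))) <= dt^2*(2*(LBINT r:{0..}. ray_bound al 4 r))"
proof -
 let ?d = "ray_dir al" and ?Y = "l+x"
 note rd = ray_dir_facts[OF al(1)]
 let ?s = "%r. of_real r*?d"
 define f where "f = (%r. ray_measure_density al l r* exp_step al dt l (?s r) x)"
 define g where "g = (%r. ?d* kernel al ?Y (of_real dt+?s r))"
 define h where "h = (%r. ?d* kernel al ?Y (?s r))"
 have fi: "sint {0..} f"
 proof (rule ray_dominated_integrable[OF al(1)])
  show "set_borel_measurable lborel {0..} f" unfolding f_def exp_step_def set_borel_measurable_def by measurable
  show "norm (f r) <= 2* ray_bound al 1 r" if "0 <= r" for r
   unfolding f_def using exp_step_bound[OF al(1) _ d(2) l x that] d by simp
 qed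
 have gi: "sint {0..} g"
  using kernel_shift_integrable[OF al(1), of dt 0 ?Y] d by (simp add: g_def)
 have hi: "sint {0..} h"
  using kernel_shift_integrable[OF al(1), of 0 0 ?Y] by (simp add: h_def)
 have hH: "(LBINT r:{0..}. h r) = Hray al 0 (of_real ?Y)"
  unfolding h_def Hray_def
  by (rule set_lebesgue_integral_cong) (auto simp: kernel_on_ray[OF al(1)])
 have kr: "(LINT s|lborel. indicator {0..dt} s *\<^sub>R (of_real s^0* kernel al ?Y (of_real s))) = of_real (dt* kernel_mean al dt ?Y)"
 proof -
  have "kernel al ?Y (of_real s) = of_real (exp (s powr (1+al)/(1+al)-s*?Y))" if "0 <= s" for s
  proof -
   have "of_real s powr of_real (1+al) / of_real (1+al) - of_real s* complex_of_real ?Y = of_real (s powr (1+al)/(1+al)-s*?Y)"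
    unfolding powr_of_real[OF that] by simp
   thus ?thesis unfolding kernel_def by (simp only: exp_of_real)
  qed
  hence "(LINT s|lborel. indicator {0..dt} s *\<^sub>R (of_real s^0* kernel al ?Y (of_real s)))
    = (LBINT s:{0..dt}. complex_of_real (exp (s powr (1+al)/(1+al)-s*?Y)))"
   unfolding slint_def by (intro Bochner_Integration.integral_cong refl) (auto simp: indicator_def)
  also have "... = of_real (dt* kernel_mean al dt ?Y)"
   unfolding set_integral_complex_of_real kernel_mean_def using d by simp
  finally show ?thesis .
 qed
 have "(LBINT r:{0..}. g r) = Hray al 0 (of_real ?Y) - of_real (dt* kernel_mean al dt ?Y)"
  using kernel_shift[OF al(1), of dt 0 ?Y] d unfolding kr by (simp add: g_def)
 hence gh: "(LBINT r:{0..}. f r) + of_real (dt* kernel_mean al dt ?Y)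
   = (LBINT r:{0..}. f r)-((LBINT r:{0..}. g r)-(LBINT r:{0..}. h r))" by (simp add: hH)
 also have "... = (LBINT r:{0..}. f r-(g r-h r))"
  by (subst set_integral_diff(2)[OF fi set_integral_diff(1)[OF gi hi]], subst set_integral_diff(2)[OF gi hi]) (rule refl)
 finally have eq: "(LBINT r:{0..}. f r) + of_real (dt* kernel_mean al dt ?Y) = (LBINT r:{0..}. f r-(g r-h r))" .
 have pw: "norm (f r-(g r-h r)) <= dt^2*(2* ray_bound al 4 r)" if r: "0 <= r" for r
 proof -
  let ?z = "?s r"
  have nz: "norm ?z = r" using rd r by (simp add: norm_mult)
  have z0: "0 < Re ?z \<or> ?z = 0" using r rd by (cases "r = 0") auto
  \<comment> \<open>P is the exponent at the shifted point; Q, its linearisation in dt, is the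
    exponent that one step of the walk produces.\<close>
  define P where "P = (?z + of_real dt) powr of_real (1+al) / of_real (1+al)"
  define Q where "Q = ?z powr of_real (1+al) / of_real (1+al) + of_real dt*?z powr of_real al"
  define E where "E = (1+r) powr al"
  have E: "0 <= E" by (simp add: E_def)
  have "norm (P-Q) <= al* dt^2*(norm ?z+1) powr (al-1)"
   unfolding P_def Q_def by (rule powr_second_increment_bound[OF z0 _ d(2) al(1)]) (use d in simp)
  also have "... <= 2* dt^2* E"
   unfolding E_def nz using al r by (intro mult_mono) (auto simp: add.commute intro!: powr_mono)
  finally have PQ: "norm (P-Q) <= 2* dt^2* E" .
  have d2: "dt\<^sup>2 <= 1" using d by (simp add: power_le_one)
  have "2* dt^2* E <= 2*1* E" using d2 E by (intro mult_mono) auto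
  hence PQ2: "norm (P-Q) <= 2* E" using PQ by simp
  have "norm (exp (P-Q)-1) <= norm (P-Q)* exp (norm (P-Q))" by (rule norm_exp_minus_1_le)
  also have "... <= (2* dt^2* E)* exp (2* E)" using PQ PQ2 E by (intro mult_mono) auto
  also have "... <= (2* dt^2* exp E)* exp (2* E)"
  proof -
   have "E <= exp E" using exp_ge_add_one_self[of E] by linarith
   thus ?thesis by (intro mult_right_mono mult_left_mono) auto
  qed
  \<comment> \<open>Together with the factor exp E from exp Q this makes the 4 in
    \<open>ray_bound al 4\<close>.\<close>
  finally have ePQ: "norm (exp (P-Q)-1) <= 2* dt^2* exp (3* E)" by (simp add: exp_add[symmetric] mult.assoc)
  have "Re Q <= - (r powr (1+al)/(1+al))+E"
  proof -
   have "Re (?z powr of_real (1+al) / of_real (1+al)) = - (r powr (1+al)/(1+al))"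
    unfolding ray_dir_powr[OF al(1) r] Re_divide_of_real by simp
   moreover have "dt* Re (?z powr of_real al) <= 1* E"
   proof -
    have "Re (?z powr of_real al) <= r powr al" using complex_Re_le_cmod[of "?z powr of_real al"] nz by simp
    also have "... <= E" unfolding E_def using r al by (intro powr_mono2) auto
    finally have "dt* Re (?z powr of_real al) <= dt* E" using d by (intro mult_left_mono) auto
    also have "... <= 1* E" using d E by (intro mult_right_mono) auto
    finally show ?thesis .
   qed
   ultimately show ?thesis by (simp add: Q_def)
  qed
  hence eQ: "norm (exp Q) <= ray_weight al r* exp E"
   unfolding norm_exp_eq_Re ray_weight_def exp_add[symmetric] by simp
  have eY: "norm (exp (- ((?z + of_real dt)* of_real ?Y))) <= 1"
   unfolding norm_exp_eq_Re using rd r d l x by auto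
  have gE: "g r = ?d*(exp P* exp (- ((?z + of_real dt)* of_real ?Y)))"
   unfolding g_def kernel_def P_def by (simp add: exp_add[symmetric] algebra_simps del: of_real_add)
  have hE: "h r = ray_measure_density al l r* exp (- (?z* of_real x))"
   unfolding h_def kernel_on_ray[OF al(1) r] ray_measure_density_def by (simp add: distrib_left exp_diff exp_minus field_simps exp_add)
  have fE: "f r = ?d*(exp Q* exp (- ((?z + of_real dt)* of_real ?Y)))-h r"
  proof -
   have w: "complex_of_real (ray_weight al r) = exp (?z powr of_real (1+al) / of_real (1+al))"
    using kernel_on_ray[OF al(1) r, of 0] by (simp add: kernel_def)
   have "exp (- (of_real r*?d* of_real l))* of_real (ray_weight al r)*(exp (- ((?z + of_real dt)* of_real x))* exp (of_real dt*(?z powr of_real al - of_real l)))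
     = exp Q* exp (- ((?z + of_real dt)* of_real ?Y))"
    unfolding w Q_def exp_add[symmetric] by (rule arg_cong[where f = exp]) (simp add: algebra_simps of_real_add[of l x] del: of_real_add)
   thus ?thesis
    unfolding f_def hE exp_step_def right_diff_distrib ray_measure_density_def by (simp only: mult.assoc)
  qed
  have "f r-(g r-h r) = - (?d*(exp (- ((?z + of_real dt)* of_real ?Y))*(exp Q*(exp (P-Q)-1))))"
   unfolding gE fE by (simp add: right_diff_distrib left_diff_distrib exp_diff mult_ac)
  hence "norm (f r-(g r-h r)) = norm (exp (- ((?z + of_real dt)* of_real ?Y)))*(norm (exp Q)* norm (exp (P-Q)-1))"
   using rd by (simp only: norm_minus_cancel norm_mult mult_1_left)
  also have "... <= 1*((ray_weight al r* exp E)*(2* dt^2* exp (3* E)))"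
   using eY eQ ePQ by (intro mult_mono) (auto simp: ray_weight_def)
  also have "... = dt^2*(2*((exp E* exp (3* E))* ray_weight al r))" by (simp only: mult_ac mult_1_left)
  also have "exp E* exp (3* E) = exp (4* E)" by (simp add: exp_add[symmetric])
  finally show ?thesis unfolding ray_bound_def E_def .
 qed
 have bi: "sint {0..} (%r. dt\<^sup>2*(2* ray_bound al 4 r))"
  using ray_bound_integrable[OF al(1), of 4] by simp
 have "norm (LBINT r:{0..}. f r-(g r-h r)) <= (LBINT r:{0..}. dt\<^sup>2*(2* ray_bound al 4 r))"
  unfolding slint_def
 proof (rule Bochner_Integration.integral_norm_bound_integral)
  show "integrable lborel (%r. indicator {0..} r *\<^sub>R (f r-(g r-h r)))"
   using set_integral_diff(1)[OF fi set_integral_diff(1)[OF gi hi]] by (simp add: set_integrable_def)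
  show "integrable lborel (%r. indicator {0..} r *\<^sub>R (dt^2*(2* ray_bound al 4 r)))" using bi by (simp add: set_integrable_def)
  show "norm (indicator {0..} r *\<^sub>R (f r-(g r-h r))) <= indicator {0..} r *\<^sub>R (dt^2*(2* ray_bound al 4 r))" for r
   using pw[of r] by (auto simp: indicator_def)
 qed
 thus ?thesis unfolding eq[symmetric] by (simp add: f_def)
qed

lemma kernel_mean_bounds:
 assumes al: "1 < al" and d: "0 < dt" "dt <= 1" and Y: "0 <= Y"
 shows "\<bar>kernel_mean al dt Y-1\<bar> <= exp (dt*(1+Y))-1" (is ?g1) "\<bar>kernel_mean al dt Y\<bar> <= exp 1" (is ?g2)
proof -
 define f where "f = (%s. exp (s powr (1+al)/(1+al)-s* Y))"
 have p: "0 <= s powr (1+al)/(1+al)" "s powr (1+al)/(1+al) <= s" if "0 <= s" "s <= dt" for s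
 proof -
  have "s powr (1+al) <= s powr 1" using powr_mono'[of 1 "1+al" s] that d al by simp
  hence "s powr (1+al)/(1+al) <= s/(1+al)" using that al by (intro divide_right_mono) auto
  also have "... <= s/1" using that al by (intro divide_left_mono) auto
  finally show "s powr (1+al)/(1+al) <= s" by simp
 qed (use al in auto)
 have fm: "set_borel_measurable lborel {0..dt} f" unfolding f_def set_borel_measurable_def by measurable
 have fi: "sint {0..dt} f"
 proof (rule set_integrable_bound[OF _ fm])
  show "sint {0..dt} (%_. exp 1 :: real)" by (auto simp: set_integrable_def emeasure_lborel_Icc_eq intro!: integrable_real_indicator)
  show "AE s in lborel. s \<in> {0..dt} --> norm (f s) <= norm (exp 1 :: real)"
  proof (intro AE_I2 impI)
   fix s assume s: "s \<in> {0..dt}"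
   hence "0 <= s* Y" using Y by simp
   thus "norm (f s) <= norm (exp 1 :: real)" unfolding f_def using p[of s] s d by simp
  qed
 qed
 have c: "(LBINT s:{0..dt}. k) = dt* k" for k :: real using d by (simp add: slint_def)
 have ci: "sint {0..dt} (%_. k)" for k :: real
  by (auto simp: set_integrable_def emeasure_lborel_Icc_eq intro!: integrable_real_indicator)
 have "(LBINT s:{0..dt}. f s) <= (LBINT s:{0..dt}. exp dt)"
 proof (rule set_integral_mono[OF fi ci])
  fix s assume s: "s \<in> {0..dt}"
  hence "0 <= s* Y" using Y by simp
  thus "f s <= exp dt" unfolding f_def using p[of s] s by simp
 qed
 moreover have "(LBINT s:{0..dt}. exp (- (dt* Y))) <= (LBINT s:{0..dt}. f s)"
 proof (rule set_integral_mono[OF ci fi])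
  fix s assume s: "s \<in> {0..dt}"
  hence "s* Y <= dt* Y" using Y by (intro mult_right_mono) auto
  thus "exp (- (dt* Y)) <= f s" unfolding f_def using p[of s] s by simp
 qed
 ultimately have b: "exp (- (dt* Y)) <= kernel_mean al dt Y" "kernel_mean al dt Y <= exp dt"
  unfolding c kernel_mean_def f_def using d by (simp_all add: field_simps)
 have dY: "0 <= dt* Y" using d Y by simp
 have "exp dt <= exp (dt*(1+Y))" using dY by (simp add: algebra_simps)
 moreover have "1-dt* Y <= exp (- (dt* Y))" using exp_ge_add_one_self[of "- (dt* Y)"] by simp
 moreover have "1+dt*(1+Y) <= exp (dt*(1+Y))" by (rule exp_ge_add_one_self)
 moreover have "dt*(1+Y) = dt+dt* Y" by (simp add: algebra_simps)
 ultimately show ?g1 using b d unfolding abs_le_iff by linarith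
 have "exp dt <= exp 1" using d by simp
 moreover have "0 <= exp (- (dt* Y))" by simp
 ultimately show ?g2 using b unfolding abs_le_iff by linarith
qed

section \<open>Limits and exchanges of expectations\<close>

context prob_space
begin

text \<open>Bounded second moments give uniform integrability: truncating at K costs at most |C| /
  K.\<close>

lemma expectation_tendsto_0:
 fixes Y :: "nat => 'a => real"
 assumes m[measurable]: "!!n. Y n \<in> borel_measurable M" and nn: "!!n om. 0 <= Y n om"
  and lim: "AE om in M. (%n. Y n om) ----> 0"
  and sq: "!!n. integrable M (%om. (Y n om)\<^sup>2)" "!!n. (LINT om|M. (Y n om)\<^sup>2) <= C"
 shows "(%n. \<integral>om. Y n om \<partial>M) ----> 0"
proof (rule LIMSEQ_I)
 fix e :: real assume e: "0 < e"
 define K where "K = 2*(\<bar>C\<bar>+1)/e"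
 have K: "0 < K" using e by (simp add: K_def)
 have "(%n. \<integral>om. min K (Y n om) \<partial>M) ----> (LINT om|M. 0)"
 proof (rule integral_dominated_convergence[where w = "%_. K"])
  show "AE om in M. (%n. min K (Y n om)) ----> 0"
   using lim
  proof eventually_elim
   case (elim om)
   have "(%n. min K (Y n om)) ----> min K 0" by (intro tendsto_min tendsto_const elim)
   thus ?case using K by simp
  qed
  show "AE om in M. norm (min K (Y n om)) <= K" for n using nn K by (auto simp: min_def)
 qed auto
 hence "eventually (%n. (LINT om|M. min K (Y n om)) < e/2) sequentially"
  using order_tendstoD(2)[of _ 0 sequentially "e/2"] e by simp
 then obtain N where N: "!!n. N <= n ==> (LINT om|M. min K (Y n om)) < e/2"
  unfolding eventually_sequentially by blast
 have "norm ((LINT om|M. Y n om)-0) < e" if "N <= n" for n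
 proof -
  have pw: "Y n om <= min K (Y n om)+(Y n om)\<^sup>2/K" for om
  proof (cases "Y n om <= K")
   case False
   hence "K* Y n om <= (Y n om)\<^sup>2" using nn[of n om] unfolding power2_eq_square by (intro mult_right_mono) auto
   hence "Y n om <= (Y n om)\<^sup>2/K" using K by (simp add: field_simps)
   thus ?thesis using K False by simp
  qed (use K in simp)
  have i1: "integrable M (%om. min K (Y n om))"
   by (rule integrable_const_bound[of _ K]) (use nn K in \<open>auto simp: min_def\<close>)
  have "(LINT om|M. Y n om) <= (LINT om|M. min K (Y n om)+(Y n om)\<^sup>2/K)"
   by (rule integral_mono') (use i1 sq pw order_trans[OF nn pw] in auto)
  also have "... = (LINT om|M. min K (Y n om))+(LINT om|M. (Y n om)\<^sup>2)/K" using i1 sq by simp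
  also have "(LINT om|M. (Y n om)\<^sup>2)/K <= (\<bar>C\<bar>+1)/K"
   using sq(2)[of n] K by (intro divide_right_mono) auto
  also have "(\<bar>C\<bar>+1)/K = e/2" using e by (simp add: K_def field_simps)
  finally have "(LINT om|M. Y n om) < e" using N[OF that] by simp
  moreover have "0 <= (LINT om|M. Y n om)" using nn by (intro integral_nonneg_AE) auto
  ultimately show ?thesis by simp
 qed
 thus "\<exists>N. \<forall>n\<ge>N. norm ((LINT om|M. Y n om)-0) < e" by blast
qed

lemma dominated_Fubini:
 fixes f :: "real => 'a => complex"
 assumes m: "(%(r, om). f r om) \<in> borel_measurable (lborel \<Otimes>\<^sub>M M)" and h: "integrable lborel h"
  and b: "!!r om. om \<in> space M ==> norm (f r om) <= h r"
 shows "integrable lborel (%r. \<integral>om. f r om \<partial>M)" (is ?g1) "(LINT r|lborel. (LINT om|M. f r om)) = (LINT om|M. (LINT r|lborel. f r om))" (is ?g2)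
proof -
 note bml = borel_measurable_lebesgue_integral
 interpret pair_sigma_finite lborel M ..
 have fr: "f r \<in> borel_measurable M" for r using measurable_compose[OF measurable_Pair1' m, of r] by simp
 have fi: "integrable M (f r)" for r
  by (rule integrable_const_bound[of _ "h r"]) (use b fr in auto)
 have h0: "0 <= h r" for r using b[OF some_in_eq[THEN iffD2, OF not_empty]] norm_ge_zero order_trans by blast
 have nb: "(LINT om|M. norm (f r om)) <= h r" for r
 proof -
  have "(LINT om|M. norm (f r om)) <= (LINT om|M. h r)" using fi b by (intro integral_mono) auto
  thus ?thesis by (simp add: prob_space)
 qed
 have fst: "integrable (lborel \<Otimes>\<^sub>M M) (%(r, om). f r om)"
 proof (rule Fubini_integrable[OF m])
  show "integrable lborel (%x. \<integral>y. norm ((%(r, om). f r om) (x, y)) \<partial>M)"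
  proof (rule Bochner_Integration.integrable_bound[OF h])
   show "(%x. \<integral>y. norm ((%(r, om). f r om) (x, y)) \<partial>M) \<in> borel_measurable lborel"
   proof -
    have "(%(x, y). norm (f x y)) \<in> borel_measurable (lborel \<Otimes>\<^sub>M M)"
     using measurable_compose[OF m borel_measurable_norm] by (simp add: split_beta')
    from bml[OF this] show ?thesis by simp
   qed
   show "AE x in lborel. norm (LINT y|M. norm ((%(r, om). f r om) (x, y))) <= norm (h x)"
    using nb h0 by (auto simp: integral_nonneg_AE)
  qed
 qed (use fi in auto)
 show ?g1 using integrable_fst[OF fst] by simp
 show ?g2
  using Fubini_integral[OF fst] by simp
qed

end

section \<open>The killed area functional and its grid approximation\<close>

text \<open>A countable condition, hence measurable; for the paths at hand it means nonnegativity on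
  [0,t] (\<open>grid_nonneg_iff\<close>).\<close>

definition grid_nonneg :: "(real => real) => real => bool" where
 "grid_nonneg f t \<longleftrightarrow> (\<forall>m j. real j/2^m <= t --> 0 <= f (real j/2^m))"

definition killed_area :: "real => (real => real) => real => real" where
 "killed_area ka f t = (if grid_nonneg f t then exp (- ka*(LBINT u:{0..t}. f u)) else 0)"

lemma le_grid_floor:
 assumes "real j/2^m0 <= t" "m0 <= m" shows "j*2^(m-m0) <= grid_floor m t"
proof -
 have "real j <= t*2^m0" using assms(1) by (simp add: divide_le_eq)
 hence "real j*2^(m-m0) <= t*2^m0*2^(m-m0)" by (rule mult_right_mono) simp
 also have "... = t*2^m" using assms(2) by (simp add: mult.assoc power_add[symmetric])
 finally have "real (j*2^(m-m0)) <= t*2^m" by simp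
 thus ?thesis unfolding grid_floor_def by linarith
qed

lemma set_integral_Icc_nonpos:
 fixes f :: "real => real"
 assumes "t <= 0" shows "(LBINT u:{0..t}. f u) = 0"
proof -
 have "(%u. indicator {0..t} u *\<^sub>R f u) = (%u. indicator {0..t} u* f 0)"
 proof
  fix u show "indicator {0..t} u *\<^sub>R f u = indicator {0..t} u* f 0"
   using assms by (cases "u = 0") (auto simp: indicator_def)
 qed
 moreover have "measure lborel {0..t} = 0" using assms by (cases "t = 0") auto
 ultimately show ?thesis by (simp add: slint_def)
qed

text \<open>On paths nonnegative at the dyadic points the exponent is a Riemann sum. Otherwise a
  negative dyadic value is seen on every finer grid and the discrete weight is eventually 0.\<close>

lemma killed_grid_limit:
 assumes f: "rcll f" and t: "0 <= t"
 shows "(%m. killed (1/2^m) l ka (%k. f (real k/2^m)) (grid_floor m t))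
  ----> exp (- l* t)* killed_area ka f t"
proof (cases "grid_nonneg f t")
 case True
 have e: "killed (1/2^m) l ka (%k. f (real k/2^m)) (grid_floor m t)
   = exp (- (l*(real (grid_floor m t)/2^m)+ka*((\<Sum>j<grid_floor m t. f (real j/2^m))/2^m)))" for m
 proof -
  have "0 <= f (real j/2^m)" if "j <= grid_floor m t" for j
  proof -
   have "real j/2^m <= real (grid_floor m t)/2^m" using that by (simp add: divide_right_mono)
   also have "... <= t" by (rule grid_floor_bounds(1)[OF t])
   finally show ?thesis using True by (simp add: grid_nonneg_def)
  qed
  thus ?thesis
   by (simp add: killed_def sum.distrib sum_distrib_left[symmetric] add_divide_distrib mult.commute)
 qed
 have lim: "(%m. (\<Sum>j<grid_floor m t. f (real j/2^m))/2^m) ----> (LBINT u:{0..t}. f u)"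
 proof (cases "t = 0")
  case True
  thus ?thesis using set_integral_Icc_nonpos[of 0 f] by (simp add: grid_floor_def)
 next
  case False
  thus ?thesis using rcll_riemann_sums[OF f, of t] t by simp
 qed
 have "(%m. killed (1/2^m) l ka (%k. f (real k/2^m)) (grid_floor m t))
  ----> exp (- (l* t+ka*(LBINT u:{0..t}. f u)))"
  unfolding e by (intro tendsto_intros lim grid_floor_tendsto[OF t])
 thus ?thesis using True by (simp add: killed_area_def exp_add[symmetric])
next
 case False
 then obtain m0 j where j: "real j/2^m0 <= t" "f (real j/2^m0) < 0"
  unfolding grid_nonneg_def by (meson not_le)
 have "killed (1/2^m) l ka (%k. f (real k/2^m)) (grid_floor m t) = 0" if m: "m0 <= m" for m
 proof -
  have "(2::real)^m = 2^(m-m0)*2^m0" using m by (simp add: power_add[symmetric])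
  hence "real (j*2^(m-m0))/2^m = real j/2^m0" by simp
  hence "f (real (j*2^(m-m0))/2^m) < 0" using j by simp
  hence "\<not> (\<forall>i\<le>grid_floor m t. 0 <= f (real i/2^m))" using le_grid_floor[OF j(1) m] by (meson not_le)
  thus ?thesis unfolding killed_def by (rule if_not_P)
 qed
 hence "eventually (%m. killed (1/2^m) l ka (%k. f (real k/2^m)) (grid_floor m t) = 0) sequentially"
  unfolding eventually_sequentially by blast
 thus ?thesis using False by (simp add: killed_area_def tendsto_eventually)
qed

lemma killed_area_bounds:
 assumes "rcll f" "no_down_jumps f" "0 <= ka" "0 <= t"
 shows "0 <= killed_area ka f t" "killed_area ka f t <= 1" (is ?g1)
proof -
 show ?g1
 proof (cases "grid_nonneg f t")
  case True
  hence "0 <= f s" if "0 <= s" "s <= t" for s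
   using nonneg_on_grid_imp_nonneg[OF assms(1,2,4) _ that] unfolding grid_nonneg_def by blast
  hence "0 <= (LBINT u:{0..t}. f u)"
   unfolding slint_def by (intro integral_nonneg_AE) (auto simp: indicator_def)
  thus ?thesis using assms by (simp add: killed_area_def)
 qed (simp add: killed_area_def)
qed (simp add: killed_area_def)

section \<open>The stable process and its killed semigroup\<close>

locale normalized_stable = stable_levy_process_no_neg_jumps +
 assumes alpha: "1 < \<alpha>" "\<alpha> <= 2"
  and normalization: "!!u::real. char (distr M borel (L 1)) u =
     exp ((\<i>* of_real u) powr of_real \<alpha> * exp (- \<i>* of_real (pi * \<alpha> * sgn u)))"
begin

lemma rv [measurable]: "0 <= t ==> L t \<in> borel_measurable M" by (rule random_variable_L)

text \<open>For u > 0 the argument al pi/2 of (i u)^al is turned by - al pi into - al pi/2, that of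
  (- i u)^al, and symmetrically for u < 0. So the exponent is the boundary value of z^al at z = - i
  u.\<close>

lemma char_L1: "char (distr M borel (L 1)) u = exp ((- \<i>* of_real u) powr of_real \<alpha>)"
proof -
 have "(\<i>* of_real u) powr of_real \<alpha> * exp (- \<i>* of_real (pi * \<alpha> * sgn u)) = (- \<i>* of_real u) powr of_real \<alpha>"
 proof -
  have e: "exp (- \<i>* of_real x) = cis (- x)" for x by (simp add: cis_conv_exp)
  consider "u = 0" | "0 < u" | "u < 0" by linarith
  thus ?thesis
  proof cases
   case 2
   have i: "\<i>* of_real u = of_real u* cis ((pi/2))" "- \<i>* of_real u = of_real u* cis (- (pi/2))"
    by (simp_all add: cis.ctr complex_eq_iff)
   have p: "(of_real u* cis ((pi/2))) powr of_real \<alpha> = of_real (u powr \<alpha>)* cis (\<alpha> * ((pi/2)))"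
    by (rule powr_rcis) (use 2 pi_gt_zero in linarith)+
   have p': "(of_real u* cis (- (pi/2))) powr of_real \<alpha> = of_real (u powr \<alpha>)* cis (\<alpha> * (- (pi/2)))"
    by (rule powr_rcis) (use 2 pi_gt_zero in linarith)+
   show ?thesis unfolding e i p p' using 2 by (simp add: cis_mult mult.assoc algebra_simps)
  next
   case 3
   have i: "\<i>* of_real u = of_real (- u)* cis (- (pi/2))" "- \<i>* of_real u = of_real (- u)* cis ((pi/2))"
    by (simp_all add: cis.ctr complex_eq_iff)
   have p: "(of_real (- u)* cis (- (pi/2))) powr of_real \<alpha> = of_real ((- u) powr \<alpha>)* cis (\<alpha> * (- (pi/2)))"
    by (rule powr_rcis) (use 3 pi_gt_zero in linarith)+
   have p': "(of_real (- u)* cis ((pi/2))) powr of_real \<alpha> = of_real ((- u) powr \<alpha>)* cis (\<alpha> * ((pi/2)))"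
    by (rule powr_rcis) (use 3 pi_gt_zero in linarith)+
   show ?thesis unfolding e i p p' using 3 by (simp add: cis_mult mult.assoc algebra_simps)
  qed simp
 qed
 thus ?thesis unfolding normalization by simp
qed

lemma L_distr:
 assumes t: "0 < t" shows "distr M borel (L t) = distr M borel (%om. t powr (1 / \<alpha>)* L 1 om)"
proof -
 have m: "(%om. \<lambda>s\<in>{0..}. L (t* s) om) \<in> measurable M (\<Pi>\<^sub>M s\<in>{0::real..}. borel)"
  "(%om. \<lambda>s\<in>{0..}. t powr (1 / \<alpha>)* L s om) \<in> measurable M (\<Pi>\<^sub>M s\<in>{0::real..}. borel)"
  using t by (auto intro!: measurable_restrict)
 have c: "(%f. f 1) \<in> measurable (\<Pi>\<^sub>M s\<in>{0::real..}. borel) (borel :: real measure)"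
  by (rule measurable_component_singleton) simp
 have "distr (distr M (\<Pi>\<^sub>M s\<in>{0::real..}. borel) (%om. \<lambda>s\<in>{0..}. L (t* s) om)) borel (%f. f 1)
   = distr (distr M (\<Pi>\<^sub>M s\<in>{0::real..}. borel) (%om. \<lambda>s\<in>{0..}. t powr (1 / \<alpha>)* L s om)) borel (%f. f 1)"
  unfolding scaling[OF t] ..
 thus ?thesis unfolding distr_distr[OF c m(1)] distr_distr[OF c m(2)] by (simp add: o_def)
qed

text \<open>\<open>laplace_of_char\<close> settles t = 1, and scaling of the marginal law the rest,
  since (c z)^al = t z^al for c = t^(1/al).\<close>

lemma laplace_L:
 assumes t: "0 < t" and z: "0 < Re z"
 shows "integrable M (%om. exp (- (z* of_real (L t om))))" (is ?g1)
  "(LINT om|M. exp (- (z* of_real (L t om)))) = exp (of_real t* z powr of_real \<alpha>)" (is ?g2)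
proof -
 have rd: "real_distribution (distr M borel (L 1))" by (rule real_distribution_distr) simp
 note L1 = laplace_of_char[OF rd alpha char_L1]
 define c where "c = t powr (1 / \<alpha>)"
 have c: "0 < c" using t by (simp add: c_def)
 have cz: "0 < Re (of_real c* z)" using c z by simp
 have em[measurable]: "(%x. exp (- (z* complex_of_real x))) \<in> borel_measurable borel" by measurable
 have 1: "integrable M (%om. exp (- (z* of_real (c* L 1 om))))"
  using L1(1)[OF cz] by (subst (asm) integrable_distr_eq) (auto simp: mult_ac)
 have 2: "(LINT om|M. exp (- (z* of_real (c* L 1 om)))) = exp ((of_real c* z) powr of_real \<alpha>)"
  using L1(2)[OF cz] by (subst (asm) integral_distr) (auto simp: mult_ac)
 have 3: "(of_real c* z) powr of_real \<alpha> = of_real t* z powr of_real \<alpha>"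
 proof -
  have z0: "z ~= 0" using z by auto
  have "Ln (of_real c* z) = of_real (ln c)+Ln z" using Ln_times_of_real[OF c z0] Ln_of_real[OF c] by simp
  moreover have "\<alpha> * ln c = ln t" using alpha t by (simp add: c_def ln_powr)
  hence "of_real \<alpha> * complex_of_real (ln c) = of_real (ln t)" by (metis of_real_mult)
  ultimately show ?thesis using c z0 t
   by (simp add: powr_def distrib_left exp_add exp_of_real[symmetric] del: of_real_mult)
    (simp add: exp_of_real)
 qed
 have "integrable M (%om. exp (- (z* of_real (L t om)))) \<longleftrightarrow> integrable (distr M borel (L t)) (%x. exp (- (z* of_real x)))"
  using t by (subst integrable_distr_eq) auto
 also have "... \<longleftrightarrow> integrable M (%om. exp (- (z* of_real (c* L 1 om))))"
  unfolding L_distr[OF t] c_def by (subst integrable_distr_eq) auto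
 finally show ?g1 using 1 by simp
 have "(LINT om|M. exp (- (z* of_real (L t om)))) = (\<integral>x. exp (- (z* of_real x)) \<partial>distr M borel (L t))"
  using t by (subst integral_distr) auto
 also have "... = (LINT om|M. exp (- (z* of_real (c* L 1 om))))"
  unfolding L_distr[OF t] c_def by (subst integral_distr) auto
 finally show ?g2
  unfolding 2 3 .
qed

definition increment :: "nat => nat => 'a => real" where
 "increment m i om = L (real (Suc i)/2^m) om-L (real i/2^m) om"

lemma exp_walk_increment: "exp_walk M (increment m) \<alpha> (1/2^m)"
proof
 show "indep_vars (%_. borel) (increment m) {..<n}" for n
  unfolding increment_def[abs_def]
  by (rule indep_increments[where s = "%i. real i/2^m"]) (auto simp: mono_on_def divide_right_mono)
 have d: "distr M borel (increment m i) = distr M borel (L (1/2^m))" for i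
 proof -
  have "real (Suc i)/2^m-real i/2^m = 1/2^m" by (simp add: diff_divide_distrib[symmetric])
  moreover have "real i/2^m <= real (Suc i)/2^m" by (intro divide_right_mono) auto
  ultimately show ?thesis
   unfolding increment_def[abs_def] using stationary_increments[of "real i/2^m" "real (Suc i)/2^m"] by simp
 qed
 have m: "increment m i \<in> borel_measurable M" for i unfolding increment_def[abs_def] by measurable
 have h: "(0::real) < 1/2^m" by simp
 fix i and s :: complex assume s: "0 < Re s"
 have em[measurable]: "(%x. exp (- (s* complex_of_real x))) \<in> borel_measurable borel" by measurable
 have "integrable M (%om. exp (- (s* of_real (increment m i om)))) \<longleftrightarrow> integrable (distr M borel (increment m i)) (%x. exp (- (s* of_real x)))"
  using m by (subst integrable_distr_eq) auto
 also have "... \<longleftrightarrow> integrable M (%om. exp (- (s* of_real (L (1/2^m) om))))"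
  unfolding d by (subst integrable_distr_eq) auto
 finally show "integrable M (%om. exp (- (s* of_real (increment m i om))))" using laplace_L(1)[OF h s] by simp
 have "(LINT om|M. exp (- (s* of_real (increment m i om)))) = (\<integral>x. exp (- (s* of_real x)) \<partial>distr M borel (increment m i))"
  using m by (subst integral_distr) auto
 also have "... = (LINT om|M. exp (- (s* of_real (L (1/2^m) om))))"
  unfolding d by (subst integral_distr) auto
 finally show "(LINT om|M. exp (- (s* of_real (increment m i om)))) = exp (of_real (1/2^m)* s powr of_real \<alpha>)"
  unfolding laplace_L(2)[OF h s] .
qed (use alpha in auto)

text \<open>\<open>max 0\<close> continues the path as a constant to negative times, so that
  \<open>rcll\<close> applies.\<close>

definition started :: "real => 'a => real => real" where
 "started y om t = y+L (max 0 t) om"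

lemma started_measurable [measurable]: "(%om. started y om t) \<in> borel_measurable M"
 unfolding started_def by measurable

lemma started_rcll: "om \<in> space M ==> rcll (started y om)"
proof -
 assume "om \<in> space M"
 hence "rcll (%t. L (max 0 t) om)" by (intro rcll_clamp_half_line cadlag)
 note r = rcll_right[OF this] rcll_left[OF this]
 have "\<exists>l. (started y om ---> l) (at_left t)" for t
 proof -
  obtain l where "((%t. L (max 0 t) om) ---> l) (at_left t)" using r(2) by blast
  from tendsto_add[OF tendsto_const this] show ?thesis unfolding started_def[abs_def] by blast
 qed
 thus "rcll (started y om)"
  unfolding rcll_def using tendsto_add[OF tendsto_const r(1)] by (simp add: started_def[abs_def])
qed

text \<open>One null set serves all starting points y, as it does in \<open>started_0\<close> and
  \<open>walk_started\<close>.\<close>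

lemma started_no_down_jumps: "AE om in M. \<forall>y. no_down_jumps (started y om)"
 using no_neg_jumps
proof eventually_elim
 case (elim om)
 show ?case unfolding no_down_jumps_def
 proof (intro allI impI)
  fix y t l :: real assume t: "0 < t" and l: "(started y om ---> l) (at_left t)"
  have "((%s. started y om s-y) ---> l-y) (at_left t)" by (intro tendsto_diff l tendsto_const)
  moreover have "eventually (%s. started y om s-y = L s om) (at_left t)"
   using eventually_at_left_real[OF t] by (rule eventually_mono) (simp add: started_def)
  ultimately have "((%s. L s om) ---> l-y) (at_left t)" by (rule Lim_transform_eventually)
  hence "l-y <= L t om" using elim t by blast
  thus "l <= started y om t" using t by (simp add: started_def)
 qed
qed

lemma started_0: "AE om in M. \<forall>y. started y om 0 = y"
 using start_0 by eventually_elim (simp add: started_def)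

lemma walk_started:
 "AE om in M. \<forall>y m. walk y (%i. increment m i om) = (%k. started y om (real k/2^m))"
 using start_0
proof eventually_elim
 case (elim om)
 have "(\<Sum>i<k. increment m i om) = L (real k/2^m) om-L 0 om" for m k
  unfolding increment_def using sum_lessThan_telescope[of "%i. L (real i/2^m) om" k] by simp
 thus ?case using elim by (simp add: walk_def started_def fun_eq_iff)
qed

lemma killed_area_measurable [measurable]: "(%om. killed_area ka (started y om) t) \<in> borel_measurable M"
proof -
 have "(%om. LBINT u:{0..t}. started y om u) \<in> borel_measurable M"
 proof (cases "0 < t")
  case True
  show ?thesis
   by (rule borel_measurable_LIMSEQ_real[where u = "%m om. (\<Sum>j<grid_floor m t. started y om (real j/2^m))/2^m"])
    (use rcll_riemann_sums[OF started_rcll True] in auto)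
 next
  case False
  thus ?thesis by (simp add: set_integral_Icc_nonpos)
 qed
 thus ?thesis unfolding killed_area_def grid_nonneg_def by measurable
qed

text \<open>The killed semigroup applied to the constant 1: a survival probability for ka = 0, the
  area-weighted one for ka = 1, survival meaning nonnegativity up to t.\<close>

definition Q :: "real => real => real => real" where
 "Q ka y t = (LINT om|M. killed_area ka (started y om) t)"

lemma killed_area_AE:
 assumes "0 <= ka" "0 <= t"
 shows "AE om in M. 0 <= killed_area ka (started y om) t & killed_area ka (started y om) t <= 1"
 using started_no_down_jumps AE_space
 by eventually_elim (use killed_area_bounds[OF started_rcll _ assms] in blast)

lemma killed_area_integrable: "0 <= ka ==> 0 <= t ==> integrable M (%om. killed_area ka (started y om) t)"
 by (rule integrable_const_bound[of _ 1]) (use killed_area_AE[of ka t y] in \<open>auto elim: eventually_mono\<close>)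

lemma Q_bounds: assumes "0 <= ka" "0 <= t" shows "0 <= Q ka y t" "Q ka y t <= 1"
proof -
 show "0 <= Q ka y t" unfolding Q_def
  using killed_area_AE[OF assms, of y] by (intro integral_nonneg_AE) (auto elim: eventually_mono)
 have "Q ka y t <= (LINT om|M. 1)" unfolding Q_def
  using killed_area_AE[OF assms, of y] killed_area_integrable[OF assms]
  by (intro integral_mono_AE) (auto elim: eventually_mono)
 thus "Q ka y t <= 1" by (simp add: prob_space)
qed

text \<open>The sum over grid times is the integral of a step function of t whose values converge by
  \<open>killed_grid_limit\<close>. The factor \<open>bet\<close> covers both the plain sum and the
  one weighted by \<open>kernel_mean\<close>.\<close>

lemma grid_sum_limit:
 assumes l: "0 <= l" and k: "0 <= ka" and bm[measurable]: "!!m. bet m \<in> borel_measurable borel"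
  and bC: "!!m x. 0 <= x ==> \<bar>bet m x\<bar> <= C"
  and b1: "!!x R. (!!m. 0 <= x m) ==> (!!m. x m <= R) ==> (%m. bet m (x m)) ----> (1::real)"
 shows "(%m. 1/2^m*(\<Sum>k<T*2^m. \<integral>om. killed (1/2^m) l ka (walk y (%i. increment m i om)) k* bet m (walk y (%i. increment m i om) k) \<partial>M))
   ----> (LBINT t:{0..<real T}. exp (- l* t)* Q ka y t)" (is ?g1)
  "sint {0..<real T} (%t. exp (- l* t)* Q ka y t)" (is ?g2)
proof -
 have C0: "0 <= C" using bC[of 0 0] by simp
 define a where "a = (%m k. \<integral>om. killed (1/2^m) l ka (walk y (%i. increment m i om)) k* bet m (walk y (%i. increment m i om) k) \<partial>M)"
 have pw: "\<bar>killed (1/2^m) l ka x k* bet m (x k)\<bar> <= C" for m x k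
 proof (cases "killed (1/2^m) l ka x k = 0")
  case False
  hence "0 <= x k" by (rule killed_nz) simp
  moreover have "killed (1/2^m) l ka x k <= exp (- (1/2^m)* l* real k)" by (rule killed_bound) (use k in auto)
  moreover have "exp (- (1/2^m)* l* real k) <= 1" using l by simp
  ultimately have "0 <= x k" "killed (1/2^m) l ka x k <= 1" by linarith+
  hence "killed (1/2^m) l ka x k*\<bar>bet m (x k)\<bar> <= 1* C"
   using bC[of "x k" m] by (intro mult_mono) (auto simp: killed_nonneg)
  thus ?thesis by (simp add: abs_mult killed_nonneg)
 qed (use C0 in simp)
 have wm[measurable]: "(%om. walk y (%i. increment m i om) k) \<in> borel_measurable M"
  "(%om. killed (1/2^m) l ka (walk y (%i. increment m i om)) k) \<in> borel_measurable M" for m k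
 proof -
  interpret W: exp_walk M "increment m" \<alpha> "1/2^m" by (rule exp_walk_increment)
  show "(%om. walk y (%i. increment m i om) k) \<in> borel_measurable M"
   "(%om. killed (1/2^m) l ka (walk y (%i. increment m i om)) k) \<in> borel_measurable M" by measurable
 qed
 have ab: "\<bar>a m k\<bar> <= C" for m k
 proof -
  have "norm (a m k) <= (LINT om|M. C)" unfolding a_def
   by (rule order_trans[OF integral_norm_bound integral_mono]) (use pw C0 in \<open>auto intro!: integrable_const_bound[of _ C]\<close>)
  thus ?thesis by (simp add: prob_space)
 qed
 have alim: "(%m. a m (grid_floor m t)) ----> exp (- l* t)* Q ka y t" if t: "0 <= t" for t
  unfolding a_def Q_def integral_mult_right_zero[symmetric]
 proof (rule integral_dominated_convergence[where w = "%_. C"])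
  show "AE om in M. (%m. killed (1/2^m) l ka (walk y (%i. increment m i om)) (grid_floor m t)* bet m (walk y (%i. increment m i om) (grid_floor m t)))
    ----> exp (- l* t)* killed_area ka (started y om) t"
   using walk_started AE_space
  proof eventually_elim
   case (elim om)
   let ?f = "started y om"
   have f: "rcll ?f" using elim by (simp add: started_rcll)
   have "0 < t+1" using t by simp
   then obtain B where B: "0 <= B" "!!s. 0 <= s ==> s <= t+1 ==> \<bar>?f s\<bar> <= B" using rcll_bounded[OF f] by blast
   define x where "x = (%m. ?f (real (grid_floor m t)/2^m))"
   have xB: "\<bar>x m\<bar> <= B" for m
    unfolding x_def using grid_floor_bounds(1)[OF t, of m] by (intro B(2)) auto
   \<comment> \<open>\<open>bet\<close> is controlled only at nonnegative arguments; where x m is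
     negative the killed weight is 0 anyway.\<close>
   have "(%m. bet m (max 0 (x m))) ----> 1"
    by (rule b1[of _ B]) (use xB B in \<open>auto simp: abs_le_iff\<close>)
   hence "(%m. killed (1/2^m) l ka (%k. ?f (real k/2^m)) (grid_floor m t)* bet m (max 0 (x m)))
     ----> (exp (- l* t)* killed_area ka ?f t)*1"
    by (intro tendsto_mult killed_grid_limit[OF f t])
   moreover have "killed (1/2^m) l ka (%k. ?f (real k/2^m)) (grid_floor m t)* bet m (max 0 (x m))
     = killed (1/2^m) l ka (%k. ?f (real k/2^m)) (grid_floor m t)* bet m (x m)" for m
    using killed_nz[of "1/2^m" l ka "%k. ?f (real k/2^m)" "grid_floor m t" "grid_floor m t"]
    by (cases "killed (1/2^m) l ka (%k. ?f (real k/2^m)) (grid_floor m t) = 0") (auto simp: x_def max_def)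
   ultimately have "(%m. killed (1/2^m) l ka (%k. ?f (real k/2^m)) (grid_floor m t)* bet m (x m))
     ----> exp (- l* t)* killed_area ka ?f t" by (simp only: mult_1_right)
   thus ?case using elim by (simp add: x_def)
  qed
 qed (use pw C0 in auto)
 have st: "has_bochner_integral lborel (%u. indicator {0..<real T} u *\<^sub>R a m (grid_floor m u)) ((1/2^m) *\<^sub>R (\<Sum>k<T*2^m. a m k))" for m
  using step_function_integral[of "1/2^m" "T*2^m" "a m"] by (simp add: grid_floor_def)
 have stm: "(%u. indicator {0..<real T} u *\<^sub>R a m (grid_floor m u)) \<in> borel_measurable lborel" for m
  using borel_measurable_integrable[OF integrable.intros[OF st]] .
 have ptw: "(%m. indicator {0..<real T} u *\<^sub>R a m (grid_floor m u)) ----> indicator {0..<real T} u *\<^sub>R (exp (- l* u)* Q ka y u)" for u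
  using alim[of u] by (auto simp: indicator_def)
 have qm: "(%u. indicator {0..<real T} u *\<^sub>R (exp (- l* u)* Q ka y u)) \<in> borel_measurable lborel"
  by (rule borel_measurable_LIMSEQ_real[OF ptw stm])
 have wi: "integrable lborel (%u. indicator {0..<real T} u *\<^sub>R C)"
  by (intro integrable_scaleR_left) (auto intro!: integrable_real_indicator)
 have nb: "AE u in lborel. norm (indicator {0..<real T} u *\<^sub>R a m (grid_floor m u)) <= indicator {0..<real T} u *\<^sub>R C" for m
  using ab by (auto simp: indicator_def)
 have "(%m. \<integral>u. indicator {0..<real T} u *\<^sub>R a m (grid_floor m u) \<partial>lborel) ----> (LINT u|lborel. indicator {0..<real T} u *\<^sub>R (exp (- l* u)* Q ka y u))"
  by (rule integral_dominated_convergence[where s = "%m u. indicator {0..<real T} u *\<^sub>R a m (grid_floor m u)", OF qm stm wi _ nb]) (use ptw in auto)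
 thus ?g1
  unfolding has_bochner_integral_integral_eq[OF st] slint_def by (simp add: a_def)
 show ?g2
  unfolding set_integrable_def by (rule integrable_dominated_convergence[where s = "%m u. indicator {0..<real T} u *\<^sub>R a m (grid_floor m u)", OF qm stm wi _ nb]) (use ptw in auto)
qed

end

section \<open>The resolvent of the killed process\<close>

lemma set_integrable_exp_neg_scaled:
 assumes c: "0 < c" shows "sint {0..} (%u::real. exp (- c* u))"
proof (rule set_integrable_bound[OF poly_exp_integrable[OF c]])
 show "set_borel_measurable lborel {0..} (%u::real. exp (- c* u))" unfolding set_borel_measurable_def by measurable
 have "exp (- c* u) <= (1+u)^4* exp (- (c* u))" if "0 <= u" for u :: real
  using that mult_right_mono[of 1 "(1+u)^4" "exp (- (c* u))"] by (simp add: one_le_power)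
 thus "AE u in lborel. u \<in> {0..} --> norm (exp (- c* u)) <= norm ((1+u)^4* exp (- (c* u)))"
  by (auto intro: order_trans[OF _ abs_ge_self])
qed

context normalized_stable
begin

abbreviation "gpath m y om \<equiv> walk y (%i. increment m i om)"

text \<open>Measurability of Q in t is inherited from the step functions of
  \<open>grid_sum_limit\<close>; the horizon T then tends to infinity under the majorant exp (- l
  t).\<close>

lemma Q_laplace_integrable:
 assumes l: "0 < l" and k: "0 <= ka"
 shows "sint {0..} (%t. exp (- l* t)* Q ka y t)"
  "(%T. LBINT t:{0..<real T}. exp (- l* t)* Q ka y t) ----> (LBINT t:{0..}. exp (- l* t)* Q ka y t)"
proof -
 let ?f = "%t. exp (- l* t)* Q ka y t"
 have b1: "!!x R. (!!m. 0 <= x m) ==> (!!m. x m <= R) ==> (%m. (%_. 1) (x m)) ----> (1::real)" by simp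
 have i: "sint {0..<real T} ?f" for T
  by (rule grid_sum_limit(2)[where bet = "%_ _. 1" and C = 1]) (use l k in auto)
 have lim: "(%T. indicator {0..<real T} t *\<^sub>R ?f t) ----> indicator {0..} t *\<^sub>R ?f t" for t
 proof -
  obtain N where N: "t < real N" using reals_Archimedean2 by blast
  have "eventually (%T. indicator {0..<real T} t *\<^sub>R ?f t = indicator {0..} t *\<^sub>R ?f t) sequentially"
   using eventually_ge_at_top[of N]
  proof eventually_elim
   case (elim T)
   hence "real N <= real T" by simp
   thus ?case using N by (auto simp: indicator_def)
  qed
  thus ?thesis by (rule tendsto_eventually)
 qed
 have m: "(%t. indicator {0..<real T} t *\<^sub>R ?f t) \<in> borel_measurable lborel" for T
  using borel_measurable_integrable i by (simp add: set_integrable_def)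
 have mm: "(%t. indicator {0..} t *\<^sub>R ?f t) \<in> borel_measurable lborel"
  by (rule borel_measurable_LIMSEQ_real[OF lim m])
 have wi: "integrable lborel (%t. indicator {0..} t *\<^sub>R exp (- l* t))"
  using set_integrable_exp_neg_scaled[OF l] by (simp add: set_integrable_def)
 have qb: "\<bar>?f t\<bar> <= exp (- l* t)" if "0 <= t" for t
  using Q_bounds[OF k that, of y] by (simp add: abs_mult mult_left_le)
 have nb: "AE t in lborel. norm (indicator {0..<real T} t *\<^sub>R ?f t) <= indicator {0..} t *\<^sub>R exp (- l* t)" for T
  using qb by (auto simp: indicator_def)
 note dc = mm m wi AE_I2[OF lim] nb
 show "sint {0..} ?f" unfolding set_integrable_def
  by (rule integrable_dominated_convergence[where s = "%T t. indicator {0..<real T} t *\<^sub>R ?f t", OF dc])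
 show "(%T. LBINT t:{0..<real T}. ?f t) ----> (LBINT t:{0..}. ?f t)" unfolding slint_def
  by (rule integral_dominated_convergence[where s = "%T t. indicator {0..<real T} t *\<^sub>R ?f t", OF dc])
qed

text \<open>The undershoot tends to 0 almost surely by \<open>undershoot_tendsto_0\<close>, and its
  exponential moments are bounded uniformly in m, so the expectation converges as well. The explicit
  bound in s later serves as a majorant along the ray.\<close>

lemma exit_error:
 fixes s :: complex and y :: real and T :: nat
 assumes y: "0 < y"
 defines "sg \<equiv> (%m s. \<integral>om. norm (exp (s* of_real (undershoot (gpath m y om) (T*2^m)))-1) \<partial>M)"
 shows "(%m. sg m s) ----> 0" (is ?g1) "sg m s <= 2+exp (norm s powr \<alpha> * real T)"
  "integrable M (%om. norm (exp (s* of_real (undershoot (gpath m y om) (T*2^m)))-1))" (is ?g2)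
proof -
 define U where "U = (%m om. undershoot (gpath m y om) (T*2^m))"
 define Y where "Y = (%m om. norm (exp (s* of_real (U m om))-1))"
 have U0: "0 <= U m om" for m om unfolding U_def by (rule undershoot_nonneg)
 have Um[measurable]: "U m \<in> borel_measurable M" for m
 proof -
  interpret W: exp_walk M "increment m" \<alpha> "1/2^m" by (rule exp_walk_increment)
  show ?thesis unfolding U_def by (rule W.undershoot_measurable)
 qed
 have mom: "integrable M (%om. exp (p* U m om))" "(LINT om|M. exp (p* U m om)) <= 1+exp (p powr \<alpha> * real T)" if "0 < p" for p m
 proof -
  interpret W: exp_walk M "increment m" \<alpha> "1/2^m" by (rule exp_walk_increment)
  show "integrable M (%om. exp (p* U m om))" "(LINT om|M. exp (p* U m om)) <= 1+exp (p powr \<alpha> * real T)"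
   unfolding U_def using W.undershoot_exp_moment[OF that less_imp_le[OF y], of "T*2^m"] by simp_all
 qed
 have Yb: "Y m om <= 1+exp (norm s* U m om)" for m om
 proof -
  have "Re s* U m om <= norm s* U m om" using U0 complex_Re_le_cmod by (intro mult_right_mono) auto
  hence "norm (exp (s* of_real (U m om))) <= exp (norm s* U m om)" unfolding norm_exp_eq_Re by simp
  thus ?thesis unfolding Y_def using norm_triangle_ineq4[of "exp (s* of_real (U m om))" 1, unfolded norm_one] by linarith
 qed
 show ?g2
  "sg m s <= 2+exp (norm s powr \<alpha> * real T)"
 proof -
  have i: "integrable M (Y m) & (LINT om|M. Y m om) <= 2+exp (norm s powr \<alpha> * real T)"
  proof (cases "s = 0")
   case False
   hence s: "0 < norm s" by simp
   have i2: "integrable M (%om. 1+exp (norm s* U m om))" using mom(1)[OF s] by simp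
   have Yi: "integrable M (Y m)"
    by (rule Bochner_Integration.integrable_bound[OF i2]) (use Yb in \<open>auto simp: Y_def intro: order_trans[OF _ abs_ge_self]\<close>)
   have "(LINT om|M. Y m om) <= (LINT om|M. 1+exp (norm s* U m om))" by (rule integral_mono[OF Yi i2 Yb])
   also have "... = 1+(LINT om|M. exp (norm s* U m om))" using mom(1)[OF s] by (simp add: prob_space)
   finally show ?thesis using mom(2)[OF s, of m] Yi by simp
  qed (simp add: Y_def)
  thus ?g2
   "sg m s <= 2+exp (norm s powr \<alpha> * real T)" by (auto simp: sg_def Y_def[abs_def] U_def)
 qed
 define p where "p = norm s+1"
 have p: "0 < 2* p" by (simp add: p_def add_nonneg_pos)
 have sq: "(Y m om)\<^sup>2 <= 4* exp (2* p* U m om)" for m om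
 proof -
  have "norm s* U m om <= p* U m om" using U0 by (intro mult_right_mono) (auto simp: p_def)
  hence "exp (norm s* U m om) <= exp (p* U m om)" by simp
  moreover have "0 <= p* U m om" using U0 p by simp
  hence "1 <= exp (p* U m om)" by simp
  ultimately have "Y m om <= 2* exp (p* U m om)" using Yb[of m om] by linarith
  hence "(Y m om)\<^sup>2 <= (2* exp (p* U m om))\<^sup>2" by (intro power_mono) (auto simp: Y_def)
  also have "... = 4* exp (2* p* U m om)" by (simp add: power2_eq_square exp_add[symmetric])
  finally show ?thesis .
 qed
 have "(%m. \<integral>om. Y m om \<partial>M) ----> 0"
 proof (rule expectation_tendsto_0[where C = "4*(1+exp ((2* p) powr \<alpha> * real T))"])
  show "Y m \<in> borel_measurable M" for m unfolding Y_def by measurable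
  show "AE om in M. (%m. Y m om) ----> 0"
   using walk_started started_no_down_jumps started_0 AE_space
  proof eventually_elim
   case (elim om)
   have "(%m. undershoot (%k. started y om (real k/2^m)) (T*2^m)) ----> 0"
    by (rule undershoot_tendsto_0) (use elim y started_rcll in auto)
   hence u: "(%m. U m om) ----> 0" using elim by (simp add: U_def)
   have "(%m. norm (exp (s* of_real (U m om))-1)) ----> norm (exp (s* of_real 0)-1)"
    by (intro tendsto_intros u)
   thus ?case by (simp add: Y_def)
  qed
  show si: "integrable M (%om. (Y m om)\<^sup>2)" for m
  proof (rule Bochner_Integration.integrable_bound)
   show "integrable M (%om. 4* exp (2* p* U m om))" using mom(1)[OF p] by simp
  qed (use sq in \<open>auto simp: Y_def\<close>)
  show "(LINT om|M. (Y m om)\<^sup>2) <= 4*(1+exp ((2* p) powr \<alpha> * real T))" for m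
  proof -
   have "(LINT om|M. (Y m om)\<^sup>2) <= (LINT om|M. 4* exp (2* p* U m om))"
    by (rule integral_mono[OF si _ sq]) (use mom(1)[OF p] in simp)
   also have "... <= 4*(1+exp ((2* p) powr \<alpha> * real T))" using mom(2)[OF p, of m] by simp
   finally show ?thesis .
  qed
 qed (simp add: Y_def)
 thus ?g1 by (simp add: sg_def Y_def U_def)
qed

text \<open>Up to the mass alive at the horizon, at most exp (- l T), and the effect of the
  undershoot, the left side of \<open>dynkin\<close> is the expected discount at the exit, which
  does not depend on s.\<close>

lemma exited_error:
 assumes y: "0 < y" and l: "0 <= l" "0 <= ka" and s: "0 < Re s \<or> s = 0"
 shows "norm ((LINT om|M. of_real (killed (1/2^m) l ka (gpath m y om) (T*2^m))* exp (- (s* of_real (gpath m y om (T*2^m)))))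
   + (LINT om|M. of_real (exited (1/2^m) l ka (gpath m y om) (T*2^m))* exp (s* of_real (undershoot (gpath m y om) (T*2^m))))
   - of_real (LINT om|M. exited (1/2^m) l ka (gpath m y om) (T*2^m)))
  <= exp (- l* real T)+(LINT om|M. norm (exp (s* of_real (undershoot (gpath m y om) (T*2^m)))-1))"
  "0 <= (LINT om|M. exited (1/2^m) l ka (gpath m y om) (T*2^m))"
  "(LINT om|M. exited (1/2^m) l ka (gpath m y om) (T*2^m)) <= 1"
proof -
 interpret W: exp_walk M "increment m" \<alpha> "1/2^m" by (rule exp_walk_increment)
 let ?n = "T*2^m"
 let ?K = "%om. killed (1/2^m) l ka (gpath m y om) ?n" and ?E = "%om. exited (1/2^m) l ka (gpath m y om) ?n"
 let ?U = "%om. undershoot (gpath m y om) ?n" and ?X = "%om. gpath m y om ?n"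
 have rs: "0 <= Re s" using s by auto
 have E1: "?E om <= 1" for om
  using killed_exited_le_1[of "1/2^m" ka l "gpath m y om" ?n] killed_nonneg[of "1/2^m" l ka "gpath m y om" ?n] l by simp
 have Ei: "integrable M ?E"
  by (rule integrable_const_bound[of _ 1]) (use E1 exited_nonneg in auto)
 show "0 <= (LINT om|M. ?E om)" by (intro integral_nonneg_AE) (simp add: exited_nonneg)
 have "(LINT om|M. ?E om) <= (LINT om|M. 1)" by (intro integral_mono Ei E1) simp
 thus "(LINT om|M. ?E om) <= 1" by (simp add: prob_space)
 have 1: "norm (LINT om|M. of_real (?K om)* exp (- (s* of_real (?X om)))) <= exp (- l* real T)"
 proof -
  have b: "norm (of_real (?K om)* exp (- (s* of_real (?X om)))) <= exp (- l* real T)" for om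
   using W.killed_exp_bound(2)[OF l rs, of "gpath m y om" ?n] by simp
  have "norm (LINT om|M. of_real (?K om)* exp (- (s* of_real (?X om)))) <= (LINT om|M. exp (- l* real T))"
   by (rule order_trans[OF integral_norm_bound integral_mono]) (use b W.killed_integrable[OF l rs] in auto)
  thus ?thesis by (simp add: prob_space)
 qed
 have Bi: "integrable M (%om. of_real (?E om)* exp (s* of_real (?U om)))" by (rule W.dynkin(1)[OF l s less_imp_le[OF y]])
 have 2: "norm ((LINT om|M. of_real (?E om)* exp (s* of_real (?U om))) - of_real (LINT om|M. ?E om))
   <= (LINT om|M. norm (exp (s* of_real (?U om))-1))"
 proof -
  have Ec: "integrable M (%om. complex_of_real (?E om))" using Ei by (simp add: complex_of_real_integrable_eq)
  have eq: "(LINT om|M. of_real (?E om)* exp (s* of_real (?U om))) - of_real (LINT om|M. ?E om)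
    = (LINT om|M. of_real (?E om)* exp (s* of_real (?U om)) - of_real (?E om))"
   unfolding integral_complex_of_real[symmetric] by (rule Bochner_Integration.integral_diff[OF Bi Ec, symmetric])
  show ?thesis unfolding eq
  proof (rule order_trans[OF integral_norm_bound integral_mono])
   show "integrable M (%om. norm (of_real (?E om)* exp (s* of_real (?U om)) - of_real (?E om)))"
    by (rule integrable_norm[OF Bochner_Integration.integrable_diff[OF Bi Ec]])
   show "integrable M (%om. norm (exp (s* of_real (?U om))-1))" by (rule exit_error(3)[OF y])
   fix om
   have "of_real (?E om)* exp (s* of_real (?U om)) - of_real (?E om) = of_real (?E om)*(exp (s* of_real (?U om))-1)"
    by (simp add: algebra_simps)
   hence "norm (of_real (?E om)* exp (s* of_real (?U om)) - of_real (?E om)) = ?E om* norm (exp (s* of_real (?U om))-1)"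
    by (simp add: norm_mult exited_nonneg)
   also have "... <= 1* norm (exp (s* of_real (?U om))-1)" by (intro mult_right_mono E1) simp
   finally show "norm (of_real (?E om)* exp (s* of_real (?U om)) - of_real (?E om)) <= norm (exp (s* of_real (?U om))-1)" by simp
  qed
 qed
 show "norm ((LINT om|M. of_real (?K om)* exp (- (s* of_real (?X om))))+(LINT om|M. of_real (?E om)* exp (s* of_real (?U om)))
   - of_real (LINT om|M. ?E om)) <= exp (- l* real T)+(LINT om|M. norm (exp (s* of_real (?U om))-1))"
  using norm_triangle_mono[OF 1 2] by (simp only: add_diff_eq)
qed

text \<open>Two exponents are compared: s = q^(1/al), for which the one-step defects vanish, and s =
  0, for which they add up to the survival transform. Both yield the same expected discount at the
  exit, so subtracting eliminates it.\<close>

lemma survival_laplace: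
 assumes y: "0 < y" and q: "0 < q"
 shows "(LBINT t:{0..}. exp (- q* t)* Q 0 y t) = (1-exp (- (y* q powr (1 / \<alpha>))))/q"
proof -
 define r where "r = q powr (1 / \<alpha>)"
 have r: "0 < r" "r powr \<alpha> = q" using q alpha by (auto simp: r_def powr_powr)
 define a where "a = (%m T. 1/2^m*(\<Sum>k<T*2^m. \<integral>om. killed (1/2^m) q 0 (gpath m y om) k*1 \<partial>M))"
 have alim: "(%m. a m T) ----> (LBINT t:{0..<real T}. exp (- q* t)* Q 0 y t)" for T
  unfolding a_def by (rule grid_sum_limit(1)[where bet = "%_ _. 1" and C = 1]) (use q in auto)
 have fin: "\<bar>1-exp (- (r* y))-q*(LBINT t:{0..<real T}. exp (- q* t)* Q 0 y t)\<bar> <= 2* exp (- q* real T)" for T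
 proof -
  let ?sg = "%m. \<integral>om. norm (exp (of_real r* of_real (undershoot (gpath m y om) (T*2^m)))-1 :: complex) \<partial>M"
  have b: "\<bar>1-exp (- (r* y))-(1-exp (- (q/2^m)))*2^m* a m T\<bar> <= 2* exp (- q* real T)+?sg m" for m
  proof -
   interpret W: exp_walk M "increment m" \<alpha> "1/2^m" by (rule exp_walk_increment)
   let ?s = "complex_of_real r" and ?n = "T*2^m"
   have s: "0 < Re ?s \<or> ?s = 0" "0 < Re 0 \<or> (0::complex) = 0" using r by auto
   have q0: "0 <= q" "(0::real) <= 0" using q by auto
   have sp: "?s powr of_real \<alpha> = of_real q" using r by (simp add: powr_of_real)
   define c where "c = (%k. \<integral>om. killed (1/2^m) q 0 (gpath m y om) k \<partial>M)"
   note e1 = exited_error(1)[OF y q0 s(1), of m T, unfolded W.dynkin(2)[OF q0 s(1) less_imp_le[OF y]]]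
   note e2 = exited_error(1)[OF y q0 s(2), of m T, unfolded W.dynkin(2)[OF q0 s(2) less_imp_le[OF y]]]
   let ?E = "complex_of_real (LINT om|M. exited (1/2^m) q 0 (gpath m y om) ?n)"
   have 1: "norm (of_real (exp (- (r* y)))-?E) <= exp (- q* real T)+?sg m"
    using e1 by (simp add: sp exp_of_real[symmetric])
   have 2: "norm (1 + of_real ((exp (- (q/2^m))-1)*(\<Sum>k<?n. c k))-?E) <= exp (- q* real T)"
   proof -
    have "(LINT om|M. of_real (killed (1/2^m) q 0 (gpath m y om) k)*(exp (of_real (1/2^m)*(0 - of_real q))-1))
      = complex_of_real ((exp (- (q/2^m))-1)* c k)" for k
    proof -
     have "exp (complex_of_real (1/2^m)*(0 - of_real q))-1 = of_real (exp (- (q/2^m))-1)"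
      by (simp add: exp_of_real[symmetric])
     thus ?thesis
      unfolding of_real_mult[symmetric] integral_complex_of_real integral_mult_left_zero c_def
      by (simp only: of_real_mult[symmetric] integral_complex_of_real integral_mult_left_zero mult.commute)
    qed
    thus ?thesis using e2 alpha by (simp add: sum_distrib_left)
   qed
   have le: "norm ((1 + of_real ((exp (- (q/2^m))-1)*(\<Sum>k<?n. c k))-?E)-(of_real (exp (- (r* y)))-?E))
     <= exp (- q* real T)+(exp (- q* real T)+?sg m)"
    by (rule order_trans[OF norm_triangle_ineq4 add_mono[OF 2 1]])
   have eq: "(1 + of_real ((exp (- (q/2^m))-1)*(\<Sum>k<?n. c k))-?E)-(of_real (exp (- (r* y)))-?E)
     = complex_of_real (1-exp (- (r* y))-(1-exp (- (q/2^m)))*2^m* a m T)"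
   proof -
    have h: "(1-exp (- (q/2^m)))*2^m* a m T = (1-exp (- (q/2^m)))*(\<Sum>k<?n. c k)"
     by (simp add: a_def c_def)
    show ?thesis unfolding h by (simp add: algebra_simps)
   qed
   show ?thesis using le unfolding eq norm_of_real by simp
  qed
  have "(%m. (1-exp (- (q/2^m)))*2^m) ----> q" using q by real_asymp
  hence 1: "(%m. \<bar>1-exp (- (r* y))-(1-exp (- (q/2^m)))*2^m* a m T\<bar>)
   ----> \<bar>1-exp (- (r* y))-q*(LBINT t:{0..<real T}. exp (- q* t)* Q 0 y t)\<bar>"
   by (intro tendsto_intros alim)
  have 2: "(%m. 2* exp (- q* real T)+?sg m) ----> 2* exp (- q* real T)+0"
   by (intro tendsto_intros exit_error(1)[OF y])
  show ?thesis using LIMSEQ_le[OF 1 2] b by auto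
 qed
 have 1: "(%T. \<bar>1-exp (- (r* y))-q*(LBINT t:{0..<real T}. exp (- q* t)* Q 0 y t)\<bar>)
   ----> \<bar>1-exp (- (r* y))-q*(LBINT t:{0..}. exp (- q* t)* Q 0 y t)\<bar>"
  by (intro tendsto_intros Q_laplace_integrable(2)) (use q in auto)
 have "(%T. 2* exp (- q* real T)) ----> 0" using q by real_asymp
 from LIMSEQ_le[OF 1 this] fin
 have "\<bar>1-exp (- (r* y))-q*(LBINT t:{0..}. exp (- q* t)* Q 0 y t)\<bar> <= 0" by auto
 thus ?thesis using q by (simp add: r_def field_simps mult.commute)
qed

text \<open>\<open>dynkin\<close> with ka = 1 is integrated over the ray: the start gives H (l + y),
  the one-step defects give minus the resolvent by \<open>ray_one_step\<close>, and the exit gives B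
  times H l with B in [0,1]. Convergence of B need not be shown: the segment is closed, so
  approximation by its points suffices.\<close>

lemma resolvent:
 assumes y: "0 < y" and l: "0 < l"
 shows "Hray \<alpha> 0 (of_real (l+y)) - of_real (LBINT t:{0..}. exp (- l* t)* Q 1 y t) \<in> closed_segment 0 (Hray \<alpha> 0 (of_real l))"
proof -
 let ?H = "Hray \<alpha> 0 (of_real (l+y))" and ?Hl = "Hray \<alpha> 0 (of_real l)"
 let ?G = "%T. LBINT t:{0..<real T}. exp (- l* t)* Q 1 y t"
 define C where "C = 2*(LBINT r:{0..}. ray_bound \<alpha> 4 r)"
 define K where "K = (LBINT r:{0..}. ray_weight \<alpha> r)"
 define w where "w = ray_measure_density \<alpha> l"
 let ?s = "%r. of_real r* ray_dir \<alpha>"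
 note rd = ray_dir_facts[OF alpha(1)]
 have l0: "0 <= l" "(0::real) <= 1" using l by auto
 have ns: "norm (?s r) = r" if "0 <= r" for r using rd that by (simp add: norm_mult)
 have s0: "0 < Re (?s r) \<or> ?s r = 0" if "0 <= r" for r using rd that by (cases "r = 0") auto
 have rwi: "sint {0..} (ray_weight \<alpha>)"
  using ray_bound_integrable[OF alpha(1), of 0] by (simp add: ray_bound_def[abs_def])
 define S where "S = (%m T. 1/2^m*(\<Sum>k<T*2^m. \<integral>om. killed (1/2^m) l 1 (gpath m y om) k* kernel_mean \<alpha> (1/2^m) (l+gpath m y om k) \<partial>M))"
 define B where "B = (%m T. \<integral>om. exited (1/2^m) l 1 (gpath m y om) (T*2^m) \<partial>M)"
 define sg where "sg = (%T m r. \<integral>om. norm (exp (?s r* of_real (undershoot (gpath m y om) (T*2^m)))-1) \<partial>M)"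
 have km[measurable]: "(%x. kernel_mean \<alpha> (1/2^m) (l+x)) \<in> borel_measurable borel" for m
  unfolding kernel_mean_def slint_def by measurable
 have Slim: "(%m. S m T) ----> ?G T" for T
  unfolding S_def
 proof (rule grid_sum_limit(1)[where bet = "%m x. kernel_mean \<alpha> (1/2^m) (l+x)" and C = "exp 1"])
  show "\<bar>kernel_mean \<alpha> (1/2^m) (l+x)\<bar> <= exp 1" if "0 <= x" for m x
   by (rule kernel_mean_bounds(2)[OF alpha(1)]) (use that l in auto)
  show "(%m. kernel_mean \<alpha> (1/2^m) (l+x m)) ----> 1" if x: "!!m. 0 <= x m" "!!m. x m <= R" for x R
  proof (rule Lim_transform2[OF tendsto_const Lim_null_comparison])
   show "eventually (%m. norm (1-kernel_mean \<alpha> (1/2^m) (l+x m)) <= exp (1/2^m*(1+(l+R)))-1) sequentially"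
   proof (intro always_eventually allI)
    fix m
    have "\<bar>kernel_mean \<alpha> (1/2^m) (l+x m)-1\<bar> <= exp (1/2^m*(1+(l+x m)))-1"
     by (rule kernel_mean_bounds(1)[OF alpha(1)]) (use x[of m] l in auto)
    also have "... <= exp (1/2^m*(1+(l+R)))-1" using x(2)[of m] by (simp add: divide_right_mono)
    finally show "norm (1-kernel_mean \<alpha> (1/2^m) (l+x m)) <= exp (1/2^m*(1+(l+R)))-1"
     by (simp add: abs_minus_commute)
   qed
   define c where "c = 1+(l+R)"
   have "(%m::nat. 1/2^m :: real) ----> 0" by real_asymp
   hence "(%m. exp (1/2^m* c)-1) ----> exp (0* c)-1" by (intro tendsto_intros)
   thus "(%m. exp (1/2^m*(1+(l+R)))-1) ----> 0" by (simp add: c_def)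
  qed
 qed (use l km in auto)
 have sgm: "sg T m \<in> borel_measurable lborel" for T m
 proof -
  interpret W: exp_walk M "increment m" \<alpha> "1/2^m" by (rule exp_walk_increment)
  define U where "U = (%om. undershoot (gpath m y om) (T*2^m))"
  have [measurable]: "U \<in> borel_measurable M" unfolding U_def by (rule W.undershoot_measurable)
  have "(%(r, om). norm (exp (?s r* of_real (U om))-1)) \<in> borel_measurable (lborel \<Otimes>\<^sub>M M)" by measurable
  from borel_measurable_lebesgue_integral[OF this] show ?thesis unfolding sg_def U_def .
 qed
 \<comment> \<open>The moment bound grows like exp (T r^al), which the ray weight still
   beats.\<close>
 have sgb: "ray_weight \<alpha> r* sg T m r <= 3* ray_bound \<alpha> (real T) r" if r: "0 <= r" for T m r
 proof -
  have "sg T m r <= 2+exp (r powr \<alpha> * real T)" unfolding sg_def using exit_error(2)[OF y, where m = m and T = T and s = "?s r"] ns[OF r] by simp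
  also have "... <= 3* exp (real T*(1+r) powr \<alpha>)"
  proof -
   have "r powr \<alpha> * real T <= (1+r) powr \<alpha> * real T" using r alpha by (intro mult_right_mono powr_mono2) auto
   hence "exp (r powr \<alpha> * real T) <= exp (real T*(1+r) powr \<alpha>)" by (simp add: mult.commute)
   moreover have "1 <= exp (real T*(1+r) powr \<alpha>)" by simp
   ultimately show ?thesis by linarith
  qed
  finally have "ray_weight \<alpha> r* sg T m r <= ray_weight \<alpha> r*(3* exp (real T*(1+r) powr \<alpha>))"
   by (intro mult_left_mono) (auto simp: ray_weight_def)
  thus ?thesis by (simp add: ray_bound_def mult_ac)
 qed
 have sg0: "0 <= sg T m r" for T m r unfolding sg_def by (intro integral_nonneg_AE) auto
 have rw0: "0 <= ray_weight \<alpha> r" for r by (simp add: ray_weight_def)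
 have rwm[measurable]: "ray_weight \<alpha> \<in> borel_measurable borel" unfolding ray_weight_def[abs_def] by measurable
 have bi: "integrable lborel (%r. indicator {0..} r *\<^sub>R (3* ray_bound \<alpha> (real T) r))" for T
  using set_integrable_mult_right[OF ray_bound_integrable[OF alpha(1)], of 3 "real T"] by (simp add: set_integrable_def)
 have sgnb: "norm (indicator {0..} r *\<^sub>R (ray_weight \<alpha> r* sg T m r)) <= indicator {0..} r *\<^sub>R (3* ray_bound \<alpha> (real T) r)" for T m r
  using sgb[of r T m] sg0[of T m r] rw0[of r] by (auto simp: indicator_def abs_mult)
 have sgi: "sint {0..} (%r. ray_weight \<alpha> r* sg T m r)" for T m
  unfolding set_integrable_def
 proof (rule Bochner_Integration.integrable_bound[OF bi[of T]])
  show "(%r. indicator {0..} r *\<^sub>R (ray_weight \<alpha> r* sg T m r)) \<in> borel_measurable lborel" using sgm[of T m] by simp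
  show "AE r in lborel. norm (indicator {0..} r *\<^sub>R (ray_weight \<alpha> r* sg T m r)) <= norm (indicator {0..} r *\<^sub>R (3* ray_bound \<alpha> (real T) r))"
   by (intro AE_I2, rule order_trans[OF sgnb]) (simp only: real_norm_def abs_ge_self)
 qed
 have sglim: "(%m. LBINT r:{0..}. ray_weight \<alpha> r* sg T m r) ----> 0" for T
 proof -
  have "(%m. \<integral>r. indicator {0..} r *\<^sub>R (ray_weight \<alpha> r* sg T m r) \<partial>lborel) ----> integral\<^sup>L lborel (%r::real. 0)"
  proof (rule integral_dominated_convergence[where w = "%r. indicator {0..} r *\<^sub>R (3* ray_bound \<alpha> (real T) r)"])
   show "integrable lborel (%r. indicator {0..} r *\<^sub>R (3* ray_bound \<alpha> (real T) r))" by (rule bi)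
   show "(%r. indicator {0..} r *\<^sub>R (ray_weight \<alpha> r* sg T m r)) \<in> borel_measurable lborel" for m using sgm[of T m] by simp
   show "AE r in lborel. (%m. indicator {0..} r *\<^sub>R (ray_weight \<alpha> r* sg T m r)) ----> 0"
   proof (intro AE_I2)
    fix r
    have "(%m. sg T m r) ----> 0" unfolding sg_def by (rule exit_error(1)[OF y])
    from tendsto_mult[OF tendsto_const[of "indicator {0..} r* ray_weight \<alpha> r"] this]
    show "(%m. indicator {0..} r *\<^sub>R (ray_weight \<alpha> r* sg T m r)) ----> 0" by (simp add: mult.assoc)
   qed
  qed (use sgnb in auto)
  thus ?thesis by (simp add: slint_def)
 qed
 \<comment> \<open>The errors in order: mass alive at the horizon T, undershoot, and T 2^m one-step
   errors of size C / 4^m each.\<close>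
 have main: "norm (?H - of_real (S m T) - of_real (B m T)*?Hl)
   <= K* exp (- l* real T)+(LBINT r:{0..}. ray_weight \<alpha> r* sg T m r)+real T* C*(1/2^m)" for m T
 proof -
  interpret W: exp_walk M "increment m" \<alpha> "1/2^m" by (rule exp_walk_increment)
  let ?dt = "1/2^m :: real" and ?n = "T*2^m"
  have d: "0 < ?dt" "?dt <= 1" by auto
  define X where "X = (%k om. gpath m y om k)"
  define Kd where "Kd = (%k om. killed ?dt l 1 (gpath m y om) k)"
  have Xm[measurable]: "X k \<in> borel_measurable M" for k unfolding X_def by (rule W.path_measurable)
  have Km[measurable]: "Kd k \<in> borel_measurable M" for k unfolding Kd_def by (rule W.killed_measurable)
  have K1: "0 <= Kd k om" "Kd k om <= 1" for k om
   using killed_exited_le_1[of ?dt 1 l "gpath m y om" k] exited_nonneg[of ?dt l 1 "gpath m y om" k] l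
   by (auto simp: Kd_def killed_nonneg)
  have KX: "Kd k om = 0 \<or> 0 <= X k om" for k om using killed_nz[of ?dt l 1 "gpath m y om" k k] by (auto simp: Kd_def X_def)
  define D where "D = (%x. LBINT r:{0..}. w r* exp_step \<alpha> ?dt l (?s r) x)"
  define F where "F = (%k r. \<integral>om. of_real (Kd k om)* exp_step \<alpha> ?dt l (?s r) (X k om) \<partial>M)"
  \<comment> \<open>Fubini moves the ray integral inside the expectation; the weight vanishes unless
    X k is nonnegative, which is where \<open>exp_step_bound\<close> holds.\<close>
  have fub: "sint {0..} (%r. w r* F k r)" "(LBINT r:{0..}. w r* F k r) = (LINT om|M. of_real (Kd k om)* D (X k om))" for k
  proof -
   let ?f = "%r om. indicator {0..} r *\<^sub>R (w r*(of_real (Kd k om)* exp_step \<alpha> ?dt l (?s r) (X k om)))"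
   have fm: "(%(r, om). ?f r om) \<in> borel_measurable (lborel \<Otimes>\<^sub>M M)"
    unfolding w_def exp_step_def by measurable
   have hi: "integrable lborel (%r. indicator {0..} r *\<^sub>R (2* ray_bound \<alpha> 1 r))"
    using set_integrable_mult_right[OF ray_bound_integrable[OF alpha(1)], of 2 1] by (simp add: set_integrable_def)
   have nb: "norm (?f r om) <= indicator {0..} r *\<^sub>R (2* ray_bound \<alpha> 1 r)" for r om
   proof (cases "0 <= r & Kd k om ~= 0")
    case True
    hence x: "0 <= X k om" using KX by auto
    have "norm (?f r om) = Kd k om* norm (w r* exp_step \<alpha> ?dt l (?s r) (X k om))"
     using True K1[of k om] by (simp add: norm_mult)
    also have "... <= 1*(2* ray_bound \<alpha> 1 r)"
     unfolding w_def using exp_step_bound[OF alpha(1) less_imp_le[OF d(1)] d(2) l0(1) x, of r] True K1[of k om]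
     by (intro mult_mono) auto
    finally show ?thesis using True by simp
   next
    case False
    thus ?thesis by (auto simp: indicator_def ray_bound_def ray_weight_def)
   qed
   note DF = dominated_Fubini[OF fm hi nb]
   have 1: "(LINT om|M. ?f r om) = indicator {0..} r *\<^sub>R (w r* F k r)" for r
    unfolding F_def by (simp only: integral_scaleR_right integral_mult_right_zero)
   have 2: "(LINT r|lborel. ?f r om) = of_real (Kd k om)* D (X k om)" for om
   proof -
    have "?f r om = of_real (Kd k om)*(indicator {0..} r *\<^sub>R (w r* exp_step \<alpha> ?dt l (?s r) (X k om)))" for r
     by (simp add: mult_ac)
    thus ?thesis unfolding D_def slint_def by (simp only: integral_mult_right_zero)
   qed
   show "sint {0..} (%r. w r* F k r)" using DF(1) unfolding 1 set_integrable_def .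
   show "(LBINT r:{0..}. w r* F k r) = (LINT om|M. of_real (Kd k om)* D (X k om))"
    using DF(2) unfolding 1 2 slint_def .
  qed
  have wE: "w r* exp (- (?s r* of_real z)) = ray_dir \<alpha> * (exp (- (of_real r* ray_dir \<alpha> * of_real (l+z)))* of_real (ray_weight \<alpha> r))" for r z
  proof -
   have "exp (- (of_real r* ray_dir \<alpha> * of_real l))* exp (- (of_real r* ray_dir \<alpha> * of_real z)) = exp (- (of_real r* ray_dir \<alpha> * of_real (l+z)))"
    by (simp add: exp_add[symmetric] algebra_simps)
   thus ?thesis unfolding w_def ray_measure_density_def by (simp only: mult_ac)
  qed
  have wi: "sint {0..} (%r. w r* exp (- (?s r* of_real z)))" "(LBINT r:{0..}. w r* exp (- (?s r* of_real z))) = Hray \<alpha> 0 (of_real (l+z))" for z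
   unfolding wE Hray_def using Hray_integrable[OF alpha(1), of 0 "of_real (l+z)"] by simp_all
  have wi0: "sint {0..} w" "(LBINT r:{0..}. w r) = ?Hl" using wi[of 0] by simp_all
  define R where "R = (%r. exp (- (?s r* of_real y))+(\<Sum>k<?n. F k r) - of_real (B m T))"
  have Rb: "norm (R r) <= exp (- l* real T)+sg T m r" if r: "0 <= r" for r
  proof -
   note e = exited_error(1)[OF y l0 s0[OF r], of m T, unfolded W.dynkin(2)[OF l0 s0[OF r] less_imp_le[OF y]]]
   thus ?thesis
    unfolding R_def F_def B_def sg_def exp_step_def Kd_def X_def mult_1_right .
  qed
  have Rw: "w r* R r = w r* exp (- (?s r* of_real y))+(\<Sum>k<?n. w r* F k r) - of_real (B m T)* w r" for r
   unfolding R_def by (simp add: algebra_simps sum_distrib_left)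
  have si: "sint {0..} (%r. \<Sum>k<?n. w r* F k r)" unfolding set_integrable_def scaleR_sum_right
   by (rule Bochner_Integration.integrable_sum) (use fub in \<open>simp add: set_integrable_def\<close>)
  have Rwi: "sint {0..} (%r. w r* R r)" unfolding Rw
   by (rule set_integral_diff(1)[OF set_integral_add(1)[OF wi(1)[of y] si] set_integrable_mult_right[OF wi0(1)]])
  have RwI: "(LBINT r:{0..}. w r* R r) = ?H+(\<Sum>k<?n. \<integral>om. of_real (Kd k om)* D (X k om) \<partial>M) - of_real (B m T)*?Hl"
  proof -
   have sI: "(LBINT r:{0..}. (\<Sum>k<?n. w r* F k r)) = (\<Sum>k<?n. LBINT r:{0..}. w r* F k r)"
    unfolding slint_def scaleR_sum_right
    by (rule Bochner_Integration.integral_sum) (use fub in \<open>simp add: set_integrable_def\<close>)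
   show ?thesis unfolding Rw
    by (subst set_integral_diff(2)[OF set_integral_add(1)[OF wi(1)[of y] si] set_integrable_mult_right[OF wi0(1)]],
      subst set_integral_add(2)[OF wi(1)[of y] si]) (simp only: sI fub(2) wi(2)[of y] set_integral_mult_right wi0(2))
  qed
  have RwB: "norm (LBINT r:{0..}. w r* R r) <= K* exp (- l* real T)+(LBINT r:{0..}. ray_weight \<alpha> r* sg T m r)"
  proof -
   have "norm (LBINT r:{0..}. w r* R r) <= (LBINT r:{0..}. exp (- l* real T)* ray_weight \<alpha> r+ray_weight \<alpha> r* sg T m r)"
    unfolding slint_def
   proof (rule order_trans[OF integral_norm_bound integral_mono])
    show "integrable lborel (%r. norm (indicator {0..} r *\<^sub>R (w r* R r)))" using Rwi unfolding set_integrable_def by (rule integrable_norm)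
    show "integrable lborel (%r. indicator {0..} r *\<^sub>R (exp (- l* real T)* ray_weight \<alpha> r+ray_weight \<alpha> r* sg T m r))"
     using set_integral_add(1)[OF set_integrable_mult_right[OF rwi] sgi] unfolding set_integrable_def .
    fix r
    show "norm (indicator {0..} r *\<^sub>R (w r* R r)) <= indicator {0..} r *\<^sub>R (exp (- l* real T)* ray_weight \<alpha> r+ray_weight \<alpha> r* sg T m r)"
    proof (cases "0 <= r")
     case True
     have "norm (w r)* norm (R r) <= ray_weight \<alpha> r*(exp (- l* real T)+sg T m r)"
      unfolding w_def using ray_measure_density_bound[OF alpha(1) l0(1) True] Rb[OF True] rw0 by (intro mult_mono) auto
     thus ?thesis using True by (simp add: norm_mult algebra_simps)
    qed simp
   qed
   also have "... = (LBINT r:{0..}. exp (- l* real T)* ray_weight \<alpha> r)+(LBINT r:{0..}. ray_weight \<alpha> r* sg T m r)"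
    by (rule set_integral_add(2)[OF set_integrable_mult_right[OF rwi] sgi])
   finally show ?thesis by (simp add: K_def mult.commute)
  qed
  have DB: "norm ((\<Sum>k<?n. \<integral>om. of_real (Kd k om)* D (X k om) \<partial>M) + of_real (S m T)) <= real T* C*?dt"
  proof -
   have C0: "norm (of_real (Kd k om)* D (X k om) + of_real (?dt*(Kd k om* kernel_mean \<alpha> ?dt (l+X k om)))) <= ?dt\<^sup>2* C" for k om
   proof (cases "Kd k om = 0")
    case True
    have "0 <= (LBINT r:{0..}. ray_bound \<alpha> 4 r)" unfolding slint_def
     by (intro integral_nonneg_AE) (auto simp: ray_bound_def ray_weight_def)
    thus ?thesis using True by (simp add: C_def)
   next
    case False
    hence x: "0 <= X k om" using KX by blast
    have "of_real (Kd k om)* D (X k om) + of_real (?dt*(Kd k om* kernel_mean \<alpha> ?dt (l+X k om)))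
     = of_real (Kd k om)*(D (X k om) + of_real (?dt* kernel_mean \<alpha> ?dt (l+X k om)))" by (simp add: algebra_simps)
    hence "norm (of_real (Kd k om)* D (X k om) + of_real (?dt*(Kd k om* kernel_mean \<alpha> ?dt (l+X k om))))
     = Kd k om* norm (D (X k om) + of_real (?dt* kernel_mean \<alpha> ?dt (l+X k om)))"
     using K1(1)[of k om] by (simp only: norm_mult norm_of_real abs_of_nonneg)
    also have "... <= 1*(?dt\<^sup>2* C)"
     unfolding D_def w_def C_def using K1[of k om] ray_one_step[OF alpha d l0(1) x] by (intro mult_mono) auto
    finally show ?thesis by simp
   qed
   have Di: "integrable M (%om. of_real (Kd k om)* D (X k om))" "integrable M (%om. complex_of_real (?dt*(Kd k om* kernel_mean \<alpha> ?dt (l+X k om))))" for k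
   proof -
    have Dm[measurable]: "D \<in> borel_measurable borel" unfolding D_def w_def exp_step_def slint_def by measurable
    have kb: "norm (complex_of_real (?dt*(Kd k om* kernel_mean \<alpha> ?dt (l+X k om)))) <= exp 1" for om
    proof (cases "Kd k om = 0")
     case False
     hence x: "0 <= l+X k om" using KX[of k om] l by auto
     have "\<bar>?dt\<bar>*(\<bar>Kd k om\<bar>*\<bar>kernel_mean \<alpha> ?dt (l+X k om)\<bar>) <= 1*(1* exp 1)"
      using kernel_mean_bounds(2)[OF alpha(1) d x] d K1[of k om] by (intro mult_mono) auto
     thus ?thesis unfolding norm_of_real abs_mult by simp
    qed simp
    show 2: "integrable M (%om. complex_of_real (?dt*(Kd k om* kernel_mean \<alpha> ?dt (l+X k om))))"
     by (rule integrable_const_bound[of _ "exp 1"]) (use kb in \<open>simp_all only: AE_I2\<close>, measurable)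
    have "integrable M (%om. of_real (Kd k om)* D (X k om) + of_real (?dt*(Kd k om* kernel_mean \<alpha> ?dt (l+X k om))))"
     by (rule integrable_const_bound[of _ "?dt\<^sup>2* C"]) (use C0 in \<open>simp_all only: AE_I2\<close>, measurable)
    from Bochner_Integration.integrable_diff[OF this 2] show "integrable M (%om. of_real (Kd k om)* D (X k om))" by simp
   qed
   have Ss: "complex_of_real (S m T) = (\<Sum>k<?n. \<integral>om. complex_of_real (?dt*(Kd k om* kernel_mean \<alpha> ?dt (l+X k om))) \<partial>M)"
    unfolding S_def Kd_def X_def integral_complex_of_real by (simp only: integral_mult_right_zero sum_distrib_left of_real_sum)
   have "norm ((LINT om|M. of_real (Kd k om)* D (X k om))+(LINT om|M. complex_of_real (?dt*(Kd k om* kernel_mean \<alpha> ?dt (l+X k om))))) <= ?dt\<^sup>2* C" for k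
   proof -
    have "norm (LINT om|M. of_real (Kd k om)* D (X k om)+complex_of_real (?dt*(Kd k om* kernel_mean \<alpha> ?dt (l+X k om)))) <= (LINT om|M. ?dt\<^sup>2* C)"
     by (rule order_trans[OF integral_norm_bound integral_mono[OF integrable_norm[OF Bochner_Integration.integrable_add[OF Di]] _ C0]]) simp
    thus ?thesis unfolding Bochner_Integration.integral_add[OF Di] by (simp add: prob_space)
   qed
   hence "norm (\<Sum>k<?n. (LINT om|M. of_real (Kd k om)* D (X k om))+(LINT om|M. complex_of_real (?dt*(Kd k om* kernel_mean \<alpha> ?dt (l+X k om))))) <= real (card {..<?n})*(?dt\<^sup>2* C)"
    by (intro sum_norm_bound)
   also have "... = real T* C*?dt" by (simp add: power2_eq_square)
   finally show ?thesis unfolding Ss sum.distrib .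
  qed
  have "?H - of_real (S m T) - of_real (B m T)*?Hl = (LBINT r:{0..}. w r* R r)
    - ((\<Sum>k<?n. \<integral>om. of_real (Kd k om)* D (X k om) \<partial>M) + of_real (S m T))"
   unfolding RwI by simp
  thus ?thesis using order_trans[OF norm_triangle_ineq4 add_mono[OF RwB DB]] by (simp only:)
 qed
 have B01: "0 <= B m T" "B m T <= 1" for m T unfolding B_def by (rule exited_error(2,3)[OF y l0, of 0]; simp)+
 \<comment> \<open>T is chosen first, for the mass at the horizon and the truncated time integral,
   and then m depending on T.\<close>
 have near: "\<exists>e\<in>{0..1}. norm ((?H - of_real (LBINT t:{0..}. exp (- l* t)* Q 1 y t)) - of_real e*?Hl) < ep" if ep: "0 < ep" for ep
 proof -
  let ?I = "LBINT t:{0..}. exp (- l* t)* Q 1 y t"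
  have "(%T. K* exp (- l* real T)) ----> K*0" using l by (intro tendsto_mult tendsto_const) real_asymp
  hence 1: "eventually (%T. K* exp (- l* real T) < ep/4) sequentially" by (rule order_tendstoD(2)) (use ep in simp)
  have 2: "eventually (%T. dist (?G T) ?I < ep/4) sequentially" by (rule tendstoD[OF Q_laplace_integrable(2)[OF l l0(2)]]) (use ep in simp)
  obtain T where T: "K* exp (- l* real T) < ep/4" "dist (?G T) ?I < ep/4"
   using eventually_happens[OF eventually_conj[OF 1 2]] by auto
  have "(%m. (LBINT r:{0..}. ray_weight \<alpha> r* sg T m r)+real T* C*(1/2^m)) ----> 0+real T* C*0"
   by (intro tendsto_add sglim tendsto_mult tendsto_const) real_asymp
  hence 3: "eventually (%m. (LBINT r:{0..}. ray_weight \<alpha> r* sg T m r)+real T* C*(1/2^m) < ep/4) sequentially"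
   by (rule order_tendstoD(2)) (use ep in simp)
  have 4: "eventually (%m. dist (S m T) (?G T) < ep/4) sequentially" by (rule tendstoD[OF Slim]) (use ep in simp)
  obtain m where m: "(LBINT r:{0..}. ray_weight \<alpha> r* sg T m r)+real T* C*(1/2^m) < ep/4" "dist (S m T) (?G T) < ep/4"
   using eventually_happens[OF eventually_conj[OF 3 4]] by auto
  have "dist (S m T) ?I < ep/4+ep/4" by (rule dist_triangle_less_add[OF m(2)]) (use T(2) in \<open>simp add: dist_commute\<close>)
  hence SI: "norm (complex_of_real (S m T) - of_real ?I) < ep/2" by (simp add: dist_norm flip: of_real_diff)
  have "norm (?H - of_real (S m T) - of_real (B m T)*?Hl) < ep/2" using main[of m T] T(1) m(1) by linarith
  from norm_add_less[OF this SI] have "norm ((?H - of_real ?I) - of_real (B m T)*?Hl) < ep" by (simp add: algebra_simps)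
  thus ?thesis using B01 by (intro bexI[of _ "B m T"]) auto
 qed
 have "?H - of_real (LBINT t:{0..}. exp (- l* t)* Q 1 y t) \<in> closure (closed_segment 0 ?Hl)"
  unfolding closure_approachable
 proof (intro allI impI)
  fix ep :: real assume "0 < ep"
  then obtain e where e: "e \<in> {0..1}" "norm ((?H - of_real (LBINT t:{0..}. exp (- l* t)* Q 1 y t)) - of_real e*?Hl) < ep"
   using near by blast
  have "of_real e*?Hl \<in> closed_segment 0 ?Hl"
   unfolding in_segment using e(1) by (intro exI[of _ e]) (simp add: scaleR_conv_of_real)
  moreover have "dist (of_real e*?Hl) (?H - of_real (LBINT t:{0..}. exp (- l* t)* Q 1 y t)) < ep"
   using e(2) by (simp add: dist_norm norm_minus_commute)
  ultimately show "\<exists>z\<in>closed_segment 0 ?Hl. dist z (?H - of_real (LBINT t:{0..}. exp (- l* t)* Q 1 y t)) < ep" by blast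
 qed
 thus ?thesis by (simp add: closure_closed)
qed

end

section \<open>Scaling, survival asymptotics and conditioning\<close>

lemma positive_null_sequence:
 assumes "!!n. 0 < Y n" "Y ----> (0::real)"
 shows "filterlim Y (at_right 0) sequentially" (is ?g1) "filterlim Y (at 0) sequentially"
proof -
 have "Y n ~= 0" for n using assms(1)[of n] by simp
 thus ?g1 "filterlim Y (at 0) sequentially"
  using assms by (auto simp: filterlim_at)
qed

lemma gamma_laplace:
 assumes s: "0 < s" and l: "0 < (l::real)"
 shows "sint {0..} (%t. exp (- l* t)* t powr (s-1))" (is ?g1)
  "(LBINT t:{0..}. exp (- l* t)* t powr (s-1)) = Gamma s* l powr (- s)" (is ?g2)
proof -
 have "Gamma s = l*(LBINT u:{0..}. (l* u) powr (s-1)* exp (- (l* u)))"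
  using Gamma_set_integral[OF s] set_integral_half_line_scale[OF l, of "%u. u powr (s-1)* exp (- u)"] by simp
 also have "(LBINT u:{0..}. (l* u) powr (s-1)* exp (- (l* u))) = (LBINT u:{0..}. l powr (s-1)*(exp (- l* u)* u powr (s-1)))"
  by (rule set_lebesgue_integral_cong) (use l in \<open>auto simp: powr_mult\<close>)
 also have "... = l powr (s-1)*(LBINT u:{0..}. exp (- l* u)* u powr (s-1))" by (rule set_integral_mult_right)
 finally have g: "Gamma s = l powr s*(LBINT u:{0..}. exp (- l* u)* u powr (s-1))"
  using l by (simp add: powr_diff)
 thus ?g2
  using l by (simp add: powr_minus field_simps)
 \<comment> \<open>A function that is not integrable has Bochner integral 0, so the nonzero value
   proves integrability.\<close>
 have "(LBINT u:{0..}. exp (- l* u)* u powr (s-1)) ~= 0" using g Gamma_real_pos[OF s] by auto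
 thus ?g1
  unfolding set_integrable_def slint_def using not_integrable_integral_eq by blast
qed

lemma set_integral_open_half_line:
 fixes f :: "real => real"
 assumes i: "sint {0..} f"
 shows "sint {0<..} f" (is ?g1) "(LBINT t:{0<..}. f t) = (LBINT t:{0..}. f t)" (is ?g2)
proof -
 show o: ?g1 by (rule set_integrable_subset[OF i]) auto
 show ?g2 unfolding slint_def
 proof (rule integral_cong_AE)
  show "AE t in lborel. indicator {0<..} t *\<^sub>R f t = indicator {0..} t *\<^sub>R f t"
   using AE_lborel_singleton[of "0::real"] by eventually_elim (auto simp: indicator_def)
 qed (use i o in \<open>auto simp: set_integrable_def\<close>)
qed

lemma grid_nonneg_iff:
 assumes "rcll f" "no_down_jumps f" "0 <= t" shows "grid_nonneg f t \<longleftrightarrow> (\<forall>s. 0 <= s & s <= t --> 0 <= f s)"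
proof
 assume "grid_nonneg f t"
 thus "\<forall>s. 0 <= s & s <= t --> 0 <= f s"
  using nonneg_on_grid_imp_nonneg[OF assms] unfolding grid_nonneg_def by blast
qed (simp add: grid_nonneg_def)

lemma no_down_jumps_scale:
 assumes j: "no_down_jumps f" and t: "0 < t" shows "no_down_jumps (%u. f (t* u))"
 unfolding no_down_jumps_def
proof (intro allI impI)
 fix u l assume u: "0 < u" and l: "((%u. f (t* u)) ---> l) (at_left u)"
 have "((%v. v/t) ---> t* u/t) (at_left (t* u))" by (intro tendsto_intros) (use t in auto)
 hence "filterlim (%v. v/t) (at_left u) (at_left (t* u))"
  unfolding filterlim_at using t by (auto simp: eventually_at_filter field_simps)
 from filterlim_compose[OF l this] have "(f ---> l) (at_left (t* u))" using t by simp
 thus "l <= f (t* u)" using j t u unfolding no_down_jumps_def by simp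
qed

lemma killed_area_time_scale:
 assumes f: "rcll f" "no_down_jumps f" and t: "0 < t"
 shows "killed_area ka f t = killed_area (ka* t) (%u. f (t* u)) 1"
proof -
 have "grid_nonneg f t \<longleftrightarrow> grid_nonneg (%u. f (t* u)) 1"
 proof -
  have "(\<forall>s. 0 <= s & s <= t --> 0 <= f s) \<longleftrightarrow> (\<forall>s. 0 <= s & s <= 1 --> 0 <= f (t* s))"
  proof (intro iffI allI impI)
   fix s assume a: "\<forall>s. 0 <= s & s <= 1 --> 0 <= f (t* s)" and s: "0 <= s & s <= t"
   hence "0 <= f (t*(s/t))" using t by (intro a[rule_format]) auto
   thus "0 <= f s" using t by simp
  qed (use t in \<open>auto simp: mult_left_le\<close>)
  thus ?thesis
   using grid_nonneg_iff[OF f, of t] grid_nonneg_iff[OF rcll_scale[OF f(1) t] no_down_jumps_scale[OF f(2) t], of 1] t by simp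
 qed
 moreover have "(LBINT u:{0..t}. f u) = t*(LBINT u:{0..1}. f (t* u))"
 proof -
  have "indicator {0..t} (t* u) = (indicator {0..1} u :: real)" for u
   using t by (auto simp: indicator_def zero_le_mult_iff)
  thus ?thesis
   using lborel_integral_real_affine[of t "%u. indicator {0..t} u *\<^sub>R f u" 0] t by (simp add: slint_def)
 qed
 ultimately show ?thesis by (simp add: killed_area_def mult.assoc)
qed

lemma killed_area_space_scale:
 assumes "0 < c" shows "killed_area ka (%u. c* f u) t = killed_area (ka* c) f t"
 using assms by (simp add: killed_area_def grid_nonneg_def zero_le_mult_iff mult.assoc)

lemma killed_area_0: "killed_area 0 f t = of_bool (grid_nonneg f t)" by (simp add: killed_area_def)

context normalized_stable
begin

text \<open>Stated for a general family of paths because \<open>Q_scaling\<close> applies it to a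
  path rescaled in time and to one rescaled in space.\<close>

lemma killed_grid_expectation_limit:
 assumes f: "!!om. om \<in> space M ==> rcll (f om)" and k: "0 <= ka" and m[measurable]: "!!u. (%om. f om u) \<in> borel_measurable M"
  and km[measurable]: "(%om. killed_area ka (f om) 1) \<in> borel_measurable M"
 shows "(%m. \<integral>om. killed (1/2^m) 0 ka (%k. f om (real k/2^m)) (grid_floor m 1) \<partial>M) ----> (LINT om|M. killed_area ka (f om) 1)"
proof (rule integral_dominated_convergence[where w = "%_. 1"])
 show "(%om. killed (1/2^m) 0 ka (%k. f om (real k/2^m)) (grid_floor m 1)) \<in> borel_measurable M" for m
  unfolding killed_def by measurable
 show "AE om in M. norm (killed (1/2^m) 0 ka (%k. f om (real k/2^m)) (grid_floor m 1)) <= 1" for m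
  using killed_bound[of "1/2^m" ka 0 _ "grid_floor m 1"] k by (auto simp: killed_nonneg)
 show "AE om in M. (%m. killed (1/2^m) 0 ka (%k. f om (real k/2^m)) (grid_floor m 1)) ----> killed_area ka (f om) 1"
  using killed_grid_limit[OF f, of _ 1 0 ka] by auto
qed auto

text \<open>The scaling assumption equates laws on the product sigma-algebra, whereas the area
  depends on the whole path; it is therefore reached through grid functionals of finitely many
  coordinates and a limit in m.\<close>

lemma Q_scaling:
 assumes t: "0 < t" and k: "0 <= ka"
 shows "Q ka y t = Q (ka* t powr (1+1 / \<alpha>)) (y* t powr (- 1 / \<alpha>)) 1"
proof -
 define c where "c = t powr (1 / \<alpha>)"
 have c: "0 < c" using t by (simp add: c_def)
 have yc: "y* t powr (- 1 / \<alpha>) = y/c" by (simp add: c_def powr_minus divide_inverse)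
 have tc: "t powr (1+1 / \<alpha>) = t* c" using t by (simp add: c_def powr_add)
 have sc: "om \<in> space M ==> rcll (%u. started y om (t* u))" for om by (rule rcll_scale[OF started_rcll t])
 have rc: "rcll (%u. c* f u)" if fr: "rcll f" for f
 proof -
  have "\<exists>l. ((%u. c* f u) ---> l) (at_left t)" for t
  proof -
   obtain l where "(f ---> l) (at_left t)" using rcll_left[OF fr] by blast
   from tendsto_mult[OF tendsto_const this] show ?thesis by blast
  qed
  thus ?thesis unfolding rcll_def using tendsto_mult[OF tendsto_const rcll_right[OF fr]] by simp
 qed
 have AEs: "AE om in M. killed_area ka (started y om) t = killed_area (ka* t) (%u. started y om (t* u)) 1"
  using started_no_down_jumps AE_space by eventually_elim (simp add: killed_area_time_scale[OF started_rcll _ t])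
 have m1: "(%om. killed_area (ka* t) (%u. started y om (t* u)) 1) \<in> borel_measurable M"
 proof -
  have "(%om. LBINT u:{0..1}. started y om (t* u)) \<in> borel_measurable M"
   by (rule borel_measurable_LIMSEQ_real[where u = "%m om. (\<Sum>j<grid_floor m 1. started y om (t*(real j/2^m)))/2^m"])
    (use rcll_riemann_sums[OF sc, of _ 1] in auto)
  thus ?thesis unfolding killed_area_def grid_nonneg_def by measurable
 qed
 define F where "F = (%m g. killed (1/2^m) 0 (ka* t) (%k. y+g (real k/2^m)) (grid_floor m 1))"
 have Fm: "F m \<in> borel_measurable (\<Pi>\<^sub>M s\<in>{0::real..}. borel)" for m
 proof -
  have [measurable]: "(%g. g (real k/2^m)) \<in> borel_measurable (\<Pi>\<^sub>M s\<in>{0::real..}. borel)" for k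
   by (rule measurable_component_singleton) simp
  show ?thesis unfolding F_def killed_def by measurable
 qed
 have mm: "(%om. \<lambda>s\<in>{0..}. L (t* s) om) \<in> measurable M (\<Pi>\<^sub>M s\<in>{0::real..}. borel)"
  "(%om. \<lambda>s\<in>{0..}. t powr (1 / \<alpha>)* L s om) \<in> measurable M (\<Pi>\<^sub>M s\<in>{0::real..}. borel)"
  using t by (auto intro!: measurable_restrict)
 have law: "(LINT om|M. F m (\<lambda>s\<in>{0..}. L (t* s) om)) = (LINT om|M. F m (\<lambda>s\<in>{0..}. c* L s om))" for m
  using scaling[OF t] integral_distr[OF mm(1) Fm[of m]] integral_distr[OF mm(2) Fm[of m]] by (simp add: c_def)
 have Fs: "F m (\<lambda>s\<in>{0..}. L (t* s) om) = killed (1/2^m) 0 (ka* t) (%k. started y om (t*(real k/2^m))) (grid_floor m 1)"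
  "F m (\<lambda>s\<in>{0..}. c* L s om) = killed (1/2^m) 0 (ka* t) (%k. c* started (y/c) om (real k/2^m)) (grid_floor m 1)" for m om
  unfolding F_def using t c by (simp_all add: started_def distrib_left)
 have k0: "0 <= ka* t" using k t by simp
 have 1: "(%m. \<integral>om. F m (\<lambda>s\<in>{0..}. L (t* s) om) \<partial>M) ----> (LINT om|M. killed_area (ka* t) (%u. started y om (t* u)) 1)"
  unfolding Fs by (rule killed_grid_expectation_limit[OF sc k0 _ m1]) auto
 have 2: "(%m. \<integral>om. F m (\<lambda>s\<in>{0..}. c* L s om) \<partial>M) ----> (LINT om|M. killed_area (ka* t) (%u. c* started (y/c) om u) 1)"
  unfolding Fs by (rule killed_grid_expectation_limit[OF rc[OF started_rcll] k0]) (auto simp: killed_area_space_scale[OF c])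
 have "Q ka y t = (LINT om|M. killed_area (ka* t) (%u. started y om (t* u)) 1)"
  unfolding Q_def by (rule integral_cong_AE) (use AEs m1 in auto)
 also have "... = (LINT om|M. killed_area (ka* t) (%u. c* started (y/c) om u) 1)"
  using LIMSEQ_unique[OF 1 2[folded law]] .
 finally show ?thesis unfolding killed_area_space_scale[OF c] yc tc Q_def by (simp add: mult.assoc)
qed

lemma Q_0_mono: assumes "x <= y" "0 <= t" shows "Q 0 x t <= Q 0 y t"
 unfolding Q_def
proof (rule integral_mono)
 fix om
 have "grid_nonneg (started x om) t ==> grid_nonneg (started y om) t"
  using assms(1) unfolding grid_nonneg_def started_def by (meson add_right_mono order_trans)
 thus "killed_area 0 (started x om) t <= killed_area 0 (started y om) t" by (auto simp: killed_area_0)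
qed (use assms killed_area_integrable[of 0] in auto)

lemma Q_0_antimono_time: assumes "s <= t" "0 <= s" shows "Q 0 x t <= Q 0 x s"
 unfolding Q_def
proof (rule integral_mono)
 fix om
 have "grid_nonneg (started x om) t ==> grid_nonneg (started x om) s"
  using assms(1) unfolding grid_nonneg_def by (meson order_trans)
 thus "killed_area 0 (started x om) t <= killed_area 0 (started x om) s" by (auto simp: killed_area_0)
qed (use assms killed_area_integrable[of 0] in auto)

lemma area_nonneg:
 assumes "rcll f" "no_down_jumps f" "0 <= t" "grid_nonneg f t" shows "0 <= (LBINT u:{0..t}. f u)"
 unfolding slint_def
 using assms grid_nonneg_iff[OF assms(1-3)] by (intro integral_nonneg_AE) (auto simp: indicator_def)

lemma Q_le_Q_0: assumes "0 <= ka" "0 <= t" shows "Q ka x t <= Q 0 x t"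
 unfolding Q_def
proof (rule integral_mono_AE)
 show "AE om in M. killed_area ka (started x om) t <= killed_area 0 (started x om) t"
  using started_no_down_jumps AE_space
  by eventually_elim (use assms area_nonneg[OF started_rcll] in \<open>auto simp: killed_area_def\<close>)
qed (use assms killed_area_integrable in auto)

text \<open>Survival decreases in time, so exp (- 1) Q at time 1 is at most the Laplace transform at
  1, which is 1 - exp (- y) <= y; scaling handles other times. The bound later dominates the
  quotients by y.\<close>

lemma Q_0_linear_bound: assumes y: "0 < y" and t: "0 < t" shows "Q 0 y t <= exp 1*(y* t powr (- 1 / \<alpha>))"
proof -
 have c: "(LBINT s:{0..d}. k) = d* k" if "0 < d" for d k :: real using that by (simp add: slint_def)
 have one: "Q 0 x 1 <= exp 1* x" if x: "0 < x" for x
 proof -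
  have i: "sint {0..} (%t. exp (- 1* t)* Q 0 x t)" by (rule Q_laplace_integrable(1)) auto
  have "exp (- 1)* Q 0 x 1 = (LBINT t:{0..1::real}. exp (- 1)* Q 0 x 1)" using c[of 1] by simp
  also have "... <= (LBINT t:{0..}. exp (- 1* t)* Q 0 x t)"
   unfolding slint_def
  proof (rule integral_mono)
   fix t :: real
   have q: "0 <= Q 0 x 1" by (rule Q_bounds) auto
   have "exp (- 1)* Q 0 x 1 <= exp (- 1* t)* Q 0 x t" if "0 <= t" "t <= 1"
    using Q_0_antimono_time[OF that(2,1), of x] that q by (intro mult_mono) auto
   moreover have "0 <= exp (- 1* t)* Q 0 x t" if "0 <= t" using Q_bounds(1)[of 0 t x] that by simp
   ultimately show "indicator {0..1} t *\<^sub>R (exp (- 1)* Q 0 x 1) <= indicator {0..} t *\<^sub>R (exp (- 1* t)* Q 0 x t)"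
    by (auto simp: indicator_def)
  qed (use i in \<open>auto simp: set_integrable_def\<close>)
  also have "... = 1-exp (- x)" using survival_laplace[OF x, of 1] by simp
  also have "... <= x" using exp_ge_add_one_self[of "- x"] by simp
  finally have "exp 1*(exp (- 1)* Q 0 x 1) <= exp 1* x" by (rule mult_left_mono) simp
  moreover have "exp 1*(exp (- 1)* Q 0 x 1) = Q 0 x 1" by (simp add: exp_minus)
  ultimately show ?thesis by simp
 qed
 show ?thesis using Q_scaling[OF t, of 0 y] one[of "y* t powr (- 1 / \<alpha>)"] y t by simp
qed

text \<open>The transform (1 - exp (- y l^(1/al))) / (l y) tends to l^(1/al-1), the transform of
  t^(-1/al) / Gamma (1-1/al); monotonicity in time turns this into convergence at t = 1.\<close>

lemma Q_0_asymptotics: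
 assumes Y: "!!n. 0 < Y n" "Y ----> 0"
 shows "(%n. Q 0 (Y n) 1/Y n) ----> 1/Gamma (1-1 / \<alpha>)"
proof -
 define s where "s = 1-1 / \<alpha>"
 have s: "0 < s" using alpha by (simp add: s_def)
 have s1: "s-1 = - 1 / \<alpha>" by (simp add: s_def)
 define g where "g = (%n t. Q 0 (Y n) t/Y n)"
 define g0 where "g0 = (%t. t powr (- 1 / \<alpha>)/Gamma s)"
 note gl = gamma_laplace[OF s, unfolded s1]
 have gi: "sint {0..} (%t. exp (- l* t)*(g n t*1))" if "0 < l" for l n
  using set_integrable_divide[OF Q_laplace_integrable(1)[OF that, of 0 "Y n"], of "Y n"] Y(1)[of n] by (simp add: g_def)
 have g0i: "sint {0..} (%t. exp (- l* t)*(g0 t*1))" if "0 < l" for l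
  using set_integrable_divide[OF gl(1)[OF that], of "Gamma s"] Gamma_real_pos[OF s] by (simp add: g0_def)
 have "(%n. g n 1) ----> g0 1"
 proof (rule laplace_monotone_lim[where w = "%_. 1" and g = g and ?g0.0 = g0 and ?t0.0 = 1])
  show "sint {0<..} (%t::real. exp (- t)*1)"
   using set_integral_open_half_line(1)[OF set_integrable_exp_neg_scaled[of 1]] by simp
  show "sint {0<..} (%t. exp (- l* t)*(g n t*1))" if "0 < l" for n l
   by (rule set_integral_open_half_line(1)[OF gi[OF that]])
  show "sint {0<..} (%t. exp (- l* t)*(g0 t*1))" if "0 < l" for l
   by (rule set_integral_open_half_line(1)[OF g0i[OF that]])
  show "0 <= g n t" if "0 < t" for n t using Q_bounds(1)[of 0 t "Y n"] Y(1)[of n] that by (simp add: g_def)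
  show "0 <= g0 t" for t using Gamma_real_pos[OF s] by (simp add: g0_def)
  show "(\<forall>n s t. 0 < s --> s <= t --> g n s <= g n t) \<or> (\<forall>n s t. 0 < s --> s <= t --> g n t <= g n s)"
   using Q_0_antimono_time Y(1) unfolding g_def by (intro disjI2 allI impI divide_right_mono) (auto intro: less_imp_le)
  show "isCont g0 1" unfolding g0_def by (intro continuous_intros) (use Gamma_real_pos[OF s] in auto)
  fix l :: real assume l: "0 < l"
  have 1: "(LBINT t:{0<..}. exp (- l* t)*(g n t*1)) = (1-exp (- (Y n* l powr (1 / \<alpha>))))/l/Y n" for n
   using set_integral_open_half_line(2)[OF gi[OF l, of n]] survival_laplace[OF Y(1) l, of n] Y(1)[of n]
   by (simp add: g_def)
  have 2: "(LBINT t:{0<..}. exp (- l* t)*(g0 t*1)) = l powr (- s)"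
   using set_integral_open_half_line(2)[OF g0i[OF l]] gl(2)[OF l] Gamma_real_pos[OF s] by (simp add: g0_def)
  define b where "b = l powr (1 / \<alpha>)"
  have b: "0 < b" using l by (simp add: b_def)
  have "((%y. (1-exp (- (y* b)))/l/y) ---> b* inverse l) (at_right 0)" using b l by real_asymp
  from filterlim_compose[OF this positive_null_sequence(1)[OF Y]]
  have "(%n. (1-exp (- (Y n* b)))/l/Y n) ----> b/l" by (simp add: divide_inverse)
  moreover have "b/l = l powr (- s)" using l by (simp add: b_def s_def powr_diff)
  ultimately show "(%n. LBINT t:{0<..}. exp (- l* t)*(g n t*1)) ----> (LBINT t:{0<..}. exp (- l* t)*(g0 t*1))"
   unfolding 1 2 by (simp add: b_def)
 qed auto
 thus ?thesis by (simp add: g_def g0_def s_def)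
qed

text \<open>Some starting point below x has positive survival probability by the asymptotics at 0;
  monotonicity does the rest.\<close>

lemma Q_0_pos: assumes "0 < x" shows "0 < Q 0 x 1"
proof -
 have "(%n. 1/(real n+1)) ----> 0" by real_asymp
 from Q_0_asymptotics[OF _ this] have l: "(%n. Q 0 (1/(real n+1)) 1/(1/(real n+1))) ----> 1/Gamma (1-1 / \<alpha>)" by simp
 have "0 < 1/Gamma (1-1 / \<alpha>)" using Gamma_real_pos[of "1-1 / \<alpha>"] alpha by simp
 hence 1: "eventually (%n. 0 < Q 0 (1/(real n+1)) 1/(1/(real n+1))) sequentially" by (rule order_tendstoD(1)[OF l])
 have 2: "eventually (%n. 1/(real n+1) < x) sequentially" using \<open>(%n. 1 / (real n + 1)) ----> 0\<close> assms by (rule order_tendstoD(2))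
 obtain n where n: "0 < Q 0 (1/(real n+1)) 1/(1/(real n+1))" "1/(real n+1) < x"
  using eventually_happens[OF eventually_conj[OF 1 2]] by auto
 hence "0 < Q 0 (1/(real n+1)) 1" by (simp add: zero_less_mult_iff)
 also have "... <= Q 0 x 1" using n by (intro Q_0_mono) auto
 finally show ?thesis .
qed

text \<open>Up to null sets the events differ only on paths from x that touch 0 without going below.
  Such a path does not survive when started from any x - 1/(k+1), and the probability of this is at
  most the left jump at x of the survival probability, here 0.\<close>

lemma hitting_time_AE:
 assumes x: "0 < x" and c: "isCont (%x. Q 0 x 1) x"
 shows "AE om in M. hitting_time_0 (%t. x+L t om) > 1 \<longleftrightarrow> grid_nonneg (started x om) 1"
proof -
 define X where "X = (%k::nat. x-1/(real k+1))"
 define B where "B = {om \<in> space M. grid_nonneg (started x om) 1 & (\<forall>k. \<not> grid_nonneg (started (X k) om) 1)}"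
 have Bm: "B \<in> sets M" unfolding B_def grid_nonneg_def by measurable
 have "measure M B <= Q 0 x 1-Q 0 (X k) 1" for k
 proof -
  have "measure M B = (LINT om|M. indicator B om)" using Bm by simp
  also have "... <= (LINT om|M. killed_area 0 (started x om) 1-killed_area 0 (started (X k) om) 1)"
  proof (rule integral_mono)
   fix om
   have "grid_nonneg (started (X k) om) 1 ==> grid_nonneg (started x om) 1"
    unfolding grid_nonneg_def started_def X_def by (smt (verit) divide_nonneg_nonneg of_nat_0_le_iff)
   thus "indicator B om <= killed_area 0 (started x om) 1-killed_area 0 (started (X k) om) 1"
    by (auto simp: killed_area_0 B_def indicator_def)
   show "integrable M (indicator B :: _ => real)" by (rule integrable_const_bound[of _ 1]) (use Bm in auto)
  qed (use killed_area_integrable in auto)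
  finally show ?thesis using killed_area_integrable[of 0 1] by (simp add: Q_def)
 qed
 moreover have "(%k. Q 0 x 1-Q 0 (X k) 1) ----> Q 0 x 1-Q 0 x 1"
 proof (intro tendsto_diff tendsto_const isCont_tendsto_compose[OF c])
  have "X ----> x-0" unfolding X_def by (intro tendsto_diff tendsto_const) real_asymp
  thus "X ----> x" by simp
 qed
 ultimately have "measure M B <= 0" by (intro LIMSEQ_le_const) auto
 hence "emeasure M B = 0" using emeasure_eq_measure measure_nonneg[of M B] by simp
 hence "B \<in> null_sets M" using Bm by auto
 hence "AE om in M. om \<notin> B" by (rule AE_not_in)
 thus ?thesis using started_no_down_jumps started_0 AE_space
 proof eventually_elim
  case (elim om)
  have h: "hitting_time_0 (%t. x+L t om) = hitting_time_0 (started x om)"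
   unfolding hitting_time_0_def started_def by (intro arg_cong[where f = "%S. Inf (ereal ` S)"]) auto
  note r = started_rcll[OF elim(4)] elim(2)[rule_format]
  show ?case unfolding h
  proof
   assume "1 < hitting_time_0 (started x om)"
   hence "0 <= started x om s" if "0 <= s" "s <= 1" for s
    using hitting_time_gt_1_imp_nonneg[OF r _ _ that] x elim(3) by simp
   thus "grid_nonneg (started x om) 1" by (simp add: grid_nonneg_def)
  next
   assume "grid_nonneg (started x om) 1"
   then obtain k where "grid_nonneg (started (X k) om) 1" using elim by (auto simp: B_def)
   hence n: "0 <= started (X k) om s" if "0 <= s" "s <= 1" for s
    using grid_nonneg_iff[OF r, of 1 "X k"] that by simp
   show "1 < hitting_time_0 (started x om)"
   proof (rule hitting_time_gt_1I[OF r(1)])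
    show "0 < 1/(real k+1)" by simp
    show "1/(real k+1) <= started x om s" if "0 <= s" "s <= 1" for s
     using n[OF that] by (simp add: started_def X_def)
   qed
  qed
 qed
qed

text \<open>The hitting event differs from a measurable one by a subset of a null set, so it lies in
  the completion. There the conditional law is a density, and the integral can be taken back to
  M.\<close>

lemma cond_not_hit_integral:
 assumes x: "0 < x" and c: "isCont (%x. Q 0 x 1) x" and F[measurable]: "F \<in> borel_measurable M"
 shows "(\<integral>om. F om \<partial>cond_not_hit M L x) = (LINT om|M. killed_area 0 (started x om) 1* F om)/Q 0 x 1"
proof -
 let ?C = "completion M"
 define E where "E = {om \<in> space M. hitting_time_0 (%t. x+L t om) > 1}"
 define A where "A = {om \<in> space M. grid_nonneg (started x om) 1}"
 have Am: "A \<in> sets M" unfolding A_def grid_nonneg_def by measurable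
 have AE: "AE om in M. om \<in> E \<longleftrightarrow> om \<in> A" using hitting_time_AE[OF x c] AE_space by eventually_elim (simp add: E_def A_def)
 then obtain N where N: "{om \<in> space M. \<not> (om \<in> E \<longleftrightarrow> om \<in> A)} \<subseteq> N" "N \<in> null_sets M" unfolding eventually_ae_filter by blast
 have "E = (A-N) \<union> (E \<inter> N)" using N(1) by (auto simp: E_def A_def)
 moreover have "E \<inter> N \<in> null_sets ?C" using N(2) by (intro null_sets_completion_subset[OF _ null_sets_completionI[OF N(2)]]) auto
 hence "(A-N) \<union> (E \<inter> N) \<in> sets ?C" using Am N(2) by (intro sets.Un) auto
 ultimately have Em: "E \<in> sets ?C" by simp
 have AEc: "AE om in ?C. om \<in> E \<longleftrightarrow> om \<in> A" by (rule AE_completion[OF AE])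
 have QA: "measure M A = Q 0 x 1"
 proof -
  have "Q 0 x 1 = (LINT om|M. indicator A om)"
   unfolding Q_def by (rule Bochner_Integration.integral_cong) (auto simp: killed_area_0 A_def indicator_def)
  thus ?thesis using Am by simp
 qed
 have mE: "emeasure ?C E = ennreal (Q 0 x 1)"
 proof -
  have "emeasure ?C E = emeasure ?C A" by (rule emeasure_eq_AE[OF AEc Em]) (use Am in simp)
  also have "... = ennreal (measure M A)" using Am by (simp add: emeasure_eq_measure)
  finally show ?thesis by (simp add: QA)
 qed
 have pos: "0 < Q 0 x 1" by (rule Q_0_pos[OF x])
 have d: "cond_not_hit M L x = density ?C (%om. ennreal (indicator E om/Q 0 x 1))"
 proof -
  have "1/ennreal (Q 0 x 1) = ennreal (1/Q 0 x 1)" using divide_ennreal[of 1 "Q 0 x 1"] pos by simp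
  hence "indicator E om/ennreal (Q 0 x 1) = ennreal (indicator E om/Q 0 x 1)" for om by (cases "om \<in> E") auto
  thus ?thesis unfolding cond_not_hit_def E_def[symmetric] uniform_measure_def mE by (simp only:)
 qed
 have Fc[measurable]: "F \<in> borel_measurable ?C" using F by (rule measurable_completion)
 have Em'[measurable]: "E \<in> sets ?C" by (rule Em)
 have [measurable]: "A \<in> sets ?C" using Am by simp
 have "(\<integral>om. F om \<partial>density ?C (%om. ennreal (indicator E om/Q 0 x 1))) = (\<integral>om. (indicator E om/Q 0 x 1) *\<^sub>R F om \<partial>?C)"
  using pos by (intro integral_density) auto
 also have "... = (\<integral>om. (indicator A om/Q 0 x 1) *\<^sub>R F om \<partial>?C)"
  by (rule integral_cong_AE) (use AEc in \<open>auto simp: indicator_def elim: eventually_mono\<close>)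
 also have "... = (LINT om|M. (indicator A om/Q 0 x 1) *\<^sub>R F om)" using Am by (intro integral_completion) auto
 also have "... = (LINT om|M. (killed_area 0 (started x om) 1* F om)/Q 0 x 1)"
  by (rule Bochner_Integration.integral_cong) (auto simp: killed_area_0 A_def indicator_def)
 finally show ?thesis unfolding d by simp
qed

text \<open>A monotone function has countably many discontinuities, and for each n the map from t to
  the starting point is injective.\<close>

lemma good_times:
 assumes Y: "!!n::nat. 0 < Y n"
 shows "countable {t. 0 < t & \<not> (\<forall>n. isCont (%x. Q 0 x 1) (Y n* t powr (- 1 / \<alpha>)))}"
proof -
 let ?D = "{x. \<not> isCont (%x. Q 0 x 1) x}"
 have D: "countable ?D" by (rule mono_ctble_discont) (auto intro!: monoI Q_0_mono)
 have "countable {t. 0 < t & Y n* t powr (- 1 / \<alpha>) \<in> ?D}" for n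
 proof (rule countable_image_inj_on)
  show "countable ((%t. Y n* t powr (- 1 / \<alpha>)) ` {t. 0 < t & Y n* t powr (- 1 / \<alpha>) \<in> ?D})"
   by (rule countable_subset[OF _ D]) auto
  show "inj_on (%t. Y n* t powr (- 1 / \<alpha>)) {t. 0 < t & Y n* t powr (- 1 / \<alpha>) \<in> ?D}"
  proof (rule inj_onI)
   fix s t assume "s \<in> {t. 0 < t & Y n* t powr (- 1 / \<alpha>) \<in> ?D}" "t \<in> {t. 0 < t & Y n* t powr (- 1 / \<alpha>) \<in> ?D}"
    and e: "Y n* s powr (- 1 / \<alpha>) = Y n* t powr (- 1 / \<alpha>)"
   hence st: "0 < s" "0 < t" by auto
   have "(s powr (- 1 / \<alpha>)) powr (- \<alpha>) = (t powr (- 1 / \<alpha>)) powr (- \<alpha>)" using e Y[of n] by simp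
   thus "s = t" using st alpha by (simp add: powr_powr)
  qed
 qed
 hence "countable (\<Union>n. {t. 0 < t & Y n* t powr (- 1 / \<alpha>) \<in> ?D})" by blast
 thus ?thesis by (rule countable_subset[rotated]) auto
qed

end

section \<open>The Laplace identity for the area of the meander\<close>

context normalized_stable
begin

lemma area_measurable [measurable]: "(%om. LBINT u:{0..1}. started y om u) \<in> borel_measurable M"
 by (rule borel_measurable_LIMSEQ_real[where u = "%m om. (\<Sum>j<grid_floor m 1. started y om (real j/2^m))/2^m"])
  (use rcll_riemann_sums[OF started_rcll, of _ 1] in auto)

text \<open>The weak convergence that defines the meander is tested with g of the area, which is
  continuous by \<open>continuous_map_area\<close>; \<open>cond_not_hit_integral\<close> rewrites
  the conditional side.\<close>

lemma meander_limit:
 assumes me: "is_meander M L N Y" and X: "!!n. 0 < X n" "X ----> 0" "!!n. isCont (%x. Q 0 x 1) (X n)"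
  and g: "continuous_on UNIV g" "!!a. \<bar>g a\<bar> <= (C::real)"
 shows "(%n. (LINT om|M. killed_area 0 (started (X n) om) 1* g (LBINT u:{0..1}. started (X n) om u))/Q 0 (X n) 1)
   ----> (LINT om|N. g (path_area Y om))"
proof -
 define F where "F = (%f::real => real. g (LBINT t:{0..1}. f t))"
 have gm[measurable]: "g \<in> borel_measurable borel" by (rule borel_measurable_continuous_onI[OF g(1)])
 have "continuous_map skorokhod_topology euclideanreal (g \<circ> (%f. LBINT t:{0..1}. f t))"
  by (rule continuous_map_compose[OF continuous_map_area]) (simp add: g)
 hence "continuous_map skorokhod_topology euclideanreal F" by (simp add: F_def o_def)
 moreover have "bounded (F ` skorokhod_space)" unfolding bounded_iff F_def using g(2) by auto
 ultimately have "((%x. \<integral>om. F (\<lambda>t\<in>{0..1}. x+L t om) \<partial>cond_not_hit M L x) ---> (LINT om|N. F (\<lambda>t\<in>{0..1}. Y t om))) (at_right 0)"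
  using me unfolding is_meander_def by blast
 moreover have "filterlim X (at_right 0) sequentially" by (rule positive_null_sequence(1)[OF X(1,2)])
 ultimately have lim: "(%n. \<integral>om. F (\<lambda>t\<in>{0..1}. X n+L t om) \<partial>cond_not_hit M L (X n)) ----> (LINT om|N. F (\<lambda>t\<in>{0..1}. Y t om))"
  by (rule filterlim_compose)
 have r: "F (\<lambda>t\<in>{0..1}. h t) = g (LBINT t:{0..1}. h t)" for h
  unfolding F_def by (rule arg_cong[where f = g], rule set_lebesgue_integral_cong) auto
 have s: "(LBINT t:{0..1}. x+L t om) = (LBINT u:{0..1}. started x om u)" for x om
  by (rule set_lebesgue_integral_cong) (auto simp: started_def)
 have "(\<integral>om. F (\<lambda>t\<in>{0..1}. X n+L t om) \<partial>cond_not_hit M L (X n))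
   = (LINT om|M. killed_area 0 (started (X n) om) 1* g (LBINT u:{0..1}. started (X n) om u))/Q 0 (X n) 1" for n
  unfolding r s by (rule cond_not_hit_integral[OF X(1,3)]) measurable
 thus ?thesis using lim unfolding r path_area_def by simp
qed

lemma good_sequence: "\<exists>X. (\<forall>n. 0 < X n) & X ----> 0 & (\<forall>n. isCont (%x. Q 0 x 1) (X n))"
proof -
 let ?Y = "%n. 1/(real n+1)"
 have "countable {t. 0 < t & \<not> (\<forall>n. isCont (%x. Q 0 x 1) (?Y n* t powr (- 1 / \<alpha>)))}" by (rule good_times) simp
 moreover have "uncountable {0<..<1::real}" by (simp add: uncountable_open_interval)
 ultimately have "\<not> {0<..<1} \<subseteq> {t. 0 < t & \<not> (\<forall>n. isCont (%x. Q 0 x 1) (?Y n* t powr (- 1 / \<alpha>)))}"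
  using countable_subset by blast
 then obtain t where t0: "t \<in> {0<..<1}" "t \<notin> {t. 0 < t & \<not> (\<forall>n. isCont (%x. Q 0 x 1) (?Y n* t powr (- 1 / \<alpha>)))}"
  unfolding subset_iff by blast
 have t: "0 < t" using t0(1) by simp
 have tc: "isCont (%x. Q 0 x 1) (?Y n* t powr (- 1 / \<alpha>))" for n using t0(2) t by blast
 have "?Y ----> 0" by real_asymp
 from tendsto_mult[OF this tendsto_const[of "t powr (- 1 / \<alpha>)"]] have "(%n. ?Y n* t powr (- 1 / \<alpha>)) ----> 0" by simp
 thus ?thesis using t by (intro exI[of _ "%n. ?Y n* t powr (- 1 / \<alpha>)"] conjI allI tc) auto
qed

lemma meander_area:
 assumes me: "is_meander M L N Y"
 shows "prob_space N" "path_area Y \<in> borel_measurable N" (is ?g1) "AE om in N. 0 <= path_area Y om" (is ?g2)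
proof -
 show N: "prob_space N" using me by (simp add: is_meander_def)
 interpret N: prob_space N by (rule N)
 have m: "Y t \<in> borel_measurable N" if "t \<in> {0..1}" for t using me that by (simp add: is_meander_def)
 have r: "rcll (%t. Y (max 0 (min 1 t)) om)" if "om \<in> space N" for om
  using me that by (intro rcll_clamp_unit_interval) (simp add: is_meander_def)
 have "(%om. LBINT u:{0..1}. Y (max 0 (min 1 u)) om) \<in> borel_measurable N"
  by (rule borel_measurable_LIMSEQ_real[where u = "%n om. (\<Sum>j<grid_floor n 1. Y (max 0 (min 1 (real j/2^n))) om)/2^n"])
   (use rcll_riemann_sums[OF r, of _ 1] in \<open>auto intro!: borel_measurable_divide borel_measurable_sum m\<close>)
 moreover have "(LBINT u:{0..1}. Y (max 0 (min 1 u)) om) = path_area Y om" for om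
  unfolding path_area_def by (rule set_lebesgue_integral_cong) auto
 ultimately show pm[measurable]: ?g1 by simp
 obtain X where X: "!!n. 0 < X n" "X ----> 0" "!!n. isCont (%x. Q 0 x 1) (X n)" using good_sequence by blast
 \<comment> \<open>Bounded, continuous, and positive exactly at negative areas; its expectation
   vanishes along the sequence and hence in the limit.\<close>
 define g where "g = (%a::real. min 1 (max 0 (- a)))"
 have g: "continuous_on UNIV g" "!!a. \<bar>g a\<bar> <= 1" unfolding g_def by (auto intro!: continuous_intros)
 have "(LINT om|M. killed_area 0 (started (X n) om) 1* g (LBINT u:{0..1}. started (X n) om u)) = 0" for n
 proof (rule integral_eq_zero_AE)
  show "AE om in M. killed_area 0 (started (X n) om) 1* g (LBINT u:{0..1}. started (X n) om u) = 0"
   using started_no_down_jumps AE_space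
   by eventually_elim (use area_nonneg[OF started_rcll, of _ "X n" 1] in \<open>auto simp: killed_area_0 g_def\<close>)
 qed
 hence "(%n. 0) ----> (LINT om|N. g (path_area Y om))" using meander_limit[OF me X g] by simp
 hence z: "(LINT om|N. g (path_area Y om)) = 0" by (simp add: LIMSEQ_const_iff)
 have "integrable N (%om. g (path_area Y om))"
  by (rule N.integrable_const_bound[of _ 1]) (use g in \<open>auto simp: g_def\<close>)
 hence "AE om in N. g (path_area Y om) = 0"
  using z by (subst (asm) integral_nonneg_eq_0_iff_AE) (auto simp: g_def)
 thus ?g2 by eventually_elim (auto simp: g_def min_def max_def split: if_splits)
qed

lemma meander_laplace_ratio:
 assumes me: "is_meander M L N Y" and X: "!!n. 0 < X n" "X ----> 0" "!!n. isCont (%x. Q 0 x 1) (X n)" and s: "0 <= s"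
 shows "(%n. Q s (X n) 1/Q 0 (X n) 1) ----> (LINT om|N. exp (- s* path_area Y om))"
proof -
 \<comment> \<open>The cut at 0 makes g bounded on all of the reals; areas of surviving paths and of
   the meander are nonnegative almost surely.\<close>
 define g where "g = (%a::real. exp (- s* max 0 a))"
 have g: "continuous_on UNIV g" "!!a. \<bar>g a\<bar> <= 1" unfolding g_def using s by (auto intro!: continuous_intros)
 have "(LINT om|M. killed_area 0 (started x om) 1* g (LBINT u:{0..1}. started x om u)) = Q s x 1" for x
  unfolding Q_def
 proof (rule integral_cong_AE)
  show "AE om in M. killed_area 0 (started x om) 1* g (LBINT u:{0..1}. started x om u) = killed_area s (started x om) 1"
   using started_no_down_jumps AE_space
   by eventually_elim (use area_nonneg[OF started_rcll, of _ x 1] in \<open>auto simp: killed_area_def g_def max_def\<close>)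
 qed (auto simp: g_def)
 moreover have "(LINT om|N. g (path_area Y om)) = (LINT om|N. exp (- s* path_area Y om))"
  using meander_area(2,3)[OF me] by (intro integral_cong_AE) (auto simp: g_def max_def elim: eventually_mono)
 ultimately show ?thesis using meander_limit[OF me X g] by simp
qed

text \<open>If the imaginary part vanished at l, membership in the segment would make it vanish at
  every l + y, against \<open>Phi_eventually_pos\<close>.\<close>

lemma resolvent_formula:
 assumes l: "0 < l"
 shows "Im (Hray \<alpha> 0 (of_real l)) ~= 0" (is ?g1)
  "0 < y ==> (LBINT t:{0..}. exp (- l* t)* Q 1 y t) = Re (Hray \<alpha> 0 (of_real (l+y)))
   - Im (Hray \<alpha> 0 (of_real (l+y)))/Im (Hray \<alpha> 0 (of_real l))* Re (Hray \<alpha> 0 (of_real l))"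
proof -
 have ex: "\<exists>e. Hray \<alpha> 0 (of_real (l+y)) - of_real (LBINT t:{0..}. exp (- l* t)* Q 1 y t) = e *\<^sub>R Hray \<alpha> 0 (of_real l)" if "0 < y" for y
 proof -
  have "\<exists>u. 0 <= u & u <= 1 & Hray \<alpha> 0 (of_real (l+y)) - of_real (LBINT t:{0..}. exp (- l* t)* Q 1 y t) = (1-u) *\<^sub>R 0+u *\<^sub>R Hray \<alpha> 0 (of_real l)"
   using resolvent[OF that l] by (simp only: in_segment)
  then obtain u where "Hray \<alpha> 0 (of_real (l+y)) - of_real (LBINT t:{0..}. exp (- l* t)* Q 1 y t) = (1-u) *\<^sub>R 0+u *\<^sub>R Hray \<alpha> 0 (of_real l)"
   by (elim exE conjE)
  thus ?thesis unfolding scaleR_zero_right add_0_left by (rule exI)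
 qed
 show n0: ?g1
 proof
  assume z: "Im (Hray \<alpha> 0 (of_real l)) = 0"
  obtain x where x: "l < x" "0 < Im (Hray \<alpha> 0 (of_real x))"
   using eventually_happens[OF eventually_conj[OF eventually_gt_at_top[of l] Phi_eventually_pos(1)[OF alpha]]] by auto
  have "0 < x-l" using x by simp
  from ex[OF this] obtain e where "Hray \<alpha> 0 (of_real (l+(x-l))) - of_real (LBINT t:{0..}. exp (- l* t)* Q 1 (x-l) t) = e *\<^sub>R Hray \<alpha> 0 (of_real l)" by blast
  from arg_cong[OF this, of Im] show False using x z by simp
 qed
 assume "0 < y"
 from ex[OF this] obtain e where e: "Hray \<alpha> 0 (of_real (l+y)) - of_real (LBINT t:{0..}. exp (- l* t)* Q 1 y t) = e *\<^sub>R Hray \<alpha> 0 (of_real l)" by blast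
 have 1: "Im (Hray \<alpha> 0 (of_real (l+y))) = e* Im (Hray \<alpha> 0 (of_real l))" using arg_cong[OF e, of Im] by simp
 have 2: "Re (Hray \<alpha> 0 (of_real (l+y)))-(LBINT t:{0..}. exp (- l* t)* Q 1 y t) = e* Re (Hray \<alpha> 0 (of_real l))"
  using arg_cong[OF e, of Re] by simp
 show "(LBINT t:{0..}. exp (- l* t)* Q 1 y t) = Re (Hray \<alpha> 0 (of_real (l+y)))
   - Im (Hray \<alpha> 0 (of_real (l+y)))/Im (Hray \<alpha> 0 (of_real l))* Re (Hray \<alpha> 0 (of_real l))"
  unfolding 1 using 2 n0 by simp
qed

lemma laplace_rhs_eq:
 assumes l: "0 < l"
 shows "laplace_rhs \<alpha> l = pi*((deriv (Psi \<alpha>) l* Phi \<alpha> l-deriv (Phi \<alpha>) l* Psi \<alpha> l)/Phi \<alpha> l)"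
proof -
 note d = Psi_Phi_derivative[OF alpha(1), THEN DERIV_imp_deriv, of l]
 note H = Hray_0_eq[OF alpha(1), of l]
 have "Phi \<alpha> l ~= 0" using resolvent_formula(1)[OF l] unfolding H by simp
 thus ?thesis unfolding laplace_rhs_def d H by (simp add: field_simps)
qed

text \<open>The resolvent is R (l + y) with R differentiable at l and R l = 0, so the quotient is a
  difference quotient.\<close>

lemma resolvent_slope:
 assumes l: "0 < l" and Y: "!!n. 0 < Y n" "Y ----> 0"
 shows "(%n. (LBINT t:{0..}. exp (- l* t)* Q 1 (Y n) t)/Y n) ----> laplace_rhs \<alpha> l"
proof -
 note H = Hray_0_eq[OF alpha(1)]
 define R where "R = (%x. pi* Psi \<alpha> x-pi* Phi \<alpha> x/Im (Hray \<alpha> 0 (of_real l))* Re (Hray \<alpha> 0 (of_real l)))"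
 have R0: "R l = 0" using resolvent_formula(1)[OF l] by (simp add: R_def H[symmetric])
 have "(R has_field_derivative pi*(- Re (Hray \<alpha> 1 (of_real l))/pi)
   - pi*(- Im (Hray \<alpha> 1 (of_real l))/pi)/Im (Hray \<alpha> 0 (of_real l))* Re (Hray \<alpha> 0 (of_real l))) (at l)"
  unfolding R_def
  by (intro DERIV_diff DERIV_cmult DERIV_cmult_right DERIV_cdivide Psi_Phi_derivative[OF alpha(1)])
 hence "(R has_field_derivative laplace_rhs \<alpha> l) (at l)" by (simp add: laplace_rhs_def)
 hence "((%h. (R (l+h)-R l)/h) ---> laplace_rhs \<alpha> l) (at 0)" by (simp add: DERIV_def)
 moreover have "filterlim Y (at 0) sequentially" by (rule positive_null_sequence(2)[OF Y])
 ultimately have "(%n. (R (l+Y n)-R l)/Y n) ----> laplace_rhs \<alpha> l" by (rule filterlim_compose)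
 moreover have "R (l+Y n) = (LBINT t:{0..}. exp (- l* t)* Q 1 (Y n) t)" for n
  unfolding resolvent_formula(2)[OF l Y(1)] R_def H ..
 ultimately show ?thesis by (simp add: R0)
qed

text \<open>By scaling, Q 1 y t / y is the product of a ratio that tends to the Laplace transform of
  the area at t^(1+1/al), a survival quotient that tends to 1 / Gamma (1-1/al), and t^(-1/al). This
  holds for all t outside a countable set, and \<open>Q_0_linear_bound\<close> dominates.\<close>

lemma meander_laplace:
 assumes me: "is_meander M L N A" and l: "0 < l"
 defines "ph \<equiv> (%s. \<integral>om. exp (- s* path_area A om) \<partial>N)"
 shows "sint {0<..} (%t. exp (- l* t)* ph (t powr (1+1 / \<alpha>))* t powr (- 1 / \<alpha>))"
  "(LBINT t:{0<..}. exp (- l* t)* ph (t powr (1+1 / \<alpha>))* t powr (- 1 / \<alpha>)) = Gamma (1-1 / \<alpha>)* laplace_rhs \<alpha> l"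
proof -
 define s where "s = 1-1 / \<alpha>"
 have s: "0 < s" "s-1 = - 1 / \<alpha>" using alpha by (auto simp: s_def)
 have Gs: "0 < Gamma s" by (rule Gamma_real_pos[OF s(1)])
 interpret N: prob_space N by (rule meander_area(1)[OF me])
 note [measurable] = meander_area(2)[OF me]
 define Y where "Y = (%n. 1/(real n+1))"
 have Y: "!!n. 0 < Y n" "Y ----> 0" unfolding Y_def by simp real_asymp
 let ?b = "{t. 0 < t & \<not> (\<forall>n. isCont (%x. Q 0 x 1) (Y n* t powr (- 1 / \<alpha>)))}"
 have AEg: "AE t in lborel. t \<notin> ?b" by (rule AE_not_in[OF countable_imp_null_set_lborel[OF good_times[OF Y(1)]]])
 let ?f = "%t. exp (- l* t)* ph (t powr (1+1 / \<alpha>))* t powr (- 1 / \<alpha>)"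
 have phm[measurable]: "ph \<in> borel_measurable borel" unfolding ph_def by measurable
 have lim: "AE t in lborel. (%n. indicator {0<..} t *\<^sub>R (exp (- l* t)* Q 1 (Y n) t/Y n)) ----> indicator {0<..} t *\<^sub>R (?f t/Gamma s)"
  using AEg
 proof eventually_elim
  case (elim t)
  show ?case
  proof (cases "0 < t")
   case t: True
   let ?c = "t powr (- 1 / \<alpha>)" and ?s = "t powr (1+1 / \<alpha>)"
   have c: "0 < ?c" using t by simp
   \<comment> \<open>X n is the starting point Y n after time t has been rescaled to 1.\<close>
   define X where "X = (%n. Y n*?c)"
   have X: "!!n. 0 < X n" "X ----> 0" "!!n. isCont (%x. Q 0 x 1) (X n)"
    using Y c elim t tendsto_mult[OF Y(2) tendsto_const[of ?c]] by (auto simp: X_def)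
   have "(%n. exp (- l* t)*(Q ?s (X n) 1/Q 0 (X n) 1*(Q 0 (X n) 1/X n)*?c)) ----> exp (- l* t)*(ph ?s*(1/Gamma s)*?c)"
    unfolding ph_def s_def by (intro tendsto_mult tendsto_const meander_laplace_ratio[OF me X] Q_0_asymptotics[OF X(1,2)]) simp
   moreover have "exp (- l* t)*(Q ?s (X n) 1/Q 0 (X n) 1*(Q 0 (X n) 1/X n)*?c) = exp (- l* t)* Q 1 (Y n) t/Y n" for n
    using Q_scaling[OF t, of 1 "Y n"] Q_0_pos[OF X(1)[of n]] X(1)[of n] c by (simp add: X_def)
   ultimately show ?thesis using t by (simp add: mult.assoc)
  qed simp
 qed
 have gi: "sint {0<..} (%t. exp (- l* t)* Q 1 (Y n) t/Y n)" for n
  using set_integral_open_half_line(1)[OF set_integrable_divide[OF Q_laplace_integrable(1)[OF l], of "Y n" 1 "Y n"]] Y(1)[of n] by simp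
 have wi: "integrable lborel (%t. indicator {0<..} t *\<^sub>R (exp 1*(exp (- l* t)* t powr (- 1 / \<alpha>))))"
  using set_integrable_mult_right[OF set_integral_open_half_line(1)[OF gamma_laplace(1)[OF s(1) l]], of "exp 1"] s(2) by (simp add: set_integrable_def)
 have nb: "AE t in lborel. norm (indicator {0<..} t *\<^sub>R (exp (- l* t)* Q 1 (Y n) t/Y n)) <= indicator {0<..} t *\<^sub>R (exp 1*(exp (- l* t)* t powr (- 1 / \<alpha>)))" for n
 proof (rule AE_I2)
  fix t
  show "norm (indicator {0<..} t *\<^sub>R (exp (- l* t)* Q 1 (Y n) t/Y n)) <= indicator {0<..} t *\<^sub>R (exp 1*(exp (- l* t)* t powr (- 1 / \<alpha>)))"
  proof (cases "0 < t")
   case t: True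
   have q: "0 <= Q 1 (Y n) t" using Q_bounds(1)[of 1 t "Y n"] t by simp
   have "Q 1 (Y n) t <= exp 1*(Y n* t powr (- 1 / \<alpha>))"
    using Q_le_Q_0[of 1 t "Y n"] Q_0_linear_bound[OF Y(1) t, of n] t by simp
   hence "Q 1 (Y n) t/Y n <= exp 1* t powr (- 1 / \<alpha>)" using Y(1)[of n] by (simp add: divide_le_eq mult_ac)
   hence "exp (- l* t)*(Q 1 (Y n) t/Y n) <= exp (- l* t)*(exp 1* t powr (- 1 / \<alpha>))" by (rule mult_left_mono) simp
   thus ?thesis using t q Y(1)[of n] by (simp add: abs_mult mult_ac)
  qed simp
 qed
 have gm: "(%t. indicator {0<..} t *\<^sub>R (exp (- l* t)* Q 1 (Y n) t/Y n)) \<in> borel_measurable lborel" for n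
  using gi[of n] by (auto simp: set_integrable_def)
 have fm: "(%t. indicator {0<..} t *\<^sub>R (?f t/Gamma s)) \<in> borel_measurable lborel" by measurable
 have fi: "sint {0<..} (%t. ?f t/Gamma s)" unfolding set_integrable_def
  by (rule integrable_dominated_convergence[where s = "%n t. indicator {0<..} t *\<^sub>R (exp (- l* t)* Q 1 (Y n) t/Y n)", OF fm gm wi lim nb])
 have L: "(%n. LBINT t:{0<..}. exp (- l* t)* Q 1 (Y n) t/Y n) ----> (LBINT t:{0<..}. ?f t/Gamma s)" unfolding slint_def
  by (rule integral_dominated_convergence[where s = "%n t. indicator {0<..} t *\<^sub>R (exp (- l* t)* Q 1 (Y n) t/Y n)", OF fm gm wi lim nb])
 have eq: "(LBINT t:{0<..}. exp (- l* t)* Q 1 (Y n) t/Y n) = (LBINT t:{0..}. exp (- l* t)* Q 1 (Y n) t)/Y n" for n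
  using set_integral_open_half_line(2)[OF Q_laplace_integrable(1)[OF l, of 1 "Y n"]] by simp
 have "(LBINT t:{0<..}. ?f t/Gamma s) = laplace_rhs \<alpha> l"
  by (rule LIMSEQ_unique[OF L[unfolded eq] resolvent_slope[OF l Y]])
 thus "(LBINT t:{0<..}. ?f t) = Gamma (1-1 / \<alpha>)* laplace_rhs \<alpha> l" using Gs by (simp add: s_def field_simps)
 have "sint {0<..} (%t. Gamma s*(?f t/Gamma s))" by (rule set_integrable_mult_right[OF fi])
 thus "sint {0<..} ?f" using Gs by simp
qed

end

section \<open>Mean and tail of the area from its Laplace identity\<close>

lemma open_half_line_scale:
 fixes f :: "real => real"
 assumes c: "0 < c"
 shows "(LBINT r:{0<..}. f r) = c*(LBINT r:{0<..}. f (c* r))" (is ?g1)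
  "sint {0<..} f ==> sint {0<..} (%r. f (c* r))"
proof -
 have ind: "indicator {0<..} (c* r) = (indicator {0<..} r :: real)" for r
  using c by (auto simp: indicator_def zero_less_mult_iff)
 show ?g1
  using lborel_integral_real_affine[of c "%r. indicator {0<..} r *\<^sub>R f r" 0] c ind by (simp add: slint_def)
 assume "sint {0<..} f"
 hence "integrable lborel (%r. indicator {0<..} (0+c* r) *\<^sub>R f (0+c* r))"
  using c unfolding set_integrable_def by (subst lborel_integrable_real_affine_iff) auto
 thus "sint {0<..} (%r. f (c* r))" using ind by (simp add: set_integrable_def)
qed

lemma gamma_laplace_open:
 assumes s: "0 < s" and l: "0 < (l::real)"
 shows "sint {0<..} (%t. exp (- l* t)* t powr (s-1))"
  "(LBINT t:{0<..}. exp (- l* t)* t powr (s-1)) = Gamma s* l powr (- s)"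
 using set_integral_open_half_line[OF gamma_laplace(1)[OF s l]] gamma_laplace(2)[OF s l] by auto

lemma tendsto_at_top_positive_seqI:
 fixes f :: "real => real"
 assumes "!!X. (!!n. 0 < X n) ==> filterlim X at_top sequentially ==> (%n. f (X n)) ----> y"
 shows "(f ---> y) at_top"
proof (rule tendsto_at_topI_sequentially)
 fix X :: "nat => real" assume X: "filterlim X at_top sequentially"
 have e: "eventually (%n. X n = max 1 (X n)) sequentially"
  using X unfolding filterlim_at_top by (auto elim: eventually_mono simp: max_def dest!: spec[of _ 1])
 have "filterlim (%n. max 1 (X n)) at_top sequentially"
  by (rule filterlim_at_top_mono[OF X]) simp
 hence "(%n. f (max 1 (X n))) ----> y" by (intro assms) auto
 moreover have "eventually (%n. f (max 1 (X n)) = f (X n)) sequentially" using e by eventually_elim simp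
 ultimately show "(%n. f (X n)) ----> y" by (rule Lim_transform_eventually)
qed

text \<open>The pointwise bounds behind the monotonicity of \<open>ps\<close> and \<open>rh\<close>.
  The second part is convexity of exp between 0 and - t a.\<close>

lemma one_minus_exp_quotient:
 fixes a s t :: real
 assumes a: "0 <= a"
 shows "0 < s ==> (1-exp (- s* a))/s <= a"
  "0 < s ==> s <= t ==> (1-exp (- t* a))/t <= (1-exp (- s* a))/s"
  "0 <= s ==> s <= t ==> exp (- s* a)-1+s* a <= exp (- t* a)-1+t* a"
proof -
 assume s: "0 < s"
 have "1 + - s* a <= exp (- s* a)" by (rule exp_ge_add_one_self)
 thus "(1-exp (- s* a))/s <= a" using s by (simp add: divide_le_eq mult.commute)
next
 assume s: "0 < s" "s <= t"
 define u where "u = s/t"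
 have u: "0 < u" "u <= 1" "s = u* t" using s by (auto simp: u_def)
 have "exp ((1-u) *\<^sub>R 0+u *\<^sub>R (- t* a)) <= (1-u)* exp 0+u* exp (- t* a)"
  by (rule convex_onD[OF exp_convex]) (use u in auto)
 hence "u*(1-exp (- t* a)) <= 1-exp (- s* a)" by (simp add: u(3) algebra_simps)
 hence "u*(1-exp (- t* a))/s <= (1-exp (- s* a))/s" using s by (intro divide_right_mono) auto
 moreover have "u*(1-exp (- t* a))/s = (1-exp (- t* a))/t" using s u by simp
 ultimately show "(1-exp (- t* a))/t <= (1-exp (- s* a))/s" by simp
next
 assume s: "0 <= s" "s <= t"
 define w where "w = (t-s)* a"
 have w: "0 <= w" using s a by (simp add: w_def)
 have "exp (- s* a)*(1-exp (- w)) <= 1* w"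
  using exp_ge_add_one_self[of "- w"] s a w by (intro mult_mono) auto
 moreover have "exp (- s* a)* exp (- w) = exp (- t* a)" by (simp add: w_def exp_add[symmetric] algebra_simps)
 moreover have "w = t* a-s* a" by (simp add: w_def algebra_simps)
 ultimately show "exp (- s* a)-1+s* a <= exp (- t* a)-1+t* a" by (simp add: algebra_simps)
qed

text \<open>From here on the process is gone: mean and tail follow from the transform identity for
  one nonnegative random variable.\<close>

locale area_law = prob_space N for N :: "'b measure" +
 fixes A :: "'b => real" and al :: real
 assumes alpha: "1 < al" "al <= 2" and A_measurable [measurable]: "A \<in> borel_measurable N"
  and A_nonneg: "AE om in N. 0 <= A om"
  and laplace_integrable: "!!l. 0 < l ==> sint {0<..}
    (%t. exp (- l* t)*(LINT om|N. exp (- (t powr (1+1/al))* A om))* t powr (- 1/al))"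
  and laplace_eq: "!!l. 0 < l ==> (LBINT t:{0<..}.
    exp (- l* t)*(LINT om|N. exp (- (t powr (1+1/al))* A om))* t powr (- 1/al)) = Gamma (1-1/al)* laplace_rhs al l"
begin

definition "ph s = (LINT om|N. exp (- s* A om))"
text \<open>The expectation of (1 - exp (- s A)) / s, which increases to the mean of A as s
  decreases to 0.\<close>

definition "ps s = (1-ph s)/s"

lemma ph_measurable [measurable]: "ph \<in> borel_measurable borel" unfolding ph_def[abs_def] by measurable
lemma ps_measurable [measurable]: "ps \<in> borel_measurable borel" unfolding ps_def[abs_def] by measurable

lemma exp_integrable: "0 <= s ==> integrable N (%om. exp (- s* A om))"
 by (rule integrable_const_bound[of _ 1]) (use A_nonneg in \<open>auto elim!: eventually_mono\<close>)

lemma ps_eq: "0 < s ==> ps s = (LINT om|N. (1-exp (- s* A om))/s)"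
 using exp_integrable[of s] by (simp add: ps_def ph_def prob_space)

lemma ps_antimono: assumes "0 < s" "s <= t" shows "ps t <= ps s"
proof -
 have "(LINT om|N. (1-exp (- t* A om))/t) <= (LINT om|N. (1-exp (- s* A om))/s)"
  by (rule integral_mono_AE) (use assms exp_integrable A_nonneg one_minus_exp_quotient(2)[OF _ assms] in \<open>auto elim!: eventually_mono\<close>)
 thus ?thesis using assms by (simp add: ps_eq)
qed

lemma ps_nonneg: assumes "0 < s" shows "0 <= ps s"
 unfolding ps_eq[OF assms] by (rule integral_nonneg_AE) (use assms A_nonneg in \<open>auto elim!: eventually_mono\<close>)

lemma exponents:
 "0 < 1-1/al" "t powr (1+1/al)* t powr (- 1/al) = (t::real) powr (2-1)" "0 < 1+1/al"
 using alpha by (auto simp: powr_collect add_pos_pos)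

text \<open>Subtracting the identity from the transform of t^(-1/al) makes 1 - \<open>ph\<close>
  appear; t = u / l moves l into the argument of \<open>ps\<close>.\<close>

lemma ps_laplace:
 assumes l: "0 < l"
 shows "sint {0<..} (%u. exp (- u)* u* ps ((u/l) powr (1+1/al)))" (is ?g1)
  "(LBINT u:{0<..}. exp (- u)* u* ps ((u/l) powr (1+1/al))) = Gamma (1-1/al)*(l^2*(l powr (1/al-1)-laplace_rhs al l))" (is ?g2)
proof -
 define s where "s = 1-1/al"
 have s: "0 < s" "s-1 = - 1/al" "- s = 1/al-1" using exponents by (auto simp: s_def)
 let ?F = "%t. exp (- l* t)* t powr (- 1/al)-exp (- l* t)* ph (t powr (1+1/al))* t powr (- 1/al)"
 note g = gamma_laplace_open[OF s(1) l, unfolded s(2,3)]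
 note i = laplace_integrable[OF l, folded ph_def] and e = laplace_eq[OF l, folded ph_def]
 have Fi: "sint {0<..} ?F" by (rule set_integral_diff(1)[OF g(1) i])
 have FI: "(LBINT t:{0<..}. ?F t) = Gamma s*(l powr (1/al-1)-laplace_rhs al l)"
  unfolding set_integral_diff(2)[OF g(1) i] g(2) e by (simp add: s_def algebra_simps)
 have pw: "?F ((1/l)* u) = (1/l)*(exp (- u)* u* ps ((u/l) powr (1+1/al)))" if u: "0 < u" for u
 proof -
  define t where "t = u/l"
  have t: "0 < t" "l* t = u" using u l by (auto simp: t_def)
  have p: "t powr (- 1/al) = t/t powr (1+1/al)" using exponents(2)[of t] t by (simp add: field_simps)
  have "?F t = exp (- u)* t powr (- 1/al)*(1-ph (t powr (1+1/al)))"
   using t(2) by (simp add: algebra_simps)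
  also have "... = exp (- u)* t* ps (t powr (1+1/al))" unfolding p by (simp add: ps_def)
  finally show ?thesis by (simp add: t_def)
 qed
 have l1: "0 < 1/l" using l by simp
 have c: "sint {0<..} (%u. ?F ((1/l)* u)) \<longleftrightarrow> sint {0<..} (%u. (1/l)*(exp (- u)* u* ps ((u/l) powr (1+1/al))))"
  unfolding set_integrable_def by (intro Bochner_Integration.integrable_cong refl) (use pw in \<open>auto simp: indicator_def\<close>)
 hence "sint {0<..} (%u. (1/l)*(exp (- u)* u* ps ((u/l) powr (1+1/al))))"
  using open_half_line_scale(2)[OF l1 Fi] by blast
 from set_integrable_mult_right[OF this, of l]
 show ?g1 using l by simp
 have "(LBINT t:{0<..}. ?F t) = (1/l)*(LBINT u:{0<..}. ?F ((1/l)* u))" by (rule open_half_line_scale(1)[OF l1])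
 also have "(LBINT u:{0<..}. ?F ((1/l)* u)) = (LBINT u:{0<..}. (1/l)*(exp (- u)* u* ps ((u/l) powr (1+1/al))))"
  by (rule set_lebesgue_integral_cong) (use pw in auto)
 also have "... = (1/l)*(LBINT u:{0<..}. exp (- u)* u* ps ((u/l) powr (1+1/al)))" by (rule set_integral_mult_right)
 finally show ?g2
  unfolding FI using l by (simp add: s_def power2_eq_square field_simps)
qed

text \<open>The averages J of \<open>ps\<close> converge by the expansion. For u in (0,1] the
  argument of \<open>ps\<close> is at most S n, so J bounds \<open>ps (S n)\<close> and monotone
  convergence gives a finite mean m. Then m dominates \<open>ps\<close>, J tends to m, and the two
  limits of J agree.\<close>

lemma area_mean: "integrable N A" "(LINT om|N. A om) = Gamma (1-1/al)*((al+1)/(2* al))"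
proof -
 let ?ga = "1+1/al" and ?mu = "Gamma (1-1/al)*((al+1)/(2* al))"
 define X where "X = (%n. real n+1)"
 have X: "!!n. 0 < X n" "filterlim X at_top sequentially" unfolding X_def by (auto simp: add_nonneg_pos) real_asymp
 define J where "J = (%n. LBINT u:{0<..}. exp (- u)* u* ps ((u/X n) powr ?ga))"
 have Jlim: "J ----> ?mu"
  unfolding J_def ps_laplace(2)[OF X(1)]
  by (intro tendsto_mult tendsto_const) (rule filterlim_compose[OF laplace_rhs_expansion(1)[OF alpha] X(2)])
 define S where "S = (%n. (1/X n) powr ?ga)"
 have S0: "0 < S n" for n using X(1)[of n] by (simp add: S_def)
 have Sdec: "S n <= S m" if "m <= n" for m n
  unfolding S_def using that exponents(3) X(1) by (intro powr_mono2) (auto simp: X_def frac_le)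
 have Slim: "S ----> 0"
 proof -
  have "(%n. 1/X n) ----> 0" unfolding X_def by real_asymp
  moreover have "(%n. 1/X n) = (%n. 1/X n)" ..
  ultimately have "(%n. (1/X n) powr ?ga) ----> 0 powr ?ga"
   using exponents(3) by (intro tendsto_powr2) (auto simp: X_def)
  thus ?thesis by (simp add: S_def)
 qed
 define c where "c = (LBINT u:{0::real<..1}. exp (- u)* u)"
 have ci: "sint {0<..} (%u::real. exp (- u)* u)" "(LBINT u:{0::real<..}. exp (- u)* u) = 1"
 proof -
  have "sint {0<..} (%u::real. exp (- u)* u) \<longleftrightarrow> sint {0<..} (%u::real. exp (- 1* u)* u powr (2-1))"
   unfolding set_integrable_def by (intro Bochner_Integration.integrable_cong refl) (auto simp: indicator_def)
  thus "sint {0<..} (%u::real. exp (- u)* u)" using gamma_laplace_open(1)[of 2 1] by simp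
  have "(LBINT u:{0::real<..}. exp (- u)* u) = (LBINT u:{0<..}. exp (- 1* u)* u powr (2-1))"
   by (rule set_lebesgue_integral_cong) auto
  thus "(LBINT u:{0::real<..}. exp (- u)* u) = 1" using gamma_laplace_open(2)[of 2 1] by (simp add: Gamma_numeral)
 qed
 have ci1: "sint {0<..1} (%u::real. exp (- u)* u)" by (rule set_integrable_subset[OF ci(1)]) auto
 have c0: "0 < c"
 proof -
  have "(LINT u|lborel. indicator {1/2<..1::real} u*(exp (- 1)/2 :: real)) <= c" unfolding c_def slint_def
  proof (rule integral_mono')
   fix u :: real
   have "exp (- 1)*(1/2) <= exp (- u)* u" if "1/2 < u" "u <= 1" using that by (intro mult_mono) auto
   thus "indicator {1/2<..1} u*(exp (- 1)/2) <= indicator {0<..1} u *\<^sub>R (exp (- u)* u)"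
    by (auto simp: indicator_def)
   show "0 <= indicator {0<..1} u *\<^sub>R (exp (- u)* u)" by (auto simp: indicator_def)
  qed (use ci1 in \<open>simp add: set_integrable_def\<close>)
  moreover have "(LINT u|lborel. indicator {1/2<..1::real} u*(exp (- 1)/2 :: real)) = 1/2*(exp (- 1)/2 :: real)" by simp
  moreover have "0 < exp (- 1 :: real)" by simp
  ultimately show ?thesis by linarith
 qed
 have low: "c* ps (S n) <= J n" for n
 proof -
  have "c* ps (S n) = (LBINT u:{0<..1}. exp (- u)* u* ps (S n))" unfolding c_def by simp
  also have "... <= J n" unfolding J_def slint_def
  proof (rule integral_mono)
   show "integrable lborel (%u. indicator {0<..1} u *\<^sub>R (exp (- u)* u* ps (S n)))"
    using set_integrable_mult_left[OF ci1, of "ps (S n)"] by (simp add: set_integrable_def)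
   show "integrable lborel (%u. indicator {0<..} u *\<^sub>R (exp (- u)* u* ps ((u/X n) powr ?ga)))"
    using ps_laplace(1)[OF X(1)] by (simp add: set_integrable_def)
   fix u :: real
   have "ps (S n) <= ps ((u/X n) powr ?ga)" if "0 < u" "u <= 1"
    unfolding S_def using that X(1)[of n] exponents(3) by (intro ps_antimono powr_mono2) (auto simp: divide_right_mono)
   moreover have "0 <= ps ((u/X n) powr ?ga)" if "0 < u" using that X(1)[of n] by (intro ps_nonneg) auto
   ultimately show "indicator {0<..1} u *\<^sub>R (exp (- u)* u* ps (S n)) <= indicator {0<..} u *\<^sub>R (exp (- u)* u* ps ((u/X n) powr ?ga))"
    by (auto simp: indicator_def)
  qed
  finally show ?thesis .
 qed
 obtain B where B: "!!n. J n <= B"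
  using convergent_imp_Bseq[OF convergentI[OF Jlim]] unfolding Bseq_def by (auto simp: abs_le_iff)
 have psB: "ps (S n) <= B/c" for n using order_trans[OF low B] c0 by (simp add: le_divide_eq mult.commute)
 have inc: "incseq (%n. ps (S n))" by (intro incseq_SucI ps_antimono S0 Sdec) simp
 obtain m where m: "(%n. ps (S n)) ----> m" using incseq_convergent[OF inc] psB by blast
 have mon: "AE om in N. mono (%n. (1-exp (- S n* A om))/S n)"
  using A_nonneg by eventually_elim (intro incseq_SucI one_minus_exp_quotient(2) S0 Sdec, auto)
 have ptw: "AE om in N. (%n. (1-exp (- S n* A om))/S n) ----> A om"
 proof (rule AE_I2)
  fix om
  have "((%s. (1-exp (- s* a))/s) ---> a) (at_right 0)" for a :: real
  proof -
   have "((%s. exp (- s* a)) has_field_derivative-a) (at 0)" by (auto intro!: derivative_eq_intros)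
   hence "((%h. (exp (- h* a)-1)/h) --->-a) (at 0)" by (simp add: DERIV_def)
   from tendsto_minus[OF this] have "((%h. (1-exp (- h* a))/h) ---> a) (at 0)" by (simp add: minus_divide_left)
   thus ?thesis by (rule filterlim_mono[OF _ order_refl at_le]) simp
  qed
  from filterlim_compose[OF this positive_null_sequence(1)[OF S0 Slim]]
  show "(%n. (1-exp (- S n* A om))/S n) ----> A om" .
 qed
 have mi: "has_bochner_integral N A m"
  by (rule has_bochner_integral_monotone_convergence[OF _ mon ptw])
   (use exp_integrable[OF less_imp_le[OF S0]] m ps_eq[OF S0] in auto)
 thus Ai: "integrable N A" by (rule integrable.intros)
 have EA: "(LINT om|N. A om) = m" using mi by (rule has_bochner_integral_integral_eq)
 have psm: "ps s <= m" if "0 < s" for s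
  unfolding EA[symmetric] ps_eq[OF that]
  by (rule integral_mono_AE) (use that exp_integrable Ai A_nonneg one_minus_exp_quotient(1) in \<open>auto elim!: eventually_mono\<close>)
 have up: "eventually (%s. a < ps s) (at_right 0)" if a: "a < m" for a
 proof -
  obtain n where n: "a < ps (S n)" using eventually_happens[OF order_tendstoD(1)[OF m a]] by auto
  have "eventually (%s. s \<in> {0<..<S n}) (at_right 0)" by (rule eventually_at_right_real[OF S0])
  thus ?thesis
  proof eventually_elim
   case (elim s)
   hence "ps (S n) <= ps s" by (intro ps_antimono) auto
   thus ?case using n by simp
  qed
 qed
 have pslim: "(ps ---> m) (at_right 0)"
 proof (rule order_tendstoI[OF up])
  fix a assume "m < a"
  have "eventually (%s. s \<in> {0<..<1::real}) (at_right 0)" by (rule eventually_at_right_real) simp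
  thus "eventually (%s. ps s < a) (at_right 0)" by eventually_elim (use psm \<open>m < a\<close> in \<open>auto intro: le_less_trans\<close>)
 qed
 have "J ----> (LBINT u:{0<..}. exp (- u)* u* m)" unfolding J_def slint_def
 proof (rule integral_dominated_convergence[where w = "%u. indicator {0<..} u *\<^sub>R (exp (- u)* u* m)"])
  show "integrable lborel (%u. indicator {0<..} u *\<^sub>R (exp (- u)* u* m))"
   using set_integrable_mult_left[OF ci(1), of m] by (simp add: set_integrable_def)
  show "AE u in lborel. norm (indicator {0<..} u *\<^sub>R (exp (- u)* u* ps ((u/X n) powr ?ga))) <= indicator {0<..} u *\<^sub>R (exp (- u)* u* m)" for n
  proof (rule AE_I2)
   fix u :: real
   have "0 <= ps ((u/X n) powr ?ga)" "ps ((u/X n) powr ?ga) <= m" if "0 < u"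
    using that X(1)[of n] by (intro ps_nonneg psm; simp)+
   thus "norm (indicator {0<..} u *\<^sub>R (exp (- u)* u* ps ((u/X n) powr ?ga))) <= indicator {0<..} u *\<^sub>R (exp (- u)* u* m)"
    by (auto simp: indicator_def abs_mult)
  qed
  show "AE u in lborel. (%n. indicator {0<..} u *\<^sub>R (exp (- u)* u* ps ((u/X n) powr ?ga))) ----> indicator {0<..} u *\<^sub>R (exp (- u)* u* m)"
  proof (rule AE_I2)
   fix u :: real
   show "(%n. indicator {0<..} u *\<^sub>R (exp (- u)* u* ps ((u/X n) powr ?ga))) ----> indicator {0<..} u *\<^sub>R (exp (- u)* u* m)"
   proof (cases "0 < u")
    case True
    have "(u/X n) powr ?ga = u powr ?ga* S n" for n using True X(1)[of n] by (simp add: S_def powr_divide)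
    moreover have "(%n. u powr ?ga* S n) ----> 0" using tendsto_mult[OF tendsto_const Slim] by simp
    ultimately have "filterlim (%n. (u/X n) powr ?ga) (at_right 0) sequentially"
     using True S0 by (intro positive_null_sequence(1)) auto
    from filterlim_compose[OF pslim this] show ?thesis by (intro tendsto_scaleR tendsto_mult tendsto_const)
   qed simp
  qed
 qed measurable
 hence "J ----> m" using ci(2) by simp
 thus "(LINT om|N. A om) = ?mu" unfolding EA using LIMSEQ_unique Jlim by blast
qed

text \<open>Second remainder of the Laplace transform at 0, chosen because it is nonnegative and
  increasing for s >= 0.\<close>

definition "rh s = ph s-1+s*(LINT om|N. A om)"

lemma rh_measurable [measurable]: "rh \<in> borel_measurable borel" unfolding rh_def[abs_def] by measurable

lemma rh_eq: "0 <= s ==> rh s = (LINT om|N. exp (- s* A om)-1+s* A om)"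
 using exp_integrable[of s] area_mean(1) by (simp add: rh_def ph_def prob_space)

lemma rh_mono: assumes "0 <= s" "s <= t" shows "rh s <= rh t"
proof -
 have "(LINT om|N. exp (- s* A om)-1+s* A om) <= (LINT om|N. exp (- t* A om)-1+t* A om)"
  by (rule integral_mono_AE)
   (use assms exp_integrable area_mean(1) A_nonneg one_minus_exp_quotient(3)[OF _ assms] in \<open>auto elim!: eventually_mono\<close>)
 thus ?thesis using assms by (simp add: rh_eq)
qed

lemma rh_nonneg: "0 <= s ==> 0 <= rh s"
 using rh_mono[of 0 s] by (simp add: rh_def ph_def prob_space)

lemma rh_laplace:
 assumes l: "0 < l"
 shows "sint {0<..} (%t. exp (- l* t)*(rh (t powr (1+1/al))* t powr (- 1/al)))" (is ?g1)
  "(LBINT t:{0<..}. exp (- l* t)*(rh (t powr (1+1/al))* t powr (- 1/al)))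
   = Gamma (1-1/al)*(laplace_rhs al l-l powr (1/al-1)+(al+1)/(2* al)* l powr (- 2))" (is ?g2)
proof -
 define s where "s = 1-1/al"
 have s: "0 < s" "s-1 = - 1/al" "- s = 1/al-1" using exponents by (auto simp: s_def)
 define m where "m = (LINT om|N. A om)"
 note g = gamma_laplace_open[OF s(1) l, unfolded s(2,3)] and g2 = gamma_laplace_open[of 2, OF _ l]
 note i = laplace_integrable[OF l, folded ph_def] and e = laplace_eq[OF l, folded ph_def]
 have g2i: "sint {0<..} (%t. m*(exp (- l* t)* t powr (2-1)))" by (rule set_integrable_mult_right[OF g2(1)]) simp
 have pw: "exp (- l* t)*(rh (t powr (1+1/al))* t powr (- 1/al))
   = exp (- l* t)* ph (t powr (1+1/al))* t powr (- 1/al)-exp (- l* t)* t powr (- 1/al)+m*(exp (- l* t)* t powr (2-1))" for t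
  unfolding exponents(2)[symmetric] by (simp add: rh_def m_def algebra_simps)
 note d = set_integral_diff[OF i g(1)]
 show ?g1
  unfolding pw by (rule set_integral_add(1)[OF d(1) g2i])
 have "(LBINT t:{0<..}. exp (- l* t)*(rh (t powr (1+1/al))* t powr (- 1/al))) = Gamma s* laplace_rhs al l-Gamma s* l powr (1/al-1)+m* l powr (- 2)"
  unfolding pw set_integral_add(2)[OF d(1) g2i] d(2) set_integral_mult_right g(2) e using g2(2) by (simp add: s_def Gamma_numeral)
 thus ?g2
  unfolding m_def area_mean(2) by (simp add: s_def algebra_simps)
qed

text \<open>The transform of rh (t^(1+1/al)) t^(-1/al) is of order x^(-e) with e = 2 + al - 1/al, so
  by monotonicity rh (t^(1+1/al)) behaves like a constant over Gamma e times t^(al+1). Returning to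
  s = t^(1+1/al) gives the exponent (al+1) / (1+1/al) = al.\<close>

lemma rh_asymptotics:
 assumes a2: "al < 2"
 shows "((%s. s powr (- al)* rh s) ---> Gamma (1-1/al)* Gamma (1+al)/Gamma (2+al-1/al)) (at_right 0)"
proof -
 let ?ga = "1+1/al"
 define c e where "c = Gamma (1-1/al)* Gamma (1+al)" and "e = 2+al-1/al"
 define J where "J = (%l. LBINT t:{0<..}. exp (- l* t)*(rh (t powr ?ga)* t powr (- 1/al)))"
 have ia: "1/al < 1" using alpha by simp
 have e: "0 < e" using alpha ia unfolding e_def by linarith
 have Ge: "0 < Gamma e" by (rule Gamma_real_pos[OF e])
 have s: "0 < 1-1/al" "(1-1/al)-1 = - 1/al" using ia by auto
 have Jlim: "((%x. x powr e* J x) ---> c) at_top"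
 proof -
  have "Gamma (2+al) = (1+al)* Gamma (1+al)" using Gamma_plus1[of "1+al"] alpha by (auto simp: add_ac nonpos_Ints_def)
  hence c: "Gamma (1-1/al)*(Gamma (2+al)/(1+al)) = c" using alpha by (simp add: c_def)
  have "((%x. Gamma (1-1/al)*(x powr (al+2-1/al)*(laplace_rhs al x-x powr (1/al-1)+(al+1)/(2* al)* x powr (- 2))))
   ---> Gamma (1-1/al)*(Gamma (2+al)/(1+al))) at_top"
   by (intro tendsto_mult tendsto_const laplace_rhs_expansion(2)[OF alpha a2])
  moreover have "eventually (%x. Gamma (1-1/al)*(x powr (al+2-1/al)*(laplace_rhs al x-x powr (1/al-1)+(al+1)/(2* al)* x powr (- 2)))
    = x powr e* J x) at_top"
   using eventually_gt_at_top[of 0] 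
  proof eventually_elim
   case (elim x)
   have "al+2-1/al = e" by (simp add: e_def)
   thus ?case unfolding J_def rh_laplace(2)[OF elim] by (simp only: mult_ac)
  qed
  ultimately show ?thesis unfolding c by (rule Lim_transform_eventually)
 qed
 have "((%x. x powr (al+1)* rh ((1/x) powr ?ga)) ---> c/Gamma e) at_top"
 proof (rule tendsto_at_top_positive_seqI)
  fix X :: "nat => real" assume X: "!!n. 0 < X n" "filterlim X at_top sequentially"
  define g where "g = (%n t. X n powr (al+1)* rh ((t/X n) powr ?ga))"
  define g0 where "g0 = (%t. c/Gamma e* t powr (al+1))"
  define w where "w = (%t::real. t powr (- 1/al))"
  define F where "F = (%l n v. exp (- (l* X n)* v)*(rh (v powr ?ga)* v powr (- 1/al)))"
  have pw: "exp (- l* t)*(g n t* w t) = X n powr (al+1-1/al)* F l n ((1/X n)* t)" if "0 < t" for l n t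
  proof -
   have "w t = X n powr (- 1/al)*(t/X n) powr (- 1/al)"
    using powr_mult[of "X n" "t/X n" "- 1/al"] X(1)[of n] that by (simp add: w_def)
   hence "exp (- l* t)*(g n t* w t) = (X n powr (al+1)* X n powr (- 1/al))*(exp (- l* t)*(rh ((t/X n) powr ?ga)*(t/X n) powr (- 1/al)))"
    by (simp add: g_def mult_ac)
   also have "X n powr (al+1)* X n powr (- 1/al) = X n powr (al+1-1/al)" by (rule powr_collect) simp
   finally show ?thesis using X(1)[of n] by (simp add: F_def)
  qed
  have pw0: "exp (- l* t)*(g0 t* w t) = c/Gamma e*(exp (- l* t)* t powr (e-1))" for l t
   using powr_collect[of "al+1" "- 1/al" "e-1" t] by (simp add: g0_def w_def e_def mult_ac)
  have Fi: "sint {0<..} (F l n)" "(LBINT v:{0<..}. F l n v) = J (l* X n)" if "0 < l" for l n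
   using rh_laplace(1)[of "l* X n"] that X(1)[of n] by (auto simp: F_def J_def)
  have X1: "0 < 1/X n" for n using X(1) by simp
  have cong: "sint {0<..} (%t. exp (- l* t)*(g n t* w t)) \<longleftrightarrow> sint {0<..} (%t. X n powr (al+1-1/al)* F l n ((1/X n)* t))" for l n
   unfolding set_integrable_def by (intro Bochner_Integration.integrable_cong refl) (use pw in \<open>auto simp: indicator_def\<close>)
  have gi: "sint {0<..} (%t. exp (- l* t)*(g n t* w t))" if "0 < l" for l n
   unfolding cong by (rule set_integrable_mult_right[OF open_half_line_scale(2)[OF X1 Fi(1)[OF that]]])
  have gI: "(LBINT t:{0<..}. exp (- l* t)*(g n t* w t)) = l powr (- e)*((l* X n) powr e* J (l* X n))" if l: "0 < l" for l n
  proof -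
   have "(LBINT t:{0<..}. exp (- l* t)*(g n t* w t)) = (LBINT t:{0<..}. X n powr (al+1-1/al)* F l n ((1/X n)* t))"
    by (rule set_lebesgue_integral_cong) (use pw in auto)
   also have "... = X n powr (al+1-1/al)*(LBINT t:{0<..}. F l n ((1/X n)* t))" by (rule set_integral_mult_right)
   also have "(LBINT t:{0<..}. F l n ((1/X n)* t)) = X n powr 1* J (l* X n)"
    using open_half_line_scale(1)[OF X1, of "F l n" n] Fi(2)[OF l, of n] X(1)[of n] by (simp add: field_simps)
   also have "X n powr (al+1-1/al)*(X n powr 1* J (l* X n)) = X n powr e* J (l* X n)"
    unfolding mult.assoc[symmetric] by (subst powr_collect[of _ _ e]) (simp_all add: e_def)
   also have "X n powr e = l powr (- e)*(l* X n) powr e" using l X(1)[of n] by (simp add: powr_mult powr_minus)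
   finally show ?thesis by simp
  qed
  note gle = gamma_laplace_open[OF e]
  have g0i: "sint {0<..} (%t. exp (- l* t)*(g0 t* w t))" if "0 < l" for l
   unfolding pw0 by (rule set_integrable_mult_right[OF gle(1)[OF that]])
  have g0I: "(LBINT t:{0<..}. exp (- l* t)*(g0 t* w t)) = l powr (- e)* c" if "0 < l" for l
   unfolding pw0 set_integral_mult_right gle(2)[OF that] using Ge by simp
  have Gs: "0 <= c" unfolding c_def using Gamma_real_pos[OF s(1)] Gamma_real_pos[of "1+al"] alpha by simp
  have "(%n. g n 1) ----> g0 1"
  proof (rule laplace_monotone_lim[where w = w and g = g and ?g0.0 = g0 and ?t0.0 = 1])
   show "sint {0<..} (%t. exp (- t)* w t)" using gamma_laplace_open(1)[OF s(1), of 1] unfolding w_def s(2) by simp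
   show "0 <= g n t" for n t using rh_nonneg[of "(t/X n) powr ?ga"] by (simp add: g_def)
   show "0 <= g0 t" for t using Gs Ge by (simp add: g0_def)
   show "(\<forall>n s t. 0 < s --> s <= t --> g n s <= g n t) \<or> (\<forall>n s t. 0 < s --> s <= t --> g n t <= g n s)"
    unfolding g_def using X(1) exponents(3)
    by (intro disjI1 allI impI mult_left_mono rh_mono powr_mono2 divide_right_mono) (auto intro: less_imp_le divide_nonneg_pos)
   show "isCont g0 1" unfolding g0_def by (intro continuous_intros) auto
   fix l :: real assume l: "0 < l"
   have "filterlim (%n. l* X n) at_top sequentially" by (rule filterlim_tendsto_pos_mult_at_top[OF tendsto_const l X(2)])
   from filterlim_compose[OF Jlim this]
   show "(%n. LBINT t:{0<..}. exp (- l* t)*(g n t* w t)) ----> (LBINT t:{0<..}. exp (- l* t)*(g0 t* w t))"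
    unfolding gI[OF l] g0I[OF l] by (intro tendsto_mult tendsto_const)
  qed (use gi g0i in \<open>auto simp: w_def\<close>)
  thus "(%n. X n powr (al+1)* rh ((1/X n) powr ?ga)) ----> c/Gamma e" by (simp add: g_def g0_def)
 qed
 moreover have "filterlim (%s::real. s powr (- (1/?ga))) at_top (at_right 0)"
 proof -
  define b where "b = 1/?ga"
  have "0 < b" using exponents(3) by (simp add: b_def)
  hence "filterlim (%s::real. s powr (- b)) at_top (at_right 0)" by real_asymp
  thus ?thesis by (simp add: b_def)
 qed
 ultimately have "((%s. (s powr (- (1/?ga))) powr (al+1)* rh ((1/s powr (- (1/?ga))) powr ?ga)) ---> c/Gamma e) (at_right 0)"
  by (rule filterlim_compose)
 moreover have "eventually (%s. (s powr (- (1/?ga))) powr (al+1)* rh ((1/s powr (- (1/?ga))) powr ?ga) = s powr (- al)* rh s) (at_right 0)"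
  using eventually_at_right_less[of "0::real"]
 proof eventually_elim
  case (elim s)
  have "- (1/?ga)*(al+1) = - al" using alpha by (simp add: field_simps)
  hence "(s powr (- (1/?ga))) powr (al+1) = s powr (- al)" by (simp only: powr_powr)
  moreover have "(1/s powr (- (1/?ga))) powr ?ga = s"
  proof -
   have "1/s powr (- (1/?ga)) = s powr (1/?ga)" by (simp only: powr_minus_divide) simp
   thus ?thesis using elim exponents(3) by (simp add: powr_powr)
  qed
  ultimately show ?case by simp
 qed
 ultimately show ?thesis unfolding c_def e_def by (rule Lim_transform_eventually)
qed

text \<open>The integrated tail. Its transform rh s / s^2 diverges at 0 like s^(al-2), so the
  monotone Laplace theorem applies to it directly; the transform of the tail itself has the finite
  limit E[A], which hides the power.\<close>

definition "V x = (LINT om|N. max 0 (A om-x))"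

lemma V_integrable: "integrable N (%om. max 0 (A om-x))"
 using area_mean(1) by simp

lemma V_antimono: "x <= y ==> V y <= V x"
 unfolding V_def by (intro integral_mono V_integrable) auto

lemma V_nonneg: "0 <= V x" unfolding V_def by (intro integral_nonneg_AE) simp

lemma hinge_laplace:
 fixes a s :: real
 assumes a: "0 <= a" and s: "0 < s"
 shows "(LINT x|lborel. indicator {0<..} x *\<^sub>R (exp (- s* x)* max 0 (a-x))) = (exp (- s* a)-1+s* a)/s^2"
proof -
 let ?G = "%x. exp (- s* x)*(1/s^2-(a-x)/s)"
 have "(LINT x|lborel. (exp (- s* x)*(a-x))* indicator {0..a} x) = ?G a-?G 0"
 proof (rule integral_FTC_Icc_real[OF a])
  fix x
  show "DERIV ?G x :> exp (- s* x)*(a-x)"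
   by (rule derivative_eq_intros refl | use s in \<open>simp add: field_simps power2_eq_square\<close>)+
  show "isCont (%x. exp (- s* x)*(a-x)) x" by (intro continuous_intros)
 qed
 moreover have "(LINT x|lborel. indicator {0<..} x *\<^sub>R (exp (- s* x)* max 0 (a-x))) = (LINT x|lborel. (exp (- s* x)*(a-x))* indicator {0..a} x)"
  by (rule integral_cong_AE) (use AE_lborel_singleton[of 0] in \<open>auto simp: indicator_def max_def elim!: eventually_mono\<close>)
 ultimately show ?thesis using s by (simp add: field_simps power2_eq_square)
qed

lemma V_laplace:
 assumes s: "0 < s"
 shows "sint {0<..} (%x. exp (- s* x)* V x)" (is ?g1) "(LBINT x:{0<..}. exp (- s* x)* V x) = rh s/s^2" (is ?g2)
proof -
 note bml = borel_measurable_lebesgue_integral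
 interpret pair_sigma_finite lborel N ..
 let ?f = "%x om. indicator {0<..} x *\<^sub>R (exp (- s* x)* max 0 (A om-x))"
 have fm: "(%(x, om). ?f x om) \<in> borel_measurable (lborel \<Otimes>\<^sub>M N)" by measurable
 have in1: "(LINT om|N. ?f x om) = indicator {0<..} x *\<^sub>R (exp (- s* x)* V x)" for x by (simp add: V_def)
 have nn: "norm (?f x om) = ?f x om" for x om by (simp add: indicator_def)
 have Vm: "V \<in> borel_measurable borel"
 proof -
  have "(%(x, om). max 0 (A om-x)) \<in> borel_measurable (borel \<Otimes>\<^sub>M N)" by measurable
  from bml[OF this] show ?thesis unfolding V_def[abs_def] .
 qed
 have Vi: ?g1
 proof (rule set_integrable_bound[OF set_integrable_mult_left[OF gamma_laplace_open(1)[of 1, OF _ s], of "V 0"]])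
  show "set_borel_measurable lborel {0<..} (%x. exp (- s* x)* V x)" unfolding set_borel_measurable_def using Vm by measurable
  have "norm (exp (- s* x)* V x) <= norm (exp (- s* x)* x powr (1-1)* V 0)" if "0 < x" for x
   using that V_antimono[of 0 x] V_nonneg by (simp add: abs_mult)
  thus "AE x in lborel. x \<in> {0<..} --> norm (exp (- s* x)* V x) <= norm (exp (- s* x)* x powr (1-1)* V 0)" by auto
 qed simp
 thus ?g1 .
 have fi: "integrable (lborel \<Otimes>\<^sub>M N) (%(x, om). ?f x om)"
 proof (rule Fubini_integrable[OF fm])
  show "integrable lborel (%x. \<integral>om. norm (case (x, om) of (x, om) => ?f x om) \<partial>N)"
   unfolding prod.case nn in1 using Vi by (simp only: set_integrable_def)
  show "AE x in lborel. integrable N (%om. case (x, om) of (x, om) => ?f x om)"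
   unfolding prod.case by (intro AE_I2 integrable_scaleR_right integrable_mult_right V_integrable)
 qed
 have "(LINT om|N. (LINT x|lborel. ?f x om)) = (LINT x|lborel. (LINT om|N. ?f x om))" by (rule Fubini_integral[OF fi])
 hence "(LBINT x:{0<..}. exp (- s* x)* V x) = (LINT om|N. (LINT x|lborel. ?f x om))"
  unfolding in1 slint_def by (rule sym)
 also have "... = (LINT om|N. (exp (- s* A om)-1+s* A om)/s^2)"
 proof (rule integral_cong_AE)
  show "(%om. \<integral>x. ?f x om \<partial>lborel) \<in> borel_measurable N"
   using fm by (intro lborel.borel_measurable_lebesgue_integral) (simp add: split_beta' measurable_pair_swap_iff[of _ N] cong: measurable_cong)
  show "AE om in N. (LINT x|lborel. ?f x om) = (exp (- s* A om)-1+s* A om)/s^2"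
   using A_nonneg by eventually_elim (rule hinge_laplace[OF _ s])
 qed measurable
 also have "... = rh s/s^2" using s by (simp add: rh_eq)
 finally show ?g2 .
qed

text \<open>The rescaled function X^(al-1) V (X x) has the transform l^(al-2) (l/X)^(-al) rh (l/X),
  which converges to c l^(al-2), the transform of c x^(1-al) / Gamma (2-al).\<close>

lemma V_asymptotics:
 assumes a2: "al < 2" and c: "((%s. s powr (- al)* rh s) ---> c) (at_right 0)" "0 <= c"
 shows "((%x. x powr (al-1)* V x) ---> c/Gamma (2-al)) at_top"
proof (rule tendsto_at_top_positive_seqI)
 fix X :: "nat => real" assume X: "!!n. 0 < X n" "filterlim X at_top sequentially"
 have b: "0 < 2-al" using a2 by simp
 have Gb: "0 < Gamma (2-al)" by (rule Gamma_real_pos[OF b])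
 define g where "g = (%n x. X n powr (al-1)* V (X n* x))"
 define g0 where "g0 = (%x. c/Gamma (2-al)* x powr ((2-al)-1))"
 define F where "F = (%l n v. exp (- (l/X n)* v)* V v)"
 have pw: "exp (- l* x)*(g n x*1) = X n powr (al-1)* F l n (X n* x)" for l n x
  using X(1)[of n] by (simp add: g_def F_def mult_ac)
 have pw0: "exp (- l* x)*(g0 x*1) = c/Gamma (2-al)*(exp (- l* x)* x powr ((2-al)-1))" for l x
  by (simp add: g0_def mult_ac)
 have lX: "0 < l/X n" if "0 < l" for l n using that X(1)[of n] by simp
 have gi: "sint {0<..} (%x. exp (- l* x)*(g n x*1))" if "0 < l" for l n
  unfolding pw F_def by (rule set_integrable_mult_right[OF open_half_line_scale(2)[OF X(1) V_laplace(1)[OF lX[OF that]]]])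
 have gI: "(LBINT x:{0<..}. exp (- l* x)*(g n x*1)) = l powr (al-2)*((l/X n) powr (- al)* rh (l/X n))" if l: "0 < l" for l n
 proof -
  have "(LBINT v:{0<..}. F l n v) = X n*(LBINT x:{0<..}. F l n (X n* x))" by (rule open_half_line_scale(1)[OF X(1)])
  hence "X n*(LBINT x:{0<..}. F l n (X n* x)) = rh (l/X n)/(l/X n)\<^sup>2"
   using V_laplace(2)[OF lX[OF l, of n]] by (simp only: F_def)
  hence "(LBINT x:{0<..}. F l n (X n* x)) = rh (l/X n)/(l/X n)\<^sup>2/X n"
   using X(1)[of n] by (metis nonzero_mult_div_cancel_left less_irrefl)
  hence "(LBINT x:{0<..}. exp (- l* x)*(g n x*1)) = X n powr (al-1)*(rh (l/X n)/(l/X n)\<^sup>2/X n)"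
   unfolding pw set_integral_mult_right by simp
  also have "... = l powr (al-2)*((l/X n) powr (- al)* rh (l/X n))"
   using l X(1)[of n] by (simp add: powr_diff powr_divide powr_minus powr_numeral field_simps power2_eq_square)
  finally show ?thesis .
 qed
 note gl = gamma_laplace_open[OF b]
 have g0i: "sint {0<..} (%x. exp (- l* x)*(g0 x*1))" if "0 < l" for l
  unfolding pw0 by (rule set_integrable_mult_right[OF gl(1)[OF that]])
 have g0I: "(LBINT x:{0<..}. exp (- l* x)*(g0 x*1)) = l powr (al-2)* c" if "0 < l" for l
  unfolding pw0 set_integral_mult_right gl(2)[OF that] using Gb by simp
 have "(%n. g n 1) ----> g0 1"
 proof (rule laplace_monotone_lim[where w = "%_. 1" and g = g and ?g0.0 = g0 and ?t0.0 = 1])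
  show "sint {0<..} (%t::real. exp (- t)*1)"
   using set_integral_open_half_line(1)[OF set_integrable_exp_neg_scaled[of 1]] by simp
  show "0 <= g n t" for n t using V_nonneg by (simp add: g_def)
  show "0 <= g0 t" for t using c(2) Gb by (simp add: g0_def)
  show "(\<forall>n s t. 0 < s --> s <= t --> g n s <= g n t) \<or> (\<forall>n s t. 0 < s --> s <= t --> g n t <= g n s)"
   unfolding g_def using X(1) by (intro disjI2 allI impI mult_left_mono V_antimono) (auto intro: less_imp_le)
  show "isCont g0 1" unfolding g0_def by (intro continuous_intros) auto
  fix l :: real assume l: "0 < l"
  have "(%n. l/X n) ----> 0" by (rule real_tendsto_divide_at_top[OF tendsto_const X(2)])
  from filterlim_compose[OF c(1) positive_null_sequence(1)[OF lX[OF l] this]]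
  show "(%n. LBINT t:{0<..}. exp (- l* t)*(g n t*1)) ----> (LBINT t:{0<..}. exp (- l* t)*(g0 t*1))"
   unfolding gI[OF l] g0I[OF l] by (intro tendsto_mult tendsto_const)
 qed (use gi g0i in auto)
 thus "(%n. X n powr (al-1)* V (X n)) ----> c/Gamma (2-al)" by (simp add: g_def g0_def)
qed

text \<open>V x - V (x+h) is the expectation of a variable that lies between h times the indicators
  of A > x+h and of A > x.\<close>

lemma tail_sandwich:
 assumes "0 < h"
 shows "V x-V (x+h) <= h* prob {om \<in> space N. A om > x}" (is ?g1) "h* prob {om \<in> space N. A om > x+h} <= V x-V (x+h)" (is ?g2)
proof -
 let ?I = "%x om. h* indicator {om \<in> space N. A om > x} om"
 have I: "integrable N (?I x)" "(LINT om|N. ?I x om) = h* prob {om \<in> space N. A om > x}" for x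
 proof -
  have m: "{om \<in> space N. A om > x} \<in> events" by measurable
  thus "integrable N (?I x)"
   by (intro integrable_mult_right integrable_const_bound[of _ 1]) (auto simp: indicator_def)
  show "(LINT om|N. ?I x om) = h* prob {om \<in> space N. A om > x}"
   unfolding integral_mult_right_zero Bochner_Integration.integral_indicator
   by (simp only: Int_absorb2[OF sets.sets_into_space[OF m]])
 qed
 have d: "V x-V (x+h) = (LINT om|N. max 0 (A om-x)-max 0 (A om-(x+h)))"
  unfolding V_def by (rule Bochner_Integration.integral_diff[symmetric]) (rule V_integrable)+
 have di: "integrable N (%om. max 0 (A om-x)-max 0 (A om-(x+h)))" using V_integrable by simp
 show ?g1
  unfolding d I(2)[symmetric] by (rule integral_mono[OF di I(1)]) (use assms in \<open>auto simp: indicator_def max_def\<close>)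
 show ?g2
  unfolding d I(2)[symmetric] by (rule integral_mono[OF I(1) di]) (use assms in \<open>auto simp: indicator_def max_def\<close>)
qed

text \<open>Monotone density argument: the tail at x lies between the difference quotients of V over
  [x, (1+ep) x] and over [(1-ep) x, x]. In units of x^(- al) their limits tend to (al-1) c as ep
  tends to 0.\<close>

lemma tail_asymptotics:
 assumes c: "((%x. x powr (al-1)* V x) ---> c) at_top"
 shows "((%x. x powr al* prob {om \<in> space N. A om > x}) ---> (al-1)* c) at_top"
proof -
 define W where "W = (%x. x powr (al-1)* V x)"
 let ?P = "%x. x powr al* prob {om \<in> space N. A om > x}"
 have sc: "((%x. W (k* x)) ---> c) at_top" if "0 < k" for k
  using c that unfolding W_def
  by (intro filterlim_compose[OF c] filterlim_tendsto_pos_mult_at_top[OF tendsto_const _ filterlim_ident])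
 have Vw: "x powr al*(V (k* x)/x) = k powr (1-al)* W (k* x)" if "0 < k" "0 < x" for k x
 proof -
  have "k powr (1-al)* W (k* x) = (k powr (1-al)* k powr (al-1))*(x powr (al-1)* V (k* x))"
   using that by (simp add: W_def powr_mult)
  also have "k powr (1-al)* k powr (al-1) = 1" using that by (simp add: powr_add[symmetric])
  finally show ?thesis using that by (simp add: powr_diff)
 qed
 show ?thesis
 proof (rule order_tendstoI)
  fix a assume a: "a < (al-1)* c"
  \<comment> \<open>ep is fixed first, close enough to 0 for the bound a; only then does x tend to
    infinity.\<close>
  have "((%ep. (1-(1+ep) powr (1-al))/ep) ---> al-1) (at_right 0)" using alpha by real_asymp
  hence "((%ep. (1-(1+ep) powr (1-al))/ep* c) ---> (al-1)* c) (at_right 0)"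
   by (intro tendsto_mult tendsto_const)
  hence "eventually (%ep. a < (1-(1+ep) powr (1-al))/ep* c) (at_right 0)" by (rule order_tendstoD(1)) (rule a)
  then obtain ep where ep: "0 < ep" "a < (1-(1+ep) powr (1-al))/ep* c"
   using eventually_happens[OF eventually_conj[OF eventually_at_right_less[of "0::real"]]] by auto
  have "((%x. (1 powr (1-al)* W (1* x)-(1+ep) powr (1-al)* W ((1+ep)* x))/ep) ---> (1 powr (1-al)* c-(1+ep) powr (1-al)* c)/ep) at_top"
   by (intro tendsto_intros sc) (use ep in auto)
  moreover have "a < (1 powr (1-al)* c-(1+ep) powr (1-al)* c)/ep" using ep by (simp add: algebra_simps)
  ultimately have "eventually (%x. a < (1 powr (1-al)* W (1* x)-(1+ep) powr (1-al)* W ((1+ep)* x))/ep) at_top"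
   by (rule order_tendstoD(1))
  thus "eventually (%x. a < ?P x) at_top"
   using eventually_gt_at_top[of 0]
  proof eventually_elim
   case (elim x)
   have "V x-V (x+ep* x) <= (ep* x)* prob {om \<in> space N. A om > x}" by (rule tail_sandwich(1)) (use elim ep in simp)
   hence "(V (1* x)/x-V ((1+ep)* x)/x)/ep <= prob {om \<in> space N. A om > x}"
    using elim ep by (simp add: field_simps)
   hence "x powr al*((V (1* x)/x-V ((1+ep)* x)/x)/ep) <= ?P x" by (rule mult_left_mono) simp
   also have "x powr al*((V (1* x)/x-V ((1+ep)* x)/x)/ep) = (x powr al*(V (1* x)/x)-x powr al*(V ((1+ep)* x)/x))/ep"
    by (simp add: right_diff_distrib)
   finally show ?case using elim ep Vw[of 1 x] Vw[of "1+ep" x] by simp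
  qed
 next
  fix a assume a: "(al-1)* c < a"
  have "((%ep. ((1-ep) powr (1-al)-1)/ep) ---> al-1) (at_right 0)" using alpha by real_asymp
  hence "((%ep. ((1-ep) powr (1-al)-1)/ep* c) ---> (al-1)* c) (at_right 0)"
   by (intro tendsto_mult tendsto_const)
  hence e1: "eventually (%ep. ((1-ep) powr (1-al)-1)/ep* c < a) (at_right 0)" by (rule order_tendstoD(2)) (rule a)
  have e2: "eventually (%ep. ep \<in> {0<..<1::real}) (at_right 0)" by (rule eventually_at_right_real) simp
  obtain ep where ep: "0 < ep" "ep < 1" "((1-ep) powr (1-al)-1)/ep* c < a"
   using eventually_happens[OF eventually_conj[OF e1 e2]] by auto
  have "((%x. ((1-ep) powr (1-al)* W ((1-ep)* x)-1 powr (1-al)* W (1* x))/ep) ---> ((1-ep) powr (1-al)* c-1 powr (1-al)* c)/ep) at_top"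
   by (intro tendsto_intros sc) (use ep in auto)
  moreover have "((1-ep) powr (1-al)* c-1 powr (1-al)* c)/ep < a" using ep by (simp add: algebra_simps)
  ultimately have "eventually (%x. ((1-ep) powr (1-al)* W ((1-ep)* x)-1 powr (1-al)* W (1* x))/ep < a) at_top"
   by (rule order_tendstoD(2))
  thus "eventually (%x. ?P x < a) at_top"
   using eventually_gt_at_top[of 0]
  proof eventually_elim
   case (elim x)
   have "(ep* x)* prob {om \<in> space N. A om > (1-ep)* x+ep* x} <= V ((1-ep)* x)-V ((1-ep)* x+ep* x)"
    by (rule tail_sandwich(2)) (use elim ep in simp)
   moreover have "(1-ep)* x+ep* x = x" by (simp add: algebra_simps)
   ultimately have "(ep* x)* prob {om \<in> space N. A om > x} <= V ((1-ep)* x)-V x" by simp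
   hence "prob {om \<in> space N. A om > x} <= (V ((1-ep)* x)/x-V (1* x)/x)/ep"
    using elim ep by (simp add: field_simps)
   hence "?P x <= x powr al*((V ((1-ep)* x)/x-V (1* x)/x)/ep)" by (rule mult_left_mono) simp
   also have "... = (x powr al*(V ((1-ep)* x)/x)-x powr al*(V (1* x)/x))/ep"
    by (simp add: right_diff_distrib)
   finally show ?case using elim ep Vw[of 1 x] Vw[of "1-ep" x] by simp
  qed
 qed
qed

lemma area_tail:
 assumes a2: "al < 2"
 shows "(%x. prob {om \<in> space N. A om > x}) \<sim>[at_top]
    (%x. (al-1)* Gamma (1+al)* Gamma (1-1/al)/(Gamma (2-al)* Gamma (2+al-1/al))* x powr (- al))"
proof -
 have ia: "1/al < 1" using alpha by simp
 define c where "c = Gamma (1-1/al)* Gamma (1+al)/Gamma (2+al-1/al)"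
 have c: "0 < c" unfolding c_def using ia alpha by (intro divide_pos_pos mult_pos_pos Gamma_real_pos) linarith+
 define C where "C = (al-1)*(c/Gamma (2-al))"
 have C: "0 < C" unfolding C_def using c alpha a2 by (intro mult_pos_pos divide_pos_pos Gamma_real_pos) auto
 have Ce: "(al-1)* Gamma (1+al)* Gamma (1-1/al)/(Gamma (2-al)* Gamma (2+al-1/al)) = C"
  by (simp add: C_def c_def mult_ac)
 have "((%x. x powr al* prob {om \<in> space N. A om > x}) ---> C) at_top"
  unfolding C_def by (rule tail_asymptotics[OF V_asymptotics[OF a2 _ less_imp_le[OF c]]])
   (unfold c_def, rule rh_asymptotics[OF a2])
 from tendsto_divide[OF this tendsto_const[of C]]
 have "((%x. x powr al* prob {om \<in> space N. A om > x}/C) ---> 1) at_top" using C by simp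
 moreover have "eventually (%x. x powr al* prob {om \<in> space N. A om > x}/C = prob {om \<in> space N. A om > x}/(C* x powr (- al))) at_top"
  using eventually_gt_at_top[of 0] by eventually_elim (simp add: powr_minus field_simps)
 ultimately have "((%x. prob {om \<in> space N. A om > x}/(C* x powr (- al))) ---> 1) at_top" by (rule Lim_transform_eventually)
 thus ?thesis unfolding Ce by (rule asymp_equivI')
qed

end

theorem theorem3:
  fixes \<alpha> :: real
    and M :: "'a measure" and L :: "real \<Rightarrow> 'a \<Rightarrow> real"
    and N :: "'b measure" and Lme :: "real \<Rightarrow> 'b \<Rightarrow> real"
  assumes alpha: "1 < \<alpha>" "\<alpha> \<le> 2"
    and stable: "stable_levy_process_no_neg_jumps M L \<alpha>"
    and normalization:
      "\<And>u::real. char (distr M borel (L 1)) u =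
         exp ((\<i> * of_real u) powr of_real \<alpha> * exp (- \<i> * of_real (pi * \<alpha> * sgn u)))"
    and meander: "is_meander M L N Lme"
  shows
    "(\<forall>l>0.
        set_integrable lborel {0<..}
          (\<lambda>t. exp (- l * t) * (\<integral>\<omega>. exp (- (t powr (1 + 1 / \<alpha>)) * path_area Lme \<omega>) \<partial>N)
               * t powr (- 1 / \<alpha>)) \<and>
        (LINT t:{0<..}|lborel.
           exp (- l * t) * (\<integral>\<omega>. exp (- (t powr (1 + 1 / \<alpha>)) * path_area Lme \<omega>) \<partial>N)
           * t powr (- 1 / \<alpha>)) =
        pi * Gamma (1 - 1 / \<alpha>) *
          ((deriv (Psi \<alpha>) l * Phi \<alpha> l - deriv (Phi \<alpha>) l * Psi \<alpha> l) / Phi \<alpha> l)) \<and>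
     (integrable N (path_area Lme) \<and>
      (\<integral>\<omega>. path_area Lme \<omega> \<partial>N) = Gamma (1 - 1 / \<alpha>) * ((\<alpha> + 1) / (2 * \<alpha>))) \<and>
     (\<alpha> < 2 \<longrightarrow>
        (\<lambda>x. measure N {\<omega> \<in> space N. path_area Lme \<omega> > x}) \<sim>[at_top]
        (\<lambda>x. (\<alpha> - 1) * Gamma (1 + \<alpha>) * Gamma (1 - 1 / \<alpha>)
               / (Gamma (2 - \<alpha>) * Gamma (2 + \<alpha> - 1 / \<alpha>)) * x powr (- \<alpha>)))"
proof -
  interpret S: normalized_stable M L \<alpha>
    using stable alpha normalization by (simp add: normalized_stable_def normalized_stable_axioms_def)
  interpret N: prob_space N by (rule S.meander_area(1)[OF meander])
  interpret A: area_law N "path_area Lme" \<alpha>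
    by unfold_locales (fact alpha S.meander_area(2,3)[OF meander] S.meander_laplace[OF meander])+
  show ?thesis
  proof (intro conjI allI impI)
    fix l :: real assume l: "0 < l"
    show "set_integrable lborel {0<..} (\<lambda>t. exp (- l * t) * (\<integral>\<omega>. exp (- (t powr (1 + 1 / \<alpha>)) * path_area Lme \<omega>) \<partial>N) * t powr (- 1 / \<alpha>))"
      by (rule S.meander_laplace(1)[OF meander l])
    show "(LINT t:{0<..}|lborel. exp (- l * t) * (\<integral>\<omega>. exp (- (t powr (1 + 1 / \<alpha>)) * path_area Lme \<omega>) \<partial>N) * t powr (- 1 / \<alpha>)) =
        pi * Gamma (1 - 1 / \<alpha>) * ((deriv (Psi \<alpha>) l * Phi \<alpha> l - deriv (Phi \<alpha>) l * Psi \<alpha> l) / Phi \<alpha> l)"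
      unfolding S.meander_laplace(2)[OF meander l] S.laplace_rhs_eq[OF l] by (simp only: mult_ac)
  qed (fact A.area_mean A.area_tail)+
qed

end
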